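(* Let $2 \leq n \leq \infty$, let $A_1, A_2, \dots, A_n$ be diffuse abelian tracial von Neumann algebras, and let $M = A_1 * \cdots * A_n$ be their tracial free product. Let $p_i \in A_i$, $1 \leq i \leq n$, be projections and let $u_i \in \mathcal{U}(M)$, $1 \leq i \leq n$, be unitaries such that $\sum_{i=1}^n u_i p_i u_i^* = 1$. Then the von Neumann subalgebra $\mathcal{A} = \sum_{i=1}^n u_i A_i p_i u_i^*$ is freely complemented in $M$.
   Context: A tracial von Neumann algebra is a von Neumann algebra equipped with a fixed faithful normal tracial state $\tau$; it is not assumed to be separable. Free products are taken with respect to the given traces, and each $A_i$ is viewed as a subalgebra of $M$. $\mathcal{U}(M)$ is the unitary group of $M$. When $n = \infty$ the index $i$ ranges over the positive integers and the sums are taken in the strong operator topology. The projections $u_i p_i u_i^*$ are then pairwise orthogonal, and $\sum_i u_i A_i p_i u_i^*$ denotes the (unital) von Neumann subalgebra of $M$ that is the direct sum of the corners $u_i A_i p_i u_i^*$. A von Neumann subalgebra $N$ of a II$_1$ factor $M$ is freely complemented (FC) in $M$ if there is a non-trivial von Neumann subalgebra $Q \subset M$ ($Q \neq \mathbb{C}1$) that is freely independent of $N$ (with respect to the trace of $M$) and such that $M = N \vee Q$, the von Neumann algebra generated by $N$ and $Q$. *)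

theory Defs
  imports "HOL-Analysis.Analysis" "HOL-Library.Extended_Nat"
begin

text \<open>
  Von Neumann algebras are concrete: sets of bounded operators on a complex Hilbert space, not
  assumed separable, that equal their double commutant. Operators are functions
  \<open>'h \<Rightarrow> 'h\<close>, so the product is \<open>\<circ>\<close> and the unit is \<open>id\<close>.
\<close>

text \<open>
  The inner product is linear in the second argument. The norm and the topology are those of the
  underlying real inner product, which is the real part of the complex one.
\<close>
class complex_hilbert = real_inner + complete_space +
  fixes scaleC :: "complex \<Rightarrow> 'a \<Rightarrow> 'a"  (infixr "*\<^sub>C" 75)
    and cinner :: "'a \<Rightarrow> 'a \<Rightarrow> complex"
  assumes scaleC_add_right: "c *\<^sub>C (x + y) = c *\<^sub>C x + c *\<^sub>C y"
    and scaleC_add_left: "(c + d) *\<^sub>C x = c *\<^sub>C x + d *\<^sub>C x"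
    and scaleC_scaleC: "c *\<^sub>C d *\<^sub>C x = (c * d) *\<^sub>C x"
    and scaleR_scaleC: "r *\<^sub>R x = complex_of_real r *\<^sub>C x"
    and cinner_commute: "cinner x y = cnj (cinner y x)"
    and cinner_add_right: "cinner x (y + z) = cinner x y + cinner x z"
    and cinner_scaleC_right: "cinner x (c *\<^sub>C y) = c * cinner x y"
    and inner_eq_Re_cinner: "inner x y = Re (cinner x y)"

definition bounded_op :: "('h::complex_hilbert \<Rightarrow> 'h) \<Rightarrow> bool" where
  "bounded_op T \<longleftrightarrow> bounded_linear T \<and> (\<forall>c x. T (c *\<^sub>C x) = c *\<^sub>C T x)"

text \<open>For a bounded operator, the adjoint exists by the Riesz representation theorem.\<close>
definition adj :: "('h::complex_hilbert \<Rightarrow> 'h) \<Rightarrow> 'h \<Rightarrow> 'h" where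
  "adj T = (THE S. \<forall>x y. cinner (S x) y = cinner x (T y))"

definition self_adjoint :: "('h::complex_hilbert \<Rightarrow> 'h) \<Rightarrow> bool" where
  "self_adjoint T \<longleftrightarrow> bounded_op T \<and> adj T = T"

definition projection :: "('h::complex_hilbert \<Rightarrow> 'h) \<Rightarrow> bool" where
  "projection P \<longleftrightarrow> self_adjoint P \<and> P \<circ> P = P"

definition unitary :: "('h::complex_hilbert \<Rightarrow> 'h) \<Rightarrow> bool" where
  "unitary U \<longleftrightarrow> bounded_op U \<and> adj U \<circ> U = id \<and> U \<circ> adj U = id"

text \<open>The operator order, intended for self-adjoint operators only.\<close>
definition op_le :: "('h::complex_hilbert \<Rightarrow> 'h) \<Rightarrow> ('h \<Rightarrow> 'h) \<Rightarrow> bool" where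
  "op_le S T \<longleftrightarrow> (\<forall>x. Re (cinner x (S x)) \<le> Re (cinner x (T x)))"

definition scalars :: "('h::complex_hilbert \<Rightarrow> 'h) set" where
  "scalars = range (\<lambda>c x. c *\<^sub>C x)"

definition commutant :: "('h::complex_hilbert \<Rightarrow> 'h) set \<Rightarrow> ('h \<Rightarrow> 'h) set" where
  "commutant S = {T. bounded_op T \<and> (\<forall>s\<in>S. T \<circ> s = s \<circ> T)}"

definition von_neumann_algebra :: "('h::complex_hilbert \<Rightarrow> 'h) set \<Rightarrow> bool" where
  "von_neumann_algebra M \<longleftrightarrow>
     (\<forall>x\<in>M. bounded_op x \<and> adj x \<in> M) \<and> commutant (commutant M) = M"

text \<open>Subalgebras are unital. The von Neumann algebra generated by \<open>S\<close> is
  \<open>von_neumann_algebra hull S\<close>.\<close>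
definition vn_subalgebra :: "('h::complex_hilbert \<Rightarrow> 'h) set \<Rightarrow> ('h \<Rightarrow> 'h) set \<Rightarrow> bool" where
  "vn_subalgebra N M \<longleftrightarrow> von_neumann_algebra N \<and> N \<subseteq> M"

definition abelian :: "('h \<Rightarrow> 'h) set \<Rightarrow> bool" where
  "abelian A \<longleftrightarrow> (\<forall>x\<in>A. \<forall>y\<in>A. x \<circ> y = y \<circ> x)"

text \<open>No minimal projections. For projections, \<open>q \<le> p\<close> means \<open>p \<circ> q = q\<close>.\<close>
definition diffuse :: "('h::complex_hilbert \<Rightarrow> 'h) set \<Rightarrow> bool" where
  "diffuse A \<longleftrightarrow>
     (\<forall>p\<in>A. projection p \<and> p \<noteq> (\<lambda>_. 0) \<longrightarrow>
        (\<exists>q\<in>A. projection q \<and> p \<circ> q = q \<and> q \<noteq> (\<lambda>_. 0) \<and> q \<noteq> p))"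

text \<open>Normality of a positive functional: it preserves least upper bounds of upward directed
  bounded families of self-adjoint elements.\<close>
definition normal_on :: "('h::complex_hilbert \<Rightarrow> 'h) set \<Rightarrow> (('h \<Rightarrow> 'h) \<Rightarrow> complex) \<Rightarrow> bool" where
  "normal_on M \<phi> \<longleftrightarrow>
     (\<forall>D x. D \<subseteq> M \<and> D \<noteq> {} \<and> (\<forall>S\<in>D. self_adjoint S) \<and>
        (\<forall>S\<in>D. \<forall>T\<in>D. \<exists>R\<in>D. op_le S R \<and> op_le T R) \<and>
        x \<in> M \<and> self_adjoint x \<and> (\<forall>S\<in>D. op_le S x) \<and>
        (\<forall>y\<in>M. self_adjoint y \<and> (\<forall>S\<in>D. op_le S y) \<longrightarrow> op_le x y)
      \<longrightarrow> Re (\<phi> x) = (SUP S\<in>D. Re (\<phi> S)))"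

text \<open>Only the values of \<open>\<tau>\<close> on \<open>M\<close> matter.\<close>
definition faithful_normal_tracial_state ::
    "('h::complex_hilbert \<Rightarrow> 'h) set \<Rightarrow> (('h \<Rightarrow> 'h) \<Rightarrow> complex) \<Rightarrow> bool" where
  "faithful_normal_tracial_state M \<tau> \<longleftrightarrow>
     (\<forall>x\<in>M. \<forall>y\<in>M. \<tau> (\<lambda>v. x v + y v) = \<tau> x + \<tau> y) \<and>
     (\<forall>c. \<forall>x\<in>M. \<tau> (\<lambda>v. c *\<^sub>C x v) = c * \<tau> x) \<and>
     (\<forall>x\<in>M. \<tau> (adj x \<circ> x) \<in> \<real>\<^sub>\<ge>\<^sub>0) \<and>
     \<tau> id = 1 \<and>
     (\<forall>x\<in>M. \<forall>y\<in>M. \<tau> (x \<circ> y) = \<tau> (y \<circ> x)) \<and>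
     (\<forall>x\<in>M. \<tau> (adj x \<circ> x) = 0 \<longrightarrow> x = (\<lambda>_. 0)) \<and>
     normal_on M \<tau>"

definition tracial_vn_algebra ::
    "('h::complex_hilbert \<Rightarrow> 'h) set \<Rightarrow> (('h \<Rightarrow> 'h) \<Rightarrow> complex) \<Rightarrow> bool" where
  "tracial_vn_algebra M \<tau> \<longleftrightarrow> von_neumann_algebra M \<and> faithful_normal_tracial_state M \<tau>"

text \<open>A factor is of type \<open>II\<^sub>1\<close> if it carries a faithful normal tracial state (it is finite) and has
  no minimal projections (it is not of type I).\<close>
definition II1_factor ::
    "('h::complex_hilbert \<Rightarrow> 'h) set \<Rightarrow> (('h \<Rightarrow> 'h) \<Rightarrow> complex) \<Rightarrow> bool" where
  "II1_factor M \<tau> \<longleftrightarrow> tracial_vn_algebra M \<tau> \<and> M \<inter> commutant M = scalars \<and> diffuse M"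

text \<open>
  Alternating products of centred elements have trace zero: \<open>xs\<close> is the word
  \<open>x\<^sub>1, \<dots>, x\<^sub>m\<close>, and \<open>js\<close> lists the indices of the algebras that the letters come from.
\<close>
definition freely_independent ::
    "'i set \<Rightarrow> ('i \<Rightarrow> ('h \<Rightarrow> 'h) set) \<Rightarrow> (('h \<Rightarrow> 'h) \<Rightarrow> complex) \<Rightarrow> bool" where
  "freely_independent I N \<tau> \<longleftrightarrow>
     (\<forall>js xs. xs \<noteq> [] \<and> length js = length xs \<and> set js \<subseteq> I \<and> distinct_adj js \<and>
        (\<forall>k<length xs. xs ! k \<in> N (js ! k) \<and> \<tau> (xs ! k) = 0)
      \<longrightarrow> \<tau> (foldr (\<circ>) xs id) = 0)"

text \<open>
  \<open>(M, \<tau>)\<close> is the tracial free product of the \<open>(A i, t i)\<close>, \<open>i \<in> I\<close>, each of which is regarded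
  as a subalgebra of \<open>M\<close>; this determines \<open>(M, \<tau>)\<close> up to trace-preserving isomorphism
  fixing the \<open>A i\<close>.
\<close>
definition tracial_free_product ::
    "'i set \<Rightarrow> ('i \<Rightarrow> ('h::complex_hilbert \<Rightarrow> 'h) set) \<Rightarrow> ('i \<Rightarrow> ('h \<Rightarrow> 'h) \<Rightarrow> complex) \<Rightarrow>
     ('h \<Rightarrow> 'h) set \<Rightarrow> (('h \<Rightarrow> 'h) \<Rightarrow> complex) \<Rightarrow> bool" where
  "tracial_free_product I A t M \<tau> \<longleftrightarrow>
     tracial_vn_algebra M \<tau> \<and>
     (\<forall>i\<in>I. vn_subalgebra (A i) M \<and> (\<forall>x\<in>A i. \<tau> x = t i x)) \<and>
     freely_independent I A \<tau> \<and>
     M = von_neumann_algebra hull (\<Union>i\<in>I. A i)"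

text \<open>
  Sums in the strong operator topology, in the unordered sense. For positive operators, and for
  operators supported on pairwise orthogonal ranges, this agrees with convergence of the sequence
  of partial sums.
\<close>
definition sot_has_sum ::
    "'i set \<Rightarrow> ('i \<Rightarrow> 'h::complex_hilbert \<Rightarrow> 'h) \<Rightarrow> ('h \<Rightarrow> 'h) \<Rightarrow> bool" where
  "sot_has_sum I T S \<longleftrightarrow> bounded_op S \<and> (\<forall>v. ((\<lambda>i. T i v) has_sum S v) I)"

definition conj_corner ::
    "('h::complex_hilbert \<Rightarrow> 'h) \<Rightarrow> ('h \<Rightarrow> 'h) set \<Rightarrow> ('h \<Rightarrow> 'h) \<Rightarrow> ('h \<Rightarrow> 'h) set" where
  "conj_corner u A p = (\<lambda>a. u \<circ> a \<circ> p \<circ> adj u) ` A"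

text \<open>
  The direct sum of corners with pairwise orthogonal units. By the uniform boundedness principle a
  family from such corners is summable in the strong operator topology iff it is norm bounded, so
  this is the usual (bounded) direct sum of von Neumann algebras.
\<close>
definition direct_sum ::
    "'i set \<Rightarrow> ('i \<Rightarrow> ('h::complex_hilbert \<Rightarrow> 'h) set) \<Rightarrow> ('h \<Rightarrow> 'h) set" where
  "direct_sum I C = {x. \<exists>c. (\<forall>i\<in>I. c i \<in> C i) \<and> sot_has_sum I c x}"

text \<open>\<open>\<tau>\<close> is necessarily the unique tracial state of the factor \<open>M\<close>. Freeness of the pair
  \<open>N\<close>, \<open>Q\<close> is freeness of the family indexed by the Booleans.\<close>
definition freely_complemented ::
    "('h::complex_hilbert \<Rightarrow> 'h) set \<Rightarrow> ('h \<Rightarrow> 'h) set \<Rightarrow> (('h \<Rightarrow> 'h) \<Rightarrow> complex) \<Rightarrow> bool" where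
  "freely_complemented N M \<tau> \<longleftrightarrow>
     II1_factor M \<tau> \<and> vn_subalgebra N M \<and>
     (\<exists>Q. vn_subalgebra Q M \<and> Q \<noteq> scalars \<and>
        freely_independent UNIV (\<lambda>b. if b then N else Q) \<tau> \<and>
        M = von_neumann_algebra hull (N \<union> Q))"

end

theory Submission
  imports Defs
begin

text \<open>
  As \<open>A\<^sub>1\<close> is diffuse, it contains orthogonal projections \<open>e\<^sub>k\<close> with
  \<open>e\<^sub>1 = p\<^sub>1\<close>, \<open>\<tau>(e\<^sub>k) = \<tau>(p\<^sub>k)\<close> and \<open>\<Sum> e\<^sub>k = 1\<close>. For \<open>k \<ge> 2\<close> the projections \<open>e\<^sub>k\<close> and \<open>p\<^sub>k\<close> are free
  with equal traces, so \<open>w\<^sub>k = sgn (e\<^sub>k + p\<^sub>k - 1)\<close> is a self-adjoint unitary that exchanges them; put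
  \<open>w\<^sub>1 = 1\<close>. Exchange the corner \<open>A\<^sub>1 e\<^sub>k\<close> of \<open>A\<^sub>1\<close> with the corner \<open>A\<^sub>k p\<^sub>k\<close> of \<open>A\<^sub>k\<close> by conjugating both with
  \<open>w\<^sub>k\<close>. The \<open>w\<^sub>k\<close> lie in the algebra \<open>N\<close> generated by the projections \<open>e\<^sub>k\<close> and \<open>p\<^sub>k\<close>, over which the words
  in the centred parts of the corners expand into alternating words, so the exchanged algebras
  \<open>B\<^sub>1 = \<Sum> w\<^sub>k A\<^sub>k p\<^sub>k w\<^sub>k\<close> and \<open>B\<^sub>k = w\<^sub>k A\<^sub>1 e\<^sub>k w\<^sub>k + A\<^sub>k (1 - p\<^sub>k)\<close>, \<open>k \<ge> 2\<close>, are again free. They still generate \<open>M\<close>,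
  because they contain \<open>e\<^sub>k\<close> and \<open>p\<^sub>k\<close>, hence \<open>w\<^sub>k\<close>. Finally the unitary \<open>\<Sum> w\<^sub>k p\<^sub>k u\<^sub>k\<^sup>*\<close> of \<open>M\<close> conjugates
  the sum of the corners \<open>u\<^sub>k A\<^sub>k p\<^sub>k u\<^sub>k\<^sup>*\<close> onto \<open>B\<^sub>1\<close>, and the algebra generated by the other \<open>B\<^sub>k\<close> is free
  from \<open>B\<^sub>1\<close>.

  Closures are taken in the norm \<open>\<parallel>x\<parallel>\<^sub>2 = \<tau>(x\<^sup>* x)\<^sup>1\<^sup>/\<^sup>2\<close> on \<open>M\<close>: a unital \<open>*\<close>-subalgebra of \<open>M\<close> that is
  closed in this norm is a von Neumann algebra, which replaces the density theorems.
\<close>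

section \<open>Semi-inner products\<close>

text \<open>The traces are matched so that the exchange preserves size: the unit of the exchanged
  algebra at \<open>k\<close> has trace \<open>1 - \<tau>(p k) + \<tau>(e k) = 1\<close>. Equal
  traces also put free projections in general position; otherwise the sign of
  \<open>e + p - 1\<close> would only be a partial isometry. Freeness is delicate because the
  \<open>w k\<close> are not words but limits of polynomials in \<open>e k\<close> and
  \<open>p k\<close>; the minimality of these projections in the algebras they span is what reduces
  such factors to scalars next to a corner. On the analytic side, \<open>M\<close> acts on an
  arbitrary Hilbert space, where the trace need not be a vector state, so the trace is first
  compared with vector states piece by piece. The space \<open>L\<^sup>2(M)\<close> is never formed:
  approximate Riesz representers in \<open>M\<close> stand for its vectors. Square roots, signs and
  range projections are limits of explicit iterations, and maximal elements are reached along
  sequences guided by the trace. Being freely complemented includes that \<open>M\<close> is a II_1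
  factor, so triviality of the centre and absence of minimal projections are proved as well.\<close>

text \<open>Degenerate forms and incomplete carriers are allowed: the instances are the Hilbert
  space and its subspaces, the form \<open>cinner v (ap T w)\<close> of a positive operator, and
  \<open>M\<close> and its subalgebras with the trace form.\<close>

locale semi_inner = vector_space sc for sc :: "complex \<Rightarrow> 'a::ab_group_add \<Rightarrow> 'a" +
  fixes V :: "'a set" and B :: "'a \<Rightarrow> 'a \<Rightarrow> complex"
  assumes V: "subspace V"
    and B_add: "\<lbrakk>x \<in> V; y \<in> V; z \<in> V\<rbrakk> \<Longrightarrow> B x (y + z) = B x y + B x z"
    and B_sc: "\<lbrakk>x \<in> V; y \<in> V\<rbrakk> \<Longrightarrow> B x (sc c y) = c * B x y"
    and B_herm: "\<lbrakk>x \<in> V; y \<in> V\<rbrakk> \<Longrightarrow> B y x = cnj (B x y)"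
    and B_pos: "x \<in> V \<Longrightarrow> 0 \<le> Re (B x x)"
begin

definition nrm :: "'a \<Rightarrow> real" where "nrm x = sqrt (Re (B x x))"

lemmas V_add = subspace_add[OF V] and V_sc = subspace_scale[OF V] and V_diff = subspace_diff[OF V]
  and V_0 = subspace_0[OF V] and V_neg = subspace_neg[OF V]

lemma B_add_left: "\<lbrakk>x \<in> V; y \<in> V; z \<in> V\<rbrakk> \<Longrightarrow> B (x + y) z = B x z + B y z"
  by (metis B_add B_herm V_add complex_cnj_add)

lemma B_sc_left: "\<lbrakk>x \<in> V; y \<in> V\<rbrakk> \<Longrightarrow> B (sc c x) y = cnj c * B x y"
  by (metis B_herm B_sc V_sc complex_cnj_mult)

lemma B_neg: "\<lbrakk>x \<in> V; y \<in> V\<rbrakk> \<Longrightarrow> B x (- y) = - B x y"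
  using B_sc[of x y "-1"] by simp

lemma B_neg_left: "\<lbrakk>x \<in> V; y \<in> V\<rbrakk> \<Longrightarrow> B (- x) y = - B x y"
  using B_sc_left[of x y "-1"] by simp

lemma B_diff: "\<lbrakk>x \<in> V; y \<in> V; z \<in> V\<rbrakk> \<Longrightarrow> B x (y - z) = B x y - B x z"
  using B_add[of x y "- z"] B_neg[of x z] V_neg by simp

lemma B_diff_left: "\<lbrakk>x \<in> V; y \<in> V; z \<in> V\<rbrakk> \<Longrightarrow> B (x - y) z = B x z - B y z"
  using B_add_left[of x "- y" z] B_neg_left[of y z] V_neg by simp

lemma B_zero: "x \<in> V \<Longrightarrow> B x 0 = 0"
  using B_sc[of x x 0] by simp

lemma Im_B: "x \<in> V \<Longrightarrow> Im (B x x) = 0"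
  using B_herm[of x x] by (metis cnj.simps(2) equation_minus_iff neg_equal_0_iff_equal
      add.inverse_inverse neg_equal_zero)

lemma nrm_sq: "x \<in> V \<Longrightarrow> (nrm x)\<^sup>2 = Re (B x x)"
  by (simp add: nrm_def B_pos)

lemma nrm_ge0: "x \<in> V \<Longrightarrow> 0 \<le> nrm x"
  by (simp add: nrm_def B_pos)

lemma B_self: "x \<in> V \<Longrightarrow> B x x = complex_of_real ((nrm x)\<^sup>2)"
  by (simp add: nrm_sq Im_B complex_eq_iff)

lemma nrm_add_sq:
  assumes "x \<in> V" "y \<in> V"
  shows "(nrm (x + y))\<^sup>2 = (nrm x)\<^sup>2 + 2 * Re (B x y) + (nrm y)\<^sup>2"
  using assms by (simp add: nrm_sq V_add B_add B_add_left B_herm[of x y])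

lemma nrm_sc: "x \<in> V \<Longrightarrow> nrm (sc c x) = cmod c * nrm x"
proof -
  assume x: "x \<in> V"
  have "(nrm (sc c x))\<^sup>2 = Re (cnj c * (c * B x x))"
    using x by (simp add: nrm_sq V_sc B_sc B_sc_left algebra_simps)
  also have "\<dots> = (cmod c * nrm x)\<^sup>2"
    using x by (simp add: nrm_sq Im_B cmod_power2 power_mult_distrib)
      (simp add: power2_eq_square Im_B algebra_simps)
  finally show ?thesis
    using x by (simp add: power2_eq_iff_nonneg nrm_ge0 V_sc)
qed

lemma nrm_neg: "x \<in> V \<Longrightarrow> nrm (- x) = nrm x"
  using nrm_sc[of x "-1"] by simp

text \<open>An approximate minimizer of the energy \<open>\<parallel>k\<parallel>\<^sup>2 - 2 Re (f k)\<close> approximately represents \<open>f\<close>.\<close>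
lemma approx_riesz:
  assumes add: "\<And>x y. x \<in> V \<Longrightarrow> y \<in> V \<Longrightarrow> f (x + y) = f x + f y"
    and sc: "\<And>c x. x \<in> V \<Longrightarrow> f (sc c x) = c * f x"
    and bd: "\<And>x. x \<in> V \<Longrightarrow> cmod (f x) \<le> C * nrm x"
    and \<epsilon>: "(0::real) < \<epsilon>"
  shows "\<exists>k\<in>V. \<forall>x\<in>V. cmod (f x - B k x) \<le> \<epsilon> * nrm x"
proof -
  define J where "J k = (nrm k)\<^sup>2 - 2 * Re (f k)" for k
  have J_ge: "- C\<^sup>2 \<le> J k" if "k \<in> V" for k
  proof -
    have "Re (f k) \<le> C * nrm k"
      using bd[OF that] complex_Re_le_cmod order_trans by blast
    moreover have "0 \<le> (nrm k - C)\<^sup>2" by simp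
    ultimately show ?thesis by (simp add: J_def power2_eq_square algebra_simps)
  qed
  have bdd: "bdd_below (J ` V)" using J_ge by (auto intro!: bdd_belowI[where m = "- C\<^sup>2"])
  have "Inf (J ` V) < Inf (J ` V) + \<epsilon>\<^sup>2" using \<epsilon> by simp
  then obtain k where k: "k \<in> V" "J k < Inf (J ` V) + \<epsilon>\<^sup>2"
    using cInf_lessD[of "J ` V"] V_0 by (metis (no_types, lifting) empty_iff image_iff)
  have min: "J k - \<epsilon>\<^sup>2 < J x" if "x \<in> V" for x
    using k cInf_lower[OF _ bdd, of "J x"] that by fastforce
  have "cmod (f x - B k x) \<le> \<epsilon> * nrm x" if x: "x \<in> V" for x
  proof -
    define g where "g = f x - B k x"
    have key: "2 * s * (cmod g)\<^sup>2 < s\<^sup>2 * (cmod g)\<^sup>2 * (nrm x)\<^sup>2 + \<epsilon>\<^sup>2" for s :: real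
    proof -
      \<comment> \<open>The phase \<open>cnj g\<close> makes the linear term of the energy along
        \<open>x\<close> real. The values of \<open>s\<close> used below beat the excess
        \<open>\<epsilon>\<^sup>2\<close> when \<open>x\<close> is null and minimize the quadratic
        otherwise.\<close>
      define l where "l = complex_of_real s * cnj g"
      have "J (k + sc l x) = J k - 2 * Re (l * g) + (cmod l)\<^sup>2 * (nrm x)\<^sup>2"
        using k x by (simp add: J_def nrm_add_sq V_sc B_sc add sc nrm_sc g_def power_mult_distrib
            algebra_simps)
      moreover have "Re (l * g) = s * (cmod g)\<^sup>2"
        unfolding l_def by (simp add: cmod_power2) (simp add: power2_eq_square algebra_simps)
      moreover have "(cmod l)\<^sup>2 = s\<^sup>2 * (cmod g)\<^sup>2"
        by (simp add: l_def norm_mult power_mult_distrib)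
      ultimately show ?thesis
        using min[of "k + sc l x"] k x V_add V_sc by (simp add: algebra_simps)
    qed
    show ?thesis
    proof (cases "nrm x = 0")
      case True
      have "g = 0"
      proof (rule ccontr)
        assume "g \<noteq> 0"
        then show False
          using key[of "\<epsilon>\<^sup>2 / (cmod g)\<^sup>2"] True by (simp add: \<epsilon>)
      qed
      then show ?thesis using True by (simp add: g_def)
    next
      case False
      then have p: "0 < nrm x" using nrm_ge0[OF x] by simp
      have "2 * (cmod g)\<^sup>2 / (nrm x)\<^sup>2 < (cmod g)\<^sup>2 / (nrm x)\<^sup>2 + \<epsilon>\<^sup>2"
        using key[of "1 / (nrm x)\<^sup>2"] p by (simp add: power2_eq_square field_simps)
      then have "(cmod g)\<^sup>2 < (\<epsilon> * nrm x)\<^sup>2"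
        using p by (simp add: field_simps power_mult_distrib)
      then show ?thesis
        using p \<epsilon> by (metis g_def less_imp_le mult_nonneg_nonneg power2_less_imp_less)
    qed
  qed
  then show ?thesis using k by blast
qed

lemma CS: assumes "x \<in> V" "y \<in> V" shows "cmod (B x y) \<le> nrm x * nrm y"
proof -
  have *: "2 * s * (cmod (B x y))\<^sup>2 \<le> (nrm x)\<^sup>2 + s\<^sup>2 * (cmod (B x y))\<^sup>2 * (nrm y)\<^sup>2" for s :: real
  proof -
    define l where "l = - complex_of_real s * cnj (B x y)"
    have "0 \<le> (nrm (x + sc l y))\<^sup>2" by simp
    also have "\<dots> = (nrm x)\<^sup>2 + 2 * Re (l * B x y) + (cmod l)\<^sup>2 * (nrm y)\<^sup>2"
      using assms by (simp add: nrm_add_sq V_sc B_sc nrm_sc power_mult_distrib)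
    also have "Re (l * B x y) = - s * (cmod (B x y))\<^sup>2"
      unfolding l_def by (simp add: cmod_power2) (simp add: power2_eq_square algebra_simps)
    also have "(cmod l)\<^sup>2 = s\<^sup>2 * (cmod (B x y))\<^sup>2"
      by (simp add: l_def norm_mult power_mult_distrib)
    finally show ?thesis by (simp add: algebra_simps)
  qed
  show ?thesis
  proof (cases "nrm y = 0")
    case True
    have "B x y = 0"
    proof (rule ccontr)
      assume "B x y \<noteq> 0"
      then show False
        using *[of "((nrm x)\<^sup>2 + 1) / (cmod (B x y))\<^sup>2"] True
        by simp (smt (verit) zero_le_power2)
    qed
    then show ?thesis using True by simp
  next
    case False
    then have p: "0 < nrm y" using nrm_ge0[OF assms(2)] by simp
    have "(cmod (B x y))\<^sup>2 \<le> (nrm x * nrm y)\<^sup>2"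
      using *[of "1 / (nrm y)\<^sup>2"] p by (simp add: field_simps power2_eq_square)
    then show ?thesis
      using assms nrm_ge0 by (meson mult_nonneg_nonneg power2_le_imp_le)
  qed
qed

lemma nrm_add: assumes "x \<in> V" "y \<in> V" shows "nrm (x + y) \<le> nrm x + nrm y"
proof -
  have "(nrm (x + y))\<^sup>2 \<le> (nrm x + nrm y)\<^sup>2"
    using CS[OF assms] complex_Re_le_cmod[of "B x y"] assms
    by (simp add: nrm_add_sq power2_sum)
  then show ?thesis using nrm_ge0 assms by (meson add_nonneg_nonneg power2_le_imp_le)
qed

lemma nrm_zero: "nrm 0 = 0"
  using B_zero[OF V_0] by (simp add: nrm_def)

text \<open>Pair \<open>k - k'\<close> with itself. Representers whose errors tend to zero therefore
  form a Cauchy sequence.\<close>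

lemma approx_riesz_unique:
  assumes "k \<in> V" "k' \<in> V"
    and "\<And>x. x \<in> V \<Longrightarrow> cmod (f x - B k x) \<le> \<epsilon> * nrm x"
    and "\<And>x. x \<in> V \<Longrightarrow> cmod (f x - B k' x) \<le> \<epsilon>' * nrm x"
    and "0 \<le> \<epsilon>" "0 \<le> \<epsilon>'"
  shows "nrm (k - k') \<le> \<epsilon> + \<epsilon>'"
proof (cases "nrm (k - k') = 0")
  case True then show ?thesis using assms by simp
next
  case False
  let ?d = "k - k'"
  have d: "?d \<in> V" using assms V_diff by simp
  have "(nrm ?d)\<^sup>2 = cmod (B ?d ?d)" by (simp only: B_self[OF d]) (simp add: norm_power)
  also have "B ?d ?d = (f ?d - B k' ?d) - (f ?d - B k ?d)"
    using B_diff_left[OF assms(1,2) d] by simp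
  also have "cmod \<dots> \<le> cmod (f ?d - B k' ?d) + cmod (f ?d - B k ?d)"
    by (rule norm_triangle_ineq4)
  also have "\<dots> \<le> (\<epsilon> + \<epsilon>') * nrm ?d"
    using assms(3)[OF d] assms(4)[OF d] by (simp add: algebra_simps)
  finally show ?thesis
    using False nrm_ge0[OF d] by (simp add: power2_eq_square)
qed

end

section \<open>Complex Hilbert spaces and the Riesz representation theorem\<close>

lemma scaleC_one [simp]: "1 *\<^sub>C (x::'h::complex_hilbert) = x"
  using scaleR_scaleC[of 1 x] by simp

interpretation hilbert: vector_space "scaleC :: complex \<Rightarrow> 'h::complex_hilbert \<Rightarrow> 'h"
  by unfold_locales (auto simp: scaleC_add_right scaleC_add_left scaleC_scaleC)

interpretation hilbert: semi_inner "scaleC :: complex \<Rightarrow> 'h::complex_hilbert \<Rightarrow> 'h" UNIV cinner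
  rewrites "semi_inner.nrm cinner = (norm :: 'h \<Rightarrow> real)"
proof -
  interpret semi_inner "scaleC :: complex \<Rightarrow> 'h::complex_hilbert \<Rightarrow> 'h" UNIV cinner
    by unfold_locales (auto simp: cinner_add_right cinner_scaleC_right hilbert.subspace_UNIV
        cinner_commute[symmetric] inner_eq_Re_cinner[symmetric])
  show "semi_inner scaleC UNIV (cinner :: 'h \<Rightarrow> 'h \<Rightarrow> complex)" by (rule semi_inner_axioms)
  show "nrm = (norm :: 'h \<Rightarrow> real)"
    by (rule ext) (simp add: nrm_def norm_eq_sqrt_inner inner_eq_Re_cinner)
qed

lemmas cinner_simps = hilbert.B_add_left[simplified] hilbert.B_sc_left[simplified]
  hilbert.B_diff[simplified] hilbert.B_diff_left[simplified] hilbert.B_neg[simplified]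
  hilbert.B_neg_left[simplified] hilbert.B_zero[simplified] cinner_add_right cinner_scaleC_right
lemmas cinner_CS = hilbert.CS[simplified]
lemmas norm_scaleC = hilbert.nrm_sc[simplified]
lemmas cinner_self = hilbert.B_self[simplified]

lemma bounded_bilinear_cinner: "bounded_bilinear (cinner :: 'h::complex_hilbert \<Rightarrow> 'h \<Rightarrow> complex)"
proof
  fix r :: real and a b :: 'h
  show "cinner (r *\<^sub>R a) b = r *\<^sub>R cinner a b" "cinner a (r *\<^sub>R b) = r *\<^sub>R cinner a b"
    by (simp_all add: scaleR_scaleC cinner_simps scaleR_conv_of_real)
  show "\<exists>K. \<forall>a b::'h. cmod (cinner a b) \<le> norm a * norm b * K"
    by (intro exI[of _ 1]) (simp add: cinner_CS)
qed (simp_all add: cinner_simps)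

lemmas tendsto_cinner = bounded_bilinear.tendsto[OF bounded_bilinear_cinner]

lemma bounded_linear_scaleC: "bounded_linear (\<lambda>x::'h::complex_hilbert. c *\<^sub>C x)"
  by (rule bounded_linear_intro[where K = "cmod c"])
    (simp_all add: scaleC_add_right scaleR_scaleC scaleC_scaleC norm_scaleC mult.commute)

lemmas tendsto_scaleC = bounded_linear.tendsto[OF bounded_linear_scaleC]

lemma cinner_zero_left [simp]: "cinner 0 (x::'h::complex_hilbert) = 0"
  by (metis cinner_commute complex_cnj_zero hilbert.B_zero UNIV_I)

lemma cinner_eqI: "(\<And>y. cinner x y = cinner x' y) \<Longrightarrow> x = (x'::'h::complex_hilbert)"
proof -
  assume "\<And>y. cinner x y = cinner x' y"
  then have "cinner (x - x') (x - x') = 0" by (simp add: cinner_simps)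
  then show ?thesis by (simp add: cinner_self)
qed

text \<open>The difference lies in the closure of \<open>V\<close> and is orthogonal to
  \<open>V\<close>. As the uniqueness half of the Riesz theorem, it shows that chosen representers
  depend linearly on their functionals and intertwine operators.\<close>

lemma cinner_eq_closure:
  fixes x x' :: "'h::complex_hilbert"
  assumes V: "hilbert.subspace V" and "x \<in> closure V" "x' \<in> closure V"
    and eq: "\<And>y. y \<in> V \<Longrightarrow> cinner x y = cinner x' y"
  shows "x = x'"
proof -
  from assms(2) obtain s where s: "\<And>n. s n \<in> V" "s \<longlonglongrightarrow> x" by (auto simp: closure_sequential)
  from assms(3) obtain s' where s': "\<And>n. s' n \<in> V" "s' \<longlonglongrightarrow> x'" by (auto simp: closure_sequential)
  have "(\<lambda>n. cinner (x - x') (s n - s' n)) \<longlonglongrightarrow> cinner (x - x') (x - x')"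
    by (intro tendsto_cinner tendsto_intros s s')
  moreover have "cinner (x - x') (s n - s' n) = 0" for n
    using eq[OF s(1)] eq[OF s'(1)] by (simp add: cinner_simps)
  ultimately have "(\<lambda>n. 0) \<longlonglongrightarrow> cinner (x - x') (x - x')" by simp
  then have "cinner (x - x') (x - x') = 0" by (simp add: LIMSEQ_const_iff)
  then show ?thesis by (simp add: cinner_self)
qed

text \<open>Approximate representers taken in \<open>V\<close> converge because the surrounding
  space is complete. Neither closedness of \<open>V\<close> nor an extension of \<open>f\<close> is
  asked for, which suits the subspaces \<open>M \<eta>\<close> below.\<close>

lemma riesz_subspace:
  fixes V :: "'h::complex_hilbert set"
  assumes V: "hilbert.subspace V"
    and add: "\<And>x y. x \<in> V \<Longrightarrow> y \<in> V \<Longrightarrow> f (x + y) = f x + f y"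
    and sc: "\<And>c x. x \<in> V \<Longrightarrow> f (c *\<^sub>C x) = c * f x"
    and bd: "\<And>x. x \<in> V \<Longrightarrow> cmod (f x) \<le> C * norm x" and "0 \<le> C"
  shows "\<exists>\<theta>\<in>closure V. norm \<theta> \<le> C \<and> (\<forall>v\<in>V. cinner \<theta> v = f v)"
proof -
  interpret S: semi_inner scaleC V cinner
    by unfold_locales (auto simp: V cinner_simps cinner_commute[symmetric]
        inner_eq_Re_cinner[symmetric])
  have nrm: "S.nrm = norm"
    by (rule ext) (simp add: S.nrm_def norm_eq_sqrt_inner inner_eq_Re_cinner)
  let ?\<epsilon> = "\<lambda>n. inverse (real (Suc n))"
  have "\<forall>n. \<exists>k\<in>V. \<forall>x\<in>V. cmod (f x - cinner k x) \<le> ?\<epsilon> n * norm x"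
    using S.approx_riesz[of f C, unfolded nrm] add sc bd by simp
  then obtain k where kV: "\<And>n. k n \<in> V"
    and k: "\<And>n x. x \<in> V \<Longrightarrow> cmod (f x - cinner (k n) x) \<le> ?\<epsilon> n * norm x" by metis
  have "norm (k m - k n) \<le> ?\<epsilon> m + ?\<epsilon> n" for m n
    using S.approx_riesz_unique[of "k m" "k n" f, unfolded nrm] k kV by simp
  moreover have "?\<epsilon> n \<le> ?\<epsilon> N" if "N \<le> n" for n N using that by (simp add: field_simps)
  ultimately have diff: "norm (k m - k n) \<le> 2 * ?\<epsilon> N" if "N \<le> m" "N \<le> n" for m n N
    using that by (smt (verit))
  have "Cauchy k"
  proof (rule metric_CauchyI)
    fix e :: real assume "0 < e"
    then obtain N where "?\<epsilon> N < e / 2" using reals_Archimedean[of "e / 2"] by auto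
    then show "\<exists>M. \<forall>m\<ge>M. \<forall>n\<ge>M. dist (k m) (k n) < e"
      using diff by (intro exI[of _ N]) (fastforce simp: dist_norm)
  qed
  then obtain \<theta> where \<theta>: "k \<longlonglongrightarrow> \<theta>" using Cauchy_convergent convergent_def by blast
  have cl: "\<theta> \<in> closure V" using \<theta> kV closure_sequential by blast
  have rep: "cinner \<theta> v = f v" if v: "v \<in> V" for v
  proof -
    have "(\<lambda>n. f v - cinner (k n) v) \<longlonglongrightarrow> 0"
    proof (rule Lim_null_comparison)
      show "\<forall>\<^sub>F n in sequentially. norm (f v - cinner (k n) v) \<le> ?\<epsilon> n * norm v"
        using k[OF v] by simp
      show "(\<lambda>n. ?\<epsilon> n * norm v) \<longlonglongrightarrow> 0"
        using tendsto_mult_left_zero[OF LIMSEQ_inverse_real_of_nat] .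
    qed
    moreover have "(\<lambda>n. f v - cinner (k n) v) \<longlonglongrightarrow> f v - cinner \<theta> v"
      by (intro tendsto_intros tendsto_cinner \<theta>)
    ultimately have "f v - cinner \<theta> v = 0" by (rule LIMSEQ_unique[symmetric])
    then show ?thesis by simp
  qed
  have "cmod (cinner \<theta> (k n)) \<le> C * norm (k n)" for n using rep bd kV by simp
  moreover have "(\<lambda>n. cmod (cinner \<theta> (k n))) \<longlonglongrightarrow> cmod (cinner \<theta> \<theta>)"
    by (intro tendsto_intros tendsto_cinner \<theta>)
  moreover have "(\<lambda>n. C * norm (k n)) \<longlonglongrightarrow> C * norm \<theta>" by (intro tendsto_intros \<theta>)
  ultimately have "cmod (cinner \<theta> \<theta>) \<le> C * norm \<theta>" by (meson LIMSEQ_le)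
  then have "norm \<theta> * norm \<theta> \<le> C * norm \<theta>"
    by (simp only: cinner_self) (simp add: norm_mult power2_eq_square)
  then have "norm \<theta> \<le> C" using \<open>0 \<le> C\<close> by (cases "norm \<theta> = 0") auto
  then show ?thesis using cl rep by blast
qed

section \<open>Bounded operators\<close>

text \<open>As a type, the bounded operators form a ring, and algebraic identities become goals for
  the simplifier. Statements about functions are translated at the end.\<close>

typedef (overloaded) 'h operator = "{T :: 'h::complex_hilbert \<Rightarrow> 'h. bounded_op T}"
  morphisms ap Op
  by (rule exI[of _ id])
    (simp add: bounded_op_def id_def bounded_linear_ident)

setup_lifting type_definition_operator

lemma bounded_op_ap [simp]: "bounded_op (ap x)"
  using ap[of x] by simp

lemma bounded_linear_ap: "bounded_linear (ap x)"
  using bounded_op_ap bounded_op_def by blast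

lemma ap_scaleC: "ap x (c *\<^sub>C v) = c *\<^sub>C ap x v"
  using bounded_op_ap bounded_op_def by blast

lemmas ap_add_right = linear_add[OF bounded_linear.linear[OF bounded_linear_ap]]
lemmas ap_diff_right = linear_diff[OF bounded_linear.linear[OF bounded_linear_ap]]
lemmas ap_zero_right = linear_0[OF bounded_linear.linear[OF bounded_linear_ap]]
lemmas tendsto_ap = bounded_linear.tendsto[OF bounded_linear_ap]

lemma operator_eqI: "(\<And>v. ap x v = ap y v) \<Longrightarrow> x = y"
  by (metis ap_inject ext)

instantiation operator :: (complex_hilbert) "{ring, monoid_mult}"
begin

lift_definition zero_operator :: "'a operator" is "\<lambda>_. 0"
  by (simp add: bounded_op_def)
lift_definition one_operator :: "'a operator" is id
  by (simp add: bounded_op_def id_def bounded_linear_ident)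
lift_definition plus_operator :: "'a operator \<Rightarrow> 'a operator \<Rightarrow> 'a operator" is "\<lambda>S T v. S v + T v"
  by (simp add: bounded_op_def bounded_linear_add scaleC_add_right)
lift_definition minus_operator :: "'a operator \<Rightarrow> 'a operator \<Rightarrow> 'a operator" is "\<lambda>S T v. S v - T v"
  by (simp add: bounded_op_def bounded_linear_sub hilbert.scale_right_diff_distrib)
lift_definition uminus_operator :: "'a operator \<Rightarrow> 'a operator" is "\<lambda>S v. - S v"
  by (simp add: bounded_op_def bounded_linear_minus)
lift_definition times_operator :: "'a operator \<Rightarrow> 'a operator \<Rightarrow> 'a operator" is "\<lambda>S T. S \<circ> T"
  by (simp add: bounded_op_def o_def bounded_linear_compose)

instance
proof
  fix a b c :: "'a operator"
  show "a * b * c = a * (b * c)" "1 * a = a" "a * 1 = a" "a + b + c = a + (b + c)"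
    "a + b = b + a" "0 + a = a" "- a + a = 0" "a - b = a + - b" "(a + b) * c = a * c + b * c"
    by (transfer, auto simp: o_def)+
  show "a * (b + c) = a * b + a * c"
    by transfer (auto simp: o_def bounded_op_def linear_add bounded_linear.linear)
qed

end

lift_definition sc :: "complex \<Rightarrow> 'h::complex_hilbert operator \<Rightarrow> 'h operator"
  is "\<lambda>c T v. c *\<^sub>C T v"
  by (auto simp: bounded_op_def scaleC_scaleC mult.commute
      intro: bounded_linear_compose[OF bounded_linear_scaleC])

lemma ap_simps [simp]:
  "ap 0 v = 0" "ap 1 v = v" "ap (x + y) v = ap x v + ap y v" "ap (x - y) v = ap x v - ap y v"
  "ap (- x) v = - ap x v" "ap (x * y) v = ap x (ap y v)" "ap (sc c x) v = c *\<^sub>C ap x v"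
  by (transfer, simp)+

interpretation op: vector_space "sc :: complex \<Rightarrow> 'h::complex_hilbert operator \<Rightarrow> 'h operator"
  by unfold_locales
    (auto intro!: operator_eqI simp: scaleC_add_right scaleC_add_left scaleC_scaleC)

lemma sc_mult_left [simp]: "sc c x * y = sc c (x * y)"
  by (auto intro!: operator_eqI)

lemma sc_mult_right [simp]: "x * sc c y = sc c (x * y)"
  by (auto intro!: operator_eqI simp: ap_scaleC)

lemma sc_sc: "sc c (sc d x) = sc (c * d) x"
  by simp

section \<open>Adjoints\<close>

lemma adjoint_exists:
  assumes T: "bounded_op (T :: 'h::complex_hilbert \<Rightarrow> 'h)"
  shows "\<exists>S. bounded_op S \<and> (\<forall>x y. cinner (S x) y = cinner x (T y))"
proof -
  have Tl: "bounded_linear T" and Tc: "\<And>c x. T (c *\<^sub>C x) = c *\<^sub>C T x"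
    using T by (auto simp: bounded_op_def)
  obtain K where K: "0 \<le> K" "\<And>x. norm (T x) \<le> norm x * K"
    using bounded_linear.nonneg_bounded[OF Tl] by blast
  have "\<exists>\<theta>. norm \<theta> \<le> norm x * K \<and> (\<forall>y. cinner \<theta> y = cinner x (T y))" for x
  proof -
    have "cmod (cinner x (T y)) \<le> norm x * K * norm y" for y
    proof -
      have "cmod (cinner x (T y)) \<le> norm x * norm (T y)" by (rule cinner_CS)
      also have "\<dots> \<le> norm x * (norm y * K)" using K by (simp add: mult_left_mono)
      finally show ?thesis by (simp add: mult.commute mult.left_commute)
    qed
    then show ?thesis
      using riesz_subspace[of UNIV "\<lambda>y. cinner x (T y)" "norm x * K"] K Tc
      by (auto simp: hilbert.subspace_UNIV linear_add[OF bounded_linear.linear[OF Tl]] cinner_simps)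
  qed
  then obtain S where S: "\<And>x. norm (S x) \<le> norm x * K" "\<And>x y. cinner (S x) y = cinner x (T y)"
    by metis
  have "S (x + y) = S x + S y" "S (c *\<^sub>C x) = c *\<^sub>C S x" for x y c
    by (rule cinner_eqI, simp add: S cinner_simps)+
  then have "bounded_op S"
    using S(1) unfolding bounded_op_def
    by (auto intro!: bounded_linear_intro[where K = K] simp: scaleR_scaleC)
  then show ?thesis using S by blast
qed

lemma adj_eqI:
  assumes "\<And>x y. cinner (S x) y = cinner x (T y)"
  shows "adj T = S"
  unfolding adj_def
proof (rule the_equality)
  show "\<forall>x y. cinner (S x) y = cinner x (T y)" using assms by blast
  fix R assume "\<forall>x y. cinner (R x) y = cinner x (T y)"
  then show "R = S" using assms by (intro ext cinner_eqI) simp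
qed

lemma adj_props:
  assumes "bounded_op T"
  shows "bounded_op (adj T)" "cinner (adj T x) y = cinner x (T y)"
  using adjoint_exists[OF assms] adj_eqI by metis+

lift_definition star :: "'h::complex_hilbert operator \<Rightarrow> 'h operator" is adj
  by (rule adj_props)

lemma ap_star: "ap (star x) = adj (ap x)"
  by (rule star.rep_eq)

lemma cinner_star: "cinner (ap (star x) v) w = cinner v (ap x w)"
  by transfer (rule adj_props)

lemma cinner_star': "cinner v (ap (star x) w) = cinner (ap x v) w"
  by (metis cinner_commute cinner_star)

lemma star_eqI: "(\<And>v w. cinner (ap y v) w = cinner v (ap x w)) \<Longrightarrow> star x = y"
  by (intro operator_eqI cinner_eqI) (simp add: cinner_star)

lemma star_simps [simp]:
  "star (star x) = x" "star 0 = 0" "star 1 = 1" "star (x + y) = star x + star y"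
  "star (x - y) = star x - star y" "star (- x) = - star x" "star (x * y) = star y * star x"
  "star (sc c x) = sc (cnj c) (star x)"
  by (rule star_eqI; simp add: cinner_star cinner_star' cinner_simps)+

lemma star_power: "star (x ^ n) = star x ^ n"
  by (induction n) (simp_all add: power_commutes)

definition opn :: "'h::complex_hilbert operator \<Rightarrow> real" where "opn x = onorm (ap x)"

lemma opn_ge0: "0 \<le> opn x"
  by (simp add: opn_def onorm_pos_le bounded_linear_ap)

lemma opn: "norm (ap x v) \<le> opn x * norm v"
  by (simp add: opn_def onorm bounded_linear_ap)

section \<open>The operator order\<close>

definition pos :: "'h::complex_hilbert operator \<Rightarrow> bool" where
  "pos x \<longleftrightarrow> star x = x \<and> (\<forall>v. 0 \<le> Re (cinner v (ap x v)))"

lemma pos_add: "pos x \<Longrightarrow> pos y \<Longrightarrow> pos (x + y)"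
  by (simp add: pos_def cinner_simps)

text \<open>Polarization: the value at \<open>v + w\<close> yields the real part of
  \<open>cinner v (ap x w)\<close>, and \<open>\<i> *\<^sub>C w\<close> in place of \<open>w\<close>
  the imaginary part. It is the antisymmetry of the operator order.\<close>

lemma quad_zero:
  fixes x :: "'h::complex_hilbert operator"
  assumes sa: "star x = x" and q: "\<And>v. Re (cinner v (ap x v)) = 0"
  shows "x = 0"
proof (rule operator_eqI, rule cinner_eqI)
  fix v w :: 'h
  have *: "Re (cinner v (ap x w)) = 0" for v w
  proof -
    have "Re (cinner (v + w) (ap x (v + w))) = 2 * Re (cinner v (ap x w))"
    proof -
      have "cinner w (ap x v) = cnj (cinner v (ap x w))"
        by (metis sa cinner_star cinner_commute)
      then show ?thesis using q[of v] q[of w] by (simp add: ap_add_right cinner_simps)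
    qed
    then show ?thesis using q[of "v + w"] by simp
  qed
  have "Im (cinner v (ap x w)) = 0" for v w
    using *[of v "\<i> *\<^sub>C w"] by (simp add: ap_scaleC cinner_simps)
  then have "cinner w (ap x v) = 0" using * by (simp add: complex_eq_iff)
  then show "cinner (ap x v) w = cinner (ap 0 v) w"
    by (metis cinner_commute complex_cnj_zero ap_simps(1) cinner_zero_left)
qed

text \<open>Unlike \<open>op_le\<close>, the order includes self-adjointness of the difference; on
  all operators the quadratic form alone would not be antisymmetric, since it ignores skew-adjoint
  parts.\<close>

instantiation operator :: (complex_hilbert) ordered_ab_group_add
begin

definition "x \<le> y \<longleftrightarrow> pos (y - x)" for x y :: "'a operator"
definition "x < y \<longleftrightarrow> x \<le> y \<and> x \<noteq> y" for x y :: "'a operator"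

instance
proof
  fix x y z :: "'a operator"
  show "x \<le> x" by (simp add: less_eq_operator_def pos_def hilbert.B_zero)
  show xz: "x \<le> z" if "x \<le> y" "y \<le> z"
  proof -
    have "z - x = (z - y) + (y - x)" by simp
    then show ?thesis
      using that pos_add[of "z - y" "y - x"] by (simp only: less_eq_operator_def)
  qed
  show xy: "x = y" if "x \<le> y" "y \<le> x"
  proof -
    have "y - x = 0"
      using that unfolding less_eq_operator_def pos_def
      by (intro quad_zero) (auto simp: cinner_simps intro!: antisym)
    then show ?thesis by simp
  qed
  show "x < y \<longleftrightarrow> x \<le> y \<and> \<not> y \<le> x"
    using xy by (auto simp: less_operator_def)
  show "x \<le> y \<Longrightarrow> z + x \<le> z + y" by (simp add: less_eq_operator_def)
qed

end

lemma operator_ge0: "0 \<le> x \<longleftrightarrow> star x = x \<and> (\<forall>v. 0 \<le> Re (cinner v (ap x v)))"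
  for x :: "'h::complex_hilbert operator"
  by (simp add: less_eq_operator_def pos_def)

lemma operator_le: "x \<le> y \<longleftrightarrow> star (y - x) = y - x \<and> (\<forall>v. Re (cinner v (ap x v)) \<le> Re (cinner v (ap y v)))"
  for x :: "'h::complex_hilbert operator"
  by (simp add: less_eq_operator_def pos_def cinner_simps)

lemma ge0_star: "0 \<le> x \<Longrightarrow> star x = x" for x :: "'h::complex_hilbert operator"
  by (simp add: operator_ge0)

lemma star_mult_ge0: "0 \<le> star x * (x :: 'h::complex_hilbert operator)"
  by (simp add: operator_ge0 cinner_star' cinner_self)

lemma conj_ge0: "0 \<le> x \<Longrightarrow> 0 \<le> star z * x * (z :: 'h::complex_hilbert operator)"
  by (simp add: operator_ge0 cinner_star' mult.assoc)

lemma conj_mono: "x \<le> y \<Longrightarrow> star z * x * z \<le> star z * y * (z :: 'h::complex_hilbert operator)"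
  using conj_ge0[of "y - x" z] by (simp add: algebra_simps)

lemma sc_ge0: "0 \<le> r \<Longrightarrow> 0 \<le> x \<Longrightarrow> 0 \<le> sc (complex_of_real r) (x :: 'h::complex_hilbert operator)"
  by (simp add: operator_ge0 cinner_simps)

lemma sc_mono: "0 \<le> r \<Longrightarrow> x \<le> y \<Longrightarrow>
    sc (complex_of_real r) x \<le> sc (complex_of_real r) (y :: 'h::complex_hilbert operator)"
  using sc_ge0[of r "y - x"] by (simp add: op.scale_right_diff_distrib)

lemma one_ge0: "0 \<le> (1 :: 'h::complex_hilbert operator)"
  using star_mult_ge0[of 1] by simp

lemma sa_le_opn:
  fixes x :: "'h::complex_hilbert operator"
  assumes "star x = x"
  shows "x \<le> sc (complex_of_real (opn x)) 1"
  unfolding operator_le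
proof (intro conjI allI)
  fix v
  have "Re (cinner v (ap x v)) \<le> norm v * norm (ap x v)"
    using complex_Re_le_cmod cinner_CS order_trans by blast
  also have "\<dots> \<le> norm v * (opn x * norm v)" by (simp add: mult_left_mono opn)
  finally show "Re (cinner v (ap x v)) \<le> Re (cinner v (ap (sc (complex_of_real (opn x)) 1) v))"
    by (simp add: cinner_simps cinner_self power2_eq_square algebra_simps)
qed (simp add: assms)

lemma star_mult_le_opn:
  fixes x :: "'h::complex_hilbert operator"
  shows "star x * x \<le> sc (complex_of_real ((opn x)\<^sup>2)) 1"
  unfolding operator_le
proof (intro conjI allI)
  fix v
  have "(norm (ap x v))\<^sup>2 \<le> (opn x * norm v)\<^sup>2" by (simp add: power_mono opn)
  then show "Re (cinner v (ap (star x * x) v)) \<le> Re (cinner v (ap (sc (complex_of_real ((opn x)\<^sup>2)) 1) v))"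
    by (simp add: cinner_simps cinner_star' cinner_self power_mult_distrib flip: of_real_power of_real_mult)
qed simp

lemma sq_le_self:
  fixes c :: "'h::complex_hilbert operator"
  assumes "0 \<le> c" "c \<le> 1"
  shows "c * c \<le> c"
proof -
  have s: "star c = c" using assms ge0_star by blast
  \<comment> \<open>Writing \<open>c - c * c\<close> as a sum of two conjugates of positive
    operators avoids a square root of \<open>c\<close>.\<close>
  have "0 \<le> star c * (1 - c) * c + star (1 - c) * c * (1 - c)"
    using assms by (intro add_nonneg_nonneg conj_ge0) auto
  also have "\<dots> = c - c * c" by (simp add: s algebra_simps)
  finally show ?thesis by simp
qed

text \<open>Cauchy-Schwarz for the possibly degenerate form \<open>cinner v (ap T w)\<close>,
  applied to \<open>v\<close> and \<open>T v\<close>. It yields strong convergence of monotone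
  sequences before square roots are available.\<close>

lemma norm_sq_le_quad:
  fixes T :: "'h::complex_hilbert operator"
  assumes "0 \<le> T" "T \<le> sc (complex_of_real C) 1"
  shows "(norm (ap T v))\<^sup>2 \<le> C * Re (cinner v (ap T v))"
proof -
  have sa: "star T = T" and p: "\<And>w. 0 \<le> Re (cinner w (ap T w))"
    using assms(1) by (auto simp: operator_ge0)
  interpret S: semi_inner scaleC UNIV "\<lambda>v w. cinner v (ap T w)"
  proof
    fix x y :: 'h
    show "cinner y (ap T x) = cnj (cinner x (ap T y))"
      by (metis cinner_commute cinner_star sa)
  qed (auto simp: cinner_simps ap_scaleC ap_add_right p hilbert.subspace_UNIV)
  let ?w = "ap T v"
  have n: "(S.nrm u)\<^sup>2 = Re (cinner u (ap T u))" for u by (rule S.nrm_sq) simp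
  have "(norm ?w)\<^sup>2 = Re (cinner v (ap T ?w))"
  proof -
    have "cinner v (ap T ?w) = complex_of_real ((norm ?w)\<^sup>2)"
      using cinner_star[of T v ?w] unfolding sa cinner_self by simp
    then show ?thesis by simp
  qed
  also have "\<dots> \<le> S.nrm v * S.nrm ?w"
    using complex_Re_le_cmod S.CS[of v ?w] by (meson UNIV_I order_trans)
  finally have "((norm ?w)\<^sup>2)\<^sup>2 \<le> (S.nrm v * S.nrm ?w)\<^sup>2" by (rule power_mono) simp
  also have "\<dots> = Re (cinner v ?w) * Re (cinner ?w (ap T ?w))"
    by (simp add: power_mult_distrib n)
  also have "\<dots> \<le> Re (cinner v ?w) * (C * (norm ?w)\<^sup>2)"
    using assms(2) p[of v] unfolding operator_le
    by (intro mult_left_mono) (auto simp: cinner_simps cinner_self simp flip: of_real_power)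
  finally have "(norm ?w)\<^sup>2 * (norm ?w)\<^sup>2 \<le> (C * Re (cinner v ?w)) * (norm ?w)\<^sup>2"
    by (simp add: power2_eq_square algebra_simps)
  note * = this
  show ?thesis
  proof (cases "?w = 0")
    case True
    then show ?thesis by (simp add: hilbert.B_zero)
  next
    case False
    then show ?thesis by (intro mult_right_le_imp_le[OF *]) simp
  qed
qed

section \<open>Strong limits of sequences\<close>

text \<open>Sequences suffice, also on a non-separable space: the trace is finite and faithful, so
  every exhaustion below can be carried out along a sequence.\<close>

definition sot :: "(nat \<Rightarrow> 'h::complex_hilbert operator) \<Rightarrow> 'h operator \<Rightarrow> bool" where
  "sot a s \<longleftrightarrow> (\<forall>v. (\<lambda>n. ap (a n) v) \<longlonglongrightarrow> ap s v)"

lemma sot_unique: "sot a s \<Longrightarrow> sot a t \<Longrightarrow> s = t"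
  unfolding sot_def by (intro operator_eqI) (meson LIMSEQ_unique)

lemma sot_const: "sot (\<lambda>n. s) s" by (simp add: sot_def)

lemma sot_Suc: "sot a s \<Longrightarrow> sot (\<lambda>n. a (Suc n)) s"
  unfolding sot_def using LIMSEQ_Suc by blast

lemma sot_add: "sot a s \<Longrightarrow> sot b t \<Longrightarrow> sot (\<lambda>n. a n + b n) (s + t)"
  by (simp add: sot_def tendsto_add)

lemma sot_diff: "sot a s \<Longrightarrow> sot b t \<Longrightarrow> sot (\<lambda>n. a n - b n) (s - t)"
  by (simp add: sot_def tendsto_diff)

lemma sot_sc: "sot a s \<Longrightarrow> sot (\<lambda>n. sc c (a n)) (sc c s)"
  by (simp add: sot_def tendsto_scaleC)

lemma sot_mult_left: "sot a s \<Longrightarrow> sot (\<lambda>n. x * a n) (x * s)"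
  by (simp add: sot_def tendsto_ap)

lemma sot_mult_right: "sot a s \<Longrightarrow> sot (\<lambda>n. a n * x) (s * x)"
  by (simp add: sot_def)

lemma sot_mult:
  assumes a: "sot a s" and b: "sot b t" and C: "\<And>n v. norm (ap (a n) v) \<le> C * norm v"
  shows "sot (\<lambda>n. a n * b n) (s * t)"
  unfolding sot_def
proof
  fix v
  have "(\<lambda>n. ap (a n) (ap (b n) v - ap t v)) \<longlonglongrightarrow> 0"
  proof (rule Lim_null_comparison)
    show "\<forall>\<^sub>F n in sequentially. norm (ap (a n) (ap (b n) v - ap t v)) \<le> C * norm (ap (b n) v - ap t v)"
      using C by simp
    have "(\<lambda>n. C * norm (ap (b n) v - ap t v)) \<longlonglongrightarrow> C * norm (ap t v - ap t v)"
      using b unfolding sot_def by (intro tendsto_intros) auto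
    then show "(\<lambda>n. C * norm (ap (b n) v - ap t v)) \<longlonglongrightarrow> 0" by simp
  qed
  moreover have "(\<lambda>n. ap (a n) (ap t v)) \<longlonglongrightarrow> ap s (ap t v)"
    using a by (simp add: sot_def)
  ultimately have "(\<lambda>n. ap (a n) (ap (b n) v - ap t v) + ap (a n) (ap t v)) \<longlonglongrightarrow> 0 + ap s (ap t v)"
    by (rule tendsto_add)
  then show "(\<lambda>n. ap (a n * b n) v) \<longlonglongrightarrow> ap (s * t) v"
    by (simp add: ap_diff_right)
qed

lemma sot_sa:
  assumes a: "sot a s" and "\<And>n. star (a n) = a n"
  shows "star s = s"
proof (rule star_eqI)
  fix v w
  have "(\<lambda>n. cinner (ap (a n) v) w) \<longlonglongrightarrow> cinner (ap s v) w"
    using a unfolding sot_def by (intro tendsto_cinner) auto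
  moreover have "(\<lambda>n. cinner v (ap (a n) w)) \<longlonglongrightarrow> cinner v (ap s w)"
    using a unfolding sot_def by (intro tendsto_cinner) auto
  moreover have "cinner (ap (a n) v) w = cinner v (ap (a n) w)" for n
    by (metis assms(2) cinner_star)
  ultimately show "cinner (ap s v) w = cinner v (ap s w)"
    by (simp add: LIMSEQ_unique)
qed

lemma sot_quad:
  "sot a s \<Longrightarrow> (\<lambda>n. Re (cinner v (ap (a n) v))) \<longlonglongrightarrow> Re (cinner v (ap s v))"
  unfolding sot_def by (intro tendsto_Re tendsto_cinner) auto

lemma sot_commute:
  assumes "sot a s" "\<And>n. t * a n = a n * t"
  shows "t * s = s * t"
proof (rule sot_unique)
  show "sot (\<lambda>n. t * a n) (t * s)" using assms(1) by (rule sot_mult_left)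
  show "sot (\<lambda>n. t * a n) (s * t)" unfolding assms(2) using assms(1) by (rule sot_mult_right)
qed

lemma sot_exists:
  fixes a :: "nat \<Rightarrow> 'h::complex_hilbert operator"
  assumes c: "\<And>v. Cauchy (\<lambda>n. ap (a n) v)" and C: "\<And>n v. norm (ap (a n) v) \<le> C * norm v"
  shows "\<exists>s. sot a s"
proof -
  obtain S where S: "\<And>v. (\<lambda>n. ap (a n) v) \<longlonglongrightarrow> S v"
    using c unfolding Cauchy_convergent_iff convergent_def by metis
  have add: "S (v + w) = S v + S w" for v w
    using S[of "v + w"] tendsto_add[OF S[of v] S[of w]] unfolding ap_add_right by (rule LIMSEQ_unique)
  have sc: "S (c *\<^sub>C v) = c *\<^sub>C S v" for c v
    using S[of "c *\<^sub>C v"] tendsto_scaleC[OF S[of v], of c] unfolding ap_scaleC by (rule LIMSEQ_unique)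
  have "norm (S v) \<le> norm v * C" for v
    using LIMSEQ_le_const2[OF tendsto_norm[OF S[of v]]] C by (simp add: mult.commute)
  then have "bounded_op S"
    unfolding bounded_op_def
    by (auto intro!: bounded_linear_intro[where K = C] simp: add sc scaleR_scaleC)
  then have "ap (Op S) = S" by (simp add: Op_inverse)
  then show ?thesis using S unfolding sot_def by metis
qed

text \<open>The quadratic forms increase and are bounded, hence converge;
  \<open>norm_sq_le_quad\<close> for the differences \<open>a n - a m\<close>, which are bounded by
  \<open>C\<close>, turns this into convergence of the vectors.\<close>

lemma sot_monotone:
  fixes a :: "nat \<Rightarrow> 'h::complex_hilbert operator"
  assumes inc: "\<And>n. a n \<le> a (Suc n)" and up: "\<And>n. a n \<le> g" and sa: "\<And>n. star (a n) = a n"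
  shows "\<exists>s. sot a s \<and> star s = s \<and> (\<forall>n. a n \<le> s) \<and> (\<forall>y. star y = y \<longrightarrow> (\<forall>n. a n \<le> y) \<longrightarrow> s \<le> y)"
proof -
  have mono: "a m \<le> a n" if "m \<le> n" for m n
    by (rule lift_Suc_mono_le[of a, OF inc that])
  define C where "C = opn (g - a 0)"
  have g: "g - a 0 \<le> sc (complex_of_real C) 1"
    unfolding C_def using up[of 0] by (intro sa_le_opn) (simp add: operator_le)
  have d: "(norm (ap (a n) v - ap (a m) v))\<^sup>2
      \<le> C * (Re (cinner v (ap (a n) v)) - Re (cinner v (ap (a m) v)))" if "m \<le> n" for m n v
  proof -
    have "a n - a m \<le> g - a 0" using up[of n] mono[of 0 m] by (intro diff_mono) auto
    then have "a n - a m \<le> sc (complex_of_real C) 1" using g by (rule order_trans)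
    then show ?thesis
      using norm_sq_le_quad[of "a n - a m" C v] mono[OF that] by (simp add: cinner_simps)
  qed
  have C0: "0 \<le> C" by (simp add: C_def opn_ge0)
  have "Cauchy (\<lambda>n. ap (a n) v)" for v
  proof (rule metric_CauchyI)
    fix e :: real assume "0 < e"
    define q where "q n = Re (cinner v (ap (a n) v))" for n
    have "incseq q" using mono by (auto simp: incseq_def q_def operator_le)
    moreover have "bdd_above (range q)"
      using up by (auto intro!: bdd_aboveI[of _ "Re (cinner v (ap g v))"] simp: q_def operator_le)
    ultimately have "Cauchy q"
      using LIMSEQ_incseq_SUP LIMSEQ_imp_Cauchy by blast
    \<comment> \<open>The divisor is \<open>C + 1\<close> because \<open>C\<close> may be 0.\<close>
    then obtain N where N: "\<And>m n. m \<ge> N \<Longrightarrow> n \<ge> N \<Longrightarrow> dist (q m) (q n) < e\<^sup>2 / (C + 1)"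
      using metric_CauchyD[of q "e\<^sup>2 / (C + 1)"] \<open>0 < e\<close> C0 by fastforce
    have "norm (ap (a n) v - ap (a m) v) < e" if "N \<le> m" "m \<le> n" for m n
    proof -
      have "q n - q m < e\<^sup>2 / (C + 1)" using N[of m n] that by (simp add: dist_real_def)
      then have "(C + 1) * (q n - q m) < e\<^sup>2" using C0 by (simp add: field_simps)
      moreover have "q m \<le> q n" using \<open>incseq q\<close> that by (simp add: incseq_def)
      ultimately have "C * (q n - q m) < e\<^sup>2" by (simp add: algebra_simps)
      then have "(norm (ap (a n) v - ap (a m) v))\<^sup>2 < e\<^sup>2"
        using d[OF that(2), of v] by (simp add: q_def)
      then show ?thesis using \<open>0 < e\<close> by (auto intro: power2_less_imp_less)
    qed
    then show "\<exists>M. \<forall>m\<ge>M. \<forall>n\<ge>M. dist (ap (a m) v) (ap (a n) v) < e"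
      by (metis dist_norm dist_commute nle_le)
  qed
  moreover have "norm (ap (a n) v) \<le> (C + opn (a 0)) * norm v" for n v
  proof -
    have "a n - a 0 \<le> sc (complex_of_real C) 1"
      using up[of n] g by (meson diff_right_mono order_trans)
    then have "(norm (ap (a n - a 0) v))\<^sup>2 \<le> C * Re (cinner v (ap (a n - a 0) v))"
      using mono[of 0 n] by (intro norm_sq_le_quad) auto
    also have "\<dots> \<le> C * (C * (norm v)\<^sup>2)"
      using \<open>a n - a 0 \<le> sc (complex_of_real C) 1\<close> C0 unfolding operator_le
      by (intro mult_left_mono) (auto simp: cinner_simps cinner_self simp flip: of_real_power)
    finally have "(norm (ap (a n - a 0) v))\<^sup>2 \<le> (C * norm v)\<^sup>2"
      by (simp add: power2_eq_square algebra_simps)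
    then have "norm (ap (a n - a 0) v) \<le> C * norm v"
      by (rule power2_le_imp_le) (simp add: C0)
    moreover have "norm (ap (a n) v) \<le> norm (ap (a n - a 0) v) + norm (ap (a 0) v)"
      using norm_triangle_ineq[of "ap (a n - a 0) v" "ap (a 0) v"] by simp
    ultimately show ?thesis using opn[of "a 0" v] by (simp add: algebra_simps)
  qed
  ultimately obtain s where s: "sot a s" using sot_exists by blast
  have ss: "star s = s" using s sa by (rule sot_sa)
  have "a n \<le> s" for n
    unfolding operator_le
  proof (intro conjI allI)
    fix v
    show "Re (cinner v (ap (a n) v)) \<le> Re (cinner v (ap s v))"
      using mono by (intro LIMSEQ_le_const[OF sot_quad[OF s]]) (auto simp: operator_le)
  qed (simp add: ss sa)
  moreover have "s \<le> y" if "star y = y" "\<forall>n. a n \<le> y" for y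
    unfolding operator_le
  proof (intro conjI allI)
    fix v
    show "Re (cinner v (ap s v)) \<le> Re (cinner v (ap y v))"
      using that by (intro LIMSEQ_le_const2[OF sot_quad[OF s]]) (auto simp: operator_le)
  qed (simp add: ss that)
  ultimately show ?thesis using s ss by blast
qed

section \<open>Von Neumann algebras\<close>

text \<open>The polynomials in \<open>d\<close> with nonnegative coefficients. They commute and, for
  positive \<open>d\<close>, are positive, so inequalities between iterates reduce to signs of
  coefficients. This takes the place of a functional calculus.\<close>

inductive_set pcone :: "'h::complex_hilbert operator \<Rightarrow> 'h operator set" for d where
  pow: "d ^ n \<in> pcone d"
| add: "x \<in> pcone d \<Longrightarrow> y \<in> pcone d \<Longrightarrow> x + y \<in> pcone d"
| scale: "0 \<le> r \<Longrightarrow> x \<in> pcone d \<Longrightarrow> sc (complex_of_real r) x \<in> pcone d"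

lemma pcone_basic: "0 \<in> pcone d" "1 \<in> pcone d" "d \<in> pcone d"
  using pcone.scale[OF _ pcone.pow, of 0 d 0] pcone.pow[of d 0] pcone.pow[of d 1] by simp_all

lemma pcone_mult:
  assumes "x \<in> pcone d" "y \<in> pcone d"
  shows "x * y \<in> pcone d"
  using assms(1)
proof induction
  case (pow m)
  from assms(2) show ?case
  proof induction
    case (pow n)
    show ?case using pcone.pow[of d "m + n"] by (simp add: power_add)
  qed (auto simp: distrib_left intro: pcone.intros)
qed (auto simp: distrib_right intro: pcone.intros)

lemma pcone_commute: "x \<in> pcone d \<Longrightarrow> t * d = d * t \<Longrightarrow> t * x = x * t"
proof (induction rule: pcone.induct)
  case (pow n)
  then show ?case by (metis power_commuting_commutes)
qed (auto simp: algebra_simps)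

lemma pcone_commutative: "x \<in> pcone d \<Longrightarrow> y \<in> pcone d \<Longrightarrow> x * y = y * x"
  by (metis pcone_commute)

text \<open>An even power is a square, an odd one a conjugate of \<open>d\<close>.\<close>

lemma power_ge0:
  fixes d :: "'h::complex_hilbert operator"
  assumes d: "0 \<le> d"
  shows "0 \<le> d ^ n"
proof -
  have s: "star (d ^ k) = d ^ k" for k using d by (simp add: star_power ge0_star)
  show ?thesis
  proof (cases "even n")
    case True
    then obtain k where "n = k + k" by (metis evenE mult_2)
    then show ?thesis using star_mult_ge0[of "d ^ k"] by (simp add: s power_add)
  next
    case False
    then obtain k where "n = Suc (k + k)" by (metis oddE mult_2 Suc_eq_plus1)
    then show ?thesis using conj_ge0[OF d, of "d ^ k"]
      by (simp add: s power_add mult.assoc power_commutes)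
  qed
qed

lemma pcone_ge0: "x \<in> pcone d \<Longrightarrow> 0 \<le> d \<Longrightarrow> 0 \<le> x"
  by (induction rule: pcone.induct) (auto intro: power_ge0 sc_ge0 add_nonneg_nonneg)

lemma norm_ap_le1:
  fixes x :: "'h::complex_hilbert operator"
  assumes "0 \<le> x" "x \<le> 1"
  shows "norm (ap x v) \<le> 1 * norm v"
proof -
  have "(norm (ap x v))\<^sup>2 \<le> 1 * Re (cinner v (ap x v))"
    using assms by (intro norm_sq_le_quad) auto
  also have "\<dots> \<le> (norm v)\<^sup>2"
    using assms(2) by (auto simp: operator_le cinner_self simp flip: of_real_power)
  finally show ?thesis by (auto intro: power2_le_imp_le)
qed

text \<open>With \<open>d = 1 - b\<close>, the iteration
  \<open>y \<mapsto> (d + y\<^sup>2) / 2\<close> increases to a fixed point \<open>s\<close> with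
  \<open>(1 - s)\<^sup>2 = b\<close>. Increments factor as half of the previous increment times the
  sum of two iterates, so they have nonnegative coefficients in \<open>d\<close>.\<close>

lemma sqrt_exists_le1:
  fixes b :: "'h::complex_hilbert operator"
  assumes b: "0 \<le> b" "b \<le> 1"
  shows "\<exists>r. 0 \<le> r \<and> r * r = b \<and> (\<forall>t. t * b = b * t \<longrightarrow> t * r = r * t)"
proof -
  define d where "d = 1 - b"
  have d: "0 \<le> d" "d \<le> 1" using b by (auto simp: d_def)
  define y where "y = rec_nat 0 (\<lambda>_ x. sc (1/2) (d + x * x))"
  have y0: "y 0 = 0" and ySuc: "y (Suc n) = sc (1/2) (d + y n * y n)" for n
    by (simp_all add: y_def)
  have half: "sc (1/2) x \<in> pcone d" if "x \<in> pcone d" for x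
    using pcone.scale[OF _ that, of "1/2"] by simp
  have yc: "y n \<in> pcone d" for n
    by (induction n) (auto simp: y0 ySuc pcone_basic intro!: half pcone.add pcone_mult)
  have inc: "y (Suc n) - y n \<in> pcone d" for n
  proof (induction n)
    case 0
    then show ?case by (simp add: y0 ySuc half pcone_basic)
  next
    case (Suc n)
    have "y (Suc (Suc n)) - y (Suc n) = sc (1/2) (y (Suc n) * y (Suc n) - y n * y n)"
      by (simp only: ySuc op.scale_right_diff_distrib[symmetric]) simp
    also have "y (Suc n) * y (Suc n) - y n * y n = (y (Suc n) - y n) * (y (Suc n) + y n)"
      using pcone_commutative[OF yc yc, of "Suc n" n] by (simp add: algebra_simps)
    also have "sc (1/2) \<dots> \<in> pcone d"
      by (intro half pcone_mult Suc pcone.add yc)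
    finally show ?case .
  qed
  have mono: "y n \<le> y (Suc n)" for n using pcone_ge0[OF inc d(1), of n] by simp
  have ge0: "0 \<le> y n" for n using pcone_ge0[OF yc d(1)] .
  have le1: "y n \<le> 1" for n
  proof (induction n)
    case 0 then show ?case by (simp add: y0 one_ge0)
  next
    case (Suc n)
    have "d + y n * y n \<le> 1 + 1"
      using sq_le_self[OF ge0 Suc] Suc d by (intro add_mono) auto
    then have "sc (complex_of_real (1/2)) (d + y n * y n) \<le> sc (complex_of_real (1/2)) (1 + 1)"
      by (intro sc_mono) auto
    moreover have "sc (complex_of_real (1/2)) (1 + 1) = (1 :: 'h operator)"
      using op.scale_left_distrib[of "1/2" "1/2" "1 :: 'h operator"]
      by (simp add: op.scale_right_distrib)
    ultimately show ?case by (simp add: ySuc)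
  qed
  obtain s where s: "sot y s" and s1: "\<And>n. y n \<le> s" "s \<le> 1"
  proof -
    have "star (y n) = y n" for n using ge0 ge0_star by blast
    then show thesis using that sot_monotone[of y 1] mono le1 by (metis star_simps(3))
  qed
  have "sot (\<lambda>n. y (Suc n)) (sc (1/2) (d + s * s))"
    unfolding ySuc using norm_ap_le1[OF ge0 le1] s
    by (intro sot_sc sot_add sot_const sot_mult[where C = 1]) auto
  then have eq: "s = sc (1/2) (d + s * s)" by (rule sot_unique[OF sot_Suc[OF s]])
  have "sc 2 s = d + s * s" by (subst eq) simp
  then have "s + s = d + s * s" using op.scale_left_distrib[of 1 1 s] by simp
  then have "(1 - s) * (1 - s) = b" by (simp add: d_def algebra_simps)
  moreover have "t * (1 - s) = (1 - s) * t" if "t * b = b * t" for t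
  proof -
    have "t * d = d * t" using that by (simp add: d_def algebra_simps)
    then have "t * y n = y n * t" for n by (rule pcone_commute[OF yc])
    then have "t * s = s * t" by (rule sot_commute[OF s])
    then show ?thesis by (simp add: algebra_simps)
  qed
  moreover have "0 \<le> 1 - s" using s1 by simp
  ultimately show ?thesis by blast
qed

lemma sqrt_exists:
  fixes b :: "'h::complex_hilbert operator"
  assumes b: "0 \<le> b"
  shows "\<exists>r. 0 \<le> r \<and> r * r = b \<and> (\<forall>t. t * b = b * t \<longrightarrow> t * r = r * t)"
proof -
  \<comment> \<open>The summand 1 keeps \<open>C\<close> positive, also for
    \<open>b = 0\<close>.\<close>
  define C where "C = opn b + 1"
  have C: "0 < C" "b \<le> sc (complex_of_real C) 1"
  proof -
    show "0 < C" using opn_ge0[of b] by (simp add: C_def)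
    have "b \<le> sc (complex_of_real (opn b)) 1" using sa_le_opn b ge0_star by blast
    also have "\<dots> \<le> sc (complex_of_real (opn b)) 1 + 1" using one_ge0 by simp
    finally show "b \<le> sc (complex_of_real C) 1" by (simp add: C_def op.scale_left_distrib)
  qed
  let ?b = "sc (complex_of_real (1 / C)) b"
  have "?b \<le> sc (complex_of_real (1 / C)) (sc (complex_of_real C) 1)"
    using C by (intro sc_mono) auto
  then have "0 \<le> ?b" "?b \<le> 1" using C b sc_ge0[of "1 / C" b] by (auto simp flip: of_real_mult)
  then obtain r where r: "0 \<le> r" "r * r = ?b" "\<And>t. t * ?b = ?b * t \<Longrightarrow> t * r = r * t"
    using sqrt_exists_le1 by blast
  let ?r = "sc (complex_of_real (sqrt C)) r"
  have "?r * ?r = b" using C(1) by (simp add: r(2) flip: of_real_mult)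
  moreover have "0 \<le> ?r" using r(1) C(1) by (intro sc_ge0) auto
  moreover have "t * ?r = ?r * t" if "t * b = b * t" for t using r(3)[of t] that by simp
  ultimately show ?thesis by blast
qed

section \<open>Commutants and generated von Neumann algebras\<close>

definition comm :: "'h::complex_hilbert operator set \<Rightarrow> 'h operator set" where
  "comm S = {t. \<forall>s\<in>S. t * s = s * t}"

definition vna :: "'h::complex_hilbert operator set \<Rightarrow> bool" where
  "vna M \<longleftrightarrow> (\<forall>x\<in>M. star x \<in> M) \<and> comm (comm M) = M"

text \<open>Adjoining the adjoints makes the set self-adjoint, so that its double commutant is a von
  Neumann algebra.\<close>

definition vhull :: "'h::complex_hilbert operator set \<Rightarrow> 'h operator set" where
  "vhull S = comm (comm (S \<union> star ` S))"

lemma comm_antimono: "S \<subseteq> T \<Longrightarrow> comm T \<subseteq> comm S"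
  by (auto simp: comm_def)

lemma comm_comm: "S \<subseteq> comm (comm S)"
  by (auto simp: comm_def)

lemma comm_triple: "comm (comm (comm S)) = comm S"
  by (meson comm_antimono comm_comm subset_antisym)

lemma comm_closed:
  "1 \<in> comm S" "0 \<in> comm S" "x \<in> comm S \<Longrightarrow> y \<in> comm S \<Longrightarrow> x + y \<in> comm S"
  "x \<in> comm S \<Longrightarrow> y \<in> comm S \<Longrightarrow> x - y \<in> comm S"
  "x \<in> comm S \<Longrightarrow> y \<in> comm S \<Longrightarrow> x * y \<in> comm S"
  "x \<in> comm S \<Longrightarrow> sc c x \<in> comm S" "x \<in> comm S \<Longrightarrow> - x \<in> comm S"
  unfolding comm_def by (auto simp: algebra_simps) (metis mult.assoc)

lemma comm_sot:
  assumes "sot a s" "\<And>n. a n \<in> comm S"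
  shows "s \<in> comm S"
  using assms sot_commute[OF assms(1)] by (fastforce simp: comm_def)

lemma comm_star: "(\<And>x. x \<in> S \<Longrightarrow> star x \<in> S) \<Longrightarrow> x \<in> comm S \<Longrightarrow> star x \<in> comm S"
  unfolding comm_def by (simp add: Ball_def) (metis star_simps(1,7))

lemma vna_comm2: "(\<And>x. x \<in> S \<Longrightarrow> star x \<in> S) \<Longrightarrow> vna (comm (comm S))"
  using comm_star[of S] comm_star[of "comm S"] by (simp add: vna_def comm_triple)

lemma vna_closed:
  assumes "vna M"
  shows "1 \<in> M" "0 \<in> M" "x \<in> M \<Longrightarrow> y \<in> M \<Longrightarrow> x + y \<in> M" "x \<in> M \<Longrightarrow> y \<in> M \<Longrightarrow> x - y \<in> M"
    "x \<in> M \<Longrightarrow> y \<in> M \<Longrightarrow> x * y \<in> M" "x \<in> M \<Longrightarrow> sc c x \<in> M" "x \<in> M \<Longrightarrow> - x \<in> M"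
    "x \<in> M \<Longrightarrow> star x \<in> M"
proof -
  note c = comm_closed[where S = "comm M"]
  have *: "comm (comm M) = M" using assms by (simp add: vna_def)
  show "1 \<in> M" "0 \<in> M" using c(1,2) * by auto
  show "x \<in> M \<Longrightarrow> y \<in> M \<Longrightarrow> x + y \<in> M" "x \<in> M \<Longrightarrow> y \<in> M \<Longrightarrow> x - y \<in> M"
    "x \<in> M \<Longrightarrow> y \<in> M \<Longrightarrow> x * y \<in> M" "x \<in> M \<Longrightarrow> sc c x \<in> M" "x \<in> M \<Longrightarrow> - x \<in> M"
    using c(3-7) * by auto
  show "x \<in> M \<Longrightarrow> star x \<in> M" using assms by (simp add: vna_def)
qed

lemma vna_sot: "vna M \<Longrightarrow> sot a s \<Longrightarrow> (\<And>n. a n \<in> M) \<Longrightarrow> s \<in> M"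
  using comm_sot[of a s "comm M"] by (auto simp: vna_def)

lemma vna_comm_mem: "vna M \<Longrightarrow> (\<And>t. t \<in> comm M \<Longrightarrow> t * x = x * t) \<Longrightarrow> x \<in> M"
  by (auto simp: vna_def comm_def)

text \<open>The root commutes with whatever commutes with \<open>b\<close>, so it lies in the double
  commutant.\<close>

lemma vna_sqrt:
  assumes "vna M" "b \<in> M" "0 \<le> b"
  shows "\<exists>r\<in>M. 0 \<le> r \<and> r * r = b"
proof -
  obtain r where r: "0 \<le> r" "r * r = b" "\<And>t. t * b = b * t \<Longrightarrow> t * r = r * t"
    using sqrt_exists[OF assms(3)] by blast
  have "r \<in> M" using assms by (intro vna_comm_mem) (auto intro!: r simp: comm_def)
  then show ?thesis using r by blast
qed

lemma vhull_vna: "vna (vhull S)"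
  unfolding vhull_def by (rule vna_comm2) auto

lemma vhull_sub: "S \<subseteq> vhull S"
  unfolding vhull_def using comm_comm by blast

lemma vhull_min:
  assumes "vna L" "S \<subseteq> L"
  shows "vhull S \<subseteq> L"
proof -
  have "S \<union> star ` S \<subseteq> L" using assms vna_closed(8) by blast
  then have "vhull S \<subseteq> comm (comm L)" unfolding vhull_def by (intro comm_antimono)
  then show ?thesis using assms by (simp add: vna_def)
qed

lemma bounded_op_iff: "bounded_op T \<longleftrightarrow> (\<exists>x. T = ap x)"
  by (metis bounded_op_ap Op_inverse mem_Collect_eq)

lemma ap_eq_iff: "ap x = ap y \<longleftrightarrow> x = y"
  by (rule ap_inject)

lemma inj_ap: "inj ap"
  by (simp add: inj_def ap_eq_iff)

lemmas ap_mem_iff = inj_image_mem_iff[OF inj_ap]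
  and ap_image_eq_iff = inj_image_eq_iff[OF inj_ap]
  and ap_image_subset_iff = inj_image_subset_iff[OF inj_ap]

lemma ap_mult: "ap (x * y) = ap x \<circ> ap y"
  by (rule ext) simp

lemma ap_one: "ap 1 = id"
  by (rule ext) simp

lemma commutant_ap: "commutant (ap ` S) = ap ` comm S"
  unfolding commutant_def comm_def
  by (auto simp: bounded_op_iff image_iff ap_eq_iff simp flip: ap_mult)

lemma von_neumann_algebra_ap: "von_neumann_algebra (ap ` M) \<longleftrightarrow> vna M"
  unfolding von_neumann_algebra_def vna_def
  by (simp add: commutant_ap ap_image_eq_iff ap_mem_iff flip: ap_star)

lemma von_neumann_algebra_imp_ap:
  assumes "von_neumann_algebra M"
  obtains M' where "M = ap ` M'" "vna M'"
proof -
  have "M = ap ` {x. ap x \<in> M}"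
    using assms unfolding von_neumann_algebra_def bounded_op_iff by (auto simp: image_iff)
  then show thesis using that assms von_neumann_algebra_ap by metis
qed

lemma hull_ap: "von_neumann_algebra hull (ap ` S) = ap ` vhull S"
proof (rule hull_unique)
  show "ap ` S \<subseteq> ap ` vhull S" using vhull_sub by blast
  show "von_neumann_algebra (ap ` vhull S)" by (simp add: von_neumann_algebra_ap vhull_vna)
  fix t :: "('a \<Rightarrow> 'a) set"
  assume "ap ` S \<subseteq> t" "von_neumann_algebra t"
  then obtain L where "t = ap ` L" "vna L" using von_neumann_algebra_imp_ap by blast
  then show "ap ` vhull S \<subseteq> t"
    using \<open>ap ` S \<subseteq> t\<close> vhull_min[of L S] by (simp add: ap_image_subset_iff)
qed

section \<open>The trace norm\<close>

lemma mult_self_le: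
  fixes T :: "'h::complex_hilbert operator"
  assumes "0 \<le> T" "T \<le> sc (complex_of_real C) 1"
  shows "T * T \<le> sc (complex_of_real C) T"
  unfolding operator_le
proof (intro conjI allI)
  have s: "star T = T" using assms ge0_star by blast
  then show "star (sc (complex_of_real C) T - T * T) = sc (complex_of_real C) T - T * T" by simp
  fix v
  have "cinner v (ap T (ap T v)) = complex_of_real ((norm (ap T v))\<^sup>2)"
    using cinner_star[of T v "ap T v"] unfolding s cinner_self by simp
  then show "Re (cinner v (ap (T * T) v)) \<le> Re (cinner v (ap (sc (complex_of_real C) T) v))"
    using norm_sq_le_quad[OF assms, of v] by (simp add: cinner_simps del: of_real_power)
qed

text \<open>Normality is phrased for increasing sequences and their strong limits, the form in which
  the exhaustions use it.\<close>

locale tracial =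
  fixes M :: "'h::complex_hilbert operator set" and tr :: "'h operator \<Rightarrow> complex"
  assumes M: "vna M"
    and tr_add: "x \<in> M \<Longrightarrow> y \<in> M \<Longrightarrow> tr (x + y) = tr x + tr y"
    and tr_sc: "x \<in> M \<Longrightarrow> tr (sc c x) = c * tr x"
    and tr_pos: "x \<in> M \<Longrightarrow> Im (tr (star x * x)) = 0 \<and> 0 \<le> Re (tr (star x * x))"
    and tr_one: "tr 1 = 1"
    and tr_comm: "x \<in> M \<Longrightarrow> y \<in> M \<Longrightarrow> tr (x * y) = tr (y * x)"
    and faithful: "x \<in> M \<Longrightarrow> tr (star x * x) = 0 \<Longrightarrow> x = 0"
    and normal: "(\<And>n. a n \<in> M) \<Longrightarrow> (\<And>n. star (a n) = a n) \<Longrightarrow> (\<And>n. a n \<le> a (Suc n)) \<Longrightarrow> sot a s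
      \<Longrightarrow> Re (tr s) = (SUP n. Re (tr (a n)))"
begin

lemmas M_closed = vna_closed[OF M]

lemma tr_zero: "tr 0 = 0"
  using tr_sc[of 0 0] M_closed(2) by simp

lemma tr_diff: "x \<in> M \<Longrightarrow> y \<in> M \<Longrightarrow> tr (x - y) = tr x - tr y"
  using tr_add[of "x - y" y] M_closed(4)[of x y] by simp

lemma tr_neg: "x \<in> M \<Longrightarrow> tr (- x) = - tr x"
  using tr_diff[of 0 x] M_closed(2) by (simp add: tr_zero)

text \<open>Positivity forces this: expanding the trace of \<open>star (y + 1) * (y + 1)\<close>
  shows that the imaginary parts of \<open>tr y\<close> and \<open>tr (star y)\<close> cancel, and
  the case \<open>y = sc \<i> x\<close> handles the real parts.\<close>

lemma tr_star: assumes x: "x \<in> M" shows "tr (star x) = cnj (tr x)"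
proof -
  have *: "Im (tr y) + Im (tr (star y)) = 0" if y: "y \<in> M" for y
  proof -
    have "tr (star (y + 1) * (y + 1)) = tr (star y * y) + tr (star y) + tr y + 1"
      using y by (simp add: algebra_simps tr_add M_closed tr_one)
    then show ?thesis using tr_pos[of "y + 1"] tr_pos[of y] y by (simp add: M_closed)
  qed
  have "Im (tr (sc \<i> x)) + Im (tr (star (sc \<i> x))) = 0" using x by (intro * M_closed)
  then have "Re (tr x) - Re (tr (star x)) = 0" using x by (simp add: tr_sc tr_neg M_closed)
  then show ?thesis using *[OF x] by (simp add: complex_eq_iff)
qed

text \<open>The form of the GNS construction. Approximation inside \<open>M\<close> replaces its
  completion.\<close>

sublocale L2: semi_inner sc M "\<lambda>x y. tr (star x * y)"
proof
  show "op.subspace M" by (auto simp: op.subspace_def M_closed)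
  fix x y z c assume "x \<in> M" "y \<in> M"
  then show "tr (star x * sc c y) = c * tr (star x * y)"
    "tr (star y * x) = cnj (tr (star x * y))"
    by (auto simp: M_closed tr_sc simp flip: tr_star)
  show "z \<in> M \<Longrightarrow> tr (star x * (y + z)) = tr (star x * y) + tr (star x * z)"
    using \<open>x \<in> M\<close> \<open>y \<in> M\<close> by (simp add: distrib_left tr_add M_closed)
  show "0 \<le> Re (tr (star x * x))" using \<open>x \<in> M\<close> tr_pos by blast
qed

abbreviation "n2 \<equiv> L2.nrm"

lemma n2_0: "x \<in> M \<Longrightarrow> n2 x = 0 \<Longrightarrow> x = 0"
  using faithful L2.B_self by fastforce

lemma n2_one: "n2 1 = 1" by (simp add: L2.nrm_def tr_one)

lemma tr_ge0: "b \<in> M \<Longrightarrow> 0 \<le> b \<Longrightarrow> 0 \<le> Re (tr b)"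
  using vna_sqrt[OF M, of b] tr_pos ge0_star by metis

lemma tr_sa: "b \<in> M \<Longrightarrow> star b = b \<Longrightarrow> tr b = complex_of_real (Re (tr b))"
  using tr_star[of b] by (simp add: complex_eq_iff)

lemma tr_mono: "a \<in> M \<Longrightarrow> b \<in> M \<Longrightarrow> a \<le> b \<Longrightarrow> Re (tr a) \<le> Re (tr b)"
  using tr_ge0[of "b - a"] by (simp add: tr_diff M_closed)

lemma tr_ge0_zero:
  assumes "b \<in> M" "0 \<le> b" "Re (tr b) \<le> 0"
  shows "b = 0"
proof -
  obtain r where r: "r \<in> M" "0 \<le> r" "r * r = b" using vna_sqrt[OF M] assms by blast
  then have "tr (star r * r) = 0"
    using assms tr_pos[of r] ge0_star[of r] by (simp add: complex_eq_iff)
  then show ?thesis using faithful[of r] r by simp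
qed

lemma n2_sq: "x \<in> M \<Longrightarrow> (n2 x)\<^sup>2 = Re (tr (star x * x))"
  by (rule L2.nrm_sq)

lemma n2_star: "x \<in> M \<Longrightarrow> n2 (star x) = n2 x"
  using tr_comm[of x "star x"] by (simp add: L2.nrm_def M_closed)

lemma n2_mult_left:
  assumes "x \<in> M" "y \<in> M" shows "n2 (x * y) \<le> opn x * n2 y"
proof (rule power2_le_imp_le)
  have "star y * (star x * x) * y \<le> star y * sc (complex_of_real ((opn x)\<^sup>2)) 1 * y"
    by (rule conj_mono[OF star_mult_le_opn])
  then have "Re (tr (star y * (star x * x) * y)) \<le> Re (tr (star y * sc (complex_of_real ((opn x)\<^sup>2)) 1 * y))"
    using assms by (intro tr_mono M_closed) (auto intro: M_closed)
  then show "(n2 (x * y))\<^sup>2 \<le> (opn x * n2 y)\<^sup>2"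
    using assms by (simp add: n2_sq M_closed mult.assoc power_mult_distrib tr_sc flip: of_real_power)
  show "0 \<le> opn x * n2 y" using assms by (simp add: opn_ge0 L2.nrm_ge0)
qed

text \<open>Traciality enters here, through \<open>n2_star\<close>: taking adjoints exchanges left
  and right multiplication.\<close>

lemma n2_mult_right:
  assumes "x \<in> M" "y \<in> M" shows "n2 (x * y) \<le> n2 x * opn (star y)"
  using n2_mult_left[of "star y" "star x"] n2_star[of "x * y"] n2_star[of x] assms
  by (simp add: M_closed mult.commute)

lemma tr_le_n2: "x \<in> M \<Longrightarrow> cmod (tr x) \<le> n2 x"
  using L2.CS[of 1 x] by (simp add: M_closed n2_one)

lemma tr_lim:
  assumes a: "\<And>n. a n \<in> M" "\<And>n. star (a n) = a n" "\<And>n. a n \<le> a (Suc n)" and s: "sot a s"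
  shows "(\<lambda>n. Re (tr (a n))) \<longlonglongrightarrow> Re (tr s)" and "\<And>n. a n \<le> s" and "s \<in> M" and "star s = s"
proof -
  show ss: "star s = s" by (rule sot_sa[OF s a(2)])
  show sM: "s \<in> M" by (rule vna_sot[OF M s a(1)])
  have mono: "a m \<le> a n" if "m \<le> n" for m n
    by (rule lift_Suc_mono_le[of a, OF a(3) that])
  show le: "a n \<le> s" for n
    unfolding operator_le
  proof (intro conjI allI)
    fix v
    show "Re (cinner v (ap (a n) v)) \<le> Re (cinner v (ap s v))"
      using mono by (intro LIMSEQ_le_const[OF sot_quad[OF s]]) (auto simp: operator_le)
  qed (simp add: ss a)
  have "incseq (\<lambda>n. Re (tr (a n)))" using a by (intro incseq_SucI tr_mono)
  moreover have "bdd_above (range (\<lambda>n. Re (tr (a n))))"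
    using le a sM by (auto intro!: bdd_aboveI[of _ "Re (tr s)"] tr_mono)
  ultimately show "(\<lambda>n. Re (tr (a n))) \<longlonglongrightarrow> Re (tr s)"
    using LIMSEQ_incseq_SUP normal[OF a s] by metis
qed

text \<open>Since \<open>s - a n\<close> lies between 0 and the scalar \<open>C\<close>, its square
  is at most \<open>C\<close> times itself, and the normality of the trace applies.\<close>

lemma n2_lim:
  assumes a: "\<And>n. a n \<in> M" "\<And>n. star (a n) = a n" "\<And>n. a n \<le> a (Suc n)" and s: "sot a s"
  shows "(\<lambda>n. n2 (s - a n)) \<longlonglongrightarrow> 0"
proof -
  note l = tr_lim[of a, OF a s]
  define C where "C = opn (s - a 0)"
  have le: "(n2 (s - a n))\<^sup>2 \<le> C * (Re (tr s) - Re (tr (a n)))" for n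
  proof -
    have "a 0 \<le> a n" by (rule lift_Suc_mono_le[of a, OF a(3)]) simp
    moreover have "s - a 0 \<le> sc (complex_of_real C) 1"
      unfolding C_def using l a by (intro sa_le_opn) simp
    ultimately have "s - a n \<le> sc (complex_of_real C) 1"
      by (meson diff_left_mono order_trans)
    then have "(s - a n) * (s - a n) \<le> sc (complex_of_real C) (s - a n)"
      using l by (intro mult_self_le) auto
    then have "Re (tr ((s - a n) * (s - a n))) \<le> Re (tr (sc (complex_of_real C) (s - a n)))"
      using l a by (intro tr_mono M_closed) auto
    then show ?thesis
      using l a by (simp only: n2_sq M_closed star_simps tr_sc tr_diff) simp
  qed
  have "(\<lambda>n. C * (Re (tr s) - Re (tr (a n)))) \<longlonglongrightarrow> C * (Re (tr s) - Re (tr s))"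
    by (intro tendsto_intros l)
  then have z: "(\<lambda>n. C * (Re (tr s) - Re (tr (a n)))) \<longlonglongrightarrow> 0" by simp
  have "(\<lambda>n. (n2 (s - a n))\<^sup>2) \<longlonglongrightarrow> 0"
    by (rule Lim_null_comparison[OF _ z]) (intro always_eventually allI, simp add: le)
  then have "(\<lambda>n. sqrt ((n2 (s - a n))\<^sup>2)) \<longlonglongrightarrow> sqrt 0" by (rule tendsto_real_sqrt)
  then show ?thesis using l a by (simp add: L2.nrm_ge0 M_closed)
qed

text \<open>Exhaustion in place of Zorn's lemma. Each term comes within \<open>1 / (n + 1)\<close>
  of the largest trace available above its predecessor; an element above the limit then has the same
  trace and equals the limit by faithfulness.\<close>

lemma maximal_element:
  assumes S: "\<And>a. a \<in> S \<Longrightarrow> a \<in> M \<and> star a = a \<and> a \<le> g" and gM: "g \<in> M" and "a0 \<in> S"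
    and cl: "\<And>a s. (\<And>n. a n \<in> S) \<Longrightarrow> (\<And>n. a n \<le> a (Suc n)) \<Longrightarrow> sot a s \<Longrightarrow> s \<in> S"
  shows "\<exists>m\<in>S. a0 \<le> m \<and> (\<forall>b\<in>S. m \<le> b \<longrightarrow> b = m)"
proof -
  let ?t = "\<lambda>a. Re (tr a)"
  have step: "\<exists>a'\<in>S. a \<le> a' \<and> (\<forall>b\<in>S. a \<le> b \<longrightarrow> ?t b < ?t a' + \<epsilon>)"
    if a: "a \<in> S" and \<epsilon>: "0 < \<epsilon>" for a \<epsilon>
  proof -
    let ?U = "?t ` {b\<in>S. a \<le> b}"
    have bdd: "bdd_above ?U"
      using S gM by (auto intro!: bdd_aboveI[of _ "?t g"] tr_mono)
    have "Sup ?U - \<epsilon> < Sup ?U" using \<epsilon> by simp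
    moreover have "?U \<noteq> {}" using a by auto
    ultimately obtain a' where a': "a' \<in> S" "a \<le> a'" "Sup ?U - \<epsilon> < ?t a'"
      using less_cSupD[of ?U "Sup ?U - \<epsilon>"] by auto
    have "?t b < ?t a' + \<epsilon>" if "b \<in> S" "a \<le> b" for b
    proof -
      have "?t b \<le> Sup ?U" using that by (intro cSup_upper bdd) auto
      then show ?thesis using a'(3) by linarith
    qed
    then show ?thesis using a'(1,2) by blast
  qed
  have "\<exists>a. \<forall>n. a n \<in> S \<and> (n = 0 \<longrightarrow> a 0 = a0) \<and>
      (a n \<le> a (Suc n) \<and> (\<forall>b\<in>S. a n \<le> b \<longrightarrow> ?t b < ?t (a (Suc n)) + inverse (real (Suc n))))"
  proof -
    obtain f where f: "\<And>a n. a \<in> S \<Longrightarrow> f a n \<in> S \<and> a \<le> f a n \<and>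
        (\<forall>b\<in>S. a \<le> b \<longrightarrow> ?t b < ?t (f a n) + inverse (real (Suc n)))"
    proof -
      have "\<forall>a n. \<exists>a'. a \<in> S \<longrightarrow> a' \<in> S \<and> a \<le> a' \<and>
          (\<forall>b\<in>S. a \<le> b \<longrightarrow> ?t b < ?t a' + inverse (real (Suc n)))"
        using step by (metis inverse_positive_iff_positive of_nat_0_less_iff zero_less_Suc)
      then show thesis using that by metis
    qed
    define a where "a = rec_nat a0 (\<lambda>n x. f x n)"
    have "a 0 = a0" "\<And>n. a (Suc n) = f (a n) n" by (simp_all add: a_def)
    moreover have "a n \<in> S" for n
      by (induction n) (use calculation f \<open>a0 \<in> S\<close> in auto)
    ultimately show ?thesis using f by (intro exI[of _ a]) auto
  qed
  then obtain a where a: "\<And>n. a n \<in> S" "a 0 = a0" "\<And>n. a n \<le> a (Suc n)"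
    and big: "\<And>n b. b \<in> S \<Longrightarrow> a n \<le> b \<Longrightarrow> ?t b < ?t (a (Suc n)) + inverse (real (Suc n))" by metis
  obtain s where s: "sot a s" using sot_monotone[of a g] a S by metis
  have sS: "s \<in> S" by (rule cl[OF a(1) a(3) s])
  have le: "a n \<le> s" for n using tr_lim(2)[of a, OF _ _ a(3) s] a S by metis
  have "b = s" if b: "b \<in> S" "s \<le> b" for b
  proof -
    have "?t b \<le> ?t s + inverse (real (Suc n))" for n
    proof -
      have "?t b < ?t (a (Suc n)) + inverse (real (Suc n))" using big b le order_trans by blast
      also have "?t (a (Suc n)) \<le> ?t s" using le a sS S by (intro tr_mono) auto
      finally show ?thesis by simp
    qed
    moreover have "(\<lambda>n. ?t s + inverse (real (Suc n))) \<longlonglongrightarrow> ?t s + 0"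
      by (intro tendsto_intros LIMSEQ_inverse_real_of_nat)
    ultimately have "?t b \<le> ?t s" by (metis (no_types, lifting) LIMSEQ_le_const add.right_neutral)
    then have "b - s = 0" using b sS S by (intro tr_ge0_zero) (auto simp: tr_diff M_closed)
    then show ?thesis by simp
  qed
  then show ?thesis using sS le[of 0] a by auto
qed

section \<open>Closures in the trace norm\<close>

text \<open>The approximants carry no bound on their operator norm, so nothing like Kaplansky's
  density theorem is involved.\<close>

definition cl :: "'h operator set \<Rightarrow> 'h operator set" where
  "cl X = {x \<in> M. \<forall>\<epsilon>>0. \<exists>a\<in>X. n2 (x - a) < \<epsilon>}"

lemma cl_M: "cl X \<subseteq> M" by (auto simp: cl_def)

lemma cl_in: "x \<in> cl X \<Longrightarrow> x \<in> M" using cl_M by blast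

lemma cl_sup: "X \<subseteq> M \<Longrightarrow> X \<subseteq> cl X"
  by (auto simp: cl_def L2.nrm_zero intro!: bexI)

lemma cl_mono: "X \<subseteq> Y \<Longrightarrow> cl X \<subseteq> cl Y"
  by (fastforce simp: cl_def)

lemma cl_cl: assumes "X \<subseteq> M" shows "cl (cl X) = cl X"
proof
  show "cl X \<subseteq> cl (cl X)" by (rule cl_sup[OF cl_M])
  show "cl (cl X) \<subseteq> cl X"
  proof
    fix x assume x: "x \<in> cl (cl X)"
    show "x \<in> cl X"
      unfolding cl_def
    proof (intro CollectI conjI allI impI)
      show "x \<in> M" using x cl_M by blast
      fix \<epsilon> :: real assume "0 < \<epsilon>"
      then have e: "0 < \<epsilon> / 2" by simp
      then obtain y where y: "y \<in> cl X" "n2 (x - y) < \<epsilon> / 2" using x unfolding cl_def by blast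
      then obtain z where z: "z \<in> X" "n2 (y - z) < \<epsilon> / 2" using e unfolding cl_def by blast
      have "n2 ((x - y) + (y - z)) \<le> n2 (x - y) + n2 (y - z)"
        using x y z assms cl_M by (intro L2.nrm_add M_closed) auto
      then have "n2 (x - z) < \<epsilon>" using y z by simp
      then show "\<exists>a\<in>X. n2 (x - a) < \<epsilon>" using z by blast
    qed
  qed
qed

lemma cl_subspace: assumes X: "X \<subseteq> M" "op.subspace X" shows "op.subspace (cl X)"
proof (rule op.subspaceI)
  show "0 \<in> cl X" using cl_sup[OF X(1)] op.subspace_0[OF X(2)] by blast
next
  fix x y assume x: "x \<in> cl X" and y: "y \<in> cl X"
  show "x + y \<in> cl X"
    unfolding cl_def
  proof (intro CollectI conjI allI impI)
    show "x + y \<in> M" using x y by (simp add: cl_in M_closed)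
    fix \<epsilon> :: real assume "0 < \<epsilon>"
    then have e: "0 < \<epsilon> / 2" by simp
    obtain a b where ab: "a \<in> X" "b \<in> X" "n2 (x - a) < \<epsilon> / 2" "n2 (y - b) < \<epsilon> / 2"
      using x y e unfolding cl_def by blast
    have "n2 ((x - a) + (y - b)) \<le> n2 (x - a) + n2 (y - b)"
      using x y ab assms cl_M by (intro L2.nrm_add M_closed) auto
    then have "n2 (x + y - (a + b)) < \<epsilon>" using ab by (simp add: algebra_simps)
    then show "\<exists>a\<in>X. n2 (x + y - a) < \<epsilon>" using ab X by (blast intro: op.subspace_add)
  qed
next
  fix c x assume x: "x \<in> cl X"
  show "sc c x \<in> cl X"
    unfolding cl_def
  proof (intro CollectI conjI allI impI)
    show "sc c x \<in> M" using x by (simp add: cl_in M_closed)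
    fix \<epsilon> :: real assume \<epsilon>: "0 < \<epsilon>"
    have "0 < \<epsilon> / (cmod c + 1)" using \<epsilon> by (simp add: add_nonneg_pos)
    then obtain a where a: "a \<in> X" "n2 (x - a) < \<epsilon> / (cmod c + 1)" using x unfolding cl_def by blast
    have xa: "x - a \<in> M" using x a X by (auto intro: cl_in M_closed(4))
    have "n2 (sc c x - sc c a) = cmod c * n2 (x - a)"
      using L2.nrm_sc[OF xa, of c] by (simp add: op.scale_right_diff_distrib)
    also have "\<dots> \<le> (cmod c + 1) * n2 (x - a)" using L2.nrm_ge0[OF xa] by (simp add: algebra_simps)
    also have "\<dots> < \<epsilon>"
    proof -
      have "0 < cmod c + 1" by (simp add: add_nonneg_pos)
      then show ?thesis using a by (simp add: field_simps)
    qed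
    finally show "\<exists>b\<in>X. n2 (sc c x - b) < \<epsilon>" using a X by (blast intro: op.subspace_scale)
  qed
qed

text \<open>As the approximants may have large operator norm, they are chosen one after the other:
  \<open>a\<close> against the norm of \<open>y\<close>, then \<open>b\<close> against the norm of
  that \<open>a\<close>.\<close>

lemma cl_mult:
  assumes X: "X \<subseteq> M" "Y \<subseteq> M" "Z \<subseteq> M" and x: "x \<in> cl X" and y: "y \<in> cl Y"
    and ab: "\<And>a b. a \<in> X \<Longrightarrow> b \<in> Y \<Longrightarrow> a * b \<in> cl Z"
  shows "x * y \<in> cl Z"
proof -
  have xM: "x \<in> M" "y \<in> M" using x y cl_M by auto
  have "x * y \<in> cl (cl Z)"
    unfolding cl_def[of "cl Z"]
  proof (intro CollectI conjI allI impI)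
    show "x * y \<in> M" using xM by (simp add: M_closed)
    fix \<epsilon> :: real assume \<epsilon>: "0 < \<epsilon>"
    have small: "\<exists>\<delta>>0. K * \<delta> < \<epsilon> / 2" if "0 \<le> K" for K
    proof -
      have "K * (\<epsilon> / (2 * (K + 1))) < \<epsilon> / 2" using that \<epsilon> by (simp add: field_simps)
      then show ?thesis using that \<epsilon> by (intro exI[of _ "\<epsilon> / (2 * (K + 1))"]) auto
    qed
    obtain \<delta> where d: "0 < \<delta>" "opn (star y) * \<delta> < \<epsilon> / 2" using small opn_ge0 by blast
    obtain a where a: "a \<in> X" "n2 (x - a) < \<delta>" using x d unfolding cl_def by blast
    obtain \<delta>' where d': "0 < \<delta>'" "opn a * \<delta>' < \<epsilon> / 2" using small opn_ge0 by blast
    obtain b where b: "b \<in> Y" "n2 (y - b) < \<delta>'" using y d' unfolding cl_def by blast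
    have aM: "a \<in> M" "b \<in> M" using a b X by auto
    have "x * y - a * b = (x - a) * y + a * (y - b)" by (simp add: algebra_simps)
    then have "n2 (x * y - a * b) \<le> n2 ((x - a) * y) + n2 (a * (y - b))"
      using xM aM by (simp add: L2.nrm_add M_closed)
    also have "\<dots> \<le> n2 (x - a) * opn (star y) + opn a * n2 (y - b)"
      using xM aM by (intro add_mono n2_mult_left n2_mult_right M_closed)
    also have "\<dots> \<le> \<delta> * opn (star y) + opn a * \<delta>'"
      using a b by (intro add_mono mult_left_mono mult_right_mono) (auto simp: opn_ge0)
    also have "\<dots> < \<epsilon>" using d d' by (simp add: mult.commute)
    finally show "\<exists>c\<in>cl Z. n2 (x * y - c) < \<epsilon>" using ab a b by blast
  qed
  then show ?thesis using cl_cl X by simp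
qed

lemma cl_star:
  assumes X: "X \<subseteq> M" and x: "x \<in> cl X" and s: "\<And>a. a \<in> X \<Longrightarrow> star a \<in> X"
  shows "star x \<in> cl X"
  unfolding cl_def
proof (intro CollectI conjI allI impI)
  show "star x \<in> M" using x by (simp add: cl_in M_closed)
  fix \<epsilon> :: real assume "0 < \<epsilon>"
  then obtain a where a: "a \<in> X" "n2 (x - a) < \<epsilon>" using x unfolding cl_def by blast
  have "n2 (star x - star a) < \<epsilon>"
    using n2_star[of "x - a"] a X M_closed(4)[OF cl_in[OF x], of a] by auto
  then show "\<exists>a\<in>X. n2 (star x - a) < \<epsilon>" using s a by blast
qed

lemma cl_tr0:
  assumes X: "X \<subseteq> M" and x: "x \<in> cl X" and 0: "\<And>a. a \<in> X \<Longrightarrow> tr a = 0"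
  shows "tr x = 0"
proof -
  have "cmod (tr x) < \<epsilon>" if "0 < \<epsilon>" for \<epsilon>
  proof -
    obtain a where a: "a \<in> X" "n2 (x - a) < \<epsilon>" using x \<open>0 < \<epsilon>\<close> unfolding cl_def by blast
    have "x \<in> M" "a \<in> M" using x a X cl_M by auto
    then have "tr (x - a) = tr x" "x - a \<in> M"
      using a 0 by (auto simp: M_closed tr_diff)
    then show ?thesis using a tr_le_n2[of "x - a"] by simp
  qed
  then show ?thesis by (metis norm_zero zero_less_norm_iff less_irrefl)
qed

lemma cl_lim:
  assumes a: "\<And>n. a n \<in> cl X" and X: "X \<subseteq> M" and s: "s \<in> M"
    and l: "(\<lambda>n. n2 (s - a n)) \<longlonglongrightarrow> 0"
  shows "s \<in> cl X"
proof -
  have "s \<in> cl (cl X)"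
    unfolding cl_def[of "cl X"]
  proof (intro CollectI conjI allI impI)
    fix \<epsilon> :: real assume "0 < \<epsilon>"
    then have "\<forall>\<^sub>F n in sequentially. n2 (s - a n) < \<epsilon>" by (rule order_tendstoD(2)[OF l])
    then show "\<exists>c\<in>cl X. n2 (s - c) < \<epsilon>" using a eventually_sequentially by auto
  qed (rule s)
  then show ?thesis using cl_cl[OF X] by simp
qed

end

section \<open>Trace-norm closed subalgebras\<close>

lemma sot_le:
  assumes s: "sot a s" and "\<And>n. star (a n) = a n" "\<And>n. a n \<le> g"
  shows "s \<le> g"
  unfolding operator_le
proof (intro conjI allI)
  have ss: "star s = s" using sot_sa[OF s assms(2)] .
  have "star (g - a 0) = g - a 0" using assms(3) by (simp only: operator_le)
  then show "star (g - s) = g - s" using ss assms(2)[of 0] by simp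
  fix v
  show "Re (cinner v (ap s v)) \<le> Re (cinner v (ap g v))"
    using assms(3) by (intro LIMSEQ_le_const2[OF sot_quad[OF s]]) (auto simp: operator_le)
qed

context tracial
begin

text \<open>A Radon-Nikodym comparison of the trace with a vector state. Removing from
  \<open>g = 1 - z\<close> a maximal \<open>m\<close> on which the state of \<open>\<xi>\<close> is
  at most the trace leaves \<open>c\<close>, below which the trace is at most the state. A small
  multiple of \<open>star (x * c) * (x * c)\<close> lies below \<open>c\<close>, which gives the
  estimate with \<open>\<eta> = c \<xi>\<close>.\<close>

lemma dominance:
  assumes z: "z \<in> M" "star z = z" "z * z = z" "z \<noteq> 1"
  shows "\<exists>c \<eta>. c \<in> M \<and> 0 \<le> c \<and> c \<le> 1 - z \<and> c \<noteq> 0 \<and> (\<forall>x\<in>M. n2 (x * c) \<le> norm (ap x \<eta>))"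
proof -
  define g where "g = 1 - z"
  have g: "g \<in> M" "star g = g" "g * g = g" "0 \<le> g" "g \<le> 1"
  proof -
    show "g \<in> M" "star g = g" "g * g = g" using z by (auto simp: g_def M_closed algebra_simps)
    then show "0 \<le> g" using star_mult_ge0[of g] by simp
    show "g \<le> 1" using star_mult_ge0[of z] z by (simp add: g_def)
  qed
  have "g \<noteq> 0" using z by (auto simp: g_def)
  then obtain v where v: "ap g v \<noteq> 0" by (metis operator_eqI ap_simps(1))
  \<comment> \<open>With norm 2 the vector state is 4 on \<open>g\<close>, while the trace there is
    at most 1; hence \<open>m\<close> differs from \<open>g\<close>.\<close>
  define \<xi> where "\<xi> = complex_of_real (2 / norm (ap g v)) *\<^sub>C ap g v"
  have \<xi>: "norm \<xi> = 2" using v by (simp add: \<xi>_def norm_scaleC norm_divide)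
  have "ap g \<xi> = complex_of_real (2 / norm (ap g v)) *\<^sub>C ap (g * g) v"
    unfolding \<xi>_def by (simp only: ap_scaleC ap_simps)
  then have g\<xi>: "ap g \<xi> = \<xi>" unfolding g(3) \<xi>_def .
  let ?w = "\<lambda>a. Re (cinner \<xi> (ap a \<xi>))"
  define S where "S = {a \<in> M. 0 \<le> a \<and> a \<le> g \<and> ?w a \<le> Re (tr a)}"
  have "\<exists>m\<in>S. 0 \<le> m \<and> (\<forall>b\<in>S. m \<le> b \<longrightarrow> b = m)"
  proof (rule maximal_element)
    show "a \<in> M \<and> star a = a \<and> a \<le> g" if "a \<in> S" for a
      using that by (auto simp: S_def ge0_star)
    show "0 \<in> S" using g by (simp add: S_def M_closed hilbert.B_zero tr_zero)
    fix a s assume a: "\<And>n. a n \<in> S" "\<And>n. a n \<le> a (Suc n)" and s: "sot a s"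
    have a': "a n \<in> M" "star (a n) = a n" "0 \<le> a n" "a n \<le> g" "?w (a n) \<le> Re (tr (a n))" for n
      using a(1)[of n] by (auto simp: S_def ge0_star)
    note l = tr_lim[OF a'(1,2) a(2) s]
    have "?w s \<le> Re (tr s)"
      using a'(5) by (intro LIMSEQ_le[OF sot_quad[OF s] l(1)]) auto
    moreover have "0 \<le> s" using a'(3)[of 0] l(2)[of 0] by (rule order_trans)
    ultimately show "s \<in> S" using sot_le[OF s a'(2,4)] l(3) by (simp add: S_def)
  qed (rule g)
  then obtain m where m: "m \<in> M" "0 \<le> m" "m \<le> g" "?w m \<le> Re (tr m)"
    and max: "\<And>b. b \<in> S \<Longrightarrow> m \<le> b \<Longrightarrow> b = m" by (auto simp: S_def)
  define c where "c = g - m"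
  have c: "c \<in> M" "0 \<le> c" "c \<le> g" "c \<le> 1" "star c = c"
  proof -
    show "c \<in> M" "0 \<le> c" "c \<le> g" using m g by (auto simp: c_def M_closed)
    then show "c \<le> 1" "star c = c" using g ge0_star by (auto intro: order_trans)
  qed
  have "c \<noteq> 0"
  proof
    assume "c = 0"
    then have "?w g \<le> Re (tr g)" using m by (simp add: c_def)
    also have "\<dots> \<le> Re (tr 1)" using g by (intro tr_mono) (auto simp: M_closed)
    finally show False by (simp add: g\<xi> cinner_self \<xi> tr_one flip: of_real_power)
  qed
  have small: "Re (tr b) \<le> ?w b" if b: "b \<in> M" "0 \<le> b" "b \<le> c" for b
  proof (rule ccontr)
    assume *: "\<not> ?thesis"
    have "m + b \<le> m + c" using b by simp
    then have "m + b \<in> S"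
      using * m b by (auto simp: S_def M_closed tr_add cinner_simps c_def intro: add_nonneg_nonneg)
    then have "m + b = m" using b by (intro max) auto
    then show False using * by (simp add: hilbert.B_zero tr_zero)
  qed
  have "n2 (x * c) \<le> norm (ap x (ap c \<xi>))" if x: "x \<in> M" for x
  proof -
    \<comment> \<open>The summand 1 permits division by \<open>K\<close>, also for
      \<open>x = 0\<close>.\<close>
    define K where "K = (opn x)\<^sup>2 + 1"
    have K: "0 < K" by (simp add: K_def add_nonneg_pos)
    let ?y = "star (x * c) * (x * c)"
    have "star c * (star x * x) * c \<le> star c * sc (complex_of_real ((opn x)\<^sup>2)) 1 * c"
      by (rule conj_mono[OF star_mult_le_opn])
    then have "?y \<le> sc (complex_of_real ((opn x)\<^sup>2)) (c * c)" by (simp add: c mult.assoc)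
    also have "\<dots> \<le> sc (complex_of_real ((opn x)\<^sup>2)) c"
      by (intro sc_mono sq_le_self c) simp
    also have "\<dots> \<le> sc (complex_of_real ((opn x)\<^sup>2)) c + c" using c by simp
    also have "\<dots> = sc (complex_of_real K) c" by (simp add: K_def op.scale_left_distrib)
    finally have "sc (complex_of_real (1 / K)) ?y \<le> sc (complex_of_real (1 / K)) (sc (complex_of_real K) c)"
      using K by (intro sc_mono) auto
    then have "sc (complex_of_real (1 / K)) ?y \<le> c" using K by (simp flip: of_real_mult)
    moreover have "0 \<le> sc (complex_of_real (1 / K)) ?y"
      using K by (intro sc_ge0 star_mult_ge0) simp
    ultimately have "Re (tr (sc (complex_of_real (1 / K)) ?y)) \<le> ?w (sc (complex_of_real (1 / K)) ?y)"
      using x c by (intro small) (auto intro!: M_closed)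
    then have "Re (tr ?y) \<le> ?w ?y"
      using K x c by (simp add: tr_sc M_closed cinner_simps divide_right_mono field_simps)
    moreover have "?w ?y = (norm (ap x (ap c \<xi>)))\<^sup>2"
      by (simp only: ap_simps cinner_star' cinner_self) (simp flip: of_real_power)
    ultimately have "(n2 (x * c))\<^sup>2 \<le> (norm (ap x (ap c \<xi>)))\<^sup>2"
      using x c by (simp only: n2_sq M_closed)
    then show ?thesis by (rule power2_le_imp_le) simp
  qed
  then show ?thesis using c \<open>c \<noteq> 0\<close> unfolding g_def by blast
qed

text \<open>The elements \<open>d\<close> for which \<open>x \<eta> \<mapsto> x d\<close> is a contraction from a cyclic subspace of the given
  Hilbert space to \<open>L\<^sup>2(M)\<close>. They link the representation of \<open>M\<close> to its trace.\<close>
definition dominated :: "'h operator set" where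
  "dominated = {d \<in> M. \<exists>\<eta>. \<forall>x\<in>M. n2 (x * d) \<le> norm (ap x \<eta>)}"

lemma span_sub: "X \<subseteq> M \<Longrightarrow> op.span X \<subseteq> M"
  by (rule op.span_minimal[OF _ L2.V])

text \<open>The closure is a left ideal. A maximal element \<open>m\<close> of it between 0 and 1 is
  idempotent, as \<open>2 m - m\<^sup>2\<close> is a candidate above it; if
  \<open>m \<noteq> 1\<close>, then \<open>dominance\<close> supplies a dominated element below
  \<open>1 - m\<close> that could be added. A left ideal containing 1 is everything.\<close>

lemma dominated_dense: "cl (op.span {x * d |x d. x \<in> M \<and> d \<in> dominated}) = M"
proof -
  define X where "X = op.span {x * d |x d. x \<in> M \<and> d \<in> dominated}"
  have gen: "{x * d |x d. x \<in> M \<and> d \<in> dominated} \<subseteq> M" by (auto simp: dominated_def M_closed)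
  have XM: "X \<subseteq> M" unfolding X_def using span_sub gen by blast
  have sub: "op.subspace (cl X)" using XM by (intro cl_subspace) (auto simp: X_def)
  have left: "a * x \<in> X" if a: "a \<in> M" and x: "x \<in> X" for a x
    using x unfolding X_def
  proof (induction rule: op.span_induct_alt)
    case base then show ?case by (simp add: op.span_zero)
  next
    case (step c y z)
    then obtain x d where "y = x * d" "x \<in> M" "d \<in> dominated" by auto
    then have "a * y \<in> op.span {x * d |x d. x \<in> M \<and> d \<in> dominated}"
    proof (intro op.span_base CollectI exI conjI)
      show "a * y = (a * x) * d" using \<open>y = x * d\<close> by (simp add: mult.assoc)
    qed (use a \<open>x \<in> M\<close> \<open>d \<in> dominated\<close> in \<open>simp_all add: M_closed\<close>)
    then show ?case using step by (simp add: distrib_left op.span_add op.span_scale)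
  qed
  have left': "a * x \<in> cl X" if a: "a \<in> M" and x: "x \<in> cl X" for a x
  proof (rule cl_mult[of M X X, OF _ XM XM])
    show "a \<in> cl M" using a cl_sup[of M] by blast
    show "b * y \<in> cl X" if "b \<in> M" "y \<in> X" for b y
      using left[OF that] cl_sup[OF XM] by blast
  qed (use x in simp_all)
  define S where "S = {a \<in> cl X. 0 \<le> a \<and> a \<le> 1}"
  have "\<exists>m\<in>S. 0 \<le> m \<and> (\<forall>b\<in>S. m \<le> b \<longrightarrow> b = m)"
  proof (rule maximal_element)
    show "a \<in> M \<and> star a = a \<and> a \<le> 1" if "a \<in> S" for a
      using that by (auto simp: S_def ge0_star cl_in)
    show "0 \<in> S" using sub by (simp add: S_def one_ge0 op.subspace_0)
    fix a s assume a: "\<And>n. a n \<in> S" "\<And>n. a n \<le> a (Suc n)" and s: "sot a s"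
    have a': "a n \<in> M" "star (a n) = a n" "0 \<le> a n" "a n \<le> 1" "a n \<in> cl X" for n
      using a(1)[of n] by (auto simp: S_def ge0_star cl_in)
    note l = tr_lim[OF a'(1,2) a(2) s]
    have "s \<in> cl X" using cl_lim[OF a'(5) XM l(3) n2_lim[OF a'(1,2) a(2) s]] .
    moreover have "0 \<le> s" using a'(3)[of 0] l(2)[of 0] by (rule order_trans)
    ultimately show "s \<in> S" using sot_le[OF s a'(2,4)] by (simp add: S_def)
  qed (rule M_closed)
  then obtain m where m: "m \<in> cl X" "0 \<le> m" "m \<le> 1"
    and max: "\<And>b. b \<in> S \<Longrightarrow> m \<le> b \<Longrightarrow> b = m" by (auto simp: S_def)
  have ms: "star m = m" using m ge0_star by blast
  have mM: "m \<in> M" using m cl_in by blast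
  have mm: "m * m \<le> m" using sq_le_self m by blast
  have "m + (m - m * m) \<in> S"
  proof -
    have "m + (m - m * m) \<in> cl X"
      using m mM left' sub by (intro op.subspace_add op.subspace_diff) auto
    moreover have "0 \<le> 1 - (m + (m - m * m))"
      using star_mult_ge0[of "1 - m"] by (simp add: ms algebra_simps)
    moreover have "0 \<le> m + (m - m * m)" using m mm by (intro add_nonneg_nonneg) auto
    ultimately show ?thesis by (simp add: S_def)
  qed
  then have "m + (m - m * m) = m" using mm by (intro max) auto
  then have idem: "m * m = m" by simp
  have "m = 1"
  proof (rule ccontr)
    assume "m \<noteq> 1"
    then obtain c \<eta> where c: "c \<in> M" "0 \<le> c" "c \<le> 1 - m" "c \<noteq> 0"
      "\<And>x. x \<in> M \<Longrightarrow> n2 (x * c) \<le> norm (ap x \<eta>)"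
      using dominance[OF mM ms idem] by blast
    have "c \<in> dominated" using c unfolding dominated_def by blast
    then have "1 * c \<in> X"
      unfolding X_def using M_closed(1) by (intro op.span_base) blast
    then have "c \<in> cl X" using cl_sup[OF XM] by auto
    moreover have "m + c \<le> 1" using c(3) by (simp add: algebra_simps)
    ultimately have "m + c \<in> S"
      using m c sub by (auto simp: S_def op.subspace_add intro: add_nonneg_nonneg)
    then have "m + c = m" using c by (intro max) auto
    then show False using c by simp
  qed
  then have "M \<subseteq> cl X" using left'[of _ m] m by auto
  then show ?thesis unfolding X_def using cl_M by blast
qed

lemma bounded_functional_zero:
  assumes \<phi>: "\<And>x y. x \<in> M \<Longrightarrow> y \<in> M \<Longrightarrow> \<phi> (x + y) = \<phi> x + \<phi> y"
    "\<And>c x. x \<in> M \<Longrightarrow> \<phi> (sc c x) = c * \<phi> x" and C: "\<And>x. x \<in> M \<Longrightarrow> cmod (\<phi> x) \<le> C * n2 x"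
    and G: "G \<subseteq> M" "\<And>x. x \<in> G \<Longrightarrow> \<phi> x = 0" and x: "x \<in> cl (op.span G)"
  shows "\<phi> x = 0"
proof -
  have GM: "op.span G \<subseteq> M" using span_sub G by blast
  have 0: "y \<in> M \<and> \<phi> y = 0" if "y \<in> op.span G" for y
    using that
  proof (induction rule: op.span_induct_alt)
    case base
    then show ?case using \<phi>(2)[of 0 0] by (simp add: M_closed)
  next
    case (step c x y)
    then have "x \<in> M" using G by auto
    then show ?case using step G by (simp add: \<phi> M_closed)
  qed
  have xM: "x \<in> M" using x cl_in by blast
  have "cmod (\<phi> x) < \<epsilon>" if \<epsilon>: "0 < \<epsilon>" for \<epsilon>
  proof -
    have p: "0 < \<epsilon> / (\<bar>C\<bar> + 1)" using \<epsilon> by simp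
    then obtain a where a: "a \<in> op.span G" "n2 (x - a) < \<epsilon> / (\<bar>C\<bar> + 1)" using x unfolding cl_def by blast
    have aM: "a \<in> M" "x - a \<in> M" using a GM xM by (auto simp: M_closed)
    have "\<phi> x = \<phi> (x - a)" using \<phi>(1)[of "x - a" a] aM 0[OF a(1)] by simp
    also have "cmod \<dots> \<le> C * n2 (x - a)" using C aM by blast
    also have "\<dots> \<le> (\<bar>C\<bar> + 1) * n2 (x - a)" using L2.nrm_ge0[OF aM(2)] by (intro mult_right_mono) auto
    also have "\<dots> < \<epsilon>" using a(2) by (simp add: field_simps)
    finally show ?thesis .
  qed
  then show ?thesis by (metis norm_zero zero_less_norm_iff less_irrefl)
qed

text \<open>\<open>p\<close> is the form \<open>(w, z) \<mapsto> \<langle>w, P z\<rangle>\<close>, where \<open>P\<close> is the orthogonal projection of \<open>L\<^sup>2(M)\<close> onto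
  the closure of \<open>K\<close>.\<close>
lemma projection_form:
  assumes K: "K \<subseteq> M" "op.subspace K" "1 \<in> K" "\<And>x y. x \<in> K \<Longrightarrow> y \<in> K \<Longrightarrow> x * y \<in> K"
    "\<And>x. x \<in> K \<Longrightarrow> star x \<in> K"
  obtains p where
    "\<And>w z z'. w \<in> M \<Longrightarrow> z \<in> M \<Longrightarrow> z' \<in> M \<Longrightarrow> p w (z + z') = p w z + p w z'"
    "\<And>w z c. w \<in> M \<Longrightarrow> z \<in> M \<Longrightarrow> p w (sc c z) = c * p w z"
    "\<And>w w' z. w \<in> M \<Longrightarrow> w' \<in> M \<Longrightarrow> z \<in> M \<Longrightarrow> p (w + w') z = p w z + p w' z"
    "\<And>w z c. w \<in> M \<Longrightarrow> z \<in> M \<Longrightarrow> p (sc c w) z = cnj c * p w z"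
    "\<And>w z. w \<in> M \<Longrightarrow> z \<in> M \<Longrightarrow> cmod (p w z) \<le> n2 w * n2 z"
    "\<And>a w z. a \<in> K \<Longrightarrow> w \<in> M \<Longrightarrow> z \<in> M \<Longrightarrow> p w (a * z) = p (star a * w) z"
    "\<And>w. w \<in> M \<Longrightarrow> p w 1 = tr (star w)"
    "\<And>y. y \<in> M \<Longrightarrow> p y y = tr (star y * y) \<Longrightarrow> y \<in> cl K"
proof -
  interpret S: semi_inner sc K "\<lambda>x y. tr (star x * y)"
  proof
    show "op.subspace K" by (rule K)
    show "tr (star x * (y + z)) = tr (star x * y) + tr (star x * z)" if "x \<in> K" "y \<in> K" "z \<in> K" for x y z
      using that K(1) by (intro L2.B_add) auto
    show "tr (star x * sc c y) = c * tr (star x * y)" if "x \<in> K" "y \<in> K" for x y c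
      using that K(1) by (intro L2.B_sc) auto
    show "tr (star y * x) = cnj (tr (star x * y))" if "x \<in> K" "y \<in> K" for x y
      using that K(1) by (intro L2.B_herm) auto
    show "0 \<le> Re (tr (star x * x))" if "x \<in> K" for x
      using that K(1) by (intro L2.B_pos) auto
  qed
  define e where "e n = inverse (real (Suc n))" for n
  have e: "0 < e n" for n by (simp add: e_def)
  have e0: "e \<longlonglongrightarrow> 0" unfolding e_def by (rule LIMSEQ_inverse_real_of_nat)
  \<comment> \<open>\<open>l n\<close> approximates the projection of \<open>z\<close> with an error
    proportional to \<open>1 / (n + 1)\<close>; the factor \<open>C\<close> leaves room for sums,
    multiples and left products of such sequences.\<close>
  define apx where "apx z C l \<longleftrightarrow> (\<forall>n. l n \<in> K \<and>
      (\<forall>x\<in>K. cmod (tr (star z * x) - tr (star (l n) * x)) \<le> C * e n * n2 x))" for z C l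
  have "\<exists>l. apx z 1 l" if z: "z \<in> M" for z
  proof -
    have "\<forall>n. \<exists>k\<in>K. \<forall>x\<in>K. cmod (tr (star z * x) - tr (star k * x)) \<le> e n * n2 x"
    proof
      fix n
      show "\<exists>k\<in>K. \<forall>x\<in>K. cmod (tr (star z * x) - tr (star k * x)) \<le> e n * n2 x"
      proof (rule S.approx_riesz[where C = "n2 z"])
        fix x y c assume "x \<in> K" "y \<in> K"
        then show "tr (star z * (x + y)) = tr (star z * x) + tr (star z * y)"
          using K(1) z by (intro L2.B_add) auto
      next
        fix x c assume "x \<in> K"
        then show "tr (star z * sc c x) = c * tr (star z * x)" "cmod (tr (star z * x)) \<le> n2 z * n2 x"
          using K(1) z L2.B_sc[of z x c] L2.CS[of z x] by auto
      qed (rule e)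
    qed
    then show ?thesis unfolding apx_def by (simp add: Bex_def) metis
  qed
  then obtain k where k: "\<And>z. z \<in> M \<Longrightarrow> apx z 1 (k z)" by metis
  have diff: "n2 (l n - l' m) \<le> \<bar>C\<bar> * e n + \<bar>C'\<bar> * e m" if "apx z C l" "apx z C' l'" for z C l C' l' n m
  proof (rule S.approx_riesz_unique[where f = "\<lambda>x. tr (star z * x)"])
    have *: "C * e n * n2 x \<le> \<bar>C\<bar> * e n * n2 x" if "x \<in> K" for x C n
      using e[of n] S.nrm_ge0[OF that] by (intro mult_right_mono) auto
    show "cmod (tr (star z * x) - tr (star (l n) * x)) \<le> \<bar>C\<bar> * e n * n2 x" if "x \<in> K" for x
      using \<open>apx z C l\<close> that * unfolding apx_def by (meson order_trans)
    show "cmod (tr (star z * x) - tr (star (l' m) * x)) \<le> \<bar>C'\<bar> * e m * n2 x" if "x \<in> K" for x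
      using \<open>apx z C' l'\<close> that * unfolding apx_def by (meson order_trans)
  qed (use that e in \<open>auto simp: apx_def less_imp_le\<close>)
  have kK: "k z n \<in> K" "k z n \<in> M" if "z \<in> M" for z n
    using k[OF that] K by (auto simp: apx_def)
  have "convergent (\<lambda>n. tr (star w * k z n))" if w: "w \<in> M" and z: "z \<in> M" for w z
    unfolding Cauchy_convergent_iff[symmetric]
  proof (rule metric_CauchyI)
    fix \<epsilon> :: real assume \<epsilon>: "0 < \<epsilon>"
    have "(\<lambda>n. (n2 w + 1) * (2 * e n)) \<longlonglongrightarrow> (n2 w + 1) * (2 * 0)" by (intro tendsto_intros e0)
    then have "\<forall>\<^sub>F n in sequentially. (n2 w + 1) * (2 * e n) < \<epsilon>" using \<epsilon> by (intro order_tendstoD) auto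
    then obtain N where N: "(n2 w + 1) * (2 * e N) < \<epsilon>" by (auto simp: eventually_sequentially)
    have "dist (tr (star w * k z m)) (tr (star w * k z n)) < \<epsilon>" if "N \<le> m" "N \<le> n" for m n
    proof -
      have "e m \<le> e N" "e n \<le> e N" using that by (auto simp: e_def field_simps)
      then have d: "n2 (k z m - k z n) \<le> 2 * e N" using diff[OF k[OF z] k[OF z], of m n] by simp
      have "tr (star w * (k z m - k z n)) = tr (star w * k z m) - tr (star w * k z n)"
        using w kK[OF z] by (intro L2.B_diff)
      then have "dist (tr (star w * k z m)) (tr (star w * k z n)) = cmod (tr (star w * (k z m - k z n)))"
        by (simp only: dist_norm)
      also have "\<dots> \<le> n2 w * n2 (k z m - k z n)"
        using w kK[OF z] by (intro L2.CS M_closed)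
      also have "\<dots> \<le> n2 w * (2 * e N)" using d L2.nrm_ge0[OF w] by (rule mult_left_mono)
      also have "\<dots> \<le> (n2 w + 1) * (2 * e N)" using e[of N] by (intro mult_right_mono) auto
      finally show ?thesis using N by simp
    qed
    then show "\<exists>M. \<forall>m\<ge>M. \<forall>n\<ge>M. dist (tr (star w * k z m)) (tr (star w * k z n)) < \<epsilon>" by blast
  qed
  then obtain p where p: "\<And>w z. w \<in> M \<Longrightarrow> z \<in> M \<Longrightarrow> (\<lambda>n. tr (star w * k z n)) \<longlonglongrightarrow> p w z"
    unfolding convergent_def by metis
  have lim: "(\<lambda>n. tr (star w * l n)) \<longlonglongrightarrow> p w z" if w: "w \<in> M" and z: "z \<in> M" and l: "apx z C l" for w z C l
  proof -
    have lM: "l n \<in> M" for n using l K by (auto simp: apx_def)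
    have "(\<lambda>n. tr (star w * (l n - k z n))) \<longlonglongrightarrow> 0"
    proof (rule Lim_null_comparison)
      have "n2 w * n2 (l n - k z n) \<le> n2 w * (\<bar>C\<bar> * e n + \<bar>1\<bar> * e n)" for n
        using diff[OF l k[OF z], of n n] L2.nrm_ge0[OF w] by (rule mult_left_mono)
      then show "\<forall>\<^sub>F n in sequentially. norm (tr (star w * (l n - k z n))) \<le> n2 w * (\<bar>C\<bar> * e n + \<bar>1\<bar> * e n)"
        using L2.CS[OF w] lM kK[OF z] M_closed(4) by (intro always_eventually allI) (meson order_trans)
      have "(\<lambda>n. n2 w * (\<bar>C\<bar> * e n + \<bar>1\<bar> * e n)) \<longlonglongrightarrow> n2 w * (\<bar>C\<bar> * 0 + \<bar>1\<bar> * 0)"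
        by (intro tendsto_intros e0)
      then show "(\<lambda>n. n2 w * (\<bar>C\<bar> * e n + \<bar>1\<bar> * e n)) \<longlonglongrightarrow> 0" by simp
    qed
    from tendsto_add[OF this p[OF w z]] show ?thesis
      using w lM kK[OF z] by (simp add: L2.B_diff)
  qed
  \<comment> \<open>Testing the representer on itself bounds its length by that of \<open>z\<close>
    up to the error.\<close>
  have kn: "n2 (k z n) \<le> n2 z + e n" if z: "z \<in> M" for z n
  proof -
    let ?k = "k z n"
    have "cmod (tr (star z * ?k) - tr (star ?k * ?k)) \<le> e n * n2 ?k"
      using k[OF z] kK[OF z] unfolding apx_def by simp
    moreover have "cmod (tr (star z * ?k)) \<le> n2 z * n2 ?k" using z kK[OF z] by (intro L2.CS)
    moreover have "cmod (tr (star ?k * ?k)) = (n2 ?k)\<^sup>2"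
      using L2.B_self[OF kK(2)[OF z]] by (simp add: norm_power)
    moreover have "cmod (tr (star ?k * ?k)) \<le> cmod (tr (star z * ?k)) + cmod (tr (star z * ?k) - tr (star ?k * ?k))"
      using norm_triangle_ineq4[of "tr (star z * ?k)" "tr (star z * ?k) - tr (star ?k * ?k)"] by simp
    ultimately have *: "n2 ?k * n2 ?k \<le> (n2 z + e n) * n2 ?k"
      by (simp add: power2_eq_square algebra_simps)
    show ?thesis
    proof (cases "n2 ?k = 0")
      case True
      then show ?thesis using L2.nrm_ge0[OF z] e[of n] by simp
    next
      case False
      then have "0 < n2 ?k" using L2.nrm_ge0[OF kK(2)[OF z, of n]] by simp
      then show ?thesis using * by simp
    qed
  qed
  show thesis
  proof
    fix w z z' assume w: "w \<in> M" and z: "z \<in> M" and z': "z' \<in> M"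
    have "apx (z + z') 2 (\<lambda>n. k z n + k z' n)"
      unfolding apx_def
    proof (intro allI conjI ballI)
      fix n x assume x: "x \<in> K"
      let ?A = "tr (star z * x) - tr (star (k z n) * x)" and ?B = "tr (star z' * x) - tr (star (k z' n) * x)"
      have "tr (star (z + z') * x) - tr (star (k z n + k z' n) * x) = ?A + ?B"
        using x K z z' kK by (simp add: L2.B_add_left subset_iff del: star_simps)
      also have "cmod \<dots> \<le> cmod ?A + cmod ?B" by (rule norm_triangle_ineq)
      also have "\<dots> \<le> 2 * e n * n2 x"
      proof -
        have "cmod ?A \<le> 1 * e n * n2 x" "cmod ?B \<le> 1 * e n * n2 x"
          using k[OF z] k[OF z'] x unfolding apx_def by blast+
        then show ?thesis by simp
      qed
      finally show "cmod (tr (star (z + z') * x) - tr (star (k z n + k z' n) * x)) \<le> 2 * e n * n2 x" .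
    qed (use kK(1)[OF z] kK(1)[OF z'] op.subspace_add[OF K(2)] in simp)
    from lim[OF w _ this] have "(\<lambda>n. tr (star w * (k z n + k z' n))) \<longlonglongrightarrow> p w (z + z')"
      using z z' by (simp add: M_closed)
    moreover have "(\<lambda>n. tr (star w * (k z n + k z' n))) \<longlonglongrightarrow> p w z + p w z'"
      using tendsto_add[OF p[OF w z] p[OF w z']] w kK z z' by (simp add: L2.B_add)
    ultimately show "p w (z + z') = p w z + p w z'" by (rule LIMSEQ_unique)
  next
    fix w z c assume w: "w \<in> M" and z: "z \<in> M"
    have "apx (sc c z) (cmod c) (\<lambda>n. sc c (k z n))"
      unfolding apx_def
    proof (intro allI conjI ballI)
      fix n x assume x: "x \<in> K"
      have "tr (star (sc c z) * x) - tr (star (sc c (k z n)) * x) = cnj c * (tr (star z * x) - tr (star (k z n) * x))"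
        using x K z kK by (simp add: L2.B_sc_left subset_iff algebra_simps del: star_simps)
      then show "cmod (tr (star (sc c z) * x) - tr (star (sc c (k z n)) * x)) \<le> cmod c * e n * n2 x"
        using k[OF z] x unfolding apx_def by (simp add: norm_mult mult.assoc mult_left_mono)
    qed (use kK(1)[OF z] op.subspace_scale[OF K(2)] in simp)
    from lim[OF w _ this] have "(\<lambda>n. tr (star w * sc c (k z n))) \<longlonglongrightarrow> p w (sc c z)"
      using z by (simp add: M_closed)
    moreover have "(\<lambda>n. tr (star w * sc c (k z n))) \<longlonglongrightarrow> c * p w z"
      using tendsto_mult_left[OF p[OF w z], of c] w kK z by (simp add: L2.B_sc del: sc_mult_right)
    ultimately show "p w (sc c z) = c * p w z" by (rule LIMSEQ_unique)
    have "(\<lambda>n. tr (star (sc c w) * k z n)) \<longlonglongrightarrow> cnj c * p w z"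
      using tendsto_mult_left[OF p[OF w z], of "cnj c"] w kK z
      by (simp add: L2.B_sc_left del: sc_mult_left star_simps)
    moreover have "(\<lambda>n. tr (star (sc c w) * k z n)) \<longlonglongrightarrow> p (sc c w) z"
      using w z by (intro p M_closed)
    ultimately show "p (sc c w) z = cnj c * p w z" using LIMSEQ_unique by blast
  next
    fix w w' z assume w: "w \<in> M" and w': "w' \<in> M" and z: "z \<in> M"
    have "(\<lambda>n. tr (star (w + w') * k z n)) \<longlonglongrightarrow> p w z + p w' z"
      using tendsto_add[OF p[OF w z] p[OF w' z]] w w' kK z by (simp add: L2.B_add_left del: star_simps)
    moreover have "(\<lambda>n. tr (star (w + w') * k z n)) \<longlonglongrightarrow> p (w + w') z"
      using w w' z by (intro p M_closed)
    ultimately show "p (w + w') z = p w z + p w' z" using LIMSEQ_unique by blast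
  next
    fix w z assume w: "w \<in> M" and z: "z \<in> M"
    have "cmod (tr (star w * k z n)) \<le> n2 w * (n2 z + e n)" for n
      using L2.CS[OF w kK(2)[OF z, of n]] kn[OF z, of n] L2.nrm_ge0[OF w] by (meson mult_left_mono order_trans)
    moreover have "(\<lambda>n. n2 w * (n2 z + e n)) \<longlonglongrightarrow> n2 w * (n2 z + 0)" by (intro tendsto_intros e0)
    ultimately have "cmod (p w z) \<le> n2 w * (n2 z + 0)"
      by (intro LIMSEQ_le[OF tendsto_norm[OF p[OF w z]]]) auto
    then show "cmod (p w z) \<le> n2 w * n2 z" by simp
  next
    fix a w z assume a: "a \<in> K" and w: "w \<in> M" and z: "z \<in> M"
    have aM: "a \<in> M" using a K by blast
    have "apx (a * z) (opn (star a)) (\<lambda>n. a * k z n)"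
      unfolding apx_def
    proof (intro allI conjI ballI)
      fix n x assume x: "x \<in> K"
      have ax: "star a * x \<in> K" using a x K by blast
      have "cmod (tr (star z * (star a * x)) - tr (star (k z n) * (star a * x))) \<le> e n * n2 (star a * x)"
        using k[OF z] ax unfolding apx_def by simp
      also have "\<dots> \<le> e n * (opn (star a) * n2 x)"
        using x K a e[of n] by (intro mult_left_mono n2_mult_left) (auto simp: subset_iff)
      finally show "cmod (tr (star (a * z) * x) - tr (star (a * k z n) * x)) \<le> opn (star a) * e n * n2 x"
        by (simp add: mult.assoc algebra_simps)
    qed (use kK(1)[OF z] a K(4) in simp)
    from lim[OF w _ this] have "(\<lambda>n. tr (star w * (a * k z n))) \<longlonglongrightarrow> p w (a * z)"
      using z aM by (simp add: M_closed)
    moreover have "(\<lambda>n. tr (star (star a * w) * k z n)) \<longlonglongrightarrow> p (star a * w) z"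
      using w z aM by (intro p M_closed)
    ultimately show "p w (a * z) = p (star a * w) z" by (simp add: mult.assoc LIMSEQ_unique)
  next
    fix w assume w: "w \<in> M"
    have "apx 1 0 (\<lambda>n. 1)" using K by (simp add: apx_def)
    from lim[OF w _ this] show "p w 1 = tr (star w)"
      by (simp add: M_closed LIMSEQ_const_iff)
  next
    \<comment> \<open>The equality says that projecting preserves the norm of \<open>y\<close>.
      Expanding the squared distance then shows that the approximants converge to
      \<open>y\<close>.\<close>
    fix y assume y: "y \<in> M" and eq: "p y y = tr (star y * y)"
    have "(\<lambda>n. tr (star y * k y n) - tr (star (k y n) * k y n)) \<longlonglongrightarrow> 0"
    proof (rule Lim_null_comparison)
      show "\<forall>\<^sub>F n in sequentially. norm (tr (star y * k y n) - tr (star (k y n) * k y n)) \<le> e n * (\<bar>n2 y\<bar> + 2)"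
      proof (intro always_eventually allI)
        fix n
        have "e n \<le> 1" by (simp add: e_def field_simps)
        then have "n2 (k y n) \<le> \<bar>n2 y\<bar> + 2" using kn[OF y, of n] by simp
        then have *: "e n * n2 (k y n) \<le> e n * (\<bar>n2 y\<bar> + 2)"
          using e[of n] by (intro mult_left_mono) auto
        have "norm (tr (star y * k y n) - tr (star (k y n) * k y n)) \<le> 1 * e n * n2 (k y n)"
          using k[OF y] kK(1)[OF y] unfolding apx_def by blast
        then show "norm (tr (star y * k y n) - tr (star (k y n) * k y n)) \<le> e n * (\<bar>n2 y\<bar> + 2)"
          using * by simp
      qed
      show "(\<lambda>n. e n * (\<bar>n2 y\<bar> + 2)) \<longlonglongrightarrow> 0" using tendsto_mult_left_zero[OF e0] .
    qed
    from tendsto_diff[OF p[OF y y] this]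
    have kk: "(\<lambda>n. tr (star (k y n) * k y n)) \<longlonglongrightarrow> tr (star y * y)" by (simp add: eq)
    have "(\<lambda>n. Re (tr (star y * y) - tr (star y * k y n) - cnj (tr (star y * k y n)) + tr (star (k y n) * k y n)))
        \<longlonglongrightarrow> Re (tr (star y * y) - p y y - cnj (p y y) + tr (star y * y))"
      by (intro tendsto_intros p y kk)
    moreover have "Re (tr (star y * y) - tr (star y * k y n) - cnj (tr (star y * k y n)) + tr (star (k y n) * k y n))
        = (n2 (y - k y n))\<^sup>2" for n
      using y kK[OF y] L2.B_herm[OF y kK(2)[OF y, of n]]
      by (simp add: n2_sq M_closed L2.B_diff L2.B_diff_left del: star_simps)
    ultimately have "(\<lambda>n. (n2 (y - k y n))\<^sup>2) \<longlonglongrightarrow> 0" by (simp add: eq)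
    then have "(\<lambda>n. sqrt ((n2 (y - k y n))\<^sup>2)) \<longlonglongrightarrow> sqrt 0" by (rule tendsto_real_sqrt)
    then have "(\<lambda>n. n2 (y - k y n)) \<longlonglongrightarrow> 0"
      using y kK[OF y] by (simp add: L2.nrm_ge0 M_closed)
    moreover have "k y n \<in> cl K" for n using kK(1)[OF y] cl_sup[OF K(1)] by blast
    ultimately show "y \<in> cl K" using cl_lim[of "k y" K y] K(1) y by blast
  qed
qed

end

lemma closure_invariant:
  assumes "\<And>v. v \<in> V \<Longrightarrow> ap a v \<in> V" "v \<in> closure V"
  shows "ap a v \<in> closure V"
proof -
  obtain s where s: "\<And>n. s n \<in> V" "s \<longlonglongrightarrow> v" using assms(2) by (auto simp: closure_sequential)
  have "(\<lambda>n. ap a (s n)) \<longlonglongrightarrow> ap a v" using s(2) by (rule tendsto_ap)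
  then show ?thesis
    unfolding closure_sequential using assms(1) s(1) by (intro exI[of _ "\<lambda>n. ap a (s n)"]) auto
qed

lemma closure_subspace_add:
  fixes V :: "'h::complex_hilbert set"
  assumes V: "hilbert.subspace V" and "v \<in> closure V" "w \<in> closure V"
  shows "v + w \<in> closure V"
proof -
  obtain s t where s: "\<And>n. s n \<in> V" "s \<longlonglongrightarrow> v" and t: "\<And>n. t n \<in> V" "t \<longlonglongrightarrow> w"
    using assms(2,3) unfolding closure_sequential by blast
  have "(\<lambda>n. s n + t n) \<longlonglongrightarrow> v + w" using s t by (intro tendsto_add)
  moreover have "s n + t n \<in> V" for n using hilbert.subspace_add[OF V] s t by blast
  ultimately show ?thesis unfolding closure_sequential by (intro exI conjI allI)
qed

lemma closure_subspace_scale: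
  fixes V :: "'h::complex_hilbert set"
  assumes V: "hilbert.subspace V" and "v \<in> closure V"
  shows "c *\<^sub>C v \<in> closure V"
proof -
  obtain s where s: "\<And>n. s n \<in> V" "s \<longlonglongrightarrow> v"
    using assms(2) unfolding closure_sequential by blast
  have "(\<lambda>n. c *\<^sub>C s n) \<longlonglongrightarrow> c *\<^sub>C v" using s by (intro tendsto_scaleC)
  moreover have "c *\<^sub>C s n \<in> V" for n using hilbert.subspace_scale[OF V] s by blast
  ultimately show ?thesis unfolding closure_sequential by (intro exI conjI allI)
qed

context tracial
begin

lemma cyclic_subspace: "hilbert.subspace ((\<lambda>x. ap x \<eta>) ` M)"
proof (rule hilbert.subspaceI)
  show "0 \<in> (\<lambda>x. ap x \<eta>) ` M" using M_closed(2) by (force intro: image_eqI[where x = 0])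
next
  fix v w assume "v \<in> (\<lambda>x. ap x \<eta>) ` M" "w \<in> (\<lambda>x. ap x \<eta>) ` M"
  then obtain x y where "v = ap x \<eta>" "w = ap y \<eta>" "x \<in> M" "y \<in> M" by auto
  then show "v + w \<in> (\<lambda>x. ap x \<eta>) ` M" by (intro image_eqI[where x = "x + y"]) (auto simp: M_closed)
next
  fix c v assume "v \<in> (\<lambda>x. ap x \<eta>) ` M"
  then obtain x where "v = ap x \<eta>" "x \<in> M" by auto
  then show "c *\<^sub>C v \<in> (\<lambda>x. ap x \<eta>) ` M" by (intro image_eqI[where x = "sc c x"]) (auto simp: M_closed)
qed

text \<open>A functional that is bounded by the norm of \<open>x d\<close> in \<open>L\<^sup>2(M)\<close> is represented by a vector of the
  given Hilbert space, since \<open>x \<eta> \<mapsto> x d\<close> is a contraction.\<close>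
lemma represent:
  assumes d: "d \<in> M" "\<And>x. x \<in> M \<Longrightarrow> n2 (x * d) \<le> norm (ap x \<eta>)"
    and f: "\<And>x y. x \<in> M \<Longrightarrow> y \<in> M \<Longrightarrow> f (x + y) = f x + f y"
    "\<And>c x. x \<in> M \<Longrightarrow> f (sc c x) = c * f x" "\<And>x. x \<in> M \<Longrightarrow> cmod (f x) \<le> C * n2 x" and C: "0 \<le> C"
  shows "\<exists>\<theta>\<in>closure ((\<lambda>x. ap x \<eta>) ` M). norm \<theta> \<le> C \<and> (\<forall>x\<in>M. cinner \<theta> (ap x \<eta>) = f (x * d))"
proof -
  \<comment> \<open>Any preimage of \<open>v\<close> will do: if \<open>x \<eta> = 0\<close>, then
    \<open>x * d\<close> has trace norm 0 and vanishes by faithfulness.\<close>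
  define h where "h v = (SOME x. x \<in> M \<and> ap x \<eta> = v)" for v
  have h: "h (ap x \<eta>) * d = x * d" if x: "x \<in> M" for x
  proof -
    have hx: "h (ap x \<eta>) \<in> M" "ap (h (ap x \<eta>)) \<eta> = ap x \<eta>"
      using someI[of "\<lambda>y. y \<in> M \<and> ap y \<eta> = ap x \<eta>" x] x by (auto simp: h_def)
    let ?y = "h (ap x \<eta>) - x"
    have yM: "?y \<in> M" using x hx(1) by (simp add: M_closed)
    have "ap ?y \<eta> = 0" using hx by simp
    then have "n2 (?y * d) \<le> 0" using d(2)[OF yM] by simp
    then have "n2 (?y * d) = 0" using L2.nrm_ge0[OF M_closed(5)[OF yM d(1)]] by simp
    then have "?y * d = 0" using hx x d by (intro n2_0 M_closed)
    then show ?thesis by (simp add: algebra_simps)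
  qed
  define g where "g v = f (h v * d)" for v
  have g: "g (ap x \<eta>) = f (x * d)" if "x \<in> M" for x using h[OF that] by (simp add: g_def)
  have "\<exists>\<theta>\<in>closure ((\<lambda>x. ap x \<eta>) ` M). norm \<theta> \<le> C \<and> (\<forall>v\<in>(\<lambda>x. ap x \<eta>) ` M. cinner \<theta> v = g v)"
  proof (rule riesz_subspace[OF cyclic_subspace _ _ _ C])
    fix v w assume "v \<in> (\<lambda>x. ap x \<eta>) ` M" "w \<in> (\<lambda>x. ap x \<eta>) ` M"
    then obtain x y where xy: "v = ap x \<eta>" "w = ap y \<eta>" "x \<in> M" "y \<in> M" by auto
    have "g (ap (x + y) \<eta>) = g (ap x \<eta>) + g (ap y \<eta>)"
      using xy d by (subst (1 2 3) g) (auto simp: M_closed f distrib_right)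
    then show "g (v + w) = g v + g w" using xy by simp
  next
    fix c v assume "v \<in> (\<lambda>x. ap x \<eta>) ` M"
    then obtain x where x: "v = ap x \<eta>" "x \<in> M" by auto
    have "g (ap (sc c x) \<eta>) = c * g (ap x \<eta>)"
      using x d by (subst (1 2) g) (auto simp: M_closed f)
    then show "g (c *\<^sub>C v) = c * g v" using x by simp
  next
    fix v assume "v \<in> (\<lambda>x. ap x \<eta>) ` M"
    then obtain x where x: "v = ap x \<eta>" "x \<in> M" by auto
    have "cmod (f (x * d)) \<le> C * n2 (x * d)" using x d by (intro f M_closed)
    also have "\<dots> \<le> C * norm (ap x \<eta>)" using d x C by (intro mult_left_mono) auto
    finally show "cmod (g v) \<le> C * norm v" using x g by simp
  qed
  then show ?thesis using g by simp
qed

text \<open>With \<open>P\<close> the projection of \<open>L\<^sup>2(M)\<close> onto the closure of \<open>K\<close> and \<open>T\<^sub>i : x \<eta>\<^sub>i \<mapsto> x d\<^sub>i\<close>, the operator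
  \<open>T\<^sub>2\<^sup>* P T\<^sub>1\<close> lies in the commutant of \<open>K\<close>, so it commutes with the bicommutant. As the \<open>d\<^sub>i\<close>
  are dense, the bicommutant commutes with \<open>P\<close>, and \<open>P\<close> fixes the unit.\<close>
theorem closed_subalgebra_vna:
  assumes KM: "K \<subseteq> M" and K: "op.subspace K" "1 \<in> K" "\<And>x y. x \<in> K \<Longrightarrow> y \<in> K \<Longrightarrow> x * y \<in> K"
    "\<And>x. x \<in> K \<Longrightarrow> star x \<in> K" and clK: "cl K = K"
  shows "vna K"
proof (rule projection_form[OF KM K])
  fix p
  assume
    p_add: "\<And>w z z'. w \<in> M \<Longrightarrow> z \<in> M \<Longrightarrow> z' \<in> M \<Longrightarrow> p w (z + z') = p w z + p w z'" and
    p_sc: "\<And>w z c. w \<in> M \<Longrightarrow> z \<in> M \<Longrightarrow> p w (sc c z) = c * p w z" and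
    p_add_left: "\<And>w w' z. w \<in> M \<Longrightarrow> w' \<in> M \<Longrightarrow> z \<in> M \<Longrightarrow> p (w + w') z = p w z + p w' z" and
    p_sc_left: "\<And>w z c. w \<in> M \<Longrightarrow> z \<in> M \<Longrightarrow> p (sc c w) z = cnj c * p w z" and
    p_bound: "\<And>w z. w \<in> M \<Longrightarrow> z \<in> M \<Longrightarrow> cmod (p w z) \<le> n2 w * n2 z" and
    p_K: "\<And>a w z. a \<in> K \<Longrightarrow> w \<in> M \<Longrightarrow> z \<in> M \<Longrightarrow> p w (a * z) = p (star a * w) z" and
    p_one: "\<And>w. w \<in> M \<Longrightarrow> p w 1 = tr (star w)" and
    p_cl: "\<And>y. y \<in> M \<Longrightarrow> p y y = tr (star y * y) \<Longrightarrow> y \<in> cl K"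
  have KinM: "x \<in> M" if "x \<in> K" for x using that KM by blast
  have "y \<in> K" if y: "y \<in> comm (comm K)" for y
  proof -
    have yM: "y \<in> M"
    proof -
      have "comm (comm K) \<subseteq> comm (comm M)" using KM by (intro comm_antimono)
      then show ?thesis using y M by (auto simp: vna_def)
    qed
    have core: "p (y * (x1 * d1)) (x2 * d2) = p (x1 * d1) (star y * (x2 * d2))"
      if d1: "d1 \<in> dominated" and d2: "d2 \<in> dominated" and x: "x1 \<in> M" "x2 \<in> M" for d1 d2 x1 x2
    proof -
      obtain \<eta>1 where \<eta>1: "d1 \<in> M" "\<And>x. x \<in> M \<Longrightarrow> n2 (x * d1) \<le> norm (ap x \<eta>1)"
        using d1 by (auto simp: dominated_def)
      obtain \<eta>2 where \<eta>2: "d2 \<in> M" "\<And>x. x \<in> M \<Longrightarrow> n2 (x * d2) \<le> norm (ap x \<eta>2)"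
        using d2 by (auto simp: dominated_def)
      let ?V1 = "(\<lambda>x. ap x \<eta>1) ` M" and ?V2 = "(\<lambda>x. ap x \<eta>2) ` M"
      note V1 = cyclic_subspace[of \<eta>1] and V2 = cyclic_subspace[of \<eta>2]
      \<comment> \<open>\<open>\<theta> z\<close> plays the role of
        \<open>T\<^sub>1\<^sup>* P z\<close>; the conjugate makes the functional linear in
        \<open>w\<close>.\<close>
      have "\<exists>\<theta>\<in>closure ?V1. norm \<theta> \<le> n2 z \<and> (\<forall>x\<in>M. cinner \<theta> (ap x \<eta>1) = cnj (p (x * d1) z))"
        if z: "z \<in> M" for z
        using z p_bound by (intro represent[OF \<eta>1, where f = "\<lambda>w. cnj (p w z)"])
          (auto simp: p_add_left p_sc_left L2.nrm_ge0 mult.commute)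
      then obtain \<theta> where \<theta>c: "\<And>z. z \<in> M \<Longrightarrow> \<theta> z \<in> closure ?V1" and \<theta>n: "\<And>z. z \<in> M \<Longrightarrow> norm (\<theta> z) \<le> n2 z"
        and \<theta>: "\<And>z x. z \<in> M \<Longrightarrow> x \<in> M \<Longrightarrow> cinner (\<theta> z) (ap x \<eta>1) = cnj (p (x * d1) z)" by metis
      have \<theta>_add: "\<theta> (z + z') = \<theta> z + \<theta> z'" if "z \<in> M" "z' \<in> M" for z z'
        using that \<eta>1(1) by (intro cinner_eq_closure[OF V1] \<theta>c closure_subspace_add[OF V1] M_closed)
          (auto simp: \<theta> cinner_simps M_closed p_add)
      have \<theta>_sc: "\<theta> (sc c z) = c *\<^sub>C \<theta> z" if "z \<in> M" for z c
        using that \<eta>1(1) by (intro cinner_eq_closure[OF V1] \<theta>c closure_subspace_scale[OF V1] M_closed)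
          (auto simp: \<theta> cinner_simps M_closed p_sc intro: \<theta>c)
      have \<theta>_K: "\<theta> (a * z) = ap a (\<theta> z)" if a: "a \<in> K" and z: "z \<in> M" for a z
      proof (rule cinner_eq_closure[OF V1])
        show "\<theta> (a * z) \<in> closure ?V1" using a z KinM by (intro \<theta>c M_closed)
        show "ap a (\<theta> z) \<in> closure ?V1"
          by (rule closure_invariant[OF _ \<theta>c[OF z]])
            (use a KinM in \<open>force intro: image_eqI[where x = "a * x" for x] M_closed\<close>)
        fix v assume "v \<in> ?V1"
        then obtain x where x: "v = ap x \<eta>1" "x \<in> M" by auto
        have "cinner (ap a (\<theta> z)) v = cinner (\<theta> z) (ap (star a * x) \<eta>1)"
          using x cinner_star[of "star a" "\<theta> z" v] by simp
        also have "\<dots> = cnj (p ((star a * x) * d1) z)"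
          using a z x KinM by (intro \<theta> M_closed)
        also have "\<dots> = cnj (p (x * d1) (a * z))"
          using p_K[OF a M_closed(5)[OF x(2) \<eta>1(1)] z] by (simp only: mult.assoc)
        also have "\<dots> = cinner (\<theta> (a * z)) v"
          using a z x KinM by (simp add: \<theta> M_closed)
        finally show "cinner (\<theta> (a * z)) v = cinner (ap a (\<theta> z)) v" by (rule sym)
      qed
      \<comment> \<open>Representing \<open>x \<eta>\<^sub>2 \<mapsto> \<langle>u, \<theta> (x
        d\<^sub>2)\<rangle>\<close> forms the adjoint of
        \<open>T\<^sub>1\<^sup>* P T\<^sub>2\<close>, which is the operator wanted.\<close>
      have "\<exists>g\<in>closure ?V2. norm g \<le> norm u \<and> (\<forall>x\<in>M. cinner g (ap x \<eta>2) = cinner u (\<theta> (x * d2)))" for u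
      proof (rule represent[OF \<eta>2, where f = "\<lambda>z. cinner u (\<theta> z)"])
        show "cmod (cinner u (\<theta> x)) \<le> norm u * n2 x" if "x \<in> M" for x
          using cinner_CS[of u "\<theta> x"] \<theta>n[OF that] by (meson mult_left_mono norm_ge_zero order_trans)
      qed (auto simp: \<theta>_add \<theta>_sc cinner_simps)
      then obtain G where Gc: "\<And>u. G u \<in> closure ?V2" and Gn: "\<And>u. norm (G u) \<le> norm u"
        and G: "\<And>u x. x \<in> M \<Longrightarrow> cinner (G u) (ap x \<eta>2) = cinner u (\<theta> (x * d2))" by metis
      have G_add: "G (u + v) = G u + G v" for u v
        by (intro cinner_eq_closure[OF V2] Gc closure_subspace_add[OF V2]) (auto simp: G cinner_simps)
      have G_sc: "G (c *\<^sub>C u) = c *\<^sub>C G u" for c u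
        by (intro cinner_eq_closure[OF V2] Gc closure_subspace_scale[OF V2]) (auto simp: G cinner_simps Gc)
      have G_K: "G (ap a u) = ap a (G u)" if a: "a \<in> K" for a u
      proof (rule cinner_eq_closure[OF V2 Gc])
        show "ap a (G u) \<in> closure ?V2"
          by (rule closure_invariant[OF _ Gc])
            (use a KinM in \<open>force intro: image_eqI[where x = "a * x" for x] M_closed\<close>)
        fix v assume "v \<in> ?V2"
        then obtain x where x: "v = ap x \<eta>2" "x \<in> M" by auto
        have "cinner (ap a (G u)) v = cinner (G u) (ap (star a * x) \<eta>2)"
          using x cinner_star[of "star a" "G u" v] by simp
        also have "\<dots> = cinner u (\<theta> (star a * (x * d2)))"
          using G[of "star a * x" u] x a KinM by (simp only: mult.assoc M_closed)
        also have "\<dots> = cinner (ap a u) (\<theta> (x * d2))"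
          using x a K \<eta>2 by (simp add: \<theta>_K M_closed cinner_star')
        finally show "cinner (G (ap a u)) v = cinner (ap a (G u)) v" using x by (simp add: G)
      qed
      have "bounded_op G"
        unfolding bounded_op_def
        by (auto intro!: bounded_linear_intro[where K = 1] simp: G_add G_sc scaleR_scaleC Gn)
      then have apG: "ap (Op G) = G" by (simp add: Op_inverse)
      have "Op G \<in> comm K"
        unfolding comm_def using G_K by (auto intro!: operator_eqI simp: apG)
      then have "Op G * y = y * Op G" using y by (auto simp: comm_def)
      then have yG: "G (ap y u) = ap y (G u)" for u by (metis ap_simps(6) apG)
      have s: "cinner (G (ap w \<eta>1)) (ap z \<eta>2) = p (w * d1) (z * d2)" if "w \<in> M" "z \<in> M" for w z
        using that \<eta>2(1) \<theta>[of "z * d2" w]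
        by (simp add: G M_closed) (metis M_closed(5) cinner_commute complex_cnj_cnj)
      have "p ((y * x1) * d1) (x2 * d2) = cinner (G (ap (y * x1) \<eta>1)) (ap x2 \<eta>2)"
        using x yM by (simp only: s M_closed)
      also have "\<dots> = cinner (ap y (G (ap x1 \<eta>1))) (ap x2 \<eta>2)" by (simp add: yG)
      also have "\<dots> = cinner (G (ap x1 \<eta>1)) (ap (star y * x2) \<eta>2)" by (simp add: cinner_star')
      also have "\<dots> = p (x1 * d1) ((star y * x2) * d2)" using x yM by (simp only: s M_closed)
      finally show ?thesis by (simp only: mult.assoc)
    qed
    let ?X = "{x * d |x d. x \<in> M \<and> d \<in> dominated}"
    have XM: "?X \<subseteq> M" by (auto simp: dominated_def M_closed)
    have bd: "cmod (a - b) \<le> (C + D) * n" if "cmod a \<le> C * n" "cmod b \<le> D * n" for a b :: complex and C D n :: real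
      using norm_triangle_ineq4[of a b] that by (simp add: algebra_simps)
    \<comment> \<open>Both sides are bounded in the trace norm, so the identity extends by density,
      here in \<open>z\<close> and afterwards in \<open>w\<close>.\<close>
    have *: "p (y * w) z = p w (star y * z)" if w: "w \<in> ?X" and z: "z \<in> M" for w z
    proof -
      have wM: "w \<in> M" using w XM by blast
      have "p (y * w) z - p w (star y * z) = 0"
      proof (rule bounded_functional_zero[where G = ?X and C = "n2 (y * w) + n2 w * opn (star y)" and
            \<phi> = "\<lambda>z. p (y * w) z - p w (star y * z)"])
        fix x assume x: "x \<in> M"
        show "cmod (p (y * w) x - p w (star y * x)) \<le> (n2 (y * w) + n2 w * opn (star y)) * n2 x"
        proof (rule bd)
          show "cmod (p (y * w) x) \<le> n2 (y * w) * n2 x" using yM wM x by (intro p_bound M_closed)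
          have "cmod (p w (star y * x)) \<le> n2 w * n2 (star y * x)" using yM wM x by (intro p_bound M_closed)
          also have "\<dots> \<le> n2 w * (opn (star y) * n2 x)"
            using yM wM x by (intro mult_left_mono n2_mult_left L2.nrm_ge0 M_closed)
          finally show "cmod (p w (star y * x)) \<le> n2 w * opn (star y) * n2 x" by (simp add: mult.assoc)
        qed
      next
        fix x assume "x \<in> ?X"
        then show "p (y * w) x - p w (star y * x) = 0" using w core by auto
      next
        show "z \<in> cl (op.span ?X)" using z dominated_dense by simp
      qed (use yM wM XM in \<open>auto simp: p_add p_sc distrib_left M_closed algebra_simps\<close>)
      then show ?thesis by simp
    qed
    have **: "p (y * w) z = p w (star y * z)" if w: "w \<in> M" and z: "z \<in> M" for w z
    proof -
      have "cnj (p (y * w) z - p w (star y * z)) = 0"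
      proof (rule bounded_functional_zero[where G = ?X and C = "opn y * n2 z + n2 (star y * z)" and
            \<phi> = "\<lambda>w. cnj (p (y * w) z - p w (star y * z))"])
        fix x assume x: "x \<in> M"
        have "cmod (p (y * x) z - p x (star y * z)) \<le> (opn y * n2 z + n2 (star y * z)) * n2 x"
        proof (rule bd)
          have "cmod (p (y * x) z) \<le> n2 (y * x) * n2 z" using yM z x by (intro p_bound M_closed)
          also have "\<dots> \<le> (opn y * n2 x) * n2 z"
            using yM z x by (intro mult_right_mono n2_mult_left L2.nrm_ge0 M_closed)
          finally show "cmod (p (y * x) z) \<le> opn y * n2 z * n2 x" by (simp add: algebra_simps)
          have "cmod (p x (star y * z)) \<le> n2 x * n2 (star y * z)" using yM z x by (intro p_bound M_closed)
          then show "cmod (p x (star y * z)) \<le> n2 (star y * z) * n2 x" by (simp add: mult.commute)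
        qed
        then show "cmod (cnj (p (y * x) z - p x (star y * z))) \<le> (opn y * n2 z + n2 (star y * z)) * n2 x"
          by (simp only: complex_mod_cnj)
      next
        fix x assume "x \<in> ?X"
        then show "cnj (p (y * x) z - p x (star y * z)) = 0" using z * by simp
      next
        show "w \<in> cl (op.span ?X)" using w dominated_dense by simp
      qed (use yM z XM in \<open>auto simp: p_add_left p_sc_left distrib_left M_closed algebra_simps\<close>)
      then show ?thesis by simp
    qed
    \<comment> \<open>At \<open>w = star y\<close> and \<open>z = 1\<close> the identity says that
      projecting preserves the norm of \<open>star y\<close>.\<close>
    have "p (star y) (star y * 1) = p (y * star y) 1" using **[of "star y" 1] yM by (simp add: M_closed)
    also have "\<dots> = tr (star (star y) * star y)" using yM p_one[of "y * star y"] by (simp add: M_closed)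
    finally have "star y \<in> cl K" using yM by (intro p_cl) (auto simp: M_closed)
    then show ?thesis using clK K(4)[of "star y"] by simp
  qed
  then show "vna K" unfolding vna_def using K(4) comm_comm[of K] by blast
qed

corollary cl_vna:
  assumes X: "X \<subseteq> M" "op.subspace X" "1 \<in> X" "\<And>x y. x \<in> X \<Longrightarrow> y \<in> X \<Longrightarrow> x * y \<in> X"
    "\<And>x. x \<in> X \<Longrightarrow> star x \<in> X"
  shows "vna (cl X)"
proof (rule closed_subalgebra_vna)
  show "x * y \<in> cl X" if "x \<in> cl X" "y \<in> cl X" for x y
  proof (rule cl_mult[OF X(1) X(1) X(1) that])
    show "a * b \<in> cl X" if "a \<in> X" "b \<in> X" for a b
      using X(4)[OF that] cl_sup[OF X(1)] by blast
  qed
  show "star x \<in> cl X" if "x \<in> cl X" for x by (rule cl_star[OF X(1) that X(5)])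
  show "cl X \<subseteq> M" by (rule cl_M)
  show "op.subspace (cl X)" by (rule cl_subspace[OF X(1,2)])
  show "1 \<in> cl X" using X(3) cl_sup[OF X(1)] by blast
  show "cl (cl X) = cl X" by (rule cl_cl[OF X(1)])
qed

end

section \<open>Alternating words and freeness\<close>

text \<open>\<open>Alt F i k x\<close>: \<open>x\<close> is an alternating word with letters in the \<open>F j\<close> whose first letter has index
  \<open>i\<close> and whose last letter has index \<open>k\<close>.\<close>
inductive Alt :: "('i \<Rightarrow> 'a::semigroup_mult set) \<Rightarrow> 'i \<Rightarrow> 'i \<Rightarrow> 'a \<Rightarrow> bool" for F where
  single: "x \<in> F i \<Longrightarrow> Alt F i i x"
| cons: "x \<in> F i \<Longrightarrow> Alt F j k y \<Longrightarrow> i \<noteq> j \<Longrightarrow> Alt F i k (x * y)"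

lemma Alt_mono: "Alt F i k x \<Longrightarrow> (\<And>i. F i \<subseteq> G i) \<Longrightarrow> Alt G i k x"
  by (induction rule: Alt.induct) (auto intro: Alt.intros)

lemma Alt_append: "Alt F i j x \<Longrightarrow> Alt F k l y \<Longrightarrow> j \<noteq> k \<Longrightarrow> Alt F i l (x * y)"
  by (induction rule: Alt.induct) (auto simp: mult.assoc intro: Alt.intros)

lemma Alt_snoc: "Alt F i j x \<Longrightarrow> y \<in> F k \<Longrightarrow> j \<noteq> k \<Longrightarrow> Alt F i k (x * y)"
  by (rule Alt_append[OF _ single])

lemma Alt_consE:
  assumes "Alt F i k x"
  obtains "i = k" "x \<in> F i" | j g y where "x = g * y" "g \<in> F i" "Alt F j k y" "i \<noteq> j"
  using assms by (cases rule: Alt.cases) blast+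

lemma Alt_snocE:
  assumes "Alt F i k x"
  obtains "i = k" "x \<in> F i" | j g y where "x = y * g" "g \<in> F k" "Alt F i j y" "j \<noteq> k"
proof -
  have "i = k \<and> x \<in> F i \<or> (\<exists>j g y. x = y * g \<and> g \<in> F k \<and> Alt F i j y \<and> j \<noteq> k)"
    using assms
  proof (induction rule: Alt.induct)
    case (cons x i j k y)
    from cons.IH show ?case
    proof (elim disjE conjE exE)
      assume "j = k" "y \<in> F j"
      moreover have "Alt F i i x" using cons.hyps(1) by (rule single)
      ultimately show ?thesis using \<open>i \<noteq> j\<close> by blast
    next
      fix l g z assume "y = z * g" "g \<in> F k" "Alt F j l z" "l \<noteq> k"
      then have "x * y = (x * z) * g" "Alt F i l (x * z)" using cons by (auto simp: mult.assoc intro: Alt.cons)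
      then show ?thesis using \<open>g \<in> F k\<close> \<open>l \<noteq> k\<close> by blast
    qed
  qed simp
  then show thesis using that by blast
qed

lemma Alt_star:
  fixes F :: "'i \<Rightarrow> 'h::complex_hilbert operator set"
  assumes "Alt F i k x" "\<And>i x. x \<in> F i \<Longrightarrow> star x \<in> F i"
  shows "Alt F k i (star x)"
  using assms(1) by (induction rule: Alt.induct) (auto intro: single Alt_snoc assms(2))

lemma span_mult:
  fixes S T U :: "'h::complex_hilbert operator set"
  assumes U: "op.subspace U" and ST: "\<And>a b. a \<in> S \<Longrightarrow> b \<in> T \<Longrightarrow> a * b \<in> U"
    and a: "a \<in> op.span S" and b: "b \<in> op.span T"
  shows "a * b \<in> U"
  using a
proof (induction rule: op.span_induct_alt)
  case base
  then show ?case by (simp add: op.subspace_0 U)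
next
  case (step c x y)
  have "x * b \<in> U"
    using b
  proof (induction rule: op.span_induct_alt)
    case base
    then show ?case by (simp add: op.subspace_0 U)
  next
    case (step d y z)
    then show ?case using ST[OF \<open>x \<in> S\<close>] by (simp add: distrib_left op.subspace_add op.subspace_scale U)
  qed
  then show ?case using step by (simp add: distrib_right op.subspace_add op.subspace_scale U)
qed

context tracial
begin

definition ctr :: "'h operator set \<Rightarrow> 'h operator set" where
  "ctr X = {x \<in> X. tr x = 0}"

definition free :: "('i \<Rightarrow> 'h operator set) \<Rightarrow> bool" where
  "free F \<longleftrightarrow> (\<forall>i k x. Alt (\<lambda>i. ctr (F i)) i k x \<longrightarrow> tr x = 0)"

text \<open>The algebraic free product: for unital algebras, alternating words in centred letters
  and the unit already span the generated algebra.\<close>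

definition wspan :: "('i \<Rightarrow> 'h operator set) \<Rightarrow> 'h operator set" where
  "wspan F = op.span (insert 1 {x. \<exists>i k. Alt (\<lambda>i. ctr (F i)) i k x})"

lemma Alt_M: "Alt F i k x \<Longrightarrow> (\<And>i. F i \<subseteq> M) \<Longrightarrow> x \<in> M"
  by (induction rule: Alt.induct) (auto intro: M_closed(5))

lemma Alt_ctr_M: "Alt (\<lambda>i. ctr (F i)) i k x \<Longrightarrow> (\<And>i. F i \<subseteq> M) \<Longrightarrow> x \<in> M"
  by (rule Alt_M[of "\<lambda>i. ctr (F i)"]) (auto simp: ctr_def)

lemma kernel_subspace: "op.subspace {x \<in> M. tr x = 0}"
  by (auto simp: op.subspace_def M_closed tr_add tr_sc tr_zero)

lemma Alt_cl:
  assumes F: "\<And>i. F i \<subseteq> cl (op.span (G i))" and G: "\<And>i. G i \<subseteq> M"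
  shows "Alt F i k x \<Longrightarrow> x \<in> cl (op.span {y. Alt G i k y})"
proof (induction rule: Alt.induct)
  case (single x i)
  have "cl (op.span (G i)) \<subseteq> cl (op.span {y. Alt G i i y})"
    by (intro cl_mono op.span_mono) (auto intro: Alt.single)
  then show ?case using F single by blast
next
  case (cons x i j k y)
  have GM: "{y. Alt G i k y} \<subseteq> M" for i k using Alt_M[OF _ G] by auto
  have "x \<in> cl (op.span (G i))" using F cons by blast
  then show ?case
  proof (rule cl_mult[OF span_sub[OF G] span_sub[OF GM] span_sub[OF GM] _ cons.IH])
    fix a b assume ab: "a \<in> op.span (G i)" "b \<in> op.span {y. Alt G j k y}"
    have "a * b \<in> op.span {y. Alt G i k y}"
    proof (rule span_mult[OF op.subspace_span _ ab])
      fix a b assume "a \<in> G i" "b \<in> {y. Alt G j k y}"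
      then have "Alt G i k (a * b)" using \<open>i \<noteq> j\<close> by (auto intro: Alt.cons)
      then show "a * b \<in> op.span {y. Alt G i k y}" by (intro op.span_base) simp
    qed
    then show "a * b \<in> cl (op.span {y. Alt G i k y})" using cl_sup[OF span_sub[OF GM]] by blast
  qed
qed

text \<open>Freeness may thus be tested on letters whose spans are dense in the centred parts;
  \<open>cl_mult\<close> carries the approximation through the word.\<close>

lemma Alt_cl_tr:
  assumes "Alt F i k x" and F: "\<And>i. F i \<subseteq> cl (op.span (G i))" and G: "\<And>i. G i \<subseteq> M"
    and tr: "\<And>i k y. Alt G i k y \<Longrightarrow> tr y = 0"
  shows "tr x = 0"
proof -
  have "op.span {y. Alt G i k y} \<subseteq> {x \<in> M. tr x = 0}"
    using Alt_M[OF _ G] tr by (intro op.span_minimal kernel_subspace) auto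
  then show ?thesis
    using cl_tr0[OF _ Alt_cl[OF F G assms(1)]] by auto
qed

lemma split_ctr:
  assumes "op.subspace F" "1 \<in> F" "a \<in> F" "F \<subseteq> M"
  shows "a - sc (tr a) 1 \<in> ctr F"
proof -
  have "a \<in> M" using assms by auto
  then have "tr (a - sc (tr a) 1) = 0" by (simp add: tr_diff tr_sc tr_one M_closed)
  then show ?thesis using assms by (simp add: ctr_def op.subspace_diff op.subspace_scale)
qed

lemma wspan_M: "(\<And>i. F i \<subseteq> M) \<Longrightarrow> wspan F \<subseteq> M"
  unfolding wspan_def using Alt_ctr_M[of F] M_closed(1) by (intro span_sub) auto

lemma wspan_subspace: "op.subspace (wspan F)" by (simp add: wspan_def)

lemma wspan_one: "1 \<in> wspan F" by (simp add: wspan_def op.span_base)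

lemma Alt_wspan: "Alt (\<lambda>i. ctr (F i)) i k x \<Longrightarrow> x \<in> wspan F"
  unfolding wspan_def by (intro op.span_base) blast

lemma wspan_sup:
  assumes F: "\<And>i. op.subspace (F i)" "\<And>i. 1 \<in> F i" "\<And>i. F i \<subseteq> M"
  shows "F i \<subseteq> wspan F"
proof
  fix a assume a: "a \<in> F i"
  have "a - sc (tr a) 1 \<in> wspan F" using split_ctr[OF F(1,2) a F(3)] by (intro Alt_wspan[OF single])
  then have "(a - sc (tr a) 1) + sc (tr a) 1 \<in> wspan F"
    by (intro op.subspace_add op.subspace_scale wspan_subspace wspan_one)
  then show "a \<in> wspan F" by simp
qed

text \<open>Multiplying by one letter at a time from the left, a letter can only meet the first
  letter of a word. If the indices agree the two are multiplied, and the product splits into its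
  centred part and a scalar.\<close>

lemma wspan_mult:
  assumes F: "\<And>i. op.subspace (F i)" "\<And>i. 1 \<in> F i" "\<And>i. F i \<subseteq> M"
    "\<And>i x y. x \<in> F i \<Longrightarrow> y \<in> F i \<Longrightarrow> x * y \<in> F i"
    and x: "x \<in> wspan F" and y: "y \<in> wspan F"
  shows "x * y \<in> wspan F"
proof -
  note sub = wspan_subspace[of F]
  have off: "a * z \<in> wspan F" if a: "a \<in> F i" and z: "Alt (\<lambda>i. ctr (F i)) j k z" and ij: "i \<noteq> j" for a z i j k
  proof -
    have "(a - sc (tr a) 1) * z \<in> wspan F"
      using split_ctr[OF F(1,2) a F(3)] z ij by (intro Alt_wspan[OF Alt.cons])
    then have "(a - sc (tr a) 1) * z + sc (tr a) z \<in> wspan F"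
      using Alt_wspan[OF z] by (intro op.subspace_add op.subspace_scale sub)
    then show ?thesis by (simp add: left_diff_distrib)
  qed
  have letter: "a * z \<in> wspan F" if a: "a \<in> F i" and z: "z \<in> wspan F" for a z i
  proof (rule span_mult[OF sub _ op.span_base[of a "{a}"] z[unfolded wspan_def]])
    fix b w assume "b \<in> {a}" and w: "w \<in> insert 1 {x. \<exists>i k. Alt (\<lambda>i. ctr (F i)) i k x}"
    then have b: "b = a" by simp
    from w consider "w = 1" | j k where "Alt (\<lambda>i. ctr (F i)) j k w" by blast
    then show "b * w \<in> wspan F"
    proof cases
      case 1
      then show ?thesis using a b wspan_sup[of F, OF F(1-3)] by auto
    next
      case (2 j k)
      show ?thesis
      proof (cases "i = j")
        case True
        from 2 show ?thesis
        proof (cases rule: Alt_consE)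
          case 1
          then have "w \<in> F i" using True by (simp add: ctr_def)
          then show ?thesis using a b F(4) wspan_sup[of F, OF F(1-3)] by blast
        next
          case (2 l g v)
          then have "g \<in> F i" using True by (simp add: ctr_def)
          then have "(a * g) * v \<in> wspan F" using 2 a F(4) True by (intro off) auto
          then show ?thesis using 2 b by (simp add: mult.assoc)
        qed
      qed (use off a 2 b in blast)
    qed
  qed simp
  have word: "w * z \<in> wspan F" if "Alt (\<lambda>i. ctr (F i)) i k w" and z: "z \<in> wspan F" for w z i k
    using that(1)
  proof (induction rule: Alt.induct)
    case (single x i)
    then show ?case using z letter by (auto simp: ctr_def)
  next
    case (cons x i j k y)
    then show ?case using letter[of x i "y * z"] by (auto simp: ctr_def mult.assoc)
  qed
  show ?thesis
    by (rule span_mult[OF sub _ x[unfolded wspan_def] op.span_base[of y "{y}"]]) (use word y in auto)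
qed

lemma wspan_star:
  assumes F: "\<And>i. F i \<subseteq> M" "\<And>i x. x \<in> F i \<Longrightarrow> star x \<in> F i" and x: "x \<in> wspan F"
  shows "star x \<in> wspan F"
proof -
  have c: "star x \<in> ctr (F i)" if "x \<in> ctr (F i)" for x i
    using that F(2) tr_star[OF subsetD[OF F(1)], of x i] by (auto simp: ctr_def)
  show ?thesis
    using x unfolding wspan_def
  proof (induction rule: op.span_induct_alt)
    case base
    then show ?case by (simp add: op.span_zero)
  next
    case (step r x y)
    then have "star x \<in> insert 1 {x. \<exists>i k. Alt (\<lambda>i. ctr (F i)) i k x}"
      by (auto dest: Alt_star[OF _ c])
    then show ?case using step by (simp add: op.span_add op.span_scale op.span_base)
  qed
qed

lemma cl_wspan_vna:
  assumes F: "\<And>i. op.subspace (F i)" "\<And>i. 1 \<in> F i" "\<And>i. F i \<subseteq> M"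
    "\<And>i x y. x \<in> F i \<Longrightarrow> y \<in> F i \<Longrightarrow> x * y \<in> F i" "\<And>i x. x \<in> F i \<Longrightarrow> star x \<in> F i"
  shows "vna (cl (wspan F))"
  using wspan_mult[OF F(1-4)] wspan_star[OF F(3,5)]
  by (intro cl_vna wspan_M wspan_subspace wspan_one F)

lemma vhull_cl_wspan:
  assumes F: "\<And>i. op.subspace (F i)" "\<And>i. 1 \<in> F i" "\<And>i. F i \<subseteq> M"
    "\<And>i x y. x \<in> F i \<Longrightarrow> y \<in> F i \<Longrightarrow> x * y \<in> F i" "\<And>i x. x \<in> F i \<Longrightarrow> star x \<in> F i"
  shows "vhull (\<Union>i. F i) \<subseteq> cl (wspan F)"
  by (intro vhull_min[OF cl_wspan_vna[OF F]] UN_least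
      order_trans[OF wspan_sup[of F, OF F(1-3)] cl_sup[OF wspan_M[of F, OF F(3)]]])

text \<open>An approximant \<open>m\<close> is corrected by the scalar
  \<open>tr (g * m) / tr g\<close>, which is small because \<open>tr (g * n) = 0\<close>. This
  carries trace constraints over to approximants.\<close>

lemma cl_kernel:
  assumes X: "X \<subseteq> M" "op.subspace X" "1 \<in> X" and g: "g \<in> M" "tr g \<noteq> 0"
    and n: "n \<in> cl X" "tr (g * n) = 0"
  shows "n \<in> cl {m \<in> X. tr (g * m) = 0}"
  unfolding cl_def
proof (intro CollectI conjI allI impI)
  show nM: "n \<in> M" using n cl_in by blast
  fix \<epsilon> :: real assume \<epsilon>: "0 < \<epsilon>"
  define C where "C = 1 + n2 (star g) / cmod (tr g)"
  have C: "0 < C" using g L2.nrm_ge0[of "star g"] by (auto simp: C_def M_closed intro!: add_pos_nonneg)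
  then have "0 < \<epsilon> / C" using \<epsilon> by simp
  then obtain m where m: "m \<in> X" "n2 (n - m) < \<epsilon> / C" using n unfolding cl_def by blast
  have mM: "m \<in> M" "n - m \<in> M" using m X nM by (auto simp: M_closed)
  define c where "c = tr (g * m) / tr g"
  have "tr (g * m) = - tr (star (star g) * (n - m))"
    using n nM mM g by (simp add: right_diff_distrib tr_diff M_closed)
  then have "cmod (tr (g * m)) \<le> n2 (star g) * n2 (n - m)"
    using L2.CS[of "star g" "n - m"] g mM by (simp add: M_closed)
  then have c: "cmod c \<le> n2 (star g) / cmod (tr g) * n2 (n - m)"
    by (simp add: c_def norm_divide divide_right_mono)
  have "n2 ((n - m) + sc c 1) \<le> n2 (n - m) + n2 (sc c 1)"
    by (intro L2.nrm_add mM M_closed(1,6))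
  also have "\<dots> = n2 (n - m) + cmod c" by (simp add: L2.nrm_sc M_closed n2_one)
  also have "\<dots> \<le> C * n2 (n - m)" using c by (simp add: C_def algebra_simps)
  also have "\<dots> < \<epsilon>" using m C by (simp add: field_simps)
  finally have "n2 (n - (m - sc c 1)) < \<epsilon>" by (simp add: algebra_simps)
  moreover have "m - sc c 1 \<in> X" using m X by (intro op.subspace_diff op.subspace_scale)
  moreover have "tr (g * (m - sc c 1)) = 0"
    using g mM by (simp add: right_diff_distrib tr_diff tr_sc M_closed c_def)
  ultimately show "\<exists>a\<in>{m \<in> X. tr (g * m) = 0}. n2 (n - a) < \<epsilon>" by blast
qed

end

section \<open>Moving pieces of free algebras\<close>

text \<open>The words obtained from alternating words in moved pieces \<open>W j * b * W j\<close> when the unitaries are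
  absorbed into the factors from \<open>N\<close>; \<open>\<phi>\<close> constrains a factor between two letters of the same piece.\<close>
inductive spread :: "('j \<Rightarrow> 'a::semigroup_mult set) \<Rightarrow> ('j \<Rightarrow> 'a \<Rightarrow> bool) \<Rightarrow> 'a set \<Rightarrow> 'j \<Rightarrow> 'a \<Rightarrow> bool"
  for P \<phi> N where
  final: "b \<in> P j \<Longrightarrow> n \<in> N \<Longrightarrow> spread P \<phi> N j (b * n)"
| step: "b \<in> P j \<Longrightarrow> n \<in> N \<Longrightarrow> spread P \<phi> N k x \<Longrightarrow> (j = k \<Longrightarrow> \<phi> j n) \<Longrightarrow> spread P \<phi> N j (b * n * x)"

text \<open>Each algebra \<open>A i\<close> contains centred pieces \<open>P j\<close>, \<open>idx j = i\<close>, supported on projections \<open>f j\<close> of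
  \<open>E i\<close>. The self-adjoint unitaries \<open>W j\<close> of the algebra generated by the \<open>E i\<close> move \<open>f j\<close> into
  \<open>E (idx' j)\<close>. Freeness of the \<open>A i\<close> implies freeness after all pieces have been moved.\<close>
locale swap = tracial M tr for M :: "'h::complex_hilbert operator set" and tr +
  fixes A E :: "'i \<Rightarrow> 'h operator set" and P :: "'j \<Rightarrow> 'h operator set" and f W :: "'j \<Rightarrow> 'h operator"
    and idx idx' :: "'j \<Rightarrow> 'i"
  assumes A: "A i \<subseteq> M" and free_A: "free A" and E_A: "E i \<subseteq> A i"
    and E: "op.subspace (E i)" "1 \<in> E i" and E_mult: "x \<in> E i \<Longrightarrow> y \<in> E i \<Longrightarrow> x * y \<in> E i"
    and P: "P j \<subseteq> ctr (A (idx j))" and Pf: "b \<in> P j \<Longrightarrow> b * f j = b" "b \<in> P j \<Longrightarrow> f j * b = b"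
    and f: "f j \<in> E (idx j)" "star (f j) = f j" "f j * f j = f j"
    and f_orth: "j \<noteq> k \<Longrightarrow> idx j = idx k \<Longrightarrow> f j * f k = 0"
    and f_minimal: "g \<in> E (idx j) \<Longrightarrow> \<exists>c. g * f j = sc c (f j) \<and> f j * g = sc c (f j)"
    and W: "W j \<in> cl (wspan E)" "W j * W j = 1"
    and f': "W j * f j * W j \<in> E (idx' j)"
begin

abbreviation "N0 \<equiv> wspan E"
abbreviation "N \<equiv> cl N0"
abbreviation "altA \<equiv> Alt (\<lambda>i. ctr (A i))"
abbreviation "altE \<equiv> Alt (\<lambda>i. ctr (E i))"

lemma EM: "E i \<subseteq> M" by (rule order_trans[OF E_A A])

lemma altE_altA: "altE i k x \<Longrightarrow> altA i k x"
  using E_A by (elim Alt_mono) (auto simp: ctr_def)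

lemma altA_tr: "altA i k x \<Longrightarrow> tr x = 0"
  using free_A by (simp add: free_def)

lemma altA_M: "altA i k x \<Longrightarrow> x \<in> M" by (rule Alt_ctr_M[OF _ A])

lemma N0_M: "N0 \<subseteq> M" by (rule wspan_M[OF EM])

lemma N0_N: "N0 \<subseteq> N" by (rule cl_sup[OF N0_M])

lemma NM: "x \<in> N \<Longrightarrow> x \<in> M" by (rule cl_in)

lemma N_mult: "x \<in> N \<Longrightarrow> y \<in> N \<Longrightarrow> x * y \<in> N"
  by (rule cl_mult[OF N0_M N0_M N0_M]) (assumption, assumption,
    rule subsetD[OF N0_N], rule wspan_mult[OF E EM E_mult])

lemma altE_N: "altE i k x \<Longrightarrow> x \<in> N"
  by (rule subsetD[OF N0_N Alt_wspan])

lemma one_N: "1 \<in> N"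
  by (rule subsetD[OF N0_N wspan_one])

lemma fM: "f j \<in> M" using f EM by blast

lemma PM: "P j \<subseteq> M" using P A by (auto simp: ctr_def)

lemma tr_f_mid: "altE a c y \<Longrightarrow> a \<noteq> idx j \<Longrightarrow> tr (f j * y) = 0"
proof -
  assume y: "altE a c y" and a: "a \<noteq> idx j"
  have "altE (idx j) c ((f j - sc (tr (f j)) 1) * y)"
    using split_ctr[OF E f(1) EM] y a by (intro Alt.cons) auto
  then have "tr ((f j - sc (tr (f j)) 1) * y) = 0" "tr y = 0" "y \<in> M"
    using altA_tr[OF altE_altA] altA_tr[OF altE_altA[OF y]] altA_M[OF altE_altA[OF y]] by simp_all
  then show ?thesis
    by (simp add: left_diff_distrib tr_diff tr_sc M_closed fM)
qed

lemma P_zero: "tr (f j) = 0 \<Longrightarrow> f j = 0"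
  using faithful[OF fM, of j] f by simp

definition mid :: "'i \<Rightarrow> 'i \<Rightarrow> 'h operator \<Rightarrow> bool" where
  "mid i i' y \<longleftrightarrow> y = 1 \<or> (\<exists>a c. a \<noteq> i \<and> c \<noteq> i' \<and> altE a c y)"

text \<open>Letters with the outer indices are split off because next to a piece, which is supported
  on a minimal projection, they act as scalars.\<close>

lemma N0_decomp: "N0 \<subseteq> op.span {g * y * g' |g y g'. g \<in> E i \<and> g' \<in> E i' \<and> mid i i' y}" (is "_ \<subseteq> op.span ?S")
  unfolding wspan_def
proof (intro op.span_minimal op.subspace_span subsetI)
  have S: "g * y * g' \<in> op.span ?S" if "g \<in> E i" "g' \<in> E i'" "mid i i' y" for g y g'
    using that by (intro op.span_base) blast
  have S0: "g * y \<in> op.span ?S" if "g \<in> E i" "altE a c y" "a \<noteq> i" for g a c y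
  proof (cases "c = i'")
    case False
    then show ?thesis using S[of g 1 y] that E by (auto simp: mid_def)
  next
    case True
    from that(2) show ?thesis
    proof (cases rule: Alt_snocE)
      case 1
      then show ?thesis using S[of g y 1] that True by (auto simp: mid_def ctr_def)
    next
      case (2 d g' z)
      then show ?thesis using S[of g g' z] that True by (auto simp: mid_def ctr_def mult.assoc)
    qed
  qed
  fix x assume "x \<in> insert 1 {x. \<exists>i k. altE i k x}"
  then consider "x = 1" | a c where "altE a c x" by blast
  then show "x \<in> op.span ?S"
  proof cases
    case 1
    then show ?thesis using S[of 1 1 1] E by (simp add: mid_def)
  next
    case (2 a c)
    show ?thesis
    proof (cases "a = i")
      case False
      then show ?thesis using S0[of 1 a c x] 2 E by simp
    next
      case True
      from 2 show ?thesis
      proof (cases rule: Alt_consE)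
        case 1
        then show ?thesis using S[of x 1 1] E True by (simp add: mid_def ctr_def)
      next
        case (2 b g y)
        then show ?thesis using S0[of g b c y] True by (auto simp: ctr_def)
      qed
    qed
  qed
qed

text \<open>Only the first letter is prescribed, since spread words grow by multiplication from the
  left.\<close>

definition Z :: "'j \<Rightarrow> 'h operator set" where
  "Z j = P j \<union> {b * z |b z. b \<in> P j \<and> (\<exists>i k. i \<noteq> idx j \<and> altA i k z)}"

lemma Z_alt: "y \<in> Z j \<Longrightarrow> \<exists>k. altA (idx j) k y"
  using P unfolding Z_def by (auto intro: single Alt.cons)

lemma Z_f: "y \<in> Z j \<Longrightarrow> f j * y = y"
  unfolding Z_def by (auto simp: Pf simp flip: mult.assoc)

lemma Z_M: "Z j \<subseteq> M" using Z_alt altA_M by blast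

lemma P_Z: "b \<in> P j \<Longrightarrow> altA i k z \<Longrightarrow> i \<noteq> idx j \<Longrightarrow> b * z \<in> Z j"
  unfolding Z_def by blast

text \<open>By minimality the outer factors of \<open>m\<close> act as scalars, so \<open>m\<close>
  may be taken to be 1 or a word that alternates with both neighbours. In the second case the
  product is alternating and \<open>tr (f j * m) = 0\<close>. For \<open>m = 1\<close>, different
  indices alternate already, distinct pieces at one index are orthogonal, and for
  \<open>j = k\<close> the subtracted scalar cancels \<open>b * y\<close>.\<close>

lemma spread_step:
  assumes b: "b \<in> P j" and y: "y \<in> Z k" and m: "m \<in> N0"
  shows "b * (m - sc (if j = k then tr (f j * m) / tr (f j) else 0) 1) * y \<in> op.span (Z j)"
proof -
  let ?c = "\<lambda>m. if j = k then tr (f j * m) / tr (f j) else 0"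
  obtain l where l: "altA (idx k) l y" using Z_alt[OF y] by blast
  have gen: "b * y0 * y - sc (?c y0) (b * y) \<in> op.span (Z j)" if y0: "mid (idx j) (idx k) y0" for y0
    using y0 unfolding mid_def
  proof (elim disjE exE conjE)
    assume y0: "y0 = 1"
    show ?thesis
    proof (cases "idx j = idx k")
      case False
      then have "b * y \<in> Z j" using P_Z[OF b l] by simp
      then show ?thesis using y0 False by (auto intro: op.span_base)
    next
      case True
      show ?thesis
      proof (cases "j = k")
        case jk: False
        have "b * y = (b * f j) * (f k * y)" by (simp add: Pf(1)[OF b] Z_f[OF y])
        also have "\<dots> = b * (f j * f k) * y" by (simp add: mult.assoc)
        also have "\<dots> = 0" using f_orth[OF jk True] by simp
        finally show ?thesis using y0 by (simp add: op.span_zero)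
      next
        case jk: True
        \<comment> \<open>For \<open>tr (f j) = 0\<close> the quotient is 0 by convention, but then
          \<open>f j\<close> and with it \<open>b\<close> vanish.\<close>
        have "b = 0" if "tr (f j) = 0" using P_zero[OF that] Pf(1)[OF b] by simp
        then have "b * y0 * y - sc (?c y0) (b * y) = 0" using y0 jk by auto
        then show ?thesis by (simp only: op.span_zero)
      qed
    qed
  next
    fix a c assume a: "a \<noteq> idx j" "c \<noteq> idx k" "altE a c y0"
    have "altA a l (y0 * y)" using altE_altA[OF a(3)] l a(2) by (rule Alt_append)
    then have "b * (y0 * y) \<in> Z j" using P_Z b a(1) by blast
    then show ?thesis
      using tr_f_mid[OF a(3,1)] by (auto intro: op.span_base simp: mult.assoc)
  qed
  have "m \<in> op.span {g * y * g' |g y g'. g \<in> E (idx j) \<and> g' \<in> E (idx k) \<and> mid (idx j) (idx k) y}"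
    using m N0_decomp by blast
  then have "m \<in> M \<and> b * m * y - sc (?c m) (b * y) \<in> op.span (Z j)"
  proof (induction rule: op.span_induct_alt)
    case base
    then show ?case by (simp add: op.span_zero tr_zero M_closed)
  next
    case (step r x z)
    then obtain g y0 g' where x: "x = g * y0 * g'" and g: "g \<in> E (idx j)" "g' \<in> E (idx k)"
      and y0: "mid (idx j) (idx k) y0" by blast
    have y0M: "y0 \<in> M" using y0 altA_M[OF altE_altA] by (auto simp: mid_def M_closed)
    have gM: "g \<in> M" "g' \<in> M" using g EM by auto
    obtain c where c: "f j * g = sc c (f j)" using f_minimal[OF g(1)] by blast
    obtain c' where c': "g' * f k = sc c' (f k)" using f_minimal[OF g(2)] by blast
    have bg: "b * g = sc c b"
    proof -
      have "b * g = b * (f j * g)" by (simp add: Pf(1)[OF b] flip: mult.assoc)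
      then show ?thesis using c Pf(1)[OF b] by simp
    qed
    have gy: "g' * y = sc c' y"
    proof -
      have "g' * y = (g' * f k) * y" by (simp add: Z_f[OF y] mult.assoc)
      then show ?thesis using c' Z_f[OF y] by simp
    qed
    have "b * x * y = (b * g) * y0 * (g' * y)" by (simp add: x mult.assoc)
    also have "\<dots> = sc (c * c') (b * y0 * y)" unfolding bg gy by (simp add: mult.assoc mult.commute)
    finally have bxy: "b * x * y = sc (c * c') (b * y0 * y)" .
    have cx: "?c x = (c * c') * ?c y0"
    proof (cases "j = k")
      case True
      have "tr (f j * x) = tr ((f j * g * y0) * g')" by (simp add: x mult.assoc)
      also have "\<dots> = tr (g' * (f j * g * y0))" using gM y0M fM by (intro tr_comm M_closed)
      also have "g' * (f j * g * y0) = sc (c * c') (f j * y0)"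
        using c c' True by (simp add: mult.commute flip: mult.assoc)
      also have "tr \<dots> = (c * c') * tr (f j * y0)" using y0M fM by (intro tr_sc M_closed)
      finally show ?thesis using True by simp
    qed simp
    have xM: "x \<in> M" using x gM y0M by (simp add: M_closed)
    have zM: "z \<in> M" using step by simp
    have eq: "b * x * y - sc (?c x) (b * y) = sc (c * c') (b * y0 * y - sc (?c y0) (b * y))"
      unfolding bxy cx by (simp add: op.scale_right_diff_distrib mult.assoc)
    have "b * x * y - sc (?c x) (b * y) \<in> op.span (Z j)"
      unfolding eq by (rule op.span_scale[OF gen[OF y0]])
    then have "sc r (b * x * y - sc (?c x) (b * y)) + (b * z * y - sc (?c z) (b * y)) \<in> op.span (Z j)"
      using step by (intro op.span_add op.span_scale) auto
    moreover have "?c (sc r x + z) = r * ?c x + ?c z"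
      using xM zM fM by (simp add: distrib_left tr_add tr_sc M_closed add_divide_distrib)
    then have "b * (sc r x + z) * y - sc (?c (sc r x + z)) (b * y)
        = sc r (b * x * y - sc (?c x) (b * y)) + (b * z * y - sc (?c z) (b * y))"
      by (simp only: distrib_left distrib_right sc_mult_left sc_mult_right op.scale_right_diff_distrib
          op.scale_left_distrib sc_sc) simp
    ultimately show ?case using xM zM by (simp add: M_closed)
  qed
  then show ?thesis by (simp add: right_diff_distrib left_diff_distrib)
qed

abbreviation "spreadA \<equiv> spread P (\<lambda>j n. tr (f j * n) = 0) N"

text \<open>A factor from \<open>N\<close> between two letters of one piece is approximated by
  elements of \<open>N0\<close> under the same trace constraint, for which the scalar in
  \<open>spread_step\<close> is 0.\<close>

lemma spread_Z: "spreadA j x \<Longrightarrow> x \<in> cl (op.span (Z j))"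
proof (induction rule: spread.induct)
  case (final b j n)
  have ZM: "op.span (Z j) \<subseteq> M" using Z_M span_sub by blast
  have bM: "{b} \<subseteq> M" using final PM by blast
  then have "b \<in> cl {b}" using cl_sup[of "{b}"] by auto
  then show ?case
  proof (rule cl_mult[OF bM N0_M ZM _ \<open>n \<in> N\<close>])
    fix a m assume a: "a \<in> {b}" and m: "m \<in> N0"
    have "a * m \<in> op.span (Z j)"
    proof (rule span_mult[OF op.subspace_span _ op.span_base[OF a] m[unfolded wspan_def]])
      fix a x assume "a \<in> {b}" and "x \<in> insert 1 {x. \<exists>i k. altE i k x}"
      then consider "a = b" "x = 1" | i k where "a = b" "altE i k x" by blast
      then show "a * x \<in> op.span (Z j)"
      proof cases
        case 1
        then show ?thesis using final by (auto simp: Z_def intro: op.span_base)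
      next
        case (2 i k)
        have bg: "\<exists>c. b * g = sc c b" if g: "g \<in> E (idx j)" for g
        proof -
          obtain c where "f j * g = sc c (f j)" using f_minimal[OF g] by blast
          then have "b * g = sc c b"
            using Pf(1)[OF final(1)] by (metis mult.assoc sc_mult_right)
          then show ?thesis by blast
        qed
        show ?thesis
        proof (cases "i = idx j")
          case False
          then show ?thesis using P_Z[OF final(1) altE_altA[OF 2(2)]] 2 by (auto intro: op.span_base)
        next
          case True
          from 2(2) show ?thesis
          proof (cases rule: Alt_consE)
            case 1
            then obtain c where "b * x = sc c b" using bg True by (auto simp: ctr_def)
            then show ?thesis using 2 final by (auto simp: Z_def intro: op.span_base op.span_scale)
          next
            case (2 l g y)
            then obtain c where "b * g = sc c b" using bg True by (auto simp: ctr_def)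
            then have "b * x = sc c (b * y)" using 2 by (simp flip: mult.assoc)
            moreover have "b * y \<in> Z j" using P_Z[OF final(1) altE_altA] 2 True by metis
            ultimately show ?thesis using \<open>a = b\<close> by (simp add: op.span_base op.span_scale)
          qed
        qed
      qed
    qed
    then show "a * m \<in> cl (op.span (Z j))" using cl_sup[OF ZM] by blast
  qed
next
  case (step b j n k x)
  have ZM: "op.span (Z j) \<subseteq> M" for j using Z_M span_sub by blast
  let ?N1 = "{m \<in> N0. j = k \<longrightarrow> tr (f j * m) = 0}"
  \<comment> \<open>If \<open>f j = 0\<close> the constraint is void; otherwise
    \<open>tr (f j)\<close> is nonzero, as \<open>cl_kernel\<close> requires.\<close>
  have n: "n \<in> cl ?N1"
  proof (cases "j = k \<and> f j \<noteq> 0")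
    case True
    then have "n \<in> cl {m \<in> N0. tr (f j * m) = 0}"
      using step P_zero by (intro cl_kernel N0_M wspan_subspace wspan_one fM) auto
    then show ?thesis using True by simp
  next
    case False
    then have "?N1 = N0" by (auto simp: tr_zero)
    then show ?thesis using step by simp
  qed
  have bM: "{b} \<subseteq> M" using step PM by blast
  have N1M: "?N1 \<subseteq> M" using N0_M by blast
  let ?Y = "(\<lambda>m. b * m) ` ?N1"
  have YM: "?Y \<subseteq> M" using bM N1M M_closed(5) by auto
  have "b \<in> cl {b}" using cl_sup[OF bM] by auto
  then have bn: "b * n \<in> cl ?Y"
    using n by (rule cl_mult[OF bM N1M YM]) (use cl_sup[OF YM] in blast)
  show ?case
  proof (rule cl_mult[OF YM ZM ZM bn step.IH])
    fix a y assume "a \<in> ?Y" and y: "y \<in> op.span (Z k)"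
    then obtain m where m: "a = b * m" "m \<in> N0" "j = k \<Longrightarrow> tr (f j * m) = 0" by auto
    have "a * y \<in> op.span (Z j)"
    proof (rule span_mult[OF op.subspace_span _ op.span_base[of a "{a}"] y])
      fix a' y' assume "a' \<in> {a}" "y' \<in> Z k"
      then show "a' * y' \<in> op.span (Z j)"
        using spread_step[OF step(1) \<open>y' \<in> Z k\<close> m(2)] m by (simp split: if_splits)
    qed simp
    then show "a * y \<in> cl (op.span (Z j))" using cl_sup[OF ZM] by blast
  qed
qed

text \<open>The last letter of a word from \<open>N0\<close> either has an index different from that
  of the piece, so that the product alternates, or acts on the piece as a scalar and leaves a word
  of the first kind.\<close>

lemma spread_tr:
  assumes n: "n \<in> N" and x: "spreadA j x"
  shows "tr (n * x) = 0"
proof -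
  let ?K = "{x \<in> M. tr x = 0}"
  have ZM: "op.span (Z j) \<subseteq> M" using Z_M span_sub by blast
  have "n * x \<in> cl ?K"
  proof (rule cl_mult[OF N0_M ZM _ n spread_Z[OF x]])
    fix m y assume m: "m \<in> N0" and y: "y \<in> op.span (Z j)"
    have "m * y \<in> ?K"
    proof (rule span_mult[OF kernel_subspace _ m[unfolded wspan_def] y])
      fix m y assume m: "m \<in> insert 1 {x. \<exists>i k. altE i k x}" and y: "y \<in> Z j"
      obtain l where l: "altA (idx j) l y" using Z_alt[OF y] by blast
      have yM: "y \<in> M" and y0: "tr y = 0" using altA_M[OF l] altA_tr[OF l] .
      have gy: "\<exists>c. g * y = sc c y" if g: "g \<in> E (idx j)" for g
      proof -
        obtain c where c: "g * f j = sc c (f j)" using f_minimal[OF g] by blast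
        have "g * y = (g * f j) * y" by (simp add: Z_f[OF y] mult.assoc)
        then have "g * y = sc c y" using c Z_f[OF y] by simp
        then show ?thesis by blast
      qed
      from m consider "m = 1" | i k where "altE i k m" by blast
      then show "m * y \<in> ?K"
      proof cases
        case 1
        then show ?thesis using yM y0 by simp
      next
        case (2 i k)
        have off: "z * y \<in> ?K" if "altE i c z" "c \<noteq> idx j" for z c
          using altA_M[OF Alt_append[OF altE_altA[OF that(1)] l that(2)]]
            altA_tr[OF Alt_append[OF altE_altA[OF that(1)] l that(2)]] by simp
        show ?thesis
        proof (cases "k = idx j")
          case False
          then show ?thesis using off 2 by blast
        next
          case True
          from 2 show ?thesis
          proof (cases rule: Alt_snocE)
            case 1
            then obtain c where "m * y = sc c y" using gy True by (auto simp: ctr_def)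
            then show ?thesis using yM y0 by (simp add: tr_sc M_closed)
          next
            case (2 d g z)
            then obtain c where "g * y = sc c y" using gy True by (auto simp: ctr_def)
            then have "m * y = sc c (z * y)" using 2 by (simp add: mult.assoc)
            moreover have "z * y \<in> ?K" using off 2 True by blast
            ultimately show ?thesis by (simp add: tr_sc M_closed)
          qed
        qed
      qed
    qed
    then show "m * y \<in> cl ?K" using cl_sup[of ?K] by blast
  qed blast
  then show ?thesis by (rule cl_tr0[rotated]) auto
qed

section \<open>The moved pieces and their freeness\<close>

definition P' :: "'j \<Rightarrow> 'h operator set" where
  "P' j = (\<lambda>b. W j * b * W j) ` P j"

abbreviation "f' j \<equiv> W j * f j * W j"
abbreviation "spread' \<equiv> spread P' (\<lambda>j n. tr (f' j * n) = 0) N"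

lemma WM: "W j \<in> M" using W NM by blast

lemma WW: "W j * (W j * x) = x" using W(2) by (simp flip: mult.assoc)

text \<open>The unitaries of neighbouring letters are absorbed into the factor between them, which
  becomes \<open>W j * n * W k\<close>. For \<open>j = k\<close> traciality turns the constraint
  with \<open>f' j\<close> into the one with \<open>f j\<close>.\<close>

lemma spread'_spread: "spread' j x \<Longrightarrow> spreadA j (W j * x)"
proof (induction rule: spread.induct)
  case (final b j n)
  then obtain b0 where b: "b = W j * b0 * W j" "b0 \<in> P j" by (auto simp: P'_def)
  have "spreadA j (b0 * (W j * n))" using final b W N_mult by (intro spread.final) auto
  then show ?case using b by (simp add: mult.assoc WW)
next
  case (step b j n k x)
  then obtain b0 where b: "b = W j * b0 * W j" "b0 \<in> P j" by (auto simp: P'_def)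
  have "spreadA j (b0 * (W j * n * W k) * (W k * x))"
  proof (rule spread.step[OF b(2) _ step.IH])
    show "W j * n * W k \<in> N" using step W N_mult by blast
    assume jk: "j = k"
    have nM: "n \<in> M" using step NM by blast
    have "tr (f j * (W j * n * W k)) = tr ((f j * W j * n) * W j)" using jk by (simp add: mult.assoc)
    also have "\<dots> = tr (W j * (f j * W j * n))" using nM fM WM by (intro tr_comm M_closed)
    finally show "tr (f j * (W j * n * W k)) = 0" using step(4)[OF jk] by (simp add: mult.assoc)
  qed
  then show ?case using b by (simp add: mult.assoc WW)
qed

lemma spread'_tr:
  assumes "n \<in> N" "spread' j x"
  shows "tr (n * x) = 0"
proof -
  have "tr ((n * W j) * (W j * x)) = 0"
    using assms W N_mult by (intro spread_tr[OF _ spread'_spread]) auto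
  then show ?thesis by (simp add: mult.assoc WW)
qed

definition L' :: "'i \<Rightarrow> 'h operator set" where
  "L' i = ctr (E i) \<union> (\<Union>j\<in>{j. idx' j = i}. P' j)"

lemma L'_M: "L' i \<subseteq> M"
  using EM PM WM unfolding L'_def P'_def ctr_def by (auto intro!: M_closed(5))

text \<open>Runs of letters from the \<open>E i\<close> are collected into the factors of a spread
  word. Two letters of one piece are never adjacent, and the run between them starts with an index
  other than that of \<open>f' j\<close>; so \<open>f' j\<close> times the run has trace 0, as
  \<open>spread'\<close> demands.\<close>

lemma L'_cases:
  assumes "Alt L' i l x"
  shows "(\<exists>k. altE i k x) \<or> (\<exists>j r. spread' j r \<and> (x = r \<and> idx' j = i \<or> (\<exists>k y. altE i k y \<and> k \<noteq> idx' j \<and> x = y * r)))"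
  using assms
proof (induction rule: Alt.induct)
  case (single x i)
  then consider "x \<in> ctr (E i)" | j where "idx' j = i" "x \<in> P' j" by (auto simp: L'_def)
  then show ?case
  proof cases
    case 1
    then show ?thesis using Alt.single[of x "\<lambda>i. ctr (E i)"] by blast
  next
    case (2 j)
    then have "spread' j (x * 1)" using one_N by (intro spread.final)
    then show ?thesis using 2 by auto
  qed
next
  case (cons x i i2 k y)
  from cons(1) consider "x \<in> ctr (E i)" | j where "idx' j = i" "x \<in> P' j" by (auto simp: L'_def)
  then show ?case
  proof cases
    case 1
    from cons.IH show ?thesis
    proof (elim disjE exE conjE)
      fix k assume "altE i2 k y"
      then show ?thesis using Alt.cons[of x "\<lambda>i. ctr (E i)" i i2 k y] 1 cons by blast
    next
      fix j r assume "spread' j r" "y = r" "idx' j = i2"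
      then show ?thesis using Alt.single[of x "\<lambda>i. ctr (E i)" i] 1 cons by blast
    next
      fix j r k z assume r: "spread' j r" "altE i2 k z" "k \<noteq> idx' j" "y = z * r"
      then have "altE i k (x * z)" using 1 cons by (intro Alt.cons) auto
      moreover have "x * y = (x * z) * r" using r by (simp add: mult.assoc)
      ultimately show ?thesis using r by blast
    qed
  next
    case (2 j0)
    from cons.IH show ?thesis
    proof (elim disjE exE conjE)
      fix k assume "altE i2 k y"
      then have "y \<in> N" by (rule altE_N)
      then have "spread' j0 (x * y)" using 2 by (intro spread.final) auto
      then show ?thesis using 2 by blast
    next
      fix j r assume r: "spread' j r" "y = r" "idx' j = i2"
      have "spread' j0 (x * 1 * r)"
        using r 2 cons.hyps one_N by (intro spread.step) auto
      then show ?thesis using r 2 by auto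
    next
      fix j r k z assume r: "spread' j r" "altE i2 k z" "k \<noteq> idx' j" "y = z * r"
      have "spread' j0 (x * z * r)"
      proof (rule spread.step[OF 2(2) _ r(1)])
        show "z \<in> N" using r(2) by (rule altE_N)
        have f'E: "f' j0 \<in> E i" using f'[of j0] 2 by simp
        then have "altE i k ((f' j0 - sc (tr (f' j0)) 1) * z)"
          using split_ctr[OF E f'E EM] r cons by (intro Alt.cons) auto
        then have "tr ((f' j0 - sc (tr (f' j0)) 1) * z) = 0" "tr z = 0" "z \<in> M"
          using altA_tr[OF altE_altA] altA_tr[OF altE_altA[OF r(2)]] altA_M[OF altE_altA[OF r(2)]]
          by simp_all
        then show "tr (f' j0 * z) = 0"
          using fM WM by (simp add: left_diff_distrib tr_diff tr_sc M_closed)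
      qed
      then show ?thesis using r 2 by (auto simp: mult.assoc)
    qed
  qed
qed

theorem swapped_free:
  assumes "Alt L' i l x"
  shows "tr x = 0"
  using L'_cases[OF assms]
proof (elim disjE exE conjE)
  fix k assume "altE i k x"
  then show ?thesis using altE_altA altA_tr by blast
next
  fix j r assume "spread' j r" "x = r"
  then show ?thesis using spread'_tr[OF one_N] by auto
next
  fix j r k y assume "spread' j r" "altE i k y" "x = y * r"
  then show ?thesis using spread'_tr[OF altE_N] by blast
qed

end

section \<open>Diffuse algebras\<close>

definition proj :: "'h::complex_hilbert operator \<Rightarrow> bool" where
  "proj p \<longleftrightarrow> star p = p \<and> p * p = p"

lemma quad_sq:
  fixes x :: "'h::complex_hilbert operator"
  assumes "star x = x"
  shows "Re (cinner v (ap (x * x) v)) = (norm (ap x v))\<^sup>2"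
proof -
  have "cinner v (ap (x * x) v) = cinner (ap x v) (ap x v)"
    using cinner_star[of x v "ap x v"] by (simp add: assms)
  then show ?thesis by (simp add: cinner_self flip: of_real_power)
qed

lemma star_mult_zero:
  fixes x :: "'h::complex_hilbert operator"
  assumes "star x * x = 0"
  shows "x = 0"
proof (rule operator_eqI)
  fix v
  have "cinner (ap x v) (ap x v) = cinner v (ap (star x * x) v)" by (simp add: cinner_star')
  then show "ap x v = ap 0 v" by (simp add: assms hilbert.B_zero cinner_self)
qed

lemma proj_ge0: "proj p \<Longrightarrow> 0 \<le> p"
  using star_mult_ge0[of p] by (simp add: proj_def)

lemma proj_compl: "proj p \<Longrightarrow> proj (1 - p)"
  by (simp add: proj_def algebra_simps)

lemma proj_le1: "proj p \<Longrightarrow> p \<le> 1"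
  using proj_ge0[OF proj_compl] by fastforce

lemma proj_sub:
  assumes "proj p" "proj q" "p * q = q"
  shows "q * p = q" "proj (p - q)" "q \<le> p"
proof -
  have "star q * star p = star q" using arg_cong[OF assms(3), of star] by simp
  then show qp: "q * p = q" using assms by (simp add: proj_def)
  then show "proj (p - q)" using assms by (simp add: proj_def algebra_simps)
  then show "q \<le> p" using proj_ge0 by fastforce
qed

lemma proj_le_mult:
  assumes "proj p" "proj q" "q \<le> p"
  shows "p * q = q"
proof -
  have sp: "star (1 - p) = 1 - p" "(1 - p) * p = 0" using assms by (auto simp: proj_def algebra_simps)
  have "star (1 - p) * q * (1 - p) \<le> star (1 - p) * p * (1 - p)" by (rule conj_mono[OF assms(3)])
  moreover have "star (q * (1 - p)) * (q * (1 - p)) = star (1 - p) * (star q * q) * (1 - p)"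
    by (simp only: star_simps mult.assoc)
  moreover have "star q * q = q" using assms by (simp add: proj_def)
  moreover have "star (1 - p) * p * (1 - p) = 0" unfolding sp by simp
  ultimately have "star (q * (1 - p)) * (q * (1 - p)) \<le> 0" by simp
  then have "star (q * (1 - p)) * (q * (1 - p)) = 0" using star_mult_ge0 antisym by blast
  then have "q * (1 - p) = 0" by (rule star_mult_zero)
  then have "q * p = q" by (simp add: algebra_simps)
  have "star p * star q = star q" using arg_cong[where f = star, OF \<open>q * p = q\<close>] by simp
  then show ?thesis using assms by (simp add: proj_def)
qed

lemma proj_add:
  assumes "proj p" "proj q" "p * q = 0"
  shows "proj (p + q)"
proof -
  have "star q * star p = 0" using arg_cong[OF assms(3), of star] by simp
  then show ?thesis using assms by (simp add: proj_def algebra_simps)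
qed

lemma proj_sot:
  assumes s: "sot a s" and a: "\<And>n. proj (a n)" "\<And>n. a n \<le> a (Suc n)"
  shows "proj s"
proof -
  have ss: "star s = s" using s by (rule sot_sa) (use a in \<open>simp add: proj_def\<close>)
  have "a n * s = a n" for n
  proof -
    have "a n * a (m + n) = a n" for m
    proof -
      have "a n \<le> a (m + n)" by (rule lift_Suc_mono_le[of a, OF a(2)]) simp
      then have "a (m + n) * a n = a n" using a(1) by (intro proj_le_mult)
      then show ?thesis using proj_sub(1) a(1) by blast
    qed
    moreover have "sot (\<lambda>m. a (m + n)) s"
      using s unfolding sot_def by (auto intro: LIMSEQ_ignore_initial_segment)
    then have "sot (\<lambda>m. a n * a (m + n)) (a n * s)" by (rule sot_mult_left)
    ultimately show ?thesis using sot_const[of "a n"] sot_unique by simp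
  qed
  then have "s * s = s" using sot_mult_right[OF s, of s] s sot_unique by simp
  then show ?thesis using ss by (simp add: proj_def)
qed

definition diffuse_op :: "'h::complex_hilbert operator set \<Rightarrow> bool" where
  "diffuse_op A \<longleftrightarrow> (\<forall>p\<in>A. proj p \<and> p \<noteq> 0 \<longrightarrow> (\<exists>q\<in>A. proj q \<and> p * q = q \<and> q \<noteq> 0 \<and> q \<noteq> p))"

context tracial
begin

lemma proj_tr_pos: "p \<in> M \<Longrightarrow> proj p \<Longrightarrow> p \<noteq> 0 \<Longrightarrow> 0 < Re (tr p)"
  using tr_ge0_zero[of p] proj_ge0[of p] by force

text \<open>Of a proper nonzero subprojection and its complement, one has at most half the
  trace.\<close>

lemma small_projection:
  assumes A: "vna A" "A \<subseteq> M" "diffuse_op A" and p: "p \<in> A" "proj p" "p \<noteq> 0" and \<epsilon>: "0 < \<epsilon>"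
  shows "\<exists>q\<in>A. proj q \<and> p * q = q \<and> q \<noteq> 0 \<and> Re (tr q) < \<epsilon>"
proof -
  have "\<exists>q\<in>A. proj q \<and> p * q = q \<and> q \<noteq> 0 \<and> Re (tr q) \<le> Re (tr p) / 2 ^ n" for n
  proof (induction n)
    case 0
    show ?case using p by (intro bexI[of _ p]) (auto simp: proj_def)
  next
    case (Suc n)
    then obtain q where q: "q \<in> A" "proj q" "p * q = q" "q \<noteq> 0" "Re (tr q) \<le> Re (tr p) / 2 ^ n" by blast
    then obtain r where r: "r \<in> A" "proj r" "q * r = r" "r \<noteq> 0" "r \<noteq> q"
      using A(3) unfolding diffuse_op_def by blast
    have qr: "q - r \<in> A" "proj (q - r)" "q * (q - r) = q - r" "q - r \<noteq> 0"
      using q r proj_sub[of q r] vna_closed(4)[OF A(1)] by (auto simp: proj_def algebra_simps)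
    have "tr (q - r) = tr q - tr r" using q r A(2) by (intro tr_diff) auto
    then have half: "Re (tr r) \<le> Re (tr q) / 2 \<or> Re (tr (q - r)) \<le> Re (tr q) / 2" by auto
    have pr: "p * x = x" if "q * x = x" for x using that q(3) by (metis mult.assoc)
    have "Re (tr q) / 2 \<le> Re (tr p) / 2 ^ Suc n" using q(5) by simp
    with half show ?case using r qr pr by (meson order_trans)
  qed
  moreover obtain n where "Re (tr p) / 2 ^ n < \<epsilon>"
  proof -
    have pos: "0 < Re (tr p)" using proj_tr_pos p A by blast
    then obtain n where "(1/2) ^ n < \<epsilon> / Re (tr p)" using \<epsilon> real_arch_pow_inv[of "\<epsilon> / Re (tr p)" "1/2"] by auto
    then have "Re (tr p) / 2 ^ n < \<epsilon>" using pos by (simp add: field_simps)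
    then show thesis by (rule that)
  qed
  ultimately show ?thesis by (meson order_le_less_trans)
qed

text \<open>A maximal subprojection of \<open>r\<close> with trace at most \<open>s\<close> attains
  \<open>s\<close>: a deficit would leave room for a small projection below
  \<open>r - q\<close>.\<close>

lemma projection_of_trace:
  assumes A: "vna A" "A \<subseteq> M" "diffuse_op A" and r: "r \<in> A" "proj r" and s: "0 \<le> s" "s \<le> Re (tr r)"
  shows "\<exists>q\<in>A. proj q \<and> r * q = q \<and> Re (tr q) = s"
proof -
  define S where "S = {q \<in> A. proj q \<and> r * q = q \<and> Re (tr q) \<le> s}"
  have "\<exists>m\<in>S. 0 \<le> m \<and> (\<forall>b\<in>S. m \<le> b \<longrightarrow> b = m)"
  proof (rule maximal_element)
    show "a \<in> M \<and> star a = a \<and> a \<le> r" if "a \<in> S" for a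
      using that A(2) r proj_sub(3)[of r a] by (auto simp: S_def proj_def)
    show "r \<in> M" using r A by blast
    show "0 \<in> S" using s vna_closed(2)[OF A(1)] by (simp add: S_def proj_def tr_zero)
    fix a t assume a: "\<And>n. a n \<in> S" "\<And>n. a n \<le> a (Suc n)" and t: "sot a t"
    have a': "a n \<in> A" "a n \<in> M" "proj (a n)" "star (a n) = a n" "r * a n = a n" "Re (tr (a n)) \<le> s" for n
      using a(1)[of n] A(2) by (auto simp: S_def proj_def)
    have "proj t" using t a'(3) a(2) by (rule proj_sot)
    moreover have "t \<in> A" using A(1) t a'(1) by (rule vna_sot)
    moreover have "r * t = t" using sot_mult_left[OF t, of r] t sot_unique by (simp add: a'(5))
    moreover have "Re (tr t) \<le> s"
      using tr_lim(1)[OF a'(2,4) a(2) t] a'(6) by (intro LIMSEQ_le_const2) auto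
    ultimately show "t \<in> S" by (simp add: S_def)
  qed
  then obtain q where q: "q \<in> A" "proj q" "r * q = q" "Re (tr q) \<le> s"
    and max: "\<And>b. b \<in> S \<Longrightarrow> q \<le> b \<Longrightarrow> b = q" by (auto simp: S_def)
  have "\<not> Re (tr q) < s"
  proof
    assume less: "Re (tr q) < s"
    note rq = proj_sub[OF r(2) q(2,3)]
    have "r \<noteq> q" using less s by auto
    then obtain e where e: "e \<in> A" "proj e" "(r - q) * e = e" "e \<noteq> 0" "Re (tr e) < s - Re (tr q)"
      using small_projection[OF A, of "r - q" "s - Re (tr q)"] rq(2) less r q vna_closed(4)[OF A(1)] by auto
    have qe: "q * e = 0"
    proof -
      have "q * e = q * ((r - q) * e)" using e by simp
      also have "\<dots> = (q * r - q * q) * e" by (simp add: algebra_simps)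
      also have "\<dots> = 0" using rq q by (simp add: proj_def)
      finally show ?thesis .
    qed
    have "r * e = e" using e(3) qe by (simp add: left_diff_distrib)
    then have "q + e \<in> S"
      using q e qe A(2) vna_closed(3)[OF A(1)] proj_add[of q e]
      by (auto simp: S_def distrib_left tr_add subset_iff)
    then have "q + e = q" using proj_ge0[OF e(2)] by (intro max) auto
    then show False using e by simp
  qed
  then show ?thesis using q by force
qed

end

text \<open>The Newton--Schulz iteration \<open>s \<mapsto> s (3 - s\<^sup>2) / 2\<close> for the sign of a self-adjoint contraction.\<close>
lemma sign_exists:
  fixes y :: "'h::complex_hilbert operator"
  assumes y: "star y = y" "y * y \<le> 1"
  obtains w D where "star w = w" "proj D" "w * w = 1 - D" "y * D = 0"
    "\<And>L. vna L \<Longrightarrow> y \<in> L \<Longrightarrow> w \<in> L" "\<And>a b. y * a = b * y \<Longrightarrow> y * b = a * y \<Longrightarrow> w * a = b * w"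
    "\<And>t. t * (y * y) = y * y * t \<Longrightarrow> t * D = D * t"
proof -
  define s where "s = rec_nat y (\<lambda>_ x. x + sc (1/2) (x * (1 - x * x)))"
  have s0: "s 0 = y" and sSuc: "s (Suc n) = s n + sc (1/2) (s n * (1 - s n * s n))" for n
    by (simp_all add: s_def)
  \<comment> \<open>The distance of \<open>s n\<close> from a symmetry. It obeys the recursion
    \<open>d \<mapsto> 3/4 d\<^sup>2 + 1/4 d\<^sup>3\<close>: nonnegative coefficients keep the
    iterates in the cone of \<open>d 0\<close>, and their sum 1 makes the iterates decrease.\<close>
  define d where "d n = 1 - s n * s n" for n
  have sd: "s (Suc n) = s n + sc (1/2) (s n * d n)" for n by (simp add: sSuc d_def)
  have ss: "star (s n) = s n" for n
  proof (induction n)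
    case (Suc n)
    have "s n * (s n * s n) = (s n * s n) * s n" by (simp add: mult.assoc)
    then show ?case using Suc by (simp add: sSuc algebra_simps)
  qed (simp add: s0 y)
  have comm_s: "t * s n = s n * t" if "t * y = y * t" for t n
  proof (induction n)
    case (Suc n)
    then have "t * (s n * s n) = (s n * s n) * t" by (metis mult.assoc)
    then have "t * (s n * (1 - s n * s n)) = (s n * (1 - s n * s n)) * t"
      using Suc by (simp add: algebra_simps) (metis mult.assoc)
    then show ?case using Suc by (simp add: sSuc distrib_left distrib_right)
  qed (use that in \<open>simp add: s0\<close>)
  have dSuc: "d (Suc n) = sc (3/4) (d n * d n) + sc (1/4) (d n * d n * d n)" for n
  proof -
    let ?s = "s n" and ?d = "d n"
    have sd': "?s * ?d = ?d * ?s" by (simp add: d_def algebra_simps)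
    have s2: "?s * ?s = 1 - ?d" by (simp add: d_def)
    have s3: "?s * ?d * (?s * x) = (1 - ?d) * ?d * x" "?s * (?s * x) = (1 - ?d) * x" for x
      using sd' s2 by (metis mult.assoc)+
    have "d (Suc n) = 1 - (?s + sc (1/2) (?s * ?d)) * (?s + sc (1/2) (?s * ?d))" by (simp add: d_def[of "Suc n"] sd)
    also have "\<dots> = 1 - (?s * ?s + sc (1/2) (?s * ?s * ?d) + sc (1/2) (?s * ?d * ?s) + sc (1/4) (?s * ?d * ?s * ?d))"
      by (simp add: algebra_simps op.scale_right_distrib)
    also have "?s * ?d * ?s = ?s * ?s * ?d" by (metis sd' mult.assoc)
    also have "?s * ?s * ?d * ?d = ?s * ?s * (?d * ?d)" by (simp add: mult.assoc)
    finally have "d (Suc n) = 1 - ((1 - ?d) + sc (1/2) ((1 - ?d) * ?d) + sc (1/2) ((1 - ?d) * ?d) + sc (1/4) ((1 - ?d) * (?d * ?d)))"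
      by (simp add: s2)
    also have "sc (1/2) ((1 - ?d) * ?d) + sc (1/2) ((1 - ?d) * ?d) = (1 - ?d) * ?d"
      using op.scale_left_distrib[of "1/2" "1/2" "(1 - ?d) * ?d"] by simp
    then have "(1 - ?d) + sc (1/2) ((1 - ?d) * ?d) + sc (1/2) ((1 - ?d) * ?d) = 1 - ?d * ?d"
      by (simp add: algebra_simps)
    finally have "d (Suc n) = ?d * ?d - sc (1/4) (?d * ?d) + sc (1/4) (?d * ?d * ?d)"
      by (simp add: algebra_simps op.scale_right_diff_distrib)
    also have "?d * ?d - sc (1/4) (?d * ?d) = sc (3/4) (?d * ?d)"
      using op.scale_left_diff_distrib[of 1 "1/4" "?d * ?d"] by simp
    finally show ?thesis .
  qed
  let ?c = "pcone (d 0)"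
  have d00: "0 \<le> d 0" using y by (simp add: d_def s0)
  have dc: "d n \<in> ?c" for n
  proof (induction n)
    case (Suc n)
    then show ?case
      using pcone.scale[of "3/4" "d n * d n" "d 0"] pcone.scale[of "1/4" "d n * d n * d n" "d 0"]
      by (auto simp: dSuc intro!: pcone.add pcone_mult)
  qed (simp add: pcone_basic)
  have d_ge0: "0 \<le> d n" for n using pcone_ge0[OF dc d00] .
  have d_sa: "star (d n) = d n" for n using d_ge0 ge0_star by blast
  have d_le1: "d n \<le> 1" for n using star_mult_ge0[of "s n"] ss by (simp add: d_def)
  have d_dec: "d (Suc n) \<le> d n" for n
  proof -
    have "0 \<le> star (d n) * (1 - d n) * d n" using d_le1 by (intro conj_ge0) simp
    then have "d n * d n * d n \<le> d n * d n" by (simp add: d_sa algebra_simps)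
    then have "sc (complex_of_real (1/4)) (d n * d n * d n) \<le> sc (complex_of_real (1/4)) (d n * d n)"
      by (intro sc_mono) auto
    then have "d (Suc n) \<le> sc (3/4) (d n * d n) + sc (1/4) (d n * d n)" by (simp add: dSuc)
    also have "\<dots> = d n * d n" using op.scale_left_distrib[of "3/4" "1/4" "d n * d n"] by simp
    also have "\<dots> \<le> d n" using sq_le_self d_ge0 d_le1 by blast
    finally show ?thesis .
  qed
  obtain c where "sot (\<lambda>n. 1 - d n) c" and c: "\<And>n. 1 - d n \<le> c" "c \<le> 1"
  proof -
    have "1 - d n \<le> 1 - d (Suc n)" "1 - d n \<le> 1" "star (1 - d n) = 1 - d n" for n
      using d_dec d_ge0 d_sa by (auto intro: diff_left_mono)
    then show thesis using that sot_monotone[of "\<lambda>n. 1 - d n" 1] by (metis star_simps(3))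
  qed
  define D where "D = 1 - c"
  have "sot (\<lambda>n. 1 - (1 - d n)) (1 - c)" by (intro sot_diff sot_const \<open>sot (\<lambda>n. 1 - d n) c\<close>)
  then have dD: "sot d D" by (simp add: D_def)
  have D: "0 \<le> D" "\<And>n. D \<le> d n" using c by (auto simp: D_def algebra_simps)
  have D_le1: "D \<le> 1" using D(2) d_le1 order_trans by blast
  have D_sa: "star D = D" using D ge0_star by blast
  have bound: "norm (ap (d n) v) \<le> 1 * norm v" for n v using d_ge0 d_le1 by (rule norm_ap_le1)
  have "sot (\<lambda>n. d n * d n) (D * D)" using dD dD bound by (rule sot_mult)
  moreover have "sot (\<lambda>n. d n * (d n * d n)) (D * (D * D))" using dD calculation bound by (rule sot_mult)
  ultimately have "sot (\<lambda>n. d (Suc n)) (sc (3/4) (D * D) + sc (1/4) (D * D * D))"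
    unfolding dSuc by (intro sot_add sot_sc) (simp_all add: mult.assoc)
  then have D_eq: "D = sc (3/4) (D * D) + sc (1/4) (D * D * D)"
    by (rule sot_unique[OF sot_Suc[OF dD]])
  \<comment> \<open>As the coefficients sum to 1 and \<open>D\<close> is a positive contraction, the
    fixed point equation gives \<open>D \<le> D\<^sup>2\<close>.\<close>
  have "D * D = D"
  proof -
    have "0 \<le> star D * (1 - D) * D" using D_le1 by (intro conj_ge0) simp
    then have "D * D * D \<le> D * D" by (simp add: D_sa algebra_simps)
    then have "sc (complex_of_real (1/4)) (D * D * D) \<le> sc (complex_of_real (1/4)) (D * D)"
      by (intro sc_mono) auto
    then have "D \<le> sc (3/4) (D * D) + sc (1/4) (D * D)" by (subst D_eq) simp
    also have "\<dots> = D * D" using op.scale_left_distrib[of "3/4" "1/4" "D * D"] by simp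
    finally show ?thesis using sq_le_self[OF D(1) D_le1] by simp
  qed
  then have D_proj: "proj D" using D_sa by (simp add: proj_def)
  \<comment> \<open>A later iterate is \<open>s n * h\<close> with \<open>h \<ge> 1\<close>, so that
    \<open>s n * s m \<ge> s n * s n\<close>. This bounds squared increments of \<open>s\<close> by
    increments of \<open>d\<close>, whence strong convergence.\<close>
  have h: "\<exists>h. s (m + n) = s n * h \<and> h \<in> ?c \<and> h - 1 \<in> ?c" for m n
  proof (induction m)
    case 0
    then show ?case by (intro exI[of _ 1]) (simp add: pcone_basic)
  next
    case (Suc m)
    then obtain h where h: "s (m + n) = s n * h" "h \<in> ?c" "h - 1 \<in> ?c" by blast
    have half: "sc (1/2) x \<in> ?c" if "x \<in> ?c" for x using pcone.scale[OF _ that, of "1/2"] by simp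
    let ?h = "h + sc (1/2) (h * d (m + n))"
    have "s (Suc m + n) = s n * ?h" using h by (simp add: sd distrib_left mult.assoc)
    moreover have "?h \<in> ?c" using h dc by (intro pcone.add half pcone_mult)
    moreover have "(h - 1) + sc (1/2) (h * d (m + n)) \<in> ?c" using h dc by (intro pcone.add half pcone_mult)
    then have "?h - 1 \<in> ?c" by (simp add: algebra_simps)
    ultimately show ?case by blast
  qed
  have diff: "(s m - s n) * (s m - s n) \<le> d n - d m" if mn: "n \<le> m" for m n
  proof -
    obtain h where h: "s m = s n * h" "h - 1 \<in> ?c" using h[of "m - n" n] mn by auto
    have "y * d 0 = d 0 * y" by (simp add: d_def s0 algebra_simps)
    then have "d 0 * s n = s n * d 0" by (intro comm_s) simp
    then have "s n * (h - 1) = (h - 1) * s n" by (intro pcone_commute[OF h(2)]) simp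
    then have hc: "s n * h = h * s n" by (simp add: algebra_simps)
    have "0 \<le> star (s n) * (h - 1) * s n" using pcone_ge0[OF h(2) d00] by (rule conj_ge0)
    also have "\<dots> = s n * (h * s n) - s n * s n" by (simp add: ss algebra_simps)
    also have "h * s n = s m" by (simp only: h(1) hc)
    finally have 1: "0 \<le> s n * s m - s n * s n" .
    have 2: "s m * s n = s n * s m" by (metis h(1) hc mult.assoc)
    have "(d n - d m) - (s m - s n) * (s m - s n) = (s n * s m - s n * s n) + (s n * s m - s n * s n)"
      by (simp add: d_def 2 algebra_simps)
    then show ?thesis using 1 by (metis add_nonneg_nonneg diff_ge_0_iff_ge)
  qed
  have normd: "(norm (ap (s m) v - ap (s n) v))\<^sup>2 \<le> Re (cinner v (ap (d n) v)) - Re (cinner v (ap (d m) v))"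
    if "n \<le> m" for m n v
  proof -
    have "(norm (ap (s m - s n) v))\<^sup>2 = Re (cinner v (ap ((s m - s n) * (s m - s n)) v))"
      by (rule quad_sq[symmetric]) (simp add: ss)
    also have "\<dots> \<le> Re (cinner v (ap (d n - d m) v))"
      using diff[OF that] unfolding operator_le by blast
    finally show ?thesis by (simp add: cinner_simps)
  qed
  have snorm: "norm (ap (s n) v) \<le> 1 * norm v" for n v
  proof (rule power2_le_imp_le)
    have "s n * s n \<le> 1" using d_ge0[of n] by (simp add: d_def)
    then have "Re (cinner v (ap (s n * s n) v)) \<le> Re (cinner v (ap 1 v))" unfolding operator_le by blast
    then show "(norm (ap (s n) v))\<^sup>2 \<le> (1 * norm v)\<^sup>2"
      unfolding quad_sq[OF ss] by (simp add: cinner_self flip: of_real_power)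
  qed simp
  have "\<exists>w. sot s w"
  proof (rule sot_exists)
    fix v
    show "Cauchy (\<lambda>n. ap (s n) v)"
    proof (rule metric_CauchyI)
      fix e :: real assume "0 < e"
      let ?q = "\<lambda>n. Re (cinner v (ap (d n) v))"
      have "Cauchy ?q" using sot_quad[OF dD] LIMSEQ_imp_Cauchy by blast
      then obtain N where N: "\<And>m n. m \<ge> N \<Longrightarrow> n \<ge> N \<Longrightarrow> dist (?q m) (?q n) < e\<^sup>2"
        using metric_CauchyD[of ?q "e\<^sup>2"] \<open>0 < e\<close> by force
      have "norm (ap (s m) v - ap (s n) v) < e" if "N \<le> n" "n \<le> m" for m n
      proof (rule power2_less_imp_less)
        show "(norm (ap (s m) v - ap (s n) v))\<^sup>2 < e\<^sup>2"
          using normd[OF that(2), of v] N[of n m] that by (simp add: dist_real_def)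
      qed (use \<open>0 < e\<close> in simp)
      then show "\<exists>M. \<forall>m\<ge>M. \<forall>n\<ge>M. dist (ap (s m) v) (ap (s n) v) < e"
        by (metis dist_norm dist_commute nle_le)
    qed
  qed (rule snorm)
  then obtain w where w: "sot s w" by blast
  show thesis
  proof
    show "star w = w" using w ss by (rule sot_sa)
    show "proj D" by (rule D_proj)
    have "sot (\<lambda>n. s n * s n) (w * w)" using w w snorm by (rule sot_mult)
    moreover have "sot (\<lambda>n. s n * s n) (1 - D)"
      using sot_diff[OF sot_const dD, of 1] by (simp add: d_def)
    ultimately show "w * w = 1 - D" by (rule sot_unique)
    have "y * y \<le> 1 - D" using D(2)[of 0] by (simp add: d_def s0 algebra_simps)
    then have "star D * (y * y) * D \<le> star D * (1 - D) * D" by (rule conj_mono)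
    then have "star (y * D) * (y * D) \<le> 0"
      using D_proj by (simp add: y proj_def mult.assoc algebra_simps)
    then have "star (y * D) * (y * D) = 0" using star_mult_ge0 antisym by blast
    then show "y * D = 0" by (rule star_mult_zero)
    show "w \<in> L" if L: "vna L" "y \<in> L" for L
    proof (rule vna_sot[OF L(1) w])
      show "s n \<in> L" for n
        by (induction n) (use L in \<open>simp_all add: s0 sSuc vna_closed\<close>)
    qed
    \<comment> \<open>The iterates are odd polynomials in \<open>y\<close> and exchange
      \<open>a\<close> and \<open>b\<close> as \<open>y\<close> does; the induction needs both
      relations at once.\<close>
    show "w * a = b * w" if ab: "y * a = b * y" "y * b = a * y" for a b
    proof -
      have "s n * a = b * s n \<and> s n * b = a * s n" for n
      proof (induction n)
        case (Suc n)
        let ?s = "s n"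
        have i: "?s * a = b * ?s" "?s * b = a * ?s" using Suc by auto
        have sa: "?s * (?s * (?s * a)) = b * (?s * (?s * ?s))" "?s * (?s * (?s * b)) = a * (?s * (?s * ?s))"
          using i by (metis mult.assoc)+
        then show ?case using i
          by (simp add: sSuc algebra_simps op.scale_right_diff_distrib)
      qed (use ab in \<open>simp add: s0\<close>)
      then have "sot (\<lambda>n. s n * a) (b * w)" using sot_mult_left[OF w, of b] by simp
      then show ?thesis using sot_mult_right[OF w, of a] sot_unique by blast
    qed
    show "t * D = D * t" if t: "t * (y * y) = y * y * t" for t
    proof (rule sot_commute[OF dD])
      have "t * d 0 = d 0 * t" using t by (simp add: d_def s0 algebra_simps)
      then show "t * d n = d n * t" for n by (rule pcone_commute[OF dc])
    qed
  qed
qed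

section \<open>Exchanging free projections\<close>

lemma power_intertwine:
  fixes x :: "'a::{monoid_mult}"
  assumes "x * a = b * x"
  shows "x * a ^ n = b ^ n * x"
  by (induction n) (use assms in \<open>simp_all add: mult.assoc power_Suc2 del: power_Suc\<close>, metis mult.assoc)

lemma power_decreasing_operator:
  fixes d :: "'h::complex_hilbert operator"
  assumes d: "0 \<le> d" "d \<le> 1"
  shows "d ^ Suc n \<le> d ^ n"
proof -
  have s: "star (d ^ k) = d ^ k" for k using d by (simp add: star_power ge0_star)
  have gen: "0 \<le> star (d ^ k) * x * d ^ k" if "0 \<le> x" for x k using that by (rule conj_ge0)
  show ?thesis
  proof (cases "even n")
    case True
    then obtain k where n: "n = k + k" by (metis evenE mult_2)
    have "0 \<le> star (d ^ k) * (1 - d) * d ^ k" using d by (intro gen) simp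
    also have "\<dots> = d ^ n - d ^ Suc n"
      by (simp add: n s algebra_simps power_add power_commutes)
    finally show ?thesis by simp
  next
    case False
    then obtain k where n: "n = Suc (k + k)" by (metis oddE mult_2 Suc_eq_plus1)
    have "0 \<le> star (d ^ k) * (d - d * d) * d ^ k" using sq_le_self[OF d] by (intro gen) simp
    also have "\<dots> = d ^ k * d * d ^ k - d ^ k * (d * d) * d ^ k" by (simp add: s algebra_simps)
    also have "d ^ k * d * d ^ k = d ^ n"
      using power_add[of d "k + 1" k] power_add[of d k 1] by (simp add: n)
    also have "d ^ k * (d * d) * d ^ k = d ^ Suc n"
      using power_add[of d "k + 2" k] power_add[of d k 2] by (simp add: n power2_eq_square)
    finally show ?thesis by simp
  qed
qed

context tracial
begin

lemma power_M: "x \<in> M \<Longrightarrow> x ^ n \<in> M"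
  by (induction n) (auto simp: M_closed)

text \<open>Halving in \<open>A\<close> gives a projection \<open>f\<close> with trace below that of
  \<open>p\<close> and \<open>f * p \<noteq> 0\<close>. The range projection of
  \<open>p * f * p\<close> lies below \<open>p\<close>, and its trace is at most
  \<open>tr f\<close>, so it is a proper subprojection.\<close>

lemma diffuse_M:
  assumes A: "vna A" "A \<subseteq> M" "diffuse_op A"
  shows "diffuse_op M"
  unfolding diffuse_op_def
proof (intro ballI impI, elim conjE)
  fix p assume p: "p \<in> M" "proj p" "p \<noteq> 0"
  have pp: "star p = p" "p * p = p" using p by (auto simp: proj_def)
  have "\<exists>f\<in>A. proj f \<and> f * p \<noteq> 0 \<and> Re (tr f) \<le> (1/2) ^ n" for n
  proof (induction n)
    case 0
    show ?case using p vna_closed(1)[OF A(1)] by (intro bexI[of _ 1]) (auto simp: proj_def tr_one)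
  next
    case (Suc n)
    then obtain f where f: "f \<in> A" "proj f" "f * p \<noteq> 0" "Re (tr f) \<le> (1/2) ^ n" by blast
    have fM: "f \<in> M" using f A by blast
    have "0 \<le> Re (tr f)" using f(2) proj_ge0 fM tr_ge0 by blast
    then obtain q where q: "q \<in> A" "proj q" "f * q = q" "Re (tr q) = Re (tr f) / 2"
      using projection_of_trace[OF A f(1,2), of "Re (tr f) / 2"] by auto
    have "f * p = q * p + (f - q) * p" by (simp add: algebra_simps)
    then have "q * p \<noteq> 0 \<or> (f - q) * p \<noteq> 0" using f(3) by auto
    moreover have "Re (tr (f - q)) = Re (tr f) / 2"
      using q A fM by (subst tr_diff) auto
    moreover have "proj (f - q)" "f - q \<in> A"
      using proj_sub(2)[OF f(2) q(2,3)] vna_closed(4)[OF A(1) f(1) q(1)] by auto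
    moreover have "Re (tr f) / 2 \<le> (1/2) ^ Suc n" using f(4) by simp
    ultimately show ?case using q by metis
  qed
  moreover obtain n where "(1/2) ^ n < Re (tr p)"
    using proj_tr_pos[OF p] real_arch_pow_inv[of "Re (tr p)" "1/2"] by auto
  ultimately obtain f where f: "f \<in> A" "proj f" "f * p \<noteq> 0" "Re (tr f) < Re (tr p)"
    by (meson order_le_less_trans)
  have fM: "f \<in> M" using f A by blast
  have ff: "star f = f" "f * f = f" using f by (auto simp: proj_def)
  have ffz: "f * (f * z) = f * z" for z by (simp add: ff flip: mult.assoc)
  define x where "x = f * p"
  have xM: "x \<in> M" using fM p by (simp add: x_def M_closed)
  define d where "d = 1 - star x * x"
  define e where "e = 1 - x * star x"
  have dM: "d \<in> M" "e \<in> M" using xM by (auto simp: d_def e_def M_closed)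
  have xx: "star x * x = star p * f * p" "x * star x = star f * p * f"
    using pp ff by (simp_all add: x_def mult.assoc) (metis mult.assoc)+
  have d01: "0 \<le> d" "d \<le> 1"
  proof -
    have "star p * f * p \<le> star p * 1 * p" using proj_le1[OF f(2)] by (rule conj_mono)
    also have "\<dots> \<le> 1" using proj_le1[OF p(2)] by (simp add: pp)
    finally show "0 \<le> d" by (simp add: d_def xx)
    show "d \<le> 1" using star_mult_ge0[of x] by (simp add: d_def)
  qed
  have e0: "0 \<le> e"
  proof -
    have "star f * p * f \<le> star f * 1 * f" using proj_le1[OF p(2)] by (rule conj_mono)
    also have "\<dots> \<le> 1" using proj_le1[OF f(2)] by (simp add: ff)
    finally show "0 \<le> e" by (simp add: e_def xx)
  qed
  \<comment> \<open>\<open>h n\<close> increases to the range projection of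
    \<open>star x * x\<close>, because the powers of the positive contraction \<open>d\<close>
    decrease to the projection onto its fixed vectors.\<close>
  define h where "h n = 1 - d ^ n" for n
  have h: "h n \<in> M" "star (h n) = h n" "h n \<le> h (Suc n)" "h n \<le> 1" for n
    using dM d01 power_decreasing_operator[OF d01, of n] power_ge0[OF d01(1), of n] ge0_star
    by (auto simp: h_def M_closed power_M diff_left_mono simp del: power_Suc)
  obtain g where g: "sot h g" using sot_monotone[of h 1, OF h(3,4,2)] by blast
  define D where "D = 1 - g"
  have "sot (\<lambda>n. 1 - h n) (1 - g)" by (intro sot_diff sot_const g)
  then have dD: "sot (\<lambda>n. d ^ n) D" by (simp add: h_def D_def)
  have "d ^ n \<le> 1" for n using h(4)[of 0] power_decreasing_operator[OF d01] 
    by (induction n) (auto simp del: power_Suc intro: order_trans)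
  then have nb: "norm (ap (d ^ n) v) \<le> 1 * norm v" for n v
    using power_ge0[OF d01(1)] by (intro norm_ap_le1)
  have "sot (\<lambda>n. d ^ n * d ^ n) (D * D)" using dD dD nb by (rule sot_mult)
  moreover have "sot (\<lambda>n. d ^ n * d ^ n) D"
  proof -
    have "(\<lambda>n. ap (d ^ (n + n)) v) \<longlonglongrightarrow> ap D v" for v
      using LIMSEQ_subseq_LIMSEQ[of "\<lambda>n. ap (d ^ n) v" "ap D v" "\<lambda>n. n + n"] dD
      by (auto simp: sot_def strict_mono_def o_def)
    then show ?thesis by (simp add: sot_def power_add)
  qed
  ultimately have "D * D = D" by (rule sot_unique)
  moreover have "star D = D" using dD by (rule sot_sa) (use d01 in \<open>simp add: star_power ge0_star\<close>)
  ultimately have "proj D" by (simp add: proj_def)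
  then have gp: "proj g" using proj_compl[of D] by (simp add: D_def)
  have gM: "g \<in> M" using M g h(1) by (rule vna_sot)
  note lim = tr_lim[OF h(1-3) g]
  have "d * (1 - p) = 1 - p" using pp by (simp add: d_def xx algebra_simps)
  then have "d ^ n * (1 - p) = 1 - p" for n
    by (induction n) (simp_all add: mult.assoc power_Suc2 del: power_Suc)
  then have "sot (\<lambda>n. 1 - p) (D * (1 - p))" using sot_mult_right[OF dD, of "1 - p"] by simp
  then have "D * (1 - p) = 1 - p" by (rule sot_unique[OF _ sot_const])
  then have gp': "g * p = g" by (simp add: D_def algebra_simps)
  have "star p * star g = star g" using arg_cong[where f = star, OF gp'] by simp
  then have pg: "p * g = g" using gp pp by (simp add: proj_def)
  have "x \<noteq> 0" using f by (simp add: x_def)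
  then have "star x * x \<noteq> 0" using star_mult_zero by blast
  then have "g \<noteq> 0"
    using lim(2)[of 1] star_mult_ge0[of x] antisym by (fastforce simp: h_def d_def)
  moreover have "g \<noteq> p"
  proof -
    have xd: "x * d = e * x" by (simp add: d_def e_def algebra_simps)
    \<comment> \<open>The relation \<open>x * d = e * x\<close> and traciality equate the traces of
      powers; since \<open>1 - e ^ n \<le> f\<close>, this bounds the trace of \<open>g\<close> by
      that of \<open>f\<close>.\<close>
    have tr_eq: "tr (d ^ n) = tr (e ^ n)" for n
    proof (induction n)
      case (Suc n)
      have "tr (d ^ n * star x * x) = tr (x * (d ^ n * star x))"
        using xM dM by (intro tr_comm M_closed power_M)
      also have "x * (d ^ n * star x) = e ^ n * (x * star x)"
        using power_intertwine[OF xd, of n] by (simp flip: mult.assoc)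
      finally have *: "tr (d ^ n * (star x * x)) = tr (e ^ n * (x * star x))" by (simp add: mult.assoc)
      have "d ^ Suc n = d ^ n - d ^ n * (star x * x)" "e ^ Suc n = e ^ n - e ^ n * (x * star x)"
        unfolding power_Suc2 by (simp_all add: d_def e_def right_diff_distrib)
      then show ?case using Suc * xM dM by (simp add: tr_diff M_closed power_M del: power_Suc)
    qed simp
    have "Re (tr (h n)) \<le> Re (tr f)" for n
    proof -
      have "e * (1 - f) = 1 - f" "(1 - f) * e = 1 - f" by (simp_all add: e_def xx ff ffz algebra_simps)
      then have "e ^ n * (1 - f) = 1 - f" "(1 - f) * e ^ n = 1 - f"
        by (induction n) (simp_all add: mult.assoc power_Suc2 del: power_Suc, metis mult.assoc)
      then have ef: "e ^ n * f = f - 1 + e ^ n" "f * e ^ n = f - 1 + e ^ n" by (simp_all add: algebra_simps)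
      have "f * e ^ n * f = f - 1 + e ^ n"
        using ff by (simp add: ef distrib_right left_diff_distrib)
      moreover have "0 \<le> star f * e ^ n * f" using power_ge0[OF e0] by (rule conj_ge0)
      ultimately have "0 \<le> f - 1 + e ^ n" by (simp add: ff)
      also have "f - 1 + e ^ n = f - (1 - e ^ n)" by simp
      finally have "1 - e ^ n \<le> f" by (simp only: diff_ge_0_iff_ge)
      then have "Re (tr (1 - e ^ n)) \<le> Re (tr f)" using fM dM by (intro tr_mono M_closed power_M)
      then show ?thesis using dM by (simp add: h_def tr_diff tr_eq M_closed power_M)
    qed
    then have "Re (tr g) \<le> Re (tr f)" using lim(1) by (intro LIMSEQ_le_const2) auto
    then show ?thesis using f(4) by auto
  qed
  ultimately show "\<exists>q\<in>M. proj q \<and> p * q = q \<and> q \<noteq> 0 \<and> q \<noteq> p" using gM gp pg by blast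
qed

section \<open>Free projections of equal trace\<close>

lemma linear_zero:
  assumes \<phi>: "\<And>x y. x \<in> M \<Longrightarrow> y \<in> M \<Longrightarrow> \<phi> (x + y) = \<phi> x + \<phi> y"
    "\<And>c x. x \<in> M \<Longrightarrow> \<phi> (sc c x) = (c * \<phi> x :: complex)"
    and G: "G \<subseteq> M" "\<And>x. x \<in> G \<Longrightarrow> \<phi> x = 0" and x: "x \<in> op.span G"
  shows "\<phi> x = 0"
proof -
  have "x \<in> M \<and> \<phi> x = 0"
    using x
  proof (induction rule: op.span_induct_alt)
    case base
    then show ?case using \<phi>(2)[of 0 0] by (simp add: M_closed)
  next
    case (step c x y)
    then have "x \<in> M" using G by auto
    then show ?case using step G by (simp add: \<phi> M_closed)
  qed
  then show ?thesis ..
qed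

text \<open>Bessel's inequality for the orthogonal words \<open>(a b)\<^sup>n\<close>, whose inner products with \<open>f\<close> are
  \<open>(- t (1 - t))\<^sup>n tr f\<close>.\<close>
lemma free_projections_disjoint:
  assumes e: "e \<in> M" "proj e" and p: "p \<in> M" "proj p" and t: "tr e = complex_of_real t" "tr p = complex_of_real t"
    and free: "\<And>i k x. Alt (\<lambda>i. if i then {e - sc t 1} else {p - sc t 1}) i k x \<Longrightarrow> tr x = 0"
    and f: "f \<in> M" "proj f" "e * f = f" "p * f = 0"
  shows "f = 0"
proof (cases "t = 0 \<or> t = 1")
  case True
  then show ?thesis
  proof
    assume "t = 0"
    then have "e = 0" using tr_ge0_zero[OF e(1) proj_ge0[OF e(2)]] t by simp
    then show ?thesis using f by simp
  next
    assume "t = 1"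
    then have "tr (1 - p) = 0" using p t by (simp add: tr_diff tr_one M_closed)
    then have "1 - p = 0" using tr_ge0_zero[OF _ proj_ge0[OF proj_compl[OF p(2)]]] p by (simp add: M_closed)
    then show ?thesis using f by simp
  qed
next
  case False
  define a where "a = e - sc t 1"
  define b where "b = p - sc t 1"
  \<comment> \<open>\<open>r\<close> is the trace of \<open>a * a\<close> and of
    \<open>b * b\<close>; a centred projection satisfies
    \<open>a\<^sup>2 = r + (1 - 2 t) a\<close>.\<close>
  define r where "r = complex_of_real (t * (1 - t))"
  have r0: "r \<noteq> 0" using False by (simp add: r_def del: of_real_mult of_real_diff)
  have rr: "cnj r = r" by (simp add: r_def)
  have sa: "star a = a" "star b = b" using e p by (auto simp: a_def b_def proj_def)
  have sq: "a * a = sc r 1 + sc (1 - 2 * t) a" "b * b = sc r 1 + sc (1 - 2 * t) b"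
  proof -
    have "(q - sc t 1) * (q - sc t 1) = sc r 1 + sc (1 - 2 * t) (q - sc t 1)" if "proj q" for q :: "'h operator"
    proof -
      have "(q - sc t 1) * (q - sc t 1) = (q - (sc t q + sc t q)) + sc (t * t) 1"
        using that by (simp add: proj_def algebra_simps)
      also have "sc t q + sc t q = sc (2 * t) q" by (simp only: mult_2 of_real_add op.scale_left_distrib)
      also have "q - sc (2 * t) q = sc (1 - 2 * t) q" by (simp add: op.scale_left_diff_distrib)
      also have "complex_of_real (t * t) = r - complex_of_real ((1 - 2 * t) * t)" by (simp add: r_def algebra_simps)
      also have "sc (1 - 2 * t) q + sc (r - (1 - 2 * t) * t) 1 = sc r 1 + sc (1 - 2 * t) (q - sc t 1)"
        by (simp only: op.scale_left_diff_distrib[of r] op.scale_right_diff_distrib sc_sc of_real_mult) simp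
      finally show ?thesis .
    qed
    then show "a * a = sc r 1 + sc (1 - 2 * t) a" "b * b = sc r 1 + sc (1 - 2 * t) b"
      using e p by (auto simp: a_def b_def)
  qed
  have M_ab: "a \<in> M" "b \<in> M" using e p by (auto simp: a_def b_def M_closed)
  let ?F = "\<lambda>i. if i then {a} else {b}"
  have tr0: "Alt ?F i k x \<Longrightarrow> tr x = 0" for i k x unfolding a_def b_def by (rule free)
  have alt: "Alt ?F True False ((a * b) ^ Suc n)" for n
  proof (induction n)
    case 0
    have "Alt ?F True False (a * b)" by (rule Alt.cons[OF _ Alt.single]) auto
    then show ?case by simp
  next
    case (Suc n)
    have "Alt ?F False False (b * (a * b) ^ Suc n)" by (rule Alt.cons[OF _ Suc]) auto
    then have "Alt ?F True False (a * (b * (a * b) ^ Suc n))" by (rule Alt.cons[rotated]) auto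
    then show ?case by (simp add: mult.assoc)
  qed
  have altb: "\<exists>k. Alt ?F False k (b * (a * b) ^ n)" for n
  proof (cases n)
    case 0
    have "Alt ?F False False b" by (rule Alt.single) simp
    then show ?thesis using 0 by auto
  next
    case (Suc m)
    have "Alt ?F False False (b * (a * b) ^ Suc m)" by (rule Alt.cons[OF _ alt]) auto
    then show ?thesis using Suc by blast
  qed
  define x where "x n = (a * b) ^ n" for n
  define y where "y n = (b * a) ^ n" for n
  have xM: "x n \<in> M" "y n \<in> M" for n using M_ab by (auto simp: x_def y_def intro!: power_M M_closed)
  have sx: "star (x n) = y n" for n by (simp add: x_def y_def star_power sa)
  let ?B = "op.span (range (\<lambda>n. b * x n))"
  \<comment> \<open>Cancelling inner letters in \<open>(b a)\<^sup>n (a b)\<^sup>n\<close> leaves a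
    scalar and words \<open>b (a b)\<^sup>k\<close>. The latter stay alternating when multiplied by
    \<open>x m\<close> on the right, which makes the \<open>x n\<close> orthogonal.\<close>
  have B: "y n * x n - sc (r ^ (2 * n)) 1 \<in> ?B" for n
  proof (induction n)
    case 0
    then show ?case by (simp add: x_def y_def op.span_zero)
  next
    case (Suc n)
    define z where "z = y n * x n - sc (r ^ (2 * n)) 1"
    have "b * a * z * (a * b) \<in> ?B"
      using Suc unfolding z_def[symmetric]
    proof (induction rule: op.span_induct_alt)
      case base
      then show ?case by (simp add: op.span_zero)
    next
      case (step c v w)
      then obtain m where v: "v = b * x m" by auto
      have "b * a * v * (a * b) = b * ((a * b) * (a * b) ^ m * (a * b))" by (simp add: v x_def mult.assoc)
      also have "(a * b) * (a * b) ^ m * (a * b) = x (Suc (Suc m))" 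
        unfolding x_def power_Suc[of "a * b" "Suc m"] power_Suc2[of "a * b" m] by (simp only: mult.assoc)
      finally have "b * a * v * (a * b) \<in> ?B" by (auto intro: op.span_base)
      then show ?case using step by (simp add: distrib_left distrib_right op.span_add op.span_scale)
    qed
    moreover have "b * a * (a * b) - sc (r * r) 1 \<in> ?B"
    proof -
      have "b * a * (a * b) = b * (a * a) * b" by (simp add: mult.assoc)
      also have "\<dots> = sc r (b * b) + sc (1 - 2 * t) (b * (a * b))" by (simp add: sq distrib_left distrib_right mult.assoc)
      also have "\<dots> = sc (r * r) 1 + (sc (r * (1 - 2 * t)) (b * x 0) + sc (1 - 2 * t) (b * x 1))"
        by (simp add: sq(2) x_def op.scale_right_distrib)
      finally have "b * a * (a * b) - sc (r * r) 1
          = sc (r * (1 - 2 * t)) (b * x 0) + sc (1 - 2 * t) (b * x 1)" by simp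
      also have "\<dots> \<in> ?B" by (intro op.span_add op.span_scale op.span_base rangeI)
      finally show ?thesis .
    qed
    moreover have "y (Suc n) * x (Suc n) - sc (r ^ (2 * Suc n)) 1
        = b * a * z * (a * b) + sc (r ^ (2 * n)) (b * a * (a * b) - sc (r * r) 1)"
    proof -
      have "y (Suc n) * x (Suc n) = b * a * (y n * x n) * (a * b)"
        by (simp add: x_def y_def mult.assoc power_commutes)
      then show ?thesis
        by (simp add: z_def algebra_simps op.scale_right_diff_distrib power2_eq_square)
    qed
    ultimately show ?case by (simp add: op.span_add op.span_scale)
  qed
  have xx: "tr (y n * x n) = r ^ (2 * n)" and xz: "tr (y n * x (n + Suc k)) = 0" for n k
  proof -
    have BM: "range (\<lambda>n. b * x n) \<subseteq> M" using xM M_ab by (auto simp: M_closed)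
    have zB: "tr (w * x k) = 0" if "w \<in> ?B" for w k
    proof (rule linear_zero[OF _ _ BM _ that])
      fix w assume "w \<in> range (\<lambda>n. b * x n)"
      then obtain m where "w = b * x m" by auto
      then have "w * x k = b * (a * b) ^ (m + k)" by (simp add: x_def power_add mult.assoc)
      then show "tr (w * x k) = 0" using altb tr0 by metis
    qed (simp_all add: distrib_right tr_add tr_sc M_closed xM)
    let ?z = "y n * x n - sc (r ^ (2 * n)) 1"
    have "tr (?z * x 0) = 0" using B zB by blast
    then show "tr (y n * x n) = r ^ (2 * n)"
      using xM by (simp add: x_def[of 0] tr_diff tr_sc tr_one M_closed)
    have "tr (?z * x (Suc k)) = 0" using B zB by blast
    moreover have "tr (x (Suc k)) = 0" unfolding x_def by (rule tr0[OF alt])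
    moreover have "?z * x (Suc k) = y n * x (n + Suc k) - sc (r ^ (2 * n)) (x (Suc k))"
      unfolding x_def power_add[of "a * b" n "Suc k"]
      by (simp add: mult.assoc left_diff_distrib del: power_Suc)
    ultimately show "tr (y n * x (n + Suc k)) = 0"
      using xM by (simp add: tr_diff tr_sc M_closed)
  qed
  \<comment> \<open>With these weights the \<open>c n\<close>-multiples of the \<open>x n\<close>
    are orthonormal, and each has inner product \<open>tr f\<close> with \<open>f\<close>.\<close>
  define c where "c n = (- 1 / r) ^ n" for n :: nat
  have c: "cnj (c n) = c n" for n by (simp add: c_def rr)
  define h where "h N = (\<Sum>n<N. sc (c n) (x n))" for N
  have hM: "h N \<in> M" for N unfolding h_def using xM by (intro op.subspace_sum L2.V) (simp add: M_closed)
  have hx: "tr (star (h N) * x m) = 0" if "N \<le> m" for N m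
    using that
  proof (induction N)
    case (Suc N)
    have "h (Suc N) = h N + sc (c N) (x N)" by (simp add: h_def)
    moreover have "tr (y N * x m) = 0" using xz[of N "m - Suc N"] Suc by simp
    ultimately show ?case using Suc xM hM by (simp add: distrib_right sx tr_add tr_sc M_closed)
  qed (simp add: h_def tr_zero)
  have hh: "Re (tr (star (h N) * h N)) = N" for N
  proof (induction N)
    case (Suc N)
    let ?x = "sc (c N) (x N)"
    have S: "h (Suc N) = h N + ?x" by (simp add: h_def)
    have "tr (star (h N) * ?x) = 0" using hx[of N N] hM xM by (simp add: tr_sc M_closed)
    moreover have "tr (star ?x * ?x) = 1"
    proof -
      have "tr (star ?x * ?x) = c N * c N * r ^ (2 * N)"
        using xM by (simp add: sx c tr_sc M_closed xx)
      also have "\<dots> = 1" using r0 by (simp add: c_def power_divide power_mult power2_eq_square flip: power_mult_distrib power_add)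
      finally show ?thesis .
    qed
    ultimately have "(n2 (h N + ?x))\<^sup>2 = N + 1"
      using Suc xM hM by (subst L2.nrm_add_sq) (simp_all only: n2_sq M_closed, simp)
    then show ?case using S n2_sq[OF hM, of "Suc N"] by simp
  qed (simp add: h_def tr_zero)
  have af: "a * f = sc (1 - t) f" "b * f = sc (- t) f"
    using f by (auto simp: a_def b_def left_diff_distrib op.scale_left_diff_distrib)
  have yf: "y n * f = sc ((- r) ^ n) f" for n
  proof (induction n)
    case (Suc n)
    have "y (Suc n) * f = b * a * (y n * f)" by (simp add: y_def mult.assoc)
    also have "\<dots> = sc ((- r) ^ n) (b * (a * f))" by (simp add: Suc mult.assoc)
    also have "\<dots> = sc ((- r) ^ Suc n) f" by (simp add: af r_def algebra_simps)
    finally show ?case .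
  qed (simp add: y_def)
  have hf: "star (h N) * f = sc (of_nat N) f" for N
  proof (induction N)
    case (Suc N)
    have "star (h (Suc N)) * f = star (h N) * f + sc (c N) (y N * f)"
      by (simp add: h_def distrib_right sx c)
    also have "sc (c N) (y N * f) = f" using r0 by (simp add: yf c_def flip: power_mult_distrib)
    finally show ?case using Suc by (simp add: op.scale_left_distrib algebra_simps)
  qed (simp add: h_def)
  \<comment> \<open>Cauchy-Schwarz for \<open>h N\<close> and \<open>f\<close> gives
    \<open>(N tr f)\<^sup>2 \<le> N tr f\<close>, hence \<open>N tr f \<le> 1\<close> for every
    \<open>N\<close> if the trace is positive.\<close>
  have "Re (tr f) \<le> 0"
  proof (rule ccontr)
    assume "\<not> ?thesis"
    then have pos: "0 < Re (tr f)" by simp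
    then obtain N :: nat where N: "1 / Re (tr f) < N" using reals_Archimedean2 by blast
    then have "0 < real N" using pos by (smt (verit) divide_pos_pos)
    have "cmod (tr (star (h N) * f)) \<le> n2 (h N) * n2 f" using hM f by (intro L2.CS)
    moreover have "tr (star (h N) * f) = of_real (N * Re (tr f))"
      using f tr_sa[OF f(1)] by (simp add: hf tr_sc proj_def)
    ultimately have "N * Re (tr f) \<le> n2 (h N) * n2 f" using pos by (simp only: norm_of_real)
    then have "(N * Re (tr f))\<^sup>2 \<le> (n2 (h N) * n2 f)\<^sup>2" using pos by (intro power_mono) auto
    also have "\<dots> = N * Re (tr f)"
      using f by (simp only: power_mult_distrib n2_sq hM hh) (simp add: proj_def)
    finally have "(N * Re (tr f)) * (N * Re (tr f)) \<le> 1 * (N * Re (tr f))" by (simp add: power2_eq_square)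
    then have "N * Re (tr f) \<le> 1" using pos \<open>0 < real N\<close> by (subst (asm) mult_le_cancel_right) auto
    then show False using N pos by (simp add: field_simps)
  qed
  then show ?thesis using tr_ge0_zero[OF f(1) proj_ge0[OF f(2)]] by blast
qed

text \<open>\<open>y = e + p - 1\<close> intertwines \<open>e\<close> and \<open>p\<close>, and so
  does its sign \<open>w\<close>, which is unitary up to the projection \<open>D\<close> onto the
  kernel of \<open>y\<close>. The part \<open>e * D\<close> lies under \<open>e\<close> and is
  orthogonal to \<open>p\<close>, so it vanishes; then \<open>D\<close> lies under \<open>p\<close>
  and is orthogonal to \<open>e\<close>, and vanishes too.\<close>

theorem exchange_unitary:
  assumes e: "e \<in> M" "proj e" and p: "p \<in> M" "proj p" and t: "tr e = complex_of_real t" "tr p = complex_of_real t"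
    and free: "\<And>i k x. Alt (\<lambda>i. if i then {e - sc t 1} else {p - sc t 1}) i k x \<Longrightarrow> tr x = 0"
  obtains w where "star w = w" "w * w = 1" "w * e * w = p" "w * p * w = e"
    "\<And>L. vna L \<Longrightarrow> e \<in> L \<Longrightarrow> p \<in> L \<Longrightarrow> w \<in> L"
proof -
  define y where "y = e + p - 1"
  have ep: "star e = e" "e * e = e" "star p = p" "p * p = p" using e p by (auto simp: proj_def)
  have ys: "star y = y" by (simp add: y_def ep)
  have yy: "y * y = 1 - (e - p) * (e - p)" by (simp add: y_def algebra_simps ep)
  have "y * y \<le> 1" using star_mult_ge0[of "e - p"] by (simp add: yy ep)
  have ye: "y * e = p * y" "y * p = e * y" by (auto simp: y_def algebra_simps ep)
  obtain w D where w: "star w = w" "proj D" "w * w = 1 - D" "y * D = 0"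
    and wL: "\<And>L. vna L \<Longrightarrow> y \<in> L \<Longrightarrow> w \<in> L"
    and wi: "\<And>a b. y * a = b * y \<Longrightarrow> y * b = a * y \<Longrightarrow> w * a = b * w"
    and Dc: "\<And>t. t * (y * y) = y * y * t \<Longrightarrow> t * D = D * t"
    using sign_exists[OF ys \<open>y * y \<le> 1\<close>] by blast
  have yM: "y \<in> M" using e p by (simp add: y_def M_closed)
  have wM: "w \<in> M" using wL M yM by blast
  have DM: "D \<in> M"
  proof -
    have "D = 1 - w * w" using w by simp
    then show ?thesis using wM by (simp add: M_closed)
  qed
  have DD: "star D = D" "D * D = D" using w by (auto simp: proj_def)
  have eD: "e * D = D * e" by (rule Dc) (metis ye mult.assoc)
  have f1: "e * D = 0"
  proof (rule free_projections_disjoint[OF e p t free])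
    show "e * D \<in> M" using e DM by (simp add: M_closed)
    show "proj (e * D)" using ep DD eD by (simp add: proj_def) (metis mult.assoc)
    show "e * (e * D) = e * D" using ep by (simp flip: mult.assoc)
    have "p * (e * D) = (p * e) * D" by (simp add: mult.assoc)
    also have "p * e = y * e" by (simp add: y_def algebra_simps ep)
    also have "y * e * D = (y * D) * e" by (simp add: eD mult.assoc)
    finally show "p * (e * D) = 0" using w by simp
  qed
  have f2: "D = 0"
  proof (rule free_projections_disjoint[OF p e t(2,1)])
    show "tr x = 0" if "Alt (\<lambda>i. if i then {p - sc t 1} else {e - sc t 1}) i k x" for i k x
    proof -
      have "Alt (\<lambda>i. if i then {e - sc t 1} else {p - sc t 1}) (\<not> i) (\<not> k) x"
        using that by (induction rule: Alt.induct) (auto intro: Alt.intros split: if_splits)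
      then show ?thesis by (rule free)
    qed
    have "y * D = e * D + p * D - D" by (simp add: y_def algebra_simps)
    then show "p * D = D" using f1 w by simp
  qed (use DM w f1 in auto)
  have ww: "w * w = 1" using w f2 by simp
  have we: "w * e = p * w" "w * p = e * w" using wi ye by blast+
  show thesis
  proof (rule that[of w])
    show "w * e * w = p" "w * p * w = e" using we ww by (simp_all add: mult.assoc)
    show "w \<in> L" if "vna L" "e \<in> L" "p \<in> L" for L
      using that by (intro wL) (auto simp: y_def vna_closed)
  qed (use w ww in auto)
qed

end

section \<open>Triviality of the center\<close>

context tracial
begin

lemma n2_unitary_conj:
  assumes u: "u \<in> M" "star u = u" "u * u = 1" and x: "x \<in> M"
  shows "n2 (u * x * u) = n2 x"
proof -
  have uu: "u * (u * z) = z" for z using u(3) by (simp flip: mult.assoc)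
  have "tr (star (u * x * u) * (u * x * u)) = tr (u * (star x * x * u))"
    by (simp add: u mult.assoc uu)
  also have "\<dots> = tr ((star x * x * u) * u)" using u x by (intro tr_comm M_closed)
  also have "\<dots> = tr (star x * x)" by (simp add: mult.assoc u)
  finally show ?thesis by (simp add: L2.nrm_def)
qed

text \<open>On the left \<open>u\<close> always extends the word, because
  \<open>l \<noteq> i\<close>. On the right it extends it or merges with the last letter, and that
  product splits into its centred part and a scalar.\<close>

lemma Alt_conj:
  assumes F: "\<And>i. op.subspace (F i)" "\<And>i. 1 \<in> F i" "\<And>i. F i \<subseteq> M"
    "\<And>i x y. x \<in> F i \<Longrightarrow> y \<in> F i \<Longrightarrow> x * y \<in> F i"
    and u: "u \<in> ctr (F i)" and x: "Alt (\<lambda>i. ctr (F i)) l k x" and l: "l \<noteq> i"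
  shows "u * x * u \<in> op.span {x. \<exists>k. Alt (\<lambda>i. ctr (F i)) i k x}"
proof -
  let ?A = "Alt (\<lambda>i. ctr (F i))"
  have ux: "?A i k (u * x)" using u x l by (intro Alt.cons) auto
  show ?thesis
  proof (cases "k = i")
    case False
    have "?A i i (u * x * u)" by (rule Alt_snoc[OF ux u False])
    then show ?thesis by (intro op.span_base) blast
  next
    case True
    from x show ?thesis
    proof (cases rule: Alt_snocE)
      case 1
      then show ?thesis using l True by simp
    next
      case (2 j g y)
      define t where "t = tr (g * u)"
      have gu: "g * u \<in> F i" using 2 u True F(4) by (auto simp: ctr_def)
      have uy: "?A i j (u * y)" using u 2 l by (intro Alt.cons) auto
      have gc: "g * u - sc t 1 \<in> ctr (F i)" using split_ctr[OF F(1,2) gu F(3)] by (simp add: t_def)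
      have "?A i i (u * y * (g * u - sc t 1))" by (rule Alt_snoc[OF uy gc]) (use 2 True in simp)
      then have "u * y * (g * u - sc t 1) + sc t (u * y) \<in> op.span {x. \<exists>k. ?A i k x}"
        using uy by (intro op.span_add op.span_scale op.span_base) blast+
      then show ?thesis using 2 by (simp add: right_diff_distrib mult.assoc)
    qed
  qed
qed

text \<open>\<open>h\<close> can merge only with \<open>g\<close>; the nonempty word
  \<open>y\<close> has a different first index and keeps the product alternating.\<close>

lemma Alt_mult_tr:
  assumes F: "\<And>i. op.subspace (F i)" "\<And>i. 1 \<in> F i" "\<And>i. F i \<subseteq> M"
    "\<And>i x y. x \<in> F i \<Longrightarrow> y \<in> F i \<Longrightarrow> x * y \<in> F i" and free: "free F"
    and g: "g \<in> ctr (F k)" and y: "Alt (\<lambda>i. ctr (F i)) l m y" "k \<noteq> l" and h: "h \<in> F j"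
  shows "tr (h * (g * y)) = 0"
proof -
  let ?A = "Alt (\<lambda>i. ctr (F i))"
  have tr0: "?A i k x \<Longrightarrow> tr x = 0" for i k x using free by (simp add: free_def)
  have AM: "?A i k x \<Longrightarrow> x \<in> M" for i k x by (rule Alt_ctr_M[OF _ F(3)])
  have key: "tr (h * y) = 0" if h: "h \<in> F j" and y: "?A l m y" "j \<noteq> l" for h y j l m
  proof -
    have "?A j m ((h - sc (tr h) 1) * y)" using split_ctr[OF F(1,2) h F(3)] y by (intro Alt.cons)
    then have "tr ((h - sc (tr h) 1) * y) = 0" by (rule tr0)
    moreover have "h \<in> M" using h F(3) by blast
    ultimately show ?thesis
      using tr0[OF y(1)] AM[OF y(1)] by (simp add: left_diff_distrib tr_diff tr_sc M_closed)
  qed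
  have gy: "?A k m (g * y)" using g y by (rule Alt.cons)
  show ?thesis
  proof (cases "j = k")
    case True
    then have "h * g \<in> F k" using h g F(4) by (auto simp: ctr_def)
    then have "tr ((h * g) * y) = 0" using y by (rule key)
    then show ?thesis by (simp add: mult.assoc)
  qed (use key[OF h gy] in simp)
qed

text \<open>Murray and von Neumann's argument that free group factors do not have property \<open>\<Gamma>\<close>.\<close>
theorem center_trivial:
  fixes F :: "'i \<Rightarrow> 'h operator set"
  assumes F: "\<And>i. op.subspace (F i)" "\<And>i. 1 \<in> F i" "\<And>i. F i \<subseteq> M"
    "\<And>i x y. x \<in> F i \<Longrightarrow> y \<in> F i \<Longrightarrow> x * y \<in> F i" "\<And>i x. x \<in> F i \<Longrightarrow> star x \<in> F i"
    and free: "free F" and dense: "M \<subseteq> cl (wspan F)" and ij: "i \<noteq> j"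
    and a: "a \<in> ctr (F i)" "star a = a" "a * a = 1"
    and b: "b \<in> ctr (F j)" "star b = b" "b * b = 1"
    and c: "c \<in> ctr (F j)" "star c = c" "c * c = 1" and bc: "tr (b * c) = 0"
    and z: "z \<in> M" "z * a = a * z" "z * b = b * z" "z * c = c * z"
  shows "z = sc (tr z) 1"
proof -
  let ?A = "Alt (\<lambda>i. ctr (F i))"
  \<comment> \<open>A paradoxical decomposition: apart from scalars, words begin with
    \<open>i\<close> or with another index. Conjugation by \<open>a\<close> maps \<open>X2\<close>
    into \<open>X1\<close>, while conjugations by \<open>b\<close> and \<open>c\<close> map
    \<open>X1\<close> into mutually orthogonal parts of \<open>X2\<close>.\<close>
  let ?G1 = "{x. \<exists>k. ?A i k x}" and ?G2 = "{x. \<exists>l k. l \<noteq> i \<and> ?A l k x}"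
  define X1 where "X1 = op.span ?G1"
  define X2 where "X2 = op.span ?G2"
  have tr0: "?A i k x \<Longrightarrow> tr x = 0" for i k x using free by (simp add: free_def)
  have AM: "?A i k x \<Longrightarrow> x \<in> M" for i k x by (rule Alt_ctr_M[OF _ F(3)])
  have GM: "?G1 \<subseteq> M" "?G2 \<subseteq> M" using AM by blast+
  have XM: "x \<in> X1 \<Longrightarrow> x \<in> M" "x \<in> X2 \<Longrightarrow> x \<in> M" for x
    using span_sub[OF GM(1)] span_sub[OF GM(2)] unfolding X1_def X2_def by blast+
  have aM: "a \<in> M" "b \<in> M" "c \<in> M" using a b c F(3) by (auto simp: ctr_def)
  have star_alt: "?A k l (star x)" if "?A l k x" for l k x
  proof (rule Alt_star[OF that])
    show "star x \<in> ctr (F i)" if "x \<in> ctr (F i)" for i x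
      using that F(5) tr_star[OF subsetD[OF F(3)], of x i] by (auto simp: ctr_def)
  qed
  have trX1: "tr x = 0" if "x \<in> X1" for x
  proof (rule linear_zero[OF tr_add tr_sc GM(1) _ that[unfolded X1_def]])
    show "tr x = 0" if "x \<in> ?G1" for x using that tr0 by blast
  qed
  have trX2: "tr x = 0" if "x \<in> X2" for x
  proof (rule linear_zero[OF tr_add tr_sc GM(2) _ that[unfolded X2_def]])
    show "tr x = 0" if "x \<in> ?G2" for x using that tr0 by blast
  qed
  have orth: "tr (star x * y) = 0" if x: "x \<in> X1" and y: "y \<in> X2" for x y
  proof -
    have "tr (star y * x) = 0"
    proof (rule linear_zero[OF _ _ GM(1) _ x[unfolded X1_def]])
      fix x assume "x \<in> ?G1"
      then obtain k where k: "?A i k x" by blast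
      have "tr (star x * y) = 0"
      proof (rule linear_zero[OF _ _ GM(2) _ y[unfolded X2_def]])
        fix y assume "y \<in> ?G2"
        then obtain l m where "l \<noteq> i" "?A l m y" by blast
        then show "tr (star x * y) = 0" using Alt_append[OF star_alt[OF k]] tr0 by metis
      qed (use AM[OF k] in \<open>simp_all add: distrib_left tr_add tr_sc M_closed\<close>)
      then show "tr (star y * x) = 0" using L2.B_herm[OF AM[OF k] XM(2)[OF y]] by simp
    qed (use XM(2)[OF y] in \<open>simp_all add: distrib_left tr_add tr_sc M_closed\<close>)
    then show ?thesis using L2.B_herm[OF XM(2)[OF y] XM(1)[OF x]] by simp
  qed
  have conj1: "a * y * a \<in> X1" if "y \<in> X2" for y
    using that unfolding X2_def
  proof (induction rule: op.span_induct_alt)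
    case base
    then show ?case by (simp add: X1_def op.span_zero)
  next
    case (step r x y)
    then have "a * x * a \<in> X1" unfolding X1_def using Alt_conj[where F = F, OF F(1-4) a(1)] by blast
    then show ?case using step by (simp add: X1_def distrib_left distrib_right op.span_add op.span_scale)
  qed
  have conj2: "u * y * u \<in> X2" if u: "u \<in> ctr (F j)" and "y \<in> X1" for u y
    using that(2) unfolding X1_def
  proof (induction rule: op.span_induct_alt)
    case base
    then show ?case by (simp add: X2_def op.span_zero)
  next
    case (step r x y)
    then have "u * x * u \<in> op.span {x. \<exists>k. ?A j k x}" using Alt_conj[where F = F, OF F(1-4) u] ij by blast
    moreover have "op.span {x. \<exists>k. ?A j k x} \<subseteq> X2"
      unfolding X2_def using ij by (intro op.span_mono) auto
    ultimately have "u * x * u \<in> X2" by blast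
    then show ?case using step by (simp add: X2_def distrib_left distrib_right op.span_add op.span_scale)
  qed
  have orth_bc: "tr (star (b * x * b) * (c * y * c)) = 0" if x: "x \<in> X1" and y: "y \<in> X1" for x y
  proof -
    have gen: "tr (star (b * x * b) * (c * y * c)) = 0" if x: "x \<in> ?G1" and y: "y \<in> ?G1" for x y
    proof -
      obtain k where k: "?A i k x" using x by blast
      obtain m where m: "?A i m y" using y by blast
      have bcF: "b * c \<in> ctr (F j)" using b c bc F(4) by (auto simp: ctr_def)
      have bcy: "?A j m ((b * c) * y)" using bcF m ij by (intro Alt.cons) auto
      have cb: "c * b \<in> F j" using b c F(4) by (auto simp: ctr_def)
      have "tr ((c * b) * (star x * ((b * c) * y))) = 0"
        using star_alt[OF k]
      proof (cases rule: Alt_consE)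
        case 1
        then show ?thesis using Alt_mult_tr[where F = F, OF F(1-4) free 1(2) bcy _ cb] ij by simp
      next
        case (2 l g w)
        have "?A l m (w * ((b * c) * y))" using 2(3) bcy ij by (rule Alt_append)
        then have "tr ((c * b) * (g * (w * ((b * c) * y)))) = 0"
          using Alt_mult_tr[where F = F, OF F(1-4) free 2(2) _ 2(4) cb] by blast
        then show ?thesis using 2(1) by (simp add: mult.assoc)
      qed
      moreover have "tr (star (b * x * b) * (c * y * c)) = tr ((b * star x * b * c * y) * c)"
        by (simp add: b mult.assoc)
      moreover have "\<dots> = tr (c * (b * star x * b * c * y))"
        using aM AM[OF k] AM[OF m] by (intro tr_comm M_closed)
      ultimately show ?thesis by (simp add: mult.assoc)
    qed
    have "tr (star (c * y * c) * (b * x * b)) = 0"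
    proof (rule linear_zero[OF _ _ GM(1) _ x[unfolded X1_def]])
      fix x assume xG: "x \<in> ?G1"
      then have xM: "x \<in> M" using GM by blast
      have "tr (star (b * x * b) * (c * y * c)) = 0"
      proof (rule linear_zero[OF _ _ GM(1) _ y[unfolded X1_def]])
        show "tr (star (b * x * b) * (c * y * c)) = 0" if "y \<in> ?G1" for y using gen xG that by blast
      qed (use xM aM in \<open>simp_all add: distrib_left distrib_right tr_add tr_sc M_closed\<close>)
      then show "tr (star (c * y * c) * (b * x * b)) = 0"
        using L2.B_herm[of "b * x * b" "c * y * c"] xM aM XM(1)[OF y] by (simp add: M_closed)
    qed (use XM(1)[OF y] aM in \<open>simp_all add: distrib_left distrib_right tr_add tr_sc M_closed\<close>)
    then show ?thesis
      using L2.B_herm[of "c * y * c" "b * x * b"] aM XM(1)[OF y] XM(1)[OF x] by (simp add: M_closed)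
  qed
  have decomp: "\<exists>r x y. v = sc r 1 + x + y \<and> x \<in> X1 \<and> y \<in> X2" if "v \<in> wspan F" for v
    using that unfolding wspan_def
  proof (induction rule: op.span_induct_alt)
    case base
    then show ?case by (intro exI[of _ 0]) (simp add: X1_def X2_def op.span_zero)
  next
    case (step q w v)
    then obtain r x y where v: "v = sc r 1 + x + y" "x \<in> X1" "y \<in> X2" by blast
    consider "w = 1" | "w \<in> X1" | "w \<in> X2"
    proof -
      assume t: "w = 1 \<Longrightarrow> thesis" "w \<in> X1 \<Longrightarrow> thesis" "w \<in> X2 \<Longrightarrow> thesis"
      from step(1) consider "w = 1" | l k where "?A l k w" by auto
      then show thesis
      proof cases
        case (2 l k)
        show thesis
        proof (cases "l = i")
          case True
          then have "w \<in> X1" unfolding X1_def using 2 by (intro op.span_base) auto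
          then show thesis by (rule t)
        next
          case False
          then have "w \<in> X2" unfolding X2_def using 2 by (intro op.span_base) auto
          then show thesis by (rule t)
        qed
      qed (rule t)
    qed
    then show ?case
    proof cases
      case 1
      then have "sc q w + v = sc (q + r) 1 + x + y" using v by (simp add: op.scale_left_distrib)
      then show ?thesis using v by blast
    next
      case 2
      then have "sc q w + v = sc r 1 + (sc q w + x) + y" "sc q w + x \<in> X1"
        using v by (auto simp: X1_def op.span_add op.span_scale)
      then show ?thesis using v by blast
    next
      case 3
      then have "sc q w + v = sc r 1 + x + (sc q w + y)" "sc q w + y \<in> X2"
        using v by (auto simp: X2_def op.span_add op.span_scale)
      then show ?thesis using v by blast
    qed
  qed
  \<comment> \<open>The components of an \<open>\<epsilon>\<close>-approximant will have norms at
    most \<open>13 \<epsilon>\<close> and \<open>15 \<epsilon>\<close>. This puts \<open>z\<close>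
    within \<open>29 \<epsilon>\<close> of a scalar, and replacing that scalar by
    \<open>tr z\<close> at most doubles the error.\<close>
  have "n2 (z - sc (tr z) 1) \<le> 58 * \<epsilon>" if \<epsilon>: "0 < \<epsilon>" for \<epsilon>
  proof -
    have "z \<in> cl (wspan F)" using dense z by blast
    then obtain v where v: "v \<in> wspan F" "n2 (z - v) < \<epsilon>" using \<epsilon> unfolding cl_def by blast
    obtain r x y where d: "v = sc r 1 + x + y" "x \<in> X1" "y \<in> X2" using decomp[OF v(1)] by blast
    have xM: "x \<in> M" and yM: "y \<in> M" using d XM by auto
    have vM: "v \<in> M" using d xM yM by (simp add: M_closed)
    define X where "X = n2 x"
    define Y where "Y = n2 y"
    have X0: "0 \<le> X" "0 \<le> Y" using xM yM L2.nrm_ge0 by (auto simp: X_def Y_def)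
    have ip_v: "tr (star w * v) = tr (star w * x) + tr (star w * y)" if "w \<in> X1 \<or> w \<in> X2" for w
    proof -
      have "w \<in> M" "tr (star w) = 0" using that XM[of w] trX1[of w] trX2[of w] tr_star[of w] by auto
      then show ?thesis using xM yM by (simp add: d distrib_left tr_add tr_sc M_closed)
    qed
    \<comment> \<open>Conjugating \<open>w\<close> by \<open>u\<close> does not change its inner
      product with \<open>z\<close>, which commutes with \<open>u\<close>, and so changes that with
      \<open>v\<close> only little.\<close>
    have near: "cmod (tr (star (u * w * u) * v) - tr (star w * v)) \<le> 2 * \<epsilon> * n2 w"
      if u: "u \<in> M" "star u = u" "u * u = 1" "z * u = u * z" and w: "w \<in> M" for u w
    proof -
      have "tr (star (u * w * u) * z) = tr (u * (star w * (u * z)))" by (simp add: u mult.assoc)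
      also have "\<dots> = tr ((star w * (u * z)) * u)" using u w z by (intro tr_comm M_closed)
      also have "\<dots> = tr (star w * (z * (u * u)))" by (simp add: mult.assoc flip: u(4))
      finally have e: "tr (star (u * w * u) * z) = tr (star w * z)" by (simp add: u(3))
      have zv: "z - v \<in> M" using z vM by (simp add: M_closed)
      have uwu: "u * w * u \<in> M" using u w by (simp add: M_closed)
      have "tr (star (u * w * u) * v) - tr (star w * v) = tr (star w * (z - v)) - tr (star (u * w * u) * (z - v))"
        using L2.B_diff[OF w z(1) vM] L2.B_diff[OF uwu z(1) vM] e by simp
      then have "cmod (tr (star (u * w * u) * v) - tr (star w * v))
          \<le> cmod (tr (star w * (z - v))) + cmod (tr (star (u * w * u) * (z - v)))"
        using norm_triangle_ineq4 by metis
      also have "\<dots> \<le> n2 w * n2 (z - v) + n2 (u * w * u) * n2 (z - v)"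
        by (intro add_mono L2.CS w uwu zv)
      also have "\<dots> = 2 * n2 w * n2 (z - v)" using n2_unitary_conj[OF u(1-3) w] by simp
      also have "\<dots> \<le> 2 * n2 w * \<epsilon>" using v L2.nrm_ge0[OF w] by (intro mult_left_mono) auto
      finally show ?thesis by (simp add: algebra_simps)
    qed
    \<comment> \<open>The inner product of \<open>a * y * a\<close> with \<open>v\<close> is close
      to \<open>Y\<^sup>2\<close>; as \<open>a * y * a\<close> lies in \<open>X1\<close>, only
      \<open>x\<close> contributes to it, at most \<open>Y X\<close>.\<close>
    have 1: "Y * Y \<le> Y * X + 2 * \<epsilon> * Y"
    proof -
      let ?w = "a * y * a"
      have wM: "?w \<in> M" using aM yM by (simp add: M_closed)
      have "tr (star ?w * v) = tr (star ?w * x)" using ip_v[of ?w] conj1[OF d(3)] orth[of ?w y] d by simp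
      moreover have "tr (star y * v) = of_real (Y * Y)"
        using ip_v[of y] d orth[of x y] L2.B_herm[OF xM yM] L2.B_self[OF yM] by (simp add: Y_def power2_eq_square)
      moreover have "cmod (tr (star ?w * x)) \<le> Y * X"
        using L2.CS[OF wM xM] n2_unitary_conj[OF aM(1) a(2,3) yM] by (simp add: X_def Y_def)
      moreover have "cmod (tr (star ?w * v) - tr (star y * v)) \<le> 2 * \<epsilon> * Y"
        unfolding Y_def by (intro near aM a z yM)
      ultimately have "cmod (tr (star ?w * x) - of_real (Y * Y)) \<le> 2 * \<epsilon> * Y" "cmod (tr (star ?w * x)) \<le> Y * X" by auto
      then have "cmod (of_real (Y * Y)) \<le> Y * X + 2 * \<epsilon> * Y"
        by (smt (verit) norm_triangle_ineq2 norm_minus_commute)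
      then show ?thesis by (simp only: norm_of_real)
    qed
    have 2: "X * X - 2 * \<epsilon> * X \<le> Re (tr (star (u * x * u) * y))"
      if u: "u \<in> ctr (F j)" "u \<in> M" "star u = u" "u * u = 1" "z * u = u * z" for u
    proof -
      let ?w = "u * x * u"
      have wM: "?w \<in> M" using u xM by (simp add: M_closed)
      have w2: "?w \<in> X2" using conj2[OF u(1) d(2)] .
      have "tr (star ?w * x) = 0" using orth[OF d(2) w2] L2.B_herm[OF xM wM] by simp
      then have "tr (star ?w * v) = tr (star ?w * y)" using ip_v[of ?w] w2 by simp
      moreover have "tr (star x * v) = of_real (X * X)"
        using ip_v[of x] d orth[of x y] L2.B_self[OF xM] by (simp add: X_def power2_eq_square)
      moreover have "cmod (tr (star ?w * v) - tr (star x * v)) \<le> 2 * \<epsilon> * X"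
        unfolding X_def by (intro near u xM)
      ultimately have "cmod (of_real (X * X) - tr (star ?w * y)) \<le> 2 * \<epsilon> * X" by (simp add: norm_minus_commute)
      then have "Re (of_real (X * X) - tr (star ?w * y)) \<le> 2 * \<epsilon> * X" using complex_Re_le_cmod order_trans by blast
      then show ?thesis by simp
    qed
    \<comment> \<open>Bessel's inequality for the orthogonal elements \<open>b * x * b\<close> and
      \<open>c * x * c\<close>, both of norm \<open>X\<close>, whose inner products with
      \<open>y\<close> have real part at least \<open>X\<^sup>2 - 2 \<epsilon> X\<close>.\<close>
    have 3: "2 * (X * X) \<le> Y * Y + 8 * \<epsilon> * X"
    proof -
      let ?b = "b * x * b" and ?c = "c * x * c"
      have bM: "?b \<in> M" "?c \<in> M" using aM xM by (auto simp: M_closed)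
      have nb: "n2 ?b = X" "n2 ?c = X"
        using n2_unitary_conj[OF aM(2) b(2,3) xM] n2_unitary_conj[OF aM(3) c(2,3) xM] by (auto simp: X_def)
      have "(n2 (?b + ?c))\<^sup>2 = X * X + X * X"
        using L2.nrm_add_sq[OF bM] orth_bc[OF d(2,2)] nb by (simp add: power2_eq_square)
      moreover have "(n2 (- (?b + ?c) + y))\<^sup>2 = (n2 (?b + ?c))\<^sup>2 - 2 * (Re (tr (star ?b * y)) + Re (tr (star ?c * y))) + Y * Y"
      proof -
        have m: "?b + ?c \<in> M" using bM by (simp add: M_closed)
        have "tr (star (- (?b + ?c)) * y) = - (tr (star ?b * y) + tr (star ?c * y))"
          using L2.B_neg_left[OF m yM] L2.B_add_left[OF bM yM] by simp
        then show ?thesis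
          using L2.nrm_add_sq[OF M_closed(7)[OF m] yM] L2.nrm_neg[OF m] by (simp add: Y_def power2_eq_square)
      qed
      moreover have "0 \<le> (n2 (- (?b + ?c) + y))\<^sup>2" by simp
      moreover have "2 * S \<le> W + 4 * E"
        if "N = S + S" "P = N - 2 * (B + C) + W" "0 \<le> P" "S - E \<le> B" "S - E \<le> C" for N P B C S W E :: real
        using that by simp
      ultimately have "2 * (X * X) \<le> Y * Y + 4 * (2 * \<epsilon> * X)"
        using 2[OF b(1) aM(2) b(2,3) z(3)] 2[OF c(1) aM(3) c(2,3) z(4)] by blast
      then show ?thesis by simp
    qed
    have YX: "Y \<le> X + 2 * \<epsilon>"
    proof (cases "Y = 0")
      case False
      then have "0 < Y" using X0 by simp
      moreover have "Y * Y \<le> Y * (X + 2 * \<epsilon>)" using 1 by (simp add: algebra_simps)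
      ultimately show ?thesis by simp
    qed (use X0 \<epsilon> in simp)
    \<comment> \<open>Inserting \<open>Y \<le> X + 2 \<epsilon>\<close> into the third inequality
      gives \<open>X\<^sup>2 \<le> 12 \<epsilon> X + 4 \<epsilon>\<^sup>2\<close>, which fails for
      \<open>X > 13 \<epsilon>\<close>.\<close>
    have "X \<le> 13 * \<epsilon>"
    proof (rule ccontr)
      assume "\<not> ?thesis"
      then have X13: "13 * \<epsilon> < X" by simp
      have "Y * Y \<le> (X + 2 * \<epsilon>) * (X + 2 * \<epsilon>)" using YX X0 by (intro mult_mono) auto
      then have "X * X \<le> 12 * (\<epsilon> * X) + 4 * (\<epsilon> * \<epsilon>)" using 3 by (simp add: algebra_simps)
      moreover have "13 * \<epsilon> * X \<le> X * X" using X13 X0 by (intro mult_right_mono) auto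
      moreover have "\<epsilon> * (13 * \<epsilon>) \<le> \<epsilon> * X" using X13 \<epsilon> by (intro mult_left_mono) auto
      ultimately have "13 * (\<epsilon> * \<epsilon>) \<le> 4 * (\<epsilon> * \<epsilon>)" by (simp add: algebra_simps)
      then show False using \<epsilon> by simp
    qed
    then have XY: "X + Y \<le> 28 * \<epsilon>" using YX by simp
    have zr: "n2 (z - sc r 1) \<le> 29 * \<epsilon>"
    proof -
      have e: "z - sc r 1 = (z - v) + (x + y)" by (simp add: d)
      have "n2 (z - sc r 1) \<le> n2 (z - v) + n2 (x + y)"
        unfolding e using z(1) vM xM yM by (intro L2.nrm_add M_closed(3,4))
      also have "n2 (x + y) \<le> X + Y" unfolding X_def Y_def using xM yM by (intro L2.nrm_add)
      finally show ?thesis using XY v by simp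
    qed
    have "cmod (tr (z - sc r 1)) \<le> 29 * \<epsilon>"
      using tr_le_n2[of "z - sc r 1"] zr z by (simp add: M_closed)
    then have "cmod (r - tr z) \<le> 29 * \<epsilon>"
      using z by (simp add: tr_diff tr_sc tr_one M_closed norm_minus_commute)
    moreover have "n2 (z - sc (tr z) 1) \<le> n2 (z - sc r 1) + n2 (sc (r - tr z) 1)"
      using L2.nrm_add[of "z - sc r 1" "sc (r - tr z) 1"] z
      by (simp add: M_closed op.scale_left_diff_distrib)
    moreover have "n2 (sc (r - tr z) 1) = cmod (r - tr z)"
      using L2.nrm_sc[OF M_closed(1)] by (simp add: n2_one)
    ultimately show ?thesis using zr by simp
  qed
  note small = this
  have zM: "z - sc (tr z) 1 \<in> M" using z by (simp add: M_closed)
  have "n2 (z - sc (tr z) 1) \<le> 0 + e" if "0 < e" for e :: real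
    using small[of "e / 58"] that by simp
  then have "n2 (z - sc (tr z) 1) \<le> 0" by (rule field_le_epsilon)
  then have "n2 (z - sc (tr z) 1) = 0" using L2.nrm_ge0[OF zM] by simp
  then have "z - sc (tr z) 1 = 0" using zM by (intro n2_0)
  then show ?thesis by simp
qed

end

section \<open>Conjugated corners\<close>

text \<open>Partial sums over \<open>I \<inter> {..n}\<close> treat finite and infinite
  \<open>I\<close> alike. In \<open>free_A\<close> the letters outside \<open>I\<close> form the
  empty set, so words use indices from \<open>I\<close> only.\<close>

locale corner_datum = tracial M tr for M :: "'h::complex_hilbert operator set" and tr +
  fixes I :: "nat set" and A :: "nat \<Rightarrow> 'h operator set" and p u :: "nat \<Rightarrow> 'h operator"
  assumes I: "0 \<notin> I" "1 \<in> I" "2 \<in> I"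
    and vna_A: "i \<in> I \<Longrightarrow> vna (A i)" and A_M: "i \<in> I \<Longrightarrow> A i \<subseteq> M"
    and abelian_A: "i \<in> I \<Longrightarrow> x \<in> A i \<Longrightarrow> y \<in> A i \<Longrightarrow> x * y = y * x"
    and diffuse_A: "i \<in> I \<Longrightarrow> diffuse_op (A i)"
    and free_A: "Alt (\<lambda>i. if i \<in> I then ctr (A i) else {}) i k x \<Longrightarrow> tr x = 0"
    and gen_A: "M = vhull (\<Union>i\<in>I. A i)"
    and p: "i \<in> I \<Longrightarrow> p i \<in> A i" "i \<in> I \<Longrightarrow> proj (p i)"
    and u: "i \<in> I \<Longrightarrow> u i \<in> M" "i \<in> I \<Longrightarrow> star (u i) * u i = 1" "i \<in> I \<Longrightarrow> u i * star (u i) = 1"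
    and sum_q: "sot (\<lambda>n. \<Sum>i\<in>I \<inter> {..n}. u i * p i * star (u i)) 1"
begin

abbreviation "q i \<equiv> u i * p i * star (u i)"

lemma A_in_M: "i \<in> I \<Longrightarrow> x \<in> A i \<Longrightarrow> x \<in> M"
  using A_M by blast

lemmas A_closed = vna_closed[OF vna_A]

lemma pM: "i \<in> I \<Longrightarrow> p i \<in> M"
  using p A_in_M by blast

lemma pp: "i \<in> I \<Longrightarrow> star (p i) = p i" "i \<in> I \<Longrightarrow> p i * p i = p i"
  using p by (auto simp: proj_def)

lemma uu: "i \<in> I \<Longrightarrow> star (u i) * (u i * x) = x" "i \<in> I \<Longrightarrow> u i * (star (u i) * x) = x"
  by (simp_all add: u flip: mult.assoc)

lemma ppz: "i \<in> I \<Longrightarrow> p i * (p i * z) = p i * z"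
  by (simp add: pp flip: mult.assoc)

lemma qM: "i \<in> I \<Longrightarrow> q i \<in> M"
  using u pM by (intro M_closed)

lemma q_proj: "i \<in> I \<Longrightarrow> proj (q i)"
  by (simp add: proj_def pp uu ppz mult.assoc)

lemma tr_q: "i \<in> I \<Longrightarrow> tr (q i) = tr (p i)"
  using tr_comm[of "u i * p i" "star (u i)"] u pM by (simp add: M_closed uu flip: mult.assoc)

lemma sum_proj:
  assumes "\<And>i. i \<in> I \<Longrightarrow> x i \<in> M \<and> proj (x i)"
  shows "(\<Sum>i\<in>I \<inter> {..n}. x i) \<in> M" "star (\<Sum>i\<in>I \<inter> {..n}. x i) = (\<Sum>i\<in>I \<inter> {..n}. x i)"
    "(\<Sum>i\<in>I \<inter> {..n}. x i) \<le> (\<Sum>i\<in>I \<inter> {..Suc n}. x i)"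
    "tr (\<Sum>i\<in>I \<inter> {..n}. x i) = (\<Sum>i\<in>I \<inter> {..n}. tr (x i))"
proof -
  have split: "I \<inter> {..Suc n} = (if Suc n \<in> I then insert (Suc n) (I \<inter> {..n}) else I \<inter> {..n})" for n
    by (auto simp: atMost_Suc)
  have sum_Suc: "(\<Sum>i\<in>I \<inter> {..Suc n}. f i) = (if Suc n \<in> I then f (Suc n) else 0) + (\<Sum>i\<in>I \<inter> {..n}. f i)"
    for n and f :: "nat \<Rightarrow> 'b::comm_monoid_add"
    unfolding split by simp
  have zero: "(\<Sum>i\<in>I \<inter> {..0}. f i) = 0" for f :: "nat \<Rightarrow> 'b::comm_monoid_add"
    using I by (intro sum.neutral) auto
  show M: "(\<Sum>i\<in>I \<inter> {..n}. x i) \<in> M" for n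
    by (induction n) (use assms in \<open>simp_all only: sum_Suc zero, auto intro!: M_closed\<close>)
  show "star (\<Sum>i\<in>I \<inter> {..n}. x i) = (\<Sum>i\<in>I \<inter> {..n}. x i)"
    by (induction n) (use assms in \<open>simp_all only: sum_Suc zero, auto simp: proj_def\<close>)
  show "(\<Sum>i\<in>I \<inter> {..n}. x i) \<le> (\<Sum>i\<in>I \<inter> {..Suc n}. x i)"
    unfolding sum_Suc using assms[of "Suc n"] proj_ge0[of "x (Suc n)"] by auto
  show "tr (\<Sum>i\<in>I \<inter> {..n}. x i) = (\<Sum>i\<in>I \<inter> {..n}. tr (x i))"
  proof (induction n)
    case (Suc n)
    show ?case
    proof (cases "Suc n \<in> I")
      case True
      then show ?thesis using Suc assms[OF True] M[of n] by (simp add: sum_Suc tr_add)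
    qed (use Suc in \<open>simp add: sum_Suc\<close>)
  qed (simp only: zero tr_zero)
qed

definition tt :: "nat \<Rightarrow> real" where "tt i = (if i \<in> I then Re (tr (p i)) else 0)"

lemma tt_ge0: "0 \<le> tt i"
  using tr_ge0[OF pM proj_ge0[OF p(2)]] by (simp add: tt_def)

lemma tr_p: "i \<in> I \<Longrightarrow> tr (p i) = complex_of_real (tt i)"
  using tr_sa[OF pM] pp by (simp add: tt_def)

lemma sum_tt: "(\<lambda>n. \<Sum>i\<le>n. tt i) \<longlonglongrightarrow> 1" "(\<Sum>i\<le>n. tt i) \<le> 1"
proof -
  note sp = sum_proj[of q, OF conjI[OF qM q_proj]]
  have eq: "Re (tr (\<Sum>i\<in>I \<inter> {..n}. q i)) = (\<Sum>i\<le>n. tt i)" for n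
  proof -
    have "Re (tr (\<Sum>i\<in>I \<inter> {..n}. q i)) = (\<Sum>i\<in>I \<inter> {..n}. tt i)"
      using sp(4) tr_q by (simp add: tt_def)
    also have "\<dots> = (\<Sum>i\<le>n. tt i)" by (rule sum.mono_neutral_left) (auto simp: tt_def)
    finally show ?thesis .
  qed
  show lim: "(\<lambda>n. \<Sum>i\<le>n. tt i) \<longlonglongrightarrow> 1"
    using tr_lim(1)[OF sp(1-3) sum_q] by (simp add: eq tr_one)
  have "incseq (\<lambda>n. \<Sum>i\<le>n. tt i)" using tt_ge0 by (intro incseq_SucI) simp
  then show "(\<Sum>i\<le>n. tt i) \<le> 1" using lim by (rule incseq_le)
qed

text \<open>The recursion runs over the remainders \<open>r n\<close>, in which there is room for
  the next projection because the traces of the \<open>p i\<close> sum to 1. The strong sum of the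
  \<open>e i\<close> is at most 1 and has trace 1, so it is 1 by faithfulness.\<close>

lemma exists_partition:
  obtains e where "\<And>i. i \<in> I \<Longrightarrow> e i \<in> A 1" "\<And>i. i \<in> I \<Longrightarrow> proj (e i)" "e 1 = p 1"
    "\<And>i j. i \<in> I \<Longrightarrow> j \<in> I \<Longrightarrow> i \<noteq> j \<Longrightarrow> e i * e j = 0"
    "\<And>i. i \<in> I \<Longrightarrow> tr (e i) = tr (p i)" "sot (\<lambda>n. \<Sum>i\<in>I \<inter> {..n}. e i) 1"
proof -
  note A1 = vna_A[OF I(2)] A_M[OF I(2)] diffuse_A[OF I(2)]
  note c1 = vna_closed[OF A1(1)]
  have tt01: "(\<Sum>i\<le>Suc 0. tt i) = Re (tr (p 1))" using I by (simp add: tt_def)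
  have "\<exists>r. \<forall>n. (r n \<in> A 1 \<and> proj (r n) \<and> Re (tr (r n)) = 1 - (\<Sum>i\<le>Suc n. tt i) \<and> (n = 0 \<longrightarrow> r n = 1 - p 1))
      \<and> r n * r (Suc n) = r (Suc n)"
  proof (rule dependent_nat_choice)
    have "1 - p 1 \<in> A 1" using p I by (intro c1) auto
    moreover have "Re (tr (1 - p 1)) = 1 - (\<Sum>i\<le>Suc 0. tt i)"
      using pM[OF I(2)] by (simp only: tt01) (simp add: tr_diff tr_one M_closed)
    ultimately show "\<exists>x. x \<in> A 1 \<and> proj x \<and> Re (tr x) = 1 - (\<Sum>i\<le>Suc 0. tt i) \<and> (0 = 0 \<longrightarrow> x = 1 - p 1)"
      using proj_compl[OF p(2)[OF I(2)]] by blast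
    fix x and n :: nat
    assume x: "x \<in> A 1 \<and> proj x \<and> Re (tr x) = 1 - (\<Sum>i\<le>Suc n. tt i) \<and> (n = 0 \<longrightarrow> x = 1 - p 1)"
    have "tt (Suc (Suc n)) \<le> Re (tr x)" using x sum_tt(2)[of "Suc (Suc n)"] by simp
    then obtain e where e: "e \<in> A 1" "proj e" "x * e = e" "Re (tr e) = tt (Suc (Suc n))"
      using projection_of_trace[OF A1, of x "tt (Suc (Suc n))"] x tt_ge0 by blast
    have xM: "x \<in> M" "e \<in> M" using x e A1 by auto
    note xe = proj_sub[of x e]
    have "x - e \<in> A 1" using x e c1(4) by blast
    then have "x - e \<in> A 1 \<and> proj (x - e) \<and> Re (tr (x - e)) = 1 - (\<Sum>i\<le>Suc (Suc n). tt i)"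
      using x e xe xM by (auto simp: tr_diff)
    moreover have "x * (x - e) = x - e" using x e by (simp add: proj_def algebra_simps)
    ultimately show "\<exists>y. (y \<in> A 1 \<and> proj y \<and> Re (tr y) = 1 - (\<Sum>i\<le>Suc (Suc n). tt i) \<and> (Suc n = 0 \<longrightarrow> y = 1 - p 1)) \<and> x * y = y"
      by blast
  qed
  then obtain r where r: "\<And>n. r n \<in> A 1" "\<And>n. proj (r n)" "\<And>n. Re (tr (r n)) = 1 - (\<Sum>i\<le>Suc n. tt i)"
    "r 0 = 1 - p 1" and rr: "\<And>n. r n * r (Suc n) = r (Suc n)" by metis
  have rM: "r n \<in> M" for n using r(1) A1 by blast
  have rle: "r (Suc n) \<le> r n" for n using proj_sub(3)[OF r(2) r(2) rr] .
  have r_dec: "r n \<le> r m" if "m \<le> n" for m n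
    using lift_Suc_antimono_le[of r, OF rle that] .
  have r_mult: "r m * r n = r n" if "m \<le> n" for m n
    using proj_le_mult[OF r(2) r(2) r_dec[OF that]] .
  \<comment> \<open>The shift comes from \<open>r 0 = 1 - p 1\<close> being the remainder after
    \<open>e 1\<close>. Outside \<open>I\<close> the prescribed traces are 0, and so are the
    differences.\<close>
  define e where "e k = (if k = 0 then 0 else if k = 1 then p 1 else r (k - 2) - r (k - 1))" for k
  have e2: "e (Suc (Suc n)) = r n - r (Suc n)" for n by (simp add: e_def)
  have e01: "e 0 = 0" "e 1 = p 1" "e (Suc 0) = p 1" by (simp_all add: e_def)
  have eA: "e k \<in> A 1" for k
    using c1(2) p(1)[OF I(2)] c1(4)[OF r(1) r(1)] by (auto simp: e_def)
  have e_proj: "proj (e k)" for k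
  proof -
    have "k = 0 \<or> k = 1 \<or> (\<exists>n. k = Suc (Suc n))" by presburger
    then show ?thesis
      using p I proj_sub(2)[OF r(2) r(2) rr] by (auto simp: e2 e01) (simp add: proj_def)
  qed
  have sum_e: "(\<Sum>k\<le>Suc n. e k) = 1 - r n" for n
    by (induction n) (simp_all add: e2 e01 r(4))
  have eM: "e k \<in> M" for k using eA A1 by blast
  have tr_e: "tr (e k) = complex_of_real (tt k)" for k
  proof -
    have "Re (tr (e k)) = tt k"
    proof -
      have "k = 0 \<or> k = 1 \<or> (\<exists>n. k = Suc (Suc n))" by presburger
      then show ?thesis
        using I rM r(3) by (auto simp: e2 e01 tr_diff tr_zero) (auto simp: tt_def)
    qed
    moreover have "star (e k) = e k" using e_proj by (simp add: proj_def)
    ultimately show ?thesis using tr_sa[OF eM, of k] by metis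
  qed
  have e_out: "e k = 0" if "k \<notin> I" for k
    using tr_ge0_zero[OF eM proj_ge0[OF e_proj]] tr_e that by (simp add: tt_def)
  have orth1: "e m * e n = 0" if "m < n" for m n
  proof -
    obtain k where n: "n = Suc k" using less_imp_Suc_add[OF \<open>m < n\<close>] by blast
    show ?thesis
    proof (cases k)
      case 0
      then show ?thesis using that n by (simp add: e01)
    next
      case (Suc l)
      have en: "e n = r l * e n" using n Suc by (simp add: e2 right_diff_distrib r_mult)
      have "e m * r l = 0"
      proof -
        consider "m = 0" | "m = 1" | j where "m = Suc (Suc j)" "Suc j \<le> l" using \<open>m < n\<close> n Suc
          by (metis One_nat_def Suc_le_eq less_Suc_eq_le not0_implies_Suc Suc_less_eq)
        then show ?thesis
        proof cases
          case 2
          have "p 1 * r 0 = 0" using pp(2)[OF I(2)] by (simp add: r(4) right_diff_distrib)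
          then have "p 1 * (r 0 * r l) = 0" by (simp flip: mult.assoc)
          then show ?thesis using 2 r_mult[of 0 l] by (simp add: e01)
        next
          case (3 j)
          then show ?thesis by (simp add: e2 left_diff_distrib r_mult)
        qed (simp add: e01)
      qed
      then show ?thesis using en by (metis mult.assoc mult_zero_left)
    qed
  qed
  have orth: "e i * e j = 0" if "i \<noteq> j" for i j
  proof (cases "i < j")
    case False
    then have "e j * e i = 0" using that orth1 by simp
    then show ?thesis using abelian_A[OF I(2) eA eA] by metis
  qed (rule orth1)
  have sum_I: "(\<Sum>i\<in>I \<inter> {..n}. e i) = (\<Sum>i\<le>n. e i)" for n
    by (rule sum.mono_neutral_left) (use e_out in auto)
  note sp = sum_proj[of e, OF conjI[OF eM e_proj]]
  have "(\<Sum>i\<in>I \<inter> {..n}. e i) \<le> 1" for n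
  proof (cases n)
    case 0
    then show ?thesis using I one_ge0 by (simp add: sum_I e01)
  next
    case (Suc m)
    then show ?thesis using proj_ge0[OF r(2)] by (simp add: sum_I sum_e del: sum.atMost_Suc)
  qed
  then obtain g where g: "sot (\<lambda>n. \<Sum>i\<in>I \<inter> {..n}. e i) g" "g \<le> 1"
    using sot_monotone[of "\<lambda>n. \<Sum>i\<in>I \<inter> {..n}. e i" 1] sp(2,3) by (metis (no_types, lifting) star_simps(3))
  note l = tr_lim[OF sp(1-3) g(1)]
  have "Re (tr (\<Sum>i\<in>I \<inter> {..n}. e i)) = (\<Sum>i\<le>n. tt i)" for n
  proof -
    have "tr (\<Sum>i\<in>I \<inter> {..n}. e i) = complex_of_real (\<Sum>i\<in>I \<inter> {..n}. tt i)"
      unfolding sp(4) by (simp add: tr_e)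
    moreover have "(\<Sum>i\<in>I \<inter> {..n}. tt i) = (\<Sum>i\<le>n. tt i)"
      by (rule sum.mono_neutral_left) (auto simp: tt_def)
    ultimately show ?thesis by simp
  qed
  then have "Re (tr g) = 1" using l(1) sum_tt(1) LIMSEQ_unique by simp
  then have "1 - g = 0"
    using g(2) l(3) by (intro tr_ge0_zero) (auto simp: tr_diff tr_one M_closed)
  then have "g = 1" by simp
  then show thesis
    using that[of e] eA e_proj e01 orth tr_e tr_p g(1) by simp
qed

section \<open>The direct sum of the conjugated corners\<close>

text \<open>The direct sum described by its compressions, without a choice of summable family;
  \<open>direct_sum_corners\<close> identifies the two.\<close>

definition corners :: "'h operator set" where
  "corners = {x. \<forall>i\<in>I. x * q i = q i * x \<and> (\<exists>a\<in>A i. x * q i = u i * a * p i * star (u i))}"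

text \<open>Two of the projections add up to at most a partial sum, hence to at most 1, so one lies
  below the complement of the other.\<close>

lemma q_orth: assumes "i \<in> I" "j \<in> I" "i \<noteq> j" shows "q i * q j = 0"
proof -
  define n where "n = max i j"
  note sp = sum_proj[of q, OF conjI[OF qM q_proj]]
  have "q i + q j = (\<Sum>k\<in>{i, j}. q k)" using assms by simp
  also have "\<dots> \<le> (\<Sum>k\<in>I \<inter> {..n}. q k)"
    using assms q_proj proj_ge0 by (intro sum_mono2) (auto simp: n_def)
  also have "\<dots> \<le> 1" by (rule tr_lim(2)[OF sp(1-3) sum_q])
  finally have "q j \<le> 1 - q i" by (simp add: algebra_simps)
  then have "(1 - q i) * q j = q j"
    using assms q_proj by (intro proj_le_mult proj_compl)
  then show ?thesis by (simp add: algebra_simps)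
qed

lemma corner_in_corners:
  assumes i: "i \<in> I" and a: "a \<in> A i"
  shows "u i * a * p i * star (u i) \<in> corners"
  unfolding corners_def
proof (intro CollectI ballI conjI)
  let ?c = "u i * a * p i * star (u i)"
  have cq: "?c * q i = ?c" using i by (simp add: uu pp ppz mult.assoc)
  have "q i * ?c = u i * (p i * a) * p i * star (u i)" using i by (simp add: uu mult.assoc)
  also have "p i * a = a * p i" using abelian_A[OF i p(1)[OF i] a] .
  finally have qc: "q i * ?c = ?c" using i by (simp add: pp ppz mult.assoc)
  fix j assume j: "j \<in> I"
  have "?c * q j = 0" "q j * ?c = 0" if "i \<noteq> j"
  proof -
    have "?c * q j = (?c * q i) * q j" by (simp only: cq)
    also have "\<dots> = ?c * (q i * q j)" by (rule mult.assoc)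
    finally show "?c * q j = 0" using q_orth[OF i j that] by (simp only: mult_zero_right)
    have "q j * ?c = q j * (q i * ?c)" by (simp only: qc)
    also have "\<dots> = (q j * q i) * ?c" by (rule mult.assoc[symmetric])
    finally show "q j * ?c = 0" using q_orth[OF j i] that by (simp only: mult_zero_left)
  qed
  then show "?c * q j = q j * ?c" using cq qc by (cases "i = j") auto
  show "\<exists>a\<in>A j. ?c * q j = u j * a * p j * star (u j)"
  proof (cases "i = j")
    case True
    then show ?thesis using a cq by auto
  next
    case False
    then show ?thesis using \<open>i \<noteq> j \<Longrightarrow> ?c * q j = 0\<close> A_closed(2)[OF j] by (intro bexI[of _ 0]) auto
  qed
qed

lemma corners_sub_M: "corners \<subseteq> M"
proof
  fix x assume x: "x \<in> corners"
  have xq: "x * q i \<in> M" if "i \<in> I" for i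
  proof -
    obtain a where "a \<in> A i" "x * q i = u i * a * p i * star (u i)"
      using x \<open>i \<in> I\<close> by (auto simp: corners_def)
    then show ?thesis using that u pM A_in_M by (auto intro!: M_closed)
  qed
  have "sot (\<lambda>n. x * (\<Sum>i\<in>I \<inter> {..n}. q i)) (x * 1)" using sum_q by (rule sot_mult_left)
  moreover have "x * (\<Sum>i\<in>I \<inter> {..n}. q i) \<in> M" for n
    unfolding sum_distrib_left using xq by (intro op.subspace_sum L2.V) auto
  ultimately show "x \<in> M" using vna_sot[OF M] by fastforce
qed

text \<open>For \<open>t\<close> in the commutant of \<open>A i\<close>, the operator
  \<open>u i * t * p i * star (u i)\<close> commutes with \<open>corners\<close>. An
  \<open>x\<close> in the double commutant, compressed to the \<open>i\<close>-th corner and moved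
  back by \<open>u i\<close>, therefore commutes with \<open>t\<close>, and so lies in
  \<open>A i\<close>.\<close>

lemma vna_corners: "vna corners"
  unfolding vna_def
proof (intro conjI ballI)
  fix x assume x: "x \<in> corners"
  show "star x \<in> corners"
    unfolding corners_def
  proof (intro CollectI ballI conjI)
    fix i assume i: "i \<in> I"
    have sq: "star (q i) = q i" using q_proj[OF i] by (simp add: proj_def)
    have xq: "x * q i = q i * x" using x i by (simp add: corners_def)
    show c: "star x * q i = q i * star x" using arg_cong[where f = star, OF xq] sq by simp
    obtain a where a: "a \<in> A i" "x * q i = u i * a * p i * star (u i)" using x i by (auto simp: corners_def)
    have "star x * q i = star (x * q i)" using c sq by simp
    also have "\<dots> = u i * (p i * star a) * star (u i)" unfolding a(2) using i by (simp add: pp mult.assoc)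
    also have "p i * star a = star a * p i" using i a A_closed(8) p by (intro abelian_A) auto
    finally show "\<exists>a\<in>A i. star x * q i = u i * a * p i * star (u i)"
      using a A_closed(8)[OF i] by (auto simp: mult.assoc)
  qed
next
  show "comm (comm corners) = corners"
  proof
    show "corners \<subseteq> comm (comm corners)" by (rule comm_comm)
    show "comm (comm corners) \<subseteq> corners"
    proof
      fix x assume x: "x \<in> comm (comm corners)"
      show "x \<in> corners"
        unfolding corners_def
      proof (intro CollectI ballI conjI)
        fix i assume i: "i \<in> I"
        have "q i \<in> comm corners" using i by (auto simp: comm_def corners_def)
        then show xq: "x * q i = q i * x" using x by (auto simp: comm_def)
        define a where "a = p i * star (u i) * x * u i * p i"
        have pux: "p i * star (u i) * x * u i = star (u i) * x * u i * p i"
        proof -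
          have "p i * star (u i) * x * u i = star (u i) * (q i * x) * u i" using i by (simp add: uu mult.assoc)
          also have "\<dots> = star (u i) * (x * q i) * u i" using xq by simp
          also have "\<dots> = star (u i) * x * u i * p i" using i by (simp add: uu u mult.assoc)
          finally show ?thesis .
        qed
        have a1: "a = p i * star (u i) * x * u i" "a = star (u i) * x * u i * p i"
          unfolding a_def pux using i by (simp_all add: pp ppz mult.assoc flip: pux)
        have "t * a = a * t" if t: "t \<in> comm (A i)" for t
        proof -
          define T where "T = u i * t * p i * star (u i)"
          have tp: "t * p i = p i * t" using t p i by (auto simp: comm_def)
          have "T \<in> comm corners"
            unfolding comm_def
          proof (intro CollectI ballI)
            fix y assume y: "y \<in> corners"
            then obtain b where b: "b \<in> A i" "y * q i = u i * b * p i * star (u i)" and yq: "y * q i = q i * y"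
              using i by (auto simp: corners_def)
            have tb: "t * b = b * t" using t b by (auto simp: comm_def)
            have pb: "p i * b = b * p i" using abelian_A[OF i] p i b by blast
            have "T * y = T * (q i * y)" using i by (simp add: T_def uu pp ppz mult.assoc)
            also have "\<dots> = T * (u i * b * p i * star (u i))" using b yq by simp
            also have "\<dots> = u i * (t * (p i * b)) * p i * star (u i)" using i by (simp add: T_def uu mult.assoc)
            also have "\<dots> = u i * (t * b) * p i * star (u i)" using i by (simp add: pb pp ppz mult.assoc)
            also have "\<dots> = u i * b * (t * p i) * star (u i)" by (simp add: tb mult.assoc)
            also have "\<dots> = (u i * b * p i * star (u i)) * T"
              using i by (simp add: T_def uu tp pp ppz mult.assoc)
            also have "\<dots> = y * (q i * T)" unfolding b(2)[symmetric] by (simp only: mult.assoc)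
            also have "q i * T = T" using i tp by (simp add: T_def uu mult.assoc) (metis tp ppz[OF i] mult.assoc)
            finally show "T * y = y * T" .
          qed
          then have xT: "x * T = T * x" using x by (auto simp: comm_def)
          have "a * t = star (u i) * x * u i * (p i * t)" by (simp add: a1(2) mult.assoc)
          also have "\<dots> = star (u i) * (x * T) * u i" using i by (simp add: T_def uu u tp mult.assoc flip: tp)
          also have "\<dots> = t * (p i * star (u i) * x * u i)" unfolding xT using i by (simp add: T_def uu mult.assoc)
          also have "\<dots> = t * a" by (simp add: a1(1))
          finally show ?thesis ..
        qed
        then have "a \<in> A i" using i by (intro vna_comm_mem[OF vna_A]) auto
        moreover have "x * q i = u i * a * p i * star (u i)"
        proof -
          have "u i * a * p i * star (u i) = x * (u i * (p i * p i) * star (u i))"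
            using i by (simp add: a1(2) uu mult.assoc)
          then show ?thesis using i by (simp add: pp)
        qed
        ultimately show "\<exists>a\<in>A i. x * q i = u i * a * p i * star (u i)" by blast
      qed
    qed
  qed
qed

end

section \<open>Exchanging corners\<close>

lemma span_star:
  assumes "\<And>x. x \<in> S \<Longrightarrow> star x \<in> S" "x \<in> op.span S"
  shows "star x \<in> op.span S"
  using assms(2)
  by (induction rule: op.span_induct_alt) (auto simp: op.span_zero op.span_add op.span_scale op.span_base assms(1))

lemma span_minimal_projection:
  assumes S: "\<And>s. s \<in> S \<Longrightarrow> \<exists>c. s * f = sc c f \<and> f * s = sc c f"
    and g: "g \<in> op.span (insert 1 S)"
  shows "\<exists>c. g * f = sc c f \<and> f * g = sc c f"
  using g
proof (induction rule: op.span_induct_alt)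
  case base
  show ?case by (intro exI[of _ 0]) simp
next
  case (step r x y)
  have "\<exists>c. x * f = sc c f \<and> f * x = sc c f"
  proof (cases "x = 1")
    case True
    then show ?thesis by (intro exI[of _ 1]) simp
  qed (use step S in auto)
  then obtain c d where "x * f = sc c f" "f * x = sc c f" "y * f = sc d f" "f * y = sc d f" using step by blast
  then show ?case by (intro exI[of _ "r * c + d"]) (simp add: distrib_left distrib_right op.scale_left_distrib)
qed

text \<open>By \<open>cl_kernel\<close> with \<open>g = 1\<close>, a centred limit is a limit of
  centred elements.\<close>

lemma (in tracial) centre_cl:
  assumes Z: "op.subspace Z" "Z \<subseteq> M" and Y: "\<And>y. y \<in> Y \<Longrightarrow> y \<in> M \<and> y - sc (tr y) 1 \<in> Z"
    and x: "x \<in> cl Y" "tr x = 0"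
  shows "x \<in> cl Z"
proof -
  let ?Y = "{y \<in> M. y - sc (tr y) 1 \<in> Z}"
  have sub: "op.subspace ?Y"
  proof (rule op.subspaceI)
    show "0 \<in> ?Y" using op.subspace_0[OF Z(1)] by (simp add: M_closed tr_zero)
    fix x y c assume x: "x \<in> ?Y" and y: "y \<in> ?Y"
    have "(x - sc (tr x) 1) + (y - sc (tr y) 1) \<in> Z" using x y op.subspace_add[OF Z(1)] by blast
    then show "x + y \<in> ?Y" using x y by (simp add: M_closed tr_add op.scale_left_distrib algebra_simps)
  next
    fix c x assume x: "x \<in> ?Y"
    have "sc c (x - sc (tr x) 1) \<in> Z" using x op.subspace_scale[OF Z(1)] by blast
    then show "sc c x \<in> ?Y" using x by (simp add: M_closed tr_sc op.scale_right_diff_distrib)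
  qed
  have one: "1 \<in> ?Y" using op.subspace_0[OF Z(1)] by (simp add: M_closed tr_one)
  have YM: "?Y \<subseteq> M" by blast
  have "x \<in> cl ?Y" using x(1) cl_mono[of Y ?Y] Y by blast
  then have "x \<in> cl {m \<in> ?Y. tr (1 * m) = 0}"
    using x(2) by (intro cl_kernel YM sub one M_closed) (auto simp: tr_one)
  moreover have "{m \<in> ?Y. tr (1 * m) = 0} \<subseteq> Z" by auto
  ultimately show ?thesis using cl_mono by blast
qed

text \<open>\<open>w_mem\<close> stands in for a formula for \<open>w i\<close>: the unitary belongs
  to the von Neumann algebra generated by \<open>e i\<close> and \<open>p i\<close>.\<close>

locale exchange_datum = corner_datum M tr I A p u
  for M :: "'h::complex_hilbert operator set" and tr I A p u +
  fixes e w :: "nat \<Rightarrow> 'h operator"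
  assumes e: "i \<in> I \<Longrightarrow> e i \<in> A 1" "i \<in> I \<Longrightarrow> proj (e i)" "e 1 = p 1"
    "i \<in> I \<Longrightarrow> j \<in> I \<Longrightarrow> i \<noteq> j \<Longrightarrow> e i * e j = 0" "i \<in> I \<Longrightarrow> tr (e i) = tr (p i)"
    and sum_e: "sot (\<lambda>n. \<Sum>i\<in>I \<inter> {..n}. e i) 1"
    and w: "i \<in> I \<Longrightarrow> star (w i) = w i" "i \<in> I \<Longrightarrow> w i * w i = 1" "i \<in> I \<Longrightarrow> w i * e i * w i = p i"
    "i \<in> I \<Longrightarrow> w i * p i * w i = e i" "w 1 = 1"
    and w_mem: "i \<in> I \<Longrightarrow> vna L \<Longrightarrow> e i \<in> L \<Longrightarrow> p i \<in> L \<Longrightarrow> w i \<in> L"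
begin

lemma eM: "i \<in> I \<Longrightarrow> e i \<in> M"
  using e(1) A_in_M I(2) by blast

lemma wM: "i \<in> I \<Longrightarrow> w i \<in> M"
  using w_mem[OF _ M eM pM] by blast

lemma ee: "i \<in> I \<Longrightarrow> star (e i) = e i" "i \<in> I \<Longrightarrow> e i * e i = e i" "i \<in> I \<Longrightarrow> e i * (e i * z) = e i * z"
  using e(2) by (auto simp: proj_def simp flip: mult.assoc)

lemma ww: "i \<in> I \<Longrightarrow> w i * (w i * z) = z"
  by (simp add: w flip: mult.assoc)

lemma we: "i \<in> I \<Longrightarrow> w i * e i = p i * w i" "i \<in> I \<Longrightarrow> e i * w i = w i * p i"
proof -
  assume i: "i \<in> I"
  have "w i * e i = (w i * e i * w i) * w i" using w(2)[OF i] by (simp add: mult.assoc)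
  then show "w i * e i = p i * w i" by (simp only: w(3)[OF i])
  have "e i * w i = (w i * p i * w i) * w i" by (simp only: w(4)[OF i])
  then show "e i * w i = w i * p i" using w(2)[OF i] by (simp add: mult.assoc)
qed

lemma e_comm: "i \<in> I \<Longrightarrow> a \<in> A 1 \<Longrightarrow> e i * a = a * e i"
  using abelian_A[OF I(2) e(1)] by blast

lemma p_comm: "i \<in> I \<Longrightarrow> a \<in> A i \<Longrightarrow> p i * a = a * p i"
  using abelian_A[OF _ p(1)] by blast

text \<open>Outside \<open>I\<close> the family is padded with scalars, whose only centred element
  is 0, so freeness is preserved.\<close>

definition Ab :: "nat \<Rightarrow> 'h operator set" where
  "Ab i = (if i \<in> I then A i else op.span {1})"

definition Eg :: "nat \<Rightarrow> 'h operator set" where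
  "Eg i = (if i = 1 then e ` I else if i \<in> I then {p i} else {})"

text \<open>The span is already an algebra: at index 1 the projections are orthogonal, elsewhere
  there is at most one.\<close>

definition E :: "nat \<Rightarrow> 'h operator set" where "E i = op.span (insert 1 (Eg i))"

text \<open>\<open>Inl k\<close> is the index of the corner of \<open>A 1\<close> at \<open>e k\<close>; \<open>Inr (k, True)\<close> and \<open>Inr (k, False)\<close> are
  those of the corners of \<open>A k\<close> at \<open>p k\<close> and \<open>1 - p k\<close>.\<close>
fun fp :: "nat + nat \<times> bool \<Rightarrow> 'h operator" where
  "fp (Inl k) = (if k \<in> I then e k else 0)"
| "fp (Inr (k, b)) = (if k \<in> I \<and> k \<noteq> 1 then if b then p k else 1 - p k else 0)"

fun Wp :: "nat + nat \<times> bool \<Rightarrow> 'h operator" where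
  "Wp (Inl k) = (if k \<in> I then w k else 1)"
| "Wp (Inr (k, b)) = (if b \<and> k \<in> I then w k else 1)"

fun ix :: "nat + nat \<times> bool \<Rightarrow> nat" where
  "ix (Inl k) = 1"
| "ix (Inr (k, b)) = k"

fun ix' :: "nat + nat \<times> bool \<Rightarrow> nat" where
  "ix' (Inl k) = (if k \<in> I then k else 1)"
| "ix' (Inr (k, b)) = (if b then 1 else k)"

definition Pp :: "nat + nat \<times> bool \<Rightarrow> 'h operator set" where
  "Pp j = {b \<in> ctr (Ab (ix j)). b * fp j = b \<and> fp j * b = b}"

lemma Ab_subspace: "op.subspace (Ab i)"
  using A_closed(2,3,6)[of i] by (auto simp: Ab_def op.subspace_def op.span_zero op.span_add op.span_scale)

lemma Ab_one: "1 \<in> Ab i"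
  using A_closed(1) by (simp add: Ab_def op.span_base)

lemma Ab_M: "Ab i \<subseteq> M"
  using A_M span_sub[of "{1}"] M_closed(1) by (auto simp: Ab_def)

lemma scalar_span: "x \<in> op.span {1} \<Longrightarrow> \<exists>c. x = sc c 1"
  by (auto simp: op.span_singleton)

lemma ctr_scalar: "x \<in> ctr (op.span {1}) \<Longrightarrow> x = 0"
proof -
  assume x: "x \<in> ctr (op.span {1})"
  then obtain c where "x = sc c 1" using scalar_span by (auto simp: ctr_def)
  then show ?thesis using x tr_sc[OF M_closed(1)] by (simp add: ctr_def tr_one)
qed

lemma free_Ab: "free Ab"
  unfolding free_def
proof (intro allI impI)
  fix i k x assume "Alt (\<lambda>i. ctr (Ab i)) i k x"
  then have "x = 0 \<or> Alt (\<lambda>i. if i \<in> I then ctr (A i) else {}) i k x"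
  proof (induction rule: Alt.induct)
    case (single x i)
    then show ?case using ctr_scalar[of x] by (cases "i \<in> I") (auto simp: Ab_def intro: Alt.single)
  next
    case (cons x i j k y)
    show ?case
    proof (cases "i \<in> I")
      case True
      then show ?thesis using cons Alt.cons[of x "\<lambda>i. if i \<in> I then ctr (A i) else {}" i j k y]
        by (auto simp: Ab_def)
    next
      case False
      then show ?thesis using cons(1) ctr_scalar[of x] by (simp add: Ab_def)
    qed
  qed
  then show "tr x = 0" using free_A tr_zero by blast
qed

lemma E_Ab: "E i \<subseteq> Ab i"
  unfolding E_def using Ab_one[of i] e p I
  by (intro op.span_minimal Ab_subspace) (auto simp: Eg_def Ab_def)

lemma E_sub: "op.subspace (E i)" "1 \<in> E i"
  by (simp_all add: E_def op.span_base)

lemma Eg_E: "x \<in> Eg i \<Longrightarrow> x \<in> E i"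
  by (simp add: E_def op.span_base)

lemma E_mult:
  assumes "x \<in> E i" "y \<in> E i"
  shows "x * y \<in> E i"
proof (rule span_mult[OF E_sub(1) _ assms[unfolded E_def]])
  fix a b assume ab: "a \<in> insert 1 (Eg i)" "b \<in> insert 1 (Eg i)"
  have "a * b = 0 \<or> a * b \<in> insert 1 (Eg i)"
  proof (cases "a = 1 \<or> b = 1")
    case False
    then show ?thesis using ab e(4) ee(2) pp(2) by (auto simp: Eg_def split: if_splits)
  qed (use ab in auto)
  then show "a * b \<in> E i" by (auto simp: E_def op.span_zero intro: op.span_base)
qed

lemma E_star: "x \<in> E i \<Longrightarrow> star x \<in> E i"
  unfolding E_def by (rule span_star) (auto simp: Eg_def ee pp split: if_splits)

lemma e_E: "i \<in> I \<Longrightarrow> e i \<in> E 1"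
  by (intro Eg_E) (simp add: Eg_def)

lemma p_E: "i \<in> I \<Longrightarrow> p i \<in> E i"
  using e(3) by (intro Eg_E) (auto simp: Eg_def intro: rev_image_eqI[of 1])

lemma E_M: "E i \<subseteq> M"
  using E_Ab Ab_M by blast

text \<open>The moved projections stay in the \<open>E i\<close> because \<open>w k\<close>
  exchanges \<open>e k\<close> and \<open>p k\<close>, while the pieces at \<open>1 - p k\<close>
  are not moved.\<close>

sublocale swap M tr Ab E Pp fp Wp ix ix'
proof
  show "Ab i \<subseteq> M" for i by (rule Ab_M)
  show "free Ab" by (rule free_Ab)
  show "E i \<subseteq> Ab i" for i by (rule E_Ab)
  show "op.subspace (E i)" "1 \<in> E i" for i by (rule E_sub)+
  show "x * y \<in> E i" if "x \<in> E i" "y \<in> E i" for x y i using that by (rule E_mult)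
  show "Pp j \<subseteq> ctr (Ab (ix j))" for j by (auto simp: Pp_def)
  show "b * fp j = b" "fp j * b = b" if "b \<in> Pp j" for b j using that by (auto simp: Pp_def)
  have ez: "0 \<in> E i" for i by (rule op.subspace_0[OF E_sub(1)])
  have mp: "1 - p i \<in> E i" if "i \<in> I" for i using op.subspace_diff[OF E_sub(1) E_sub(2) p_E[OF that]] .
  show "fp j \<in> E (ix j)" for j using e_E p_E mp ez by (cases j rule: fp.cases) auto
  show "star (fp j) = fp j" for j by (cases j rule: fp.cases) (auto simp: ee pp)
  show "fp j * fp j = fp j" for j by (cases j rule: fp.cases) (auto simp: ee pp algebra_simps)
  show "fp j * fp k = 0" if "j \<noteq> k" "ix j = ix k" for j k
    using that e(4) by (cases j rule: fp.cases; cases k rule: fp.cases) (auto simp: pp algebra_simps)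
  show "\<exists>c. g * fp j = sc c (fp j) \<and> fp j * g = sc c (fp j)" if "g \<in> E (ix j)" for g j
  proof (rule span_minimal_projection[OF _ that[unfolded E_def]])
    fix s assume s: "s \<in> Eg (ix j)"
    have z: "\<exists>c. s * x = sc c x \<and> x * s = sc c x" if "s * x = 0" "x * s = 0" for x
      using that by (intro exI[of _ 0]) simp
    have o: "\<exists>c. s * x = sc c x \<and> x * s = sc c x" if "s * x = x" "x * s = x" for x
      using that by (intro exI[of _ 1]) simp
    show "\<exists>c. s * fp j = sc c (fp j) \<and> fp j * s = sc c (fp j)"
    proof (cases j rule: fp.cases)
      case (1 k)
      show ?thesis
      proof (cases "k \<in> I")
        case True
        obtain l where l: "l \<in> I" "s = e l" using s 1 by (auto simp: Eg_def)
        show ?thesis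
        proof (cases "k = l")
          case True
          then show ?thesis using 1 l ee(2) by (intro o) auto
        next
          case False
          then show ?thesis using 1 l \<open>k \<in> I\<close> e(4) by (intro z) auto
        qed
      qed (use 1 z in auto)
    next
      case (2 k b)
      show ?thesis
      proof (cases "k \<in> I \<and> k \<noteq> 1")
        case True
        then have sp: "s = p k" using s 2 by (auto simp: Eg_def)
        show ?thesis
        proof (cases b)
          case True
          then show ?thesis using 2 sp pp(2) \<open>k \<in> I \<and> k \<noteq> 1\<close> by (intro o) auto
        next
          case False
          then show ?thesis using 2 sp pp(2) \<open>k \<in> I \<and> k \<noteq> 1\<close> by (intro z) (auto simp: algebra_simps)
        qed
      next
        case False
        then have "fp j = 0" using 2 by auto
        then show ?thesis using z by simp
      qed
    qed
  qed
  have L: "vna (cl (wspan E))" by (rule cl_wspan_vna[of E, OF E_sub E_M E_mult E_star])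
  have Ecl: "E i \<subseteq> cl (wspan E)" for i
    using wspan_sup[of E, OF E_sub E_M] cl_sup[OF wspan_M[of E, OF E_M]] by blast
  have wL: "w i \<in> cl (wspan E)" if "i \<in> I" for i
    using w_mem[OF that L] Ecl e_E[OF that] p_E[OF that] by blast
  show "Wp j \<in> cl (wspan E)" for j
    using wL vna_closed(1)[OF L] by (cases j rule: fp.cases) auto
  show "Wp j * Wp j = 1" for j using w(2) by (cases j rule: fp.cases) auto
  show "Wp j * fp j * Wp j \<in> E (ix' j)" for j
    using w(3,4) e_E p_E mp ez by (cases j rule: fp.cases) auto
qed

section \<open>The exchanged algebras\<close>

text \<open>At index 1 only scalars are taken: the exchanged algebra there is the sum of the
  corners, the free partner of the algebra that the other \<open>B k\<close> generate.\<close>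

definition B :: "nat \<Rightarrow> 'h operator set" where
  "B k = (if k \<in> I \<and> k \<noteq> 1 then {w k * a * e k * w k + b * (1 - p k) |a b. a \<in> A 1 \<and> b \<in> A k}
     else op.span {1})"

definition L'' :: "nat \<Rightarrow> 'h operator set" where
  "L'' i = (if i = 1 then {} else L' i)"

lemma B_mem: "k \<in> I \<Longrightarrow> k \<noteq> 1 \<Longrightarrow> a \<in> A 1 \<Longrightarrow> b \<in> A k \<Longrightarrow> w k * a * e k * w k + b * (1 - p k) \<in> B k"
  by (auto simp: B_def)

lemma B_cases:
  assumes "x \<in> B k"
  obtains a b where "k \<in> I" "k \<noteq> 1" "a \<in> A 1" "b \<in> A k" "x = w k * a * e k * w k + b * (1 - p k)"
  | c where "\<not> (k \<in> I \<and> k \<noteq> 1)" "x = sc c 1"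
  using assms scalar_span unfolding B_def by (auto split: if_splits)

lemma B_subspace: "op.subspace (B k)"
proof (cases "k \<in> I \<and> k \<noteq> 1")
  case True
  then have k: "k \<in> I" "k \<noteq> 1" by auto
  note c1 = A_closed[OF I(2)] and ck = A_closed[OF k(1)]
  show ?thesis
  proof (rule op.subspaceI)
    show "0 \<in> B k" using B_mem[OF k c1(2) ck(2)] by simp
  next
    fix x y assume "x \<in> B k" "y \<in> B k"
    then obtain a b a' b' where x: "x = w k * a * e k * w k + b * (1 - p k)" "a \<in> A 1" "b \<in> A k"
      and y: "y = w k * a' * e k * w k + b' * (1 - p k)" "a' \<in> A 1" "b' \<in> A k"
      using k by (auto simp: B_def)
    have "x + y = w k * (a + a') * e k * w k + (b + b') * (1 - p k)" by (simp add: x y algebra_simps)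
    then show "x + y \<in> B k" using B_mem[OF k c1(3)[OF x(2) y(2)] ck(3)[OF x(3) y(3)]] by simp
  next
    fix c x assume "x \<in> B k"
    then obtain a b where x: "x = w k * a * e k * w k + b * (1 - p k)" "a \<in> A 1" "b \<in> A k"
      using k by (auto simp: B_def)
    have "sc c x = w k * sc c a * e k * w k + sc c b * (1 - p k)" by (simp add: x op.scale_right_distrib)
    then show "sc c x \<in> B k" using B_mem[OF k c1(6)[OF x(2)] ck(6)[OF x(3)]] by simp
  qed
next
  case False
  then have "B k = op.span {1}" by (simp only: B_def if_False)
  then show ?thesis by simp
qed

lemma B_one: "1 \<in> B k"
proof (cases "k \<in> I \<and> k \<noteq> 1")
  case True
  then have "w k * 1 * e k * w k + 1 * (1 - p k) = 1" by (simp add: w)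
  then show ?thesis using B_mem[of k 1 1] True A_closed(1) I(2) by simp
next
  case False
  then have "B k = op.span {1}" by (simp only: B_def if_False)
  then show ?thesis by (simp add: op.span_base)
qed

lemma B_M: "B k \<subseteq> M"
proof
  fix x assume "x \<in> B k"
  then show "x \<in> M"
  proof (cases rule: B_cases)
    case (1 a b)
    then show ?thesis using A_in_M[OF I(2)] A_in_M[of k] wM eM pM by (auto intro!: M_closed)
  qed (simp add: M_closed)
qed

lemma B_mult:
  assumes x: "x \<in> B k" and y: "y \<in> B k"
  shows "x * y \<in> B k"
  using x
proof (cases rule: B_cases)
  case (2 c)
  then show ?thesis using op.subspace_scale[OF B_subspace y] by simp
next
  case (1 a b)
  note k = 1(1,2)
  obtain a' b' where ab: "a' \<in> A 1" "b' \<in> A k" "y = w k * a' * e k * w k + b' * (1 - p k)"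
    using y k by (auto simp: B_def)
  have aa: "e k * a' = a' * e k" "e k * a = a * e k" "p k * b' = b' * p k"
    using e_comm p_comm k ab 1 by auto
  have t1: "(w k * a * e k * w k) * (w k * a' * e k * w k) = w k * (a * a') * e k * w k"
    using k by (simp add: mult.assoc ww) (metis aa(1) ee(3) mult.assoc)
  have z: "p k * (1 - p k) = 0" "(1 - p k) * p k = 0" using k by (simp_all add: algebra_simps pp)
  have t2: "(w k * a * e k * w k) * (b' * (1 - p k)) = 0"
  proof -
    have "w k * a * e k * w k = w k * a * w k * p k" using we(2)[OF k(1)] by (simp add: mult.assoc)
    then have "(w k * a * e k * w k) * (b' * (1 - p k)) = w k * a * w k * (p k * b') * (1 - p k)" by (simp add: mult.assoc)
    also have "\<dots> = w k * a * w k * b' * (p k * (1 - p k))" by (simp only: aa mult.assoc)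
    finally show ?thesis using z by simp
  qed
  have t3: "(b * (1 - p k)) * (w k * a' * e k * w k) = 0"
  proof -
    have "w k * a' * e k * w k = p k * (w k * a' * w k)"
      using we(1)[OF k(1)] by (simp add: mult.assoc flip: aa(1)) (simp flip: mult.assoc)
    then have "(b * (1 - p k)) * (w k * a' * e k * w k) = b * ((1 - p k) * p k) * (w k * a' * w k)" by (simp add: mult.assoc)
    then show ?thesis using z by simp
  qed
  have t4: "(b * (1 - p k)) * (b' * (1 - p k)) = (b * b') * (1 - p k)"
  proof -
    have "(1 - p k) * b' = b' * (1 - p k)" using aa(3) by (simp add: algebra_simps)
    then have "(b * (1 - p k)) * (b' * (1 - p k)) = (b * b') * ((1 - p k) * (1 - p k))"
      by (metis mult.assoc)
    then show ?thesis using k by (simp add: algebra_simps pp)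
  qed
  have "x * y = w k * (a * a') * e k * w k + (b * b') * (1 - p k)"
    unfolding 1(5) ab(3) distrib_left distrib_right t1 t2 t3 t4 by simp
  then show ?thesis
    using B_mem[OF k A_closed(5)[OF I(2) 1(3) ab(1)] A_closed(5)[OF k(1) 1(4) ab(2)]] by simp
qed

lemma B_star:
  assumes x: "x \<in> B k"
  shows "star x \<in> B k"
  using x
proof (cases rule: B_cases)
  case (2 c)
  then show ?thesis using op.subspace_scale[OF B_subspace B_one] by simp
next
  case (1 a b)
  note k = 1(1,2)
  have s: "star a \<in> A 1" "star b \<in> A k" using 1 A_closed(8) I(2) by auto
  have "star x = w k * (e k * star a) * w k + (star b - p k * star b)"
    using k by (simp add: 1(5) w ee pp mult.assoc algebra_simps)
  also have "\<dots> = w k * star a * e k * w k + star b * (1 - p k)"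
    using e_comm[OF k(1) s(1)] p_comm[OF k(1) s(2)] by (simp add: mult.assoc algebra_simps)
  finally show ?thesis using B_mem[OF k s] by simp
qed

lemmas B_family = B_subspace B_one B_M B_mult B_star

text \<open>Subtracting a multiple of \<open>f\<close> rather than of 1 centres \<open>y\<close>
  inside the corner. If \<open>tr f = 0\<close> the quotient is 0 by convention, and
  \<open>y = 0\<close> because \<open>f = 0\<close>.\<close>

lemma centred_piece:
  assumes f: "proj f" "f \<in> Ab i" and y: "y \<in> Ab i" "y * f = y" "f * y = y"
  shows "y - sc (tr y / tr f) f \<in> ctr (Ab i)" "(y - sc (tr y / tr f) f) * f = y - sc (tr y / tr f) f"
    "f * (y - sc (tr y / tr f) f) = y - sc (tr y / tr f) f"
proof -
  have ff: "f * f = f" "star f = f" using f by (auto simp: proj_def)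
  show "(y - sc (tr y / tr f) f) * f = y - sc (tr y / tr f) f"
    "f * (y - sc (tr y / tr f) f) = y - sc (tr y / tr f) f"
    using y ff by (simp_all add: algebra_simps)
  have M: "f \<in> M" "y \<in> M" using f y Ab_M by auto
  have "tr (y - sc (tr y / tr f) f) = 0"
  proof (cases "tr f = 0")
    case True
    then have "f = 0" using tr_ge0_zero[OF M(1) proj_ge0[OF f(1)]] by simp
    then show ?thesis using y tr_zero by simp
  next
    case False
    then show ?thesis using M by (simp add: tr_diff tr_sc M_closed)
  qed
  moreover have "y - sc (tr y / tr f) f \<in> Ab i"
    using f y by (intro op.subspace_diff op.subspace_scale Ab_subspace)
  ultimately show "y - sc (tr y / tr f) f \<in> ctr (Ab i)" by (simp add: ctr_def)
qed

lemma P'_L': "x \<in> P' j \<Longrightarrow> ix' j = i \<Longrightarrow> x \<in> L' i"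
  unfolding L'_def by blast

lemma tr_P': "x \<in> P' j \<Longrightarrow> tr x = 0 \<and> x \<in> M"
  using swapped_free[OF Alt.single, of x "ix' j"] L'_M[of "ix' j"] P'_L'[of x j "ix' j"] by blast

lemma ctr_B: "ctr (B k) \<subseteq> op.span (L'' k)"
proof
  fix x assume x: "x \<in> ctr (B k)"
  then have "x \<in> B k" by (simp add: ctr_def)
  then show "x \<in> op.span (L'' k)"
  proof (cases rule: B_cases)
    case (2 c)
    then have "x = 0" using x tr_sc[OF M_closed(1), of c] by (simp add: ctr_def tr_one)
    then show ?thesis by (simp add: op.span_zero)
  next
    case (1 a b)
    note k = 1(1,2)
    have k1: "1 - p k \<in> A k" using A_closed(1,4)[OF k(1)] p k by blast
    define l where "l = tr (a * e k) / tr (e k)"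
    define m where "m = tr (b * (1 - p k)) / tr (1 - p k)"
    define c where "c = a * e k - sc l (e k)"
    define d where "d = b * (1 - p k) - sc m (1 - p k)"
    have Abk: "Ab k = A k" "Ab 1 = A 1" using k I by (auto simp: Ab_def)
    have "c \<in> Pp (Inl k)"
    proof -
      have ae: "a * e k \<in> Ab 1" "e k \<in> Ab 1" 
        unfolding Abk using A_closed(5)[OF I(2) 1(3) e(1)[OF k(1)]] e(1)[OF k(1)] by simp_all
      have "a * e k * e k = a * e k" using ee(2)[OF k(1)] by (simp add: mult.assoc)
      moreover have "e k * (a * e k) = a * e k"
        using e_comm[OF k(1) 1(3)] ee(2)[OF k(1)] by (metis mult.assoc)
      ultimately show ?thesis
        using centred_piece[OF e(2)[OF k(1)] ae(2,1)] k by (simp add: Pp_def c_def l_def)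
    qed
    then have cP: "w k * c * w k \<in> P' (Inl k)" using k by (auto simp: P'_def)
    have "d \<in> Pp (Inr (k, False))"
    proof -
      have ae: "b * (1 - p k) \<in> Ab k" "1 - p k \<in> Ab k" using 1 k1 A_closed(5) by (auto simp: Abk)
      have pr: "proj (1 - p k)" using p k proj_compl by blast
      have e2: "b * (1 - p k) * (1 - p k) = b * (1 - p k)" using pr by (simp add: proj_def mult.assoc)
      have "(1 - p k) * b = b * (1 - p k)" using p_comm[OF k(1) 1(4)] by (simp add: algebra_simps)
      then have "(1 - p k) * (b * (1 - p k)) = b * (1 - p k)" using e2 by (metis mult.assoc)
      with e2 show ?thesis
        using centred_piece[OF pr ae(2,1)] k by (simp add: Pp_def d_def m_def)
    qed
    then have dP: "d \<in> P' (Inr (k, False))" using k by (auto simp: P'_def)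
    \<comment> \<open>The multiples subtracted in the two corners recombine to an element of
      \<open>E k\<close>. It is centred because \<open>x\<close> and both pieces are.\<close>
    define g where "g = sc l (p k) + sc m (1 - p k)"
    have gE: "g \<in> E k"
      unfolding g_def using p_E[OF k(1)] E_sub by (intro op.subspace_add op.subspace_scale op.subspace_diff)
    have xg: "x = g + w k * c * w k + d"
      using w(3)[OF k(1)] by (simp add: 1(5) g_def c_def d_def algebra_simps)
    have "tr g = 0"
      using x tr_P'[OF cP] tr_P'[OF dP] subsetD[OF E_M gE] by (simp add: xg ctr_def tr_add M_closed)
    then have "g \<in> L' k" using gE by (simp add: L'_def ctr_def)
    moreover have "w k * c * w k \<in> L' k" using P'_L'[OF cP] k by simp
    moreover have "d \<in> L' k" using P'_L'[OF dP] by simp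
    moreover have "L'' k = L' k" using k by (simp add: L''_def)
    ultimately show ?thesis unfolding xg by (simp only: op.span_add op.span_base)
  qed
qed

lemma L''_M: "L'' i \<subseteq> M"
  using L'_M by (simp add: L''_def)

lemma Alt_L'': "Alt L'' i k x \<Longrightarrow> i \<noteq> 1 \<and> k \<noteq> 1 \<and> Alt L' i k x"
  by (induction rule: Alt.induct) (auto simp: L''_def split: if_splits intro: Alt.intros)

definition Q0 :: "'h operator set" where "Q0 = vhull (\<Union>k. B k)"

definition words'' :: "'h operator set" where "words'' = {x. \<exists>i k. Alt L'' i k x}"

lemma words''_M: "words'' \<subseteq> M"
  unfolding words''_def using Alt_M[OF _ L''_M] by auto

lemma Q0_cl: "Q0 \<subseteq> cl (wspan B)"
  unfolding Q0_def by (rule vhull_cl_wspan[of B, OF B_family])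

text \<open>Words in \<open>L''\<close> neither begin nor end with index 1, so they fit between
  letters of \<open>L' 1\<close>. The letters span the centred part of each \<open>B i\<close>, and
  \<open>centre_cl\<close> passes to the closure.\<close>

lemma ctr_Q0: "ctr Q0 \<subseteq> cl (op.span words'')"
proof
  fix x assume x: "x \<in> ctr Q0"
  have Z: "op.span words'' \<subseteq> M" by (rule span_sub[OF words''_M])
  have sub: "op.subspace (cl (op.span words''))" by (rule cl_subspace[OF Z]) simp
  have "y \<in> M \<and> y - sc (tr y) 1 \<in> cl (op.span words'')" if "y \<in> wspan B" for y
    using that unfolding wspan_def
  proof (induction rule: op.span_induct_alt)
    case base
    then show ?case using op.subspace_0[OF sub] by (simp add: M_closed tr_zero)
  next
    case (step c v y)
    have v: "v \<in> M \<and> v - sc (tr v) 1 \<in> cl (op.span words'')"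
    proof (cases "v = 1")
      case True
      then show ?thesis using op.subspace_0[OF sub] by (simp add: M_closed tr_one)
    next
      case False
      then obtain i k where v: "Alt (\<lambda>i. ctr (B i)) i k v" using step by blast
      have cB: "ctr (B i) \<subseteq> cl (op.span (L'' i))" for i
        using ctr_B cl_sup[OF span_sub[OF L''_M]] by blast
      have "v \<in> cl (op.span {y. Alt L'' i k y})" by (rule Alt_cl[OF cB L''_M v])
      moreover have "cl (op.span {y. Alt L'' i k y}) \<subseteq> cl (op.span words'')"
        unfolding words''_def by (intro cl_mono op.span_mono) blast
      moreover have "tr v = 0"
      proof (rule Alt_cl_tr[OF v cB L''_M])
        show "tr y = 0" if "Alt L'' i k y" for i k y using swapped_free Alt_L''[OF that] by blast
      qed
      moreover have "v \<in> M" by (rule Alt_ctr_M[OF v B_M])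
      ultimately show ?thesis by auto
    qed
    have "sc c (v - sc (tr v) 1) + (y - sc (tr y) 1) \<in> cl (op.span words'')"
      using v step by (intro op.subspace_add op.subspace_scale sub) auto
    moreover have "sc c v + y - sc (tr (sc c v + y)) 1 = sc c (v - sc (tr v) 1) + (y - sc (tr y) 1)"
      using v step by (simp add: tr_add tr_sc M_closed op.scale_left_distrib op.scale_right_diff_distrib)
    ultimately have "sc c v + y - sc (tr (sc c v + y)) 1 \<in> cl (op.span words'')" by (simp only:)
    then show ?case using v step by (simp add: M_closed)
  qed
  then have "x \<in> cl (cl (op.span words''))"
    using x Q0_cl by (intro centre_cl[OF sub cl_M, of "wspan B"]) (auto simp: ctr_def)
  then show "x \<in> cl (op.span words'')" using cl_cl[OF Z] by simp
qed

text \<open>A partial sum of the \<open>e i\<close> cuts out finitely many corners of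
  \<open>x\<close>. Each is a multiple of \<open>e i\<close> plus a moved centred piece, and the
  multiples combine to an element of \<open>E 1\<close>.\<close>

lemma standard_corner_cl:
  assumes x: "x \<in> M" "tr x = 0"
    and c: "\<And>i. i \<in> I \<Longrightarrow> x * e i = e i * x" "\<And>i. i \<in> I \<Longrightarrow> \<exists>a\<in>A i. x * e i = w i * a * p i * w i"
  shows "x \<in> cl (op.span (L' 1))"
proof -
  have sub: "op.subspace (op.span (L' 1))" by simp
  have LM: "op.span (L' 1) \<subseteq> M" by (rule span_sub[OF L'_M])
  have each: "\<exists>l b. x * e i = sc l (e i) + b \<and> b \<in> L' 1" if i: "i \<in> I" for i
  proof -
    obtain a where a: "a \<in> A i" "x * e i = w i * a * p i * w i" using c(2)[OF i] by blast
    have Abi: "Ab i = A i" using i by (simp add: Ab_def)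
    define l where "l = tr (a * p i) / tr (p i)"
    define b where "b = a * p i - sc l (p i)"
    have ap: "a * p i \<in> Ab i" "p i \<in> Ab i" using a p i A_closed(5) by (auto simp: Abi)
    have e2: "a * p i * p i = a * p i" using pp(2)[OF i] by (simp add: mult.assoc)
    have "p i * (a * p i) = a * p i" using p_comm[OF i a(1)] e2 by (metis mult.assoc)
    note cp = centred_piece[OF p(2)[OF i] ap(2,1) e2 this]
    have "w i * b * w i \<in> L' 1"
    proof (cases "i = 1")
      case True
      then have "b \<in> Pp (Inl 1)" using cp e(3) I by (simp add: Pp_def b_def l_def)
      then have "w i * b * w i \<in> P' (Inl 1)" using True I w(5) by (auto simp: P'_def)
      then show ?thesis using P'_L' I by simp
    next
      case False
      then have "b \<in> Pp (Inr (i, True))" using cp i by (simp add: Pp_def b_def l_def)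
      then have "w i * b * w i \<in> P' (Inr (i, True))" using i by (auto simp: P'_def)
      then show ?thesis using P'_L' by simp
    qed
    moreover have "x * e i = sc l (e i) + w i * b * w i"
      using a(2) w(4)[OF i] by (simp add: b_def algebra_simps)
    ultimately show ?thesis by blast
  qed
  define s where "s n = (\<Sum>i\<in>I \<inter> {..n}. e i)" for n
  have sp: "s n \<in> M" "star (s n) = s n" "s n \<le> s (Suc n)" for n
    unfolding s_def using sum_proj(1-3)[of e] eM e(2) by blast+
  have fin: "\<exists>g b. (\<Sum>i\<in>F. x * e i) = g + b \<and> g \<in> E 1 \<and> b \<in> op.span (L' 1)"
    if "finite F" "F \<subseteq> I" for F
    using that
  proof (induction F rule: finite_induct)
    case empty
    show ?case by (intro exI[of _ 0]) (simp add: op.span_zero op.subspace_0[OF E_sub(1)])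
  next
    case (insert i F)
    then obtain g b where gb: "(\<Sum>i\<in>F. x * e i) = g + b" "g \<in> E 1" "b \<in> op.span (L' 1)" by blast
    obtain l c where lc: "x * e i = sc l (e i) + c" "c \<in> L' 1" using each insert by blast
    have "sc l (e i) + g \<in> E 1"
      using gb e_E insert by (intro op.subspace_add op.subspace_scale E_sub(1)) auto
    moreover have "c + b \<in> op.span (L' 1)" by (rule op.span_add[OF op.span_base[OF lc(2)] gb(3)])
    moreover have "(\<Sum>i\<in>insert i F. x * e i) = (sc l (e i) + g) + (c + b)"
      using insert gb lc by simp
    ultimately show ?case by blast
  qed
  have xs: "x * s n \<in> M \<and> x * s n - sc (tr (x * s n)) 1 \<in> op.span (L' 1)" for n
  proof -
    obtain g b where gb: "x * s n = g + b" "g \<in> E 1" "b \<in> op.span (L' 1)"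
      using fin[of "I \<inter> {..n}"] by (auto simp: s_def sum_distrib_left)
    have "tr b = 0"
    proof (rule linear_zero[OF tr_add tr_sc L'_M _ gb(3)])
      show "tr x = 0" if "x \<in> L' 1" for x using swapped_free[OF Alt.single[of x L' 1]] that by blast
    qed
    moreover have M: "g \<in> M" "b \<in> M" using gb E_M LM by auto
    ultimately have t: "tr (g + b) = tr g" by (simp add: tr_add)
    have "g - sc (tr g) 1 \<in> L' 1" using split_ctr[OF E_sub gb(2) E_M] by (simp add: L'_def)
    then have "(g - sc (tr g) 1) + b \<in> op.span (L' 1)" by (rule op.span_add[OF op.span_base gb(3)])
    moreover have "x * s n - sc (tr (x * s n)) 1 = (g - sc (tr g) 1) + b" unfolding gb(1) t by simp
    ultimately show ?thesis using x sp(1) by (simp add: M_closed)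
  qed
  have "x \<in> cl (range (\<lambda>n. x * s n))"
    unfolding cl_def
  proof (intro CollectI conjI allI impI)
    fix \<epsilon> :: real assume "0 < \<epsilon>"
    have "(\<lambda>n. opn x * n2 (1 - s n)) \<longlonglongrightarrow> opn x * 0"
      using n2_lim[of s 1, OF sp] sum_e by (intro tendsto_intros) (simp add: s_def[abs_def])
    then have "\<forall>\<^sub>F n in sequentially. opn x * n2 (1 - s n) < \<epsilon>"
      using \<open>0 < \<epsilon>\<close> by (intro order_tendstoD) auto
    then obtain n where n: "opn x * n2 (1 - s n) < \<epsilon>" by (auto simp: eventually_sequentially)
    have "n2 (x - x * s n) \<le> opn x * n2 (1 - s n)"
      using n2_mult_left[of x "1 - s n"] x sp(1) by (simp add: right_diff_distrib M_closed)
    then show "\<exists>a\<in>range (\<lambda>n. x * s n). n2 (x - a) < \<epsilon>" using n by (auto intro: order_le_less_trans)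
  qed (rule x)
  then show ?thesis using xs x(2) by (intro centre_cl[OF sub LM]) auto
qed

text \<open>Blocks from \<open>words''\<close> alternating with letters of \<open>L' 1\<close> form
  an alternating word in \<open>L'\<close>, to which \<open>swapped_free\<close> applies;
  \<open>Alt_cl_tr\<close> passes to the limits.\<close>

lemma free_pair:
  assumes X: "\<And>x. x \<in> X \<Longrightarrow> tr x = 0 \<Longrightarrow> x \<in> cl (op.span (L' 1))"
    and y: "Alt (\<lambda>b. if b then ctr X else ctr Q0) b c y"
  shows "tr y = 0"
proof (rule Alt_cl_tr[OF y])
  let ?G = "\<lambda>b. if b then L' 1 else words''"
  show "(if b then ctr X else ctr Q0) \<subseteq> cl (op.span (?G b))" for b
    using X ctr_Q0 by (auto simp: ctr_def)
  show "?G b \<subseteq> M" for b using L'_M words''_M by simp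
  fix b c y assume "Alt ?G b c y"
  then have "\<exists>i k. Alt L' i k y \<and> (b \<longleftrightarrow> i = 1) \<and> (c \<longleftrightarrow> k = 1)"
  proof (induction rule: Alt.induct)
    case (single x b)
    show ?case
    proof (cases b)
      case True
      then show ?thesis using single Alt.single[of x L' 1] by auto
    next
      case False
      then show ?thesis using single Alt_L'' by (auto simp: words''_def) blast
    qed
  next
    case (cons x b c d y)
    then obtain i k where ik: "Alt L' i k y" "c \<longleftrightarrow> i = 1" "d \<longleftrightarrow> k = 1" by blast
    show ?case
    proof (cases b)
      case True
      then have "Alt L' 1 k (x * y)" using cons ik by (intro Alt.cons) auto
      then show ?thesis using True ik by blast
    next
      case False
      then obtain j l where "Alt L'' j l x" using cons by (auto simp: words''_def)
      then have jl: "j \<noteq> 1" "l \<noteq> 1" "Alt L' j l x" using Alt_L'' by blast+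
      then have "Alt L' j k (x * y)" using ik False cons by (intro Alt_append[OF jl(3) ik(1)]) auto
      then show ?thesis using False ik jl by blast
    qed
  qed
  then show "tr y = 0" using swapped_free by blast
qed

end

section \<open>The free complement\<close>

lemma star_sum: "star (\<Sum>i\<in>F. g i) = (\<Sum>i\<in>F. star (g i))"
  by (induction F rule: infinite_finite_induct) auto

lemma sum_orthogonal:
  fixes g h :: "nat \<Rightarrow> 'a::ring"
  assumes "\<And>i j. i \<in> F \<Longrightarrow> j \<in> F \<Longrightarrow> i \<noteq> j \<Longrightarrow> g i * h j = 0"
  shows "(\<Sum>i\<in>F. g i) * (\<Sum>i\<in>F. h i) = (\<Sum>i\<in>F. g i * h i)"
proof (cases "finite F")
  case True
  have "(\<Sum>i\<in>F. g i) * (\<Sum>i\<in>F. h i) = (\<Sum>i\<in>F. \<Sum>j\<in>F. g i * h j)" by (rule sum_product)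
  also have "\<dots> = (\<Sum>i\<in>F. \<Sum>j\<in>F. if j = i then g i * h i else 0)"
    using assms by (intro sum.cong refl) auto
  also have "\<dots> = (\<Sum>i\<in>F. g i * h i)" using True by simp
  finally show ?thesis .
qed simp

lemma sot_of_increments:
  assumes d: "\<And>m n. n \<le> m \<Longrightarrow> star (S m - S n) * (S m - S n) = s m - s n"
    and b: "\<And>n. star (S n) * S n \<le> 1" and s: "sot s t"
  shows "\<exists>W. sot S W" and "norm (ap (S n) v) \<le> 1 * norm v"
proof -
  have sq: "Re (cinner v (ap (star x * x) v)) = (norm (ap x v))\<^sup>2" for x :: "'a operator" and v
    by (simp add: cinner_star' cinner_self flip: of_real_power)
  show bd: "norm (ap (S n) v) \<le> 1 * norm v" for n v
  proof (rule power2_le_imp_le)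
    have "Re (cinner v (ap (star (S n) * S n) v)) \<le> Re (cinner v (ap 1 v))" using b[of n] unfolding operator_le by blast
    then show "(norm (ap (S n) v))\<^sup>2 \<le> (1 * norm v)\<^sup>2" unfolding sq by (simp add: cinner_self flip: of_real_power)
  qed simp
  show "\<exists>W. sot S W"
  proof (rule sot_exists[OF _ bd])
    fix v
    show "Cauchy (\<lambda>n. ap (S n) v)"
    proof (rule metric_CauchyI)
      fix e :: real assume "0 < e"
      let ?q = "\<lambda>n. Re (cinner v (ap (s n) v))"
      have "Cauchy ?q" using sot_quad[OF s] LIMSEQ_imp_Cauchy by blast
      then obtain N where N: "\<And>m n. m \<ge> N \<Longrightarrow> n \<ge> N \<Longrightarrow> dist (?q m) (?q n) < e\<^sup>2"
        using metric_CauchyD[of ?q "e\<^sup>2"] \<open>0 < e\<close> by force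
      have "norm (ap (S m) v - ap (S n) v) < e" if "N \<le> n" "n \<le> m" for m n
      proof (rule power2_less_imp_less)
        have "(norm (ap (S m - S n) v))\<^sup>2 = ?q m - ?q n"
          using sq[of v "S m - S n"] unfolding d[OF that(2)] by (simp add: cinner_simps)
        then show "(norm (ap (S m) v - ap (S n) v))\<^sup>2 < e\<^sup>2"
          using N[of m n] that by (simp add: dist_real_def)
      qed (use \<open>0 < e\<close> in simp)
      then show "\<exists>M. \<forall>m\<ge>M. \<forall>n\<ge>M. dist (ap (S m) v) (ap (S n) v) < e"
        by (metis dist_norm dist_commute nle_le)
    qed
  qed
qed

text \<open>Taking adjoints is not strongly continuous, so the convergence of
  \<open>star (S n)\<close> is derived separately, from \<open>r\<close>, and its limit is then
  identified with \<open>star W\<close> through inner products.\<close>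

lemma unitary_of_increments:
  assumes d: "\<And>m n. n \<le> m \<Longrightarrow> star (S m - S n) * (S m - S n) = s m - s n"
    "\<And>m n. n \<le> m \<Longrightarrow> (S m - S n) * star (S m - S n) = r m - r n"
    and sr: "\<And>n. star (S n) * S n = s n" "\<And>n. S n * star (S n) = r n"
    and b: "\<And>n. s n \<le> 1" "\<And>n. r n \<le> 1" and lim: "sot s 1" "sot r 1"
  obtains W where "sot S W" "star W * W = 1" "W * star W = 1"
proof -
  obtain W where W: "sot S W" using sot_of_increments(1)[of S s, OF d(1)] sr b lim by metis
  have d2: "star (star (S m) - star (S n)) * (star (S m) - star (S n)) = r m - r n" if "n \<le> m" for m n
    using d(2)[OF that] by simp
  obtain V where V: "sot (\<lambda>n. star (S n)) V"
    using sot_of_increments(1)[of "\<lambda>n. star (S n)" r, OF d2] sr b lim by (metis star_simps(1))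
  have VW: "star W = V"
  proof (rule star_eqI)
    fix v w
    have "(\<lambda>n. cinner (ap (star (S n)) v) w) \<longlonglongrightarrow> cinner (ap V v) w"
      using V unfolding sot_def by (intro tendsto_cinner) auto
    moreover have "(\<lambda>n. cinner v (ap (S n) w)) \<longlonglongrightarrow> cinner v (ap W w)"
      using W unfolding sot_def by (intro tendsto_cinner) auto
    ultimately show "cinner (ap V v) w = cinner v (ap W w)"
      unfolding cinner_star by (rule LIMSEQ_unique)
  qed
  have bd: "norm (ap (S n) v) \<le> 1 * norm v" "norm (ap (star (S n)) v) \<le> 1 * norm v" for n v
    using sot_of_increments(2)[of S s, OF d(1)] sot_of_increments(2)[of "\<lambda>n. star (S n)" r, OF d2] sr b lim
    by (metis star_simps(1))+
  have "sot (\<lambda>n. star (S n) * S n) (V * W)" using V W bd(2) by (rule sot_mult)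
  then have "V * W = 1" unfolding sr by (rule sot_unique[OF _ lim(1)])
  moreover have "sot (\<lambda>n. S n * star (S n)) (W * V)" using W V bd(1) by (rule sot_mult)
  then have "W * V = 1" unfolding sr by (rule sot_unique[OF _ lim(2)])
  ultimately show thesis using that W VW by blast
qed

lemma vna_conjugate:
  assumes W: "star W * W = 1" "W * star W = 1" and L: "vna L"
  shows "vna {x. W * x * star W \<in> L}"
proof -
  let ?L = "{x. W * x * star W \<in> L}"
  have W1: "star W * (W * x) = x" "W * (star W * x) = x" for x by (simp_all add: W flip: mult.assoc)
  have "comm (comm ?L) \<subseteq> ?L"
  proof
    fix x assume x: "x \<in> comm (comm ?L)"
    have "t * (W * x * star W) = (W * x * star W) * t" if t: "t \<in> comm L" for t
    proof -
      have "star W * t * W \<in> comm ?L"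
        unfolding comm_def
      proof (intro CollectI ballI)
        fix y assume y: "y \<in> ?L"
        have "(star W * t * W) * y = star W * (t * (W * y * star W)) * W" by (simp add: mult.assoc W)
        also have "t * (W * y * star W) = (W * y * star W) * t" using t y by (simp add: comm_def)
        finally show "star W * t * W * y = y * (star W * t * W)" by (simp add: mult.assoc W1)
      qed
      then have "x * (star W * t * W) = (star W * t * W) * x" using x by (simp add: comm_def)
      then have "W * (x * (star W * t * W)) * star W = W * ((star W * t * W) * x) * star W" by simp
      then show ?thesis by (simp add: mult.assoc W1 W)
    qed
    then show "x \<in> ?L" using vna_comm_mem[OF L] by simp
  qed
  moreover have "star x \<in> ?L" if "x \<in> ?L" for x
    using vna_closed(8)[OF L, of "W * x * star W"] that by (simp add: mult.assoc)
  ultimately show ?thesis unfolding vna_def using comm_comm[of ?L] by blast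
qed

context exchange_datum
begin

text \<open>\<open>w i * p i * star (u i)\<close> is a partial isometry from the range of
  \<open>q i\<close> onto that of \<open>e i\<close>. Both families of projections sum to 1, so
  these partial isometries sum to a unitary.\<close>

lemma conj_unitary_exists:
  obtains W where "W \<in> M" "star W * W = 1" "W * star W = 1"
    "\<And>i. i \<in> I \<Longrightarrow> W * q i = w i * p i * star (u i)" "\<And>i. i \<in> I \<Longrightarrow> e i * W = w i * p i * star (u i)"
proof -
  define g where "g i = w i * p i * star (u i)" for i
  define S where "S n = (\<Sum>i\<in>I \<inter> {..n}. g i)" for n
  have gs: "star (g i) = u i * p i * w i" if "i \<in> I" for i
    using that by (simp add: g_def pp w mult.assoc)
  have wwp: "p i * (w i * (w i * x)) = p i * x" if "i \<in> I" for i x using that by (simp add: ww)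
  have gg: "star (g i) * g i = q i" "g i * star (g i) = e i" if i: "i \<in> I" for i
  proof -
    show "star (g i) * g i = q i" unfolding gs[OF i] using i by (simp add: g_def mult.assoc ww ppz)
    have "g i * star (g i) = w i * p i * w i" unfolding gs[OF i] using i by (simp add: g_def mult.assoc uu ppz)
    then show "g i * star (g i) = e i" using w(4)[OF i] by simp
  qed
  have ge: "g i = e i * (w i * star (u i))" "star (g i) = u i * w i * e i" if i: "i \<in> I" for i
  proof -
    have "g i = (w i * p i) * star (u i)" by (simp add: g_def)
    also have "w i * p i = e i * w i" using we(2)[OF i] by simp
    finally show "g i = e i * (w i * star (u i))" by (simp only: mult.assoc)
    have "star (g i) = u i * (p i * w i)" unfolding gs[OF i] by (simp only: mult.assoc)
    also have "p i * w i = w i * e i" using we(1)[OF i] by simp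
    finally show "star (g i) = u i * w i * e i" by (simp only: mult.assoc)
  qed
  have gq: "g i * q i = g i" if i: "i \<in> I" for i using i by (simp add: g_def mult.assoc uu ppz)
  have eg: "e i * g i = g i" if i: "i \<in> I" for i using ge(1)[OF i] ee(3)[OF i] by simp
  have orth1: "star (g i) * g j = 0" if "i \<in> I" "j \<in> I" "i \<noteq> j" for i j
  proof -
    have "star (g i) * g j = u i * w i * (e i * e j) * (w j * star (u j))"
      unfolding ge(2)[OF that(1)] ge(1)[OF that(2)] by (simp only: mult.assoc)
    then show ?thesis using e(4)[OF that] by simp
  qed
  have orth2: "g i * star (g j) = 0" if "i \<in> I" "j \<in> I" "i \<noteq> j" for i j
  proof -
    have "star (g j) = star (g j * q j)" using gq that by simp
    then have gj: "star (g j) = q j * star (g j)" using q_proj[OF that(2)] by (simp add: proj_def)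
    have "g i * star (g j) = (g i * q i) * (q j * star (g j))" using gq[OF that(1)] gj by simp
    also have "\<dots> = g i * (q i * q j) * star (g j)" by (simp only: mult.assoc)
    finally show ?thesis using q_orth[OF that] by (simp only: mult_zero_left mult_zero_right)
  qed
  have sumsq: "star (\<Sum>i\<in>F. g i) * (\<Sum>i\<in>F. g i) = (\<Sum>i\<in>F. q i)"
    "(\<Sum>i\<in>F. g i) * star (\<Sum>i\<in>F. g i) = (\<Sum>i\<in>F. e i)" if F: "F \<subseteq> I" for F
  proof -
    have "star (\<Sum>i\<in>F. g i) * (\<Sum>i\<in>F. g i) = (\<Sum>i\<in>F. star (g i) * g i)"
      unfolding star_sum using F orth1 by (intro sum_orthogonal) auto
    then show "star (\<Sum>i\<in>F. g i) * (\<Sum>i\<in>F. g i) = (\<Sum>i\<in>F. q i)"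
      using F gg(1) by (auto intro: sum.cong)
    have "(\<Sum>i\<in>F. g i) * star (\<Sum>i\<in>F. g i) = (\<Sum>i\<in>F. g i * star (g i))"
      unfolding star_sum using F orth2 by (intro sum_orthogonal) auto
    then show "(\<Sum>i\<in>F. g i) * star (\<Sum>i\<in>F. g i) = (\<Sum>i\<in>F. e i)"
      using F gg(2) by (auto intro: sum.cong)
  qed
  have split: "(\<Sum>i\<in>I \<inter> {..m}. f i) - (\<Sum>i\<in>I \<inter> {..n}. f i) = (\<Sum>i\<in>I \<inter> {n<..m}. f i)"
    if "n \<le> m" for m n and f :: "nat \<Rightarrow> 'h operator"
  proof -
    have "I \<inter> {n<..m} = I \<inter> {..m} - I \<inter> {..n}" by auto
    then show ?thesis using sum_diff[of "I \<inter> {..m}" "I \<inter> {..n}" f] that by fastforce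
  qed
  have qs: "(\<Sum>i\<in>I \<inter> {..n}. q i) \<in> M" "star (\<Sum>i\<in>I \<inter> {..n}. q i) = (\<Sum>i\<in>I \<inter> {..n}. q i)"
    "(\<Sum>i\<in>I \<inter> {..n}. q i) \<le> (\<Sum>i\<in>I \<inter> {..Suc n}. q i)" for n
    using sum_proj(1-3)[of q] qM q_proj by blast+
  have es: "(\<Sum>i\<in>I \<inter> {..n}. e i) \<in> M" "star (\<Sum>i\<in>I \<inter> {..n}. e i) = (\<Sum>i\<in>I \<inter> {..n}. e i)"
    "(\<Sum>i\<in>I \<inter> {..n}. e i) \<le> (\<Sum>i\<in>I \<inter> {..Suc n}. e i)" for n
    using sum_proj(1-3)[of e] eM e(2) by blast+
  have "\<exists>W. sot S W \<and> star W * W = 1 \<and> W * star W = 1"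
  proof (rule unitary_of_increments)
    fix m n :: nat assume nm: "n \<le> m"
    show "star (S m - S n) * (S m - S n) = (\<Sum>i\<in>I \<inter> {..m}. q i) - (\<Sum>i\<in>I \<inter> {..n}. q i)"
      "(S m - S n) * star (S m - S n) = (\<Sum>i\<in>I \<inter> {..m}. e i) - (\<Sum>i\<in>I \<inter> {..n}. e i)"
      unfolding S_def split[OF nm] by (intro sumsq; blast)+
  next
    fix n
    show "star (S n) * S n = (\<Sum>i\<in>I \<inter> {..n}. q i)" "S n * star (S n) = (\<Sum>i\<in>I \<inter> {..n}. e i)"
      unfolding S_def by (intro sumsq; blast)+
    show "(\<Sum>i\<in>I \<inter> {..n}. q i) \<le> 1" by (rule tr_lim(2)[OF qs sum_q])
    show "(\<Sum>i\<in>I \<inter> {..n}. e i) \<le> 1" by (rule tr_lim(2)[OF es sum_e])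
  qed (rule sum_q sum_e | blast)+
  then obtain W where W: "sot S W" "star W * W = 1" "W * star W = 1" by blast
  have gM: "g i \<in> M" if "i \<in> I" for i using that wM pM u unfolding g_def by (intro M_closed) auto
  have "S n \<in> M" for n unfolding S_def using gM by (intro op.subspace_sum L2.V) auto
  then have WM: "W \<in> M" by (rule vna_sot[OF M W(1)])
  have single: "(\<Sum>j\<in>I \<inter> {..n}. if j = i then x else 0) = x" if "i \<in> I" "i \<le> n" for i n and x :: "'h operator"
    using that by simp
  have "W * q i = g i" if i: "i \<in> I" for i
  proof (rule sot_unique)
    \<comment> \<open>The shift by \<open>i\<close> puts the term \<open>i\<close> into every
      partial sum.\<close>
    show "sot (\<lambda>n. S (n + i) * q i) (W * q i)"
      using sot_mult_right[OF W(1), of "q i"] unfolding sot_def by (auto intro: LIMSEQ_ignore_initial_segment)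
    have "S (n + i) * q i = g i" for n
    proof -
      have "g j * q i = (if j = i then g i else 0)" if "j \<in> I" for j
      proof (cases "j = i")
        case False
        have "g j * q i = g j * q j * q i" using gq[OF that] by simp
        also have "\<dots> = g j * (q j * q i)" by (simp only: mult.assoc)
        finally show ?thesis using q_orth[OF that i False] False by simp
      qed (use gq i in simp)
      then have "S (n + i) * q i = (\<Sum>j\<in>I \<inter> {..n + i}. if j = i then g i else 0)"
        unfolding S_def sum_distrib_right by (intro sum.cong) auto
      then show ?thesis using single[OF i, of "n + i"] by simp
    qed
    then show "sot (\<lambda>n. S (n + i) * q i) (g i)" by (simp add: sot_const)
  qed
  moreover have "e i * W = g i" if i: "i \<in> I" for i
  proof (rule sot_unique)
    show "sot (\<lambda>n. e i * S (n + i)) (e i * W)"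
      using sot_mult_left[OF W(1), of "e i"] unfolding sot_def
      by (auto intro: LIMSEQ_ignore_initial_segment[of "\<lambda>n. ap (e i) (ap (S n) v)" for v])
    have "e i * S (n + i) = g i" for n
    proof -
      have "e i * g j = (if j = i then g i else 0)" if "j \<in> I" for j
      proof (cases "j = i")
        case False
        have "e i * g j = (e i * e j) * g j" using eg[OF that] by (simp add: mult.assoc)
        then show ?thesis using e(4)[OF i that] False by simp
      qed (use eg i in simp)
      then have "e i * S (n + i) = (\<Sum>j\<in>I \<inter> {..n + i}. if j = i then g i else 0)"
        unfolding S_def sum_distrib_left by (intro sum.cong) auto
      then show ?thesis using single[OF i, of "n + i"] by simp
    qed
    then show "sot (\<lambda>n. e i * S (n + i)) (g i)" by (simp add: sot_const)
  qed
  ultimately show thesis using that[of W] WM W unfolding g_def by blast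
qed

lemma scalar_projection:
  assumes "proj (sc c 1 :: 'h operator)" "sc c 1 \<noteq> (0 :: 'h operator)"
  shows "sc c 1 = (1 :: 'h operator)"
proof -
  have "c = 0 \<or> c = 1 \<or> (1 :: 'h operator) = 0" using assms(1) by (simp add: proj_def)
  then show ?thesis using assms(2) by auto
qed

text \<open>If \<open>p 2 \<noteq> 1\<close>, then \<open>B 2\<close> contains a proper
  subprojection of \<open>1 - p 2\<close>; if \<open>p 2 = 1\<close>, then \<open>e 2 = 1\<close>
  and all of \<open>A 1\<close> has been moved into \<open>B 2\<close>.\<close>

lemma Q0_nontrivial: "\<exists>x\<in>Q0. \<forall>c. x \<noteq> sc c 1"
proof (rule ccontr)
  assume "\<not> ?thesis"
  then have sca: "\<exists>c. x = sc c 1" if "x \<in> Q0" for x using that by blast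
  have B2: "B 2 \<subseteq> Q0" unfolding Q0_def using vhull_sub[of "\<Union>k. B k"] by blast
  note c1 = A_closed[OF I(2)] and c2 = A_closed[OF I(3)]
  show False
  proof (cases "p 2 = 1")
    case False
    have p2: "1 - p 2 \<in> A 2" "proj (1 - p 2)" "1 - p 2 \<noteq> 0"
      using p[OF I(3)] c2(1,4) proj_compl False by auto
    then obtain f where f: "f \<in> A 2" "proj f" "(1 - p 2) * f = f" "f \<noteq> 0" "f \<noteq> 1 - p 2"
      using diffuse_A[OF I(3)] unfolding diffuse_op_def by blast
    have "f * (1 - p 2) = f" using proj_sub(1)[OF p2(2) f(2,3)] .
    then have "f \<in> B 2" using B_mem[OF I(3) _ c1(2) f(1)] by simp
    then obtain c where c: "f = sc c 1" using sca B2 by blast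
    then have "f = 1" using scalar_projection[of c] f by simp
    then show False using f by simp
  next
    case True
    then have "e 2 = 1" using w(2,4)[OF I(3)] by simp
    obtain f where f: "f \<in> A 1" "proj f" "f \<noteq> 0" "f \<noteq> 1"
      using diffuse_A[OF I(2)] c1(1) tr_one tr_zero unfolding diffuse_op_def
      by (metis mult_1 proj_def star_simps(3) zero_neq_one)
    have "w 2 * f * e 2 * w 2 + 0 * (1 - p 2) \<in> B 2" by (rule B_mem[OF I(3) _ f(1) c2(2)]) simp
    then have "w 2 * f * w 2 \<in> Q0" using \<open>e 2 = 1\<close> B2 by auto
    then obtain c where c: "w 2 * f * w 2 = sc c 1" using sca by blast
    have "f = w 2 * (w 2 * f * w 2) * w 2" using I(3) by (simp add: mult.assoc ww w)
    also have "\<dots> = sc c 1" using I(3) by (simp add: c w)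
    finally have "f = 1" using scalar_projection[of c] f by simp
    then show False using f by simp
  qed
qed

lemma Q0_M: "Q0 \<subseteq> M"
  unfolding Q0_def using B_M by (intro vhull_min[OF M]) blast

text \<open>The units of the corners put \<open>e i\<close> and \<open>p i\<close>, and with them
  \<open>w i\<close>, into \<open>L\<close>; conjugation by \<open>w i\<close> then recovers the
  corners of \<open>A i\<close> at \<open>p i\<close> and of \<open>A 1\<close> at
  \<open>e i\<close>.\<close>

lemma generate:
  assumes L: "vna L" and Q: "Q0 \<subseteq> L" and c: "\<And>i a. i \<in> I \<Longrightarrow> a \<in> A i \<Longrightarrow> w i * a * p i * w i \<in> L"
  shows "M \<subseteq> L"
proof -
  note cL = vna_closed[OF L]
  have BL: "B k \<subseteq> L" for k using Q vhull_sub[of "\<Union>k. B k"] unfolding Q0_def by blast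
  have eL: "e i \<in> L" if "i \<in> I" for i using c[OF that A_closed(1)[OF that]] w(4)[OF that] by simp
  have pL: "p i \<in> L" if i: "i \<in> I" for i
  proof (cases "i = 1")
    case False
    have "w i * 1 * e i * w i + 0 * (1 - p i) \<in> B i"
      using B_mem[OF i False] A_closed(1)[OF I(2)] A_closed(2)[OF i] by blast
    then show ?thesis using BL w(3)[OF i] by auto
  qed (use eL[OF I(2)] e(3) in simp)
  have wL: "w i \<in> L" if "i \<in> I" for i using w_mem[OF that L] eL pL that by blast
  have ap: "a * p i \<in> L" if i: "i \<in> I" and a: "a \<in> A i" for i a
  proof -
    have "a * p i = w i * (w i * a * p i * w i) * w i" using i by (simp add: mult.assoc ww w)
    then show ?thesis using c[OF i a] wL[OF i] cL(5) by metis
  qed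
  have ae: "a * e i \<in> L" if i: "i \<in> I" and a: "a \<in> A 1" for i a
  proof (cases "i = 1")
    case True
    then show ?thesis using ap[OF I(2) a] e(3) by simp
  next
    case False
    have "w i * a * e i * w i + 0 * (1 - p i) \<in> B i" using B_mem[OF i False a A_closed(2)[OF i]] .
    then have "w i * a * e i * w i \<in> L" using BL by auto
    moreover have "a * e i = w i * (w i * a * e i * w i) * w i" using i by (simp add: mult.assoc ww w)
    ultimately show ?thesis using wL[OF i] cL(5) by metis
  qed
  have "A i \<subseteq> L" if i: "i \<in> I" for i
  proof
    fix a assume a: "a \<in> A i"
    show "a \<in> L"
    proof (cases "i = 1")
      case True
      have "sot (\<lambda>n. a * (\<Sum>i\<in>I \<inter> {..n}. e i)) (a * 1)" using sum_e by (rule sot_mult_left)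
      moreover have "a * (\<Sum>i\<in>I \<inter> {..n}. e i) \<in> L" for n
        unfolding sum_distrib_left
      proof (rule op.subspace_sum)
        show "op.subspace L" using cL(2,3,6) by (simp add: op.subspace_def)
      qed (use ae a True in auto)
      ultimately show ?thesis using vna_sot[OF L] by fastforce
    next
      case False
      have "w i * 0 * e i * w i + a * (1 - p i) \<in> B i" using B_mem[OF i False A_closed(2)[OF I(2)] a] .
      then have "a * (1 - p i) \<in> L" using BL by auto
      then have "a * p i + a * (1 - p i) \<in> L" using ap[OF i a] cL(3) by blast
      then show ?thesis by (simp add: algebra_simps)
    qed
  qed
  then show ?thesis using gen_A vhull_min[OF L, of "\<Union>i\<in>I. A i"] by blast
qed

text \<open>\<open>Q0\<close> complements the corners after conjugation by \<open>W\<close>.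
  Conjugating back affects neither freeness nor generation, because \<open>W\<close> is a unitary of
  \<open>M\<close>.\<close>

theorem complement:
  "\<exists>Q. vna Q \<and> Q \<subseteq> M \<and> (\<exists>x\<in>Q. \<forall>c. x \<noteq> sc c 1) \<and> free (\<lambda>b. if b then corners else Q) \<and> M = vhull (corners \<union> Q)"
proof -
  obtain W where W: "W \<in> M" "star W * W = 1" "W * star W = 1"
    and Wq: "\<And>i. i \<in> I \<Longrightarrow> W * q i = w i * p i * star (u i)"
    and eW: "\<And>i. i \<in> I \<Longrightarrow> e i * W = w i * p i * star (u i)" using conj_unitary_exists by blast
  have W1: "star W * (W * x) = x" "W * (star W * x) = x" for x by (simp_all add: W flip: mult.assoc)
  define Q where "Q = {x. W * x * star W \<in> Q0}"
  have sq: "star (q i) = q i" if "i \<in> I" for i using q_proj[OF that] by (simp add: proj_def)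
  have qW: "q i * star W = u i * p i * w i" "star W * e i = u i * p i * w i" if i: "i \<in> I" for i
    using arg_cong[where f = star, OF Wq[OF i]] arg_cong[where f = star, OF eW[OF i]] i
    by (simp_all add: sq ee pp w mult.assoc)
  have move: "W * (u i * a * p i * star (u i)) * star W = w i * a * p i * w i" if i: "i \<in> I" and a: "a \<in> A i" for i a
  proof -
    have "u i * a * p i * star (u i) = q i * (u i * a * p i * star (u i)) * q i"
    proof -
      have "q i * (u i * a * p i * star (u i)) * q i = u i * (p i * a) * p i * star (u i)"
        using i by (simp add: mult.assoc uu ppz)
      also have "p i * a = a * p i" by (rule p_comm[OF i a])
      finally show ?thesis using i by (simp add: mult.assoc ppz)
    qed
    then have "W * (u i * a * p i * star (u i)) * star W = W * (q i * (u i * a * p i * star (u i)) * q i) * star W" by simp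
    also have "\<dots> = (W * q i) * (u i * a * p i * star (u i)) * (q i * star W)" by (simp only: mult.assoc)
    also have "\<dots> = w i * (p i * a) * p i * w i" unfolding Wq[OF i] qW(1)[OF i] using i by (simp add: mult.assoc uu ppz)
    also have "p i * a = a * p i" by (rule p_comm[OF i a])
    finally show ?thesis using i by (simp add: mult.assoc ppz)
  qed
  have vQ: "vna Q" unfolding Q_def by (rule vna_conjugate[OF W(2,3)]) (simp add: Q0_def vhull_vna)
  have QM: "Q \<subseteq> M"
  proof
    fix x assume "x \<in> Q"
    then have "W * x * star W \<in> M" using Q0_M by (auto simp: Q_def)
    then have "star W * (W * x * star W) * W \<in> M"
      by (intro M_closed(5)[OF M_closed(5)[OF M_closed(8)[OF W(1)]] W(1)])
    then show "x \<in> M" by (simp add: mult.assoc W1 W)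
  qed
  have nontriv: "\<exists>x\<in>Q. \<forall>c. x \<noteq> sc c 1"
  proof -
    obtain y where y: "y \<in> Q0" "\<And>c. y \<noteq> sc c 1" using Q0_nontrivial by blast
    have "star W * y * W \<in> Q" using y by (simp add: Q_def mult.assoc W1 W)
    moreover have "star W * y * W \<noteq> sc c 1" for c
    proof
      assume "star W * y * W = sc c 1"
      then have "W * (star W * y * W) * star W = W * sc c 1 * star W" by simp
      then show False using y(2)[of c] by (simp add: mult.assoc W1 W)
    qed
    ultimately show ?thesis by blast
  qed
  have trW: "tr (W * x * star W) = tr x" if "x \<in> M" for x
    using tr_comm[of "W * x" "star W"] that W by (simp add: M_closed W1)
  define X where "X = (\<lambda>x. W * x * star W) ` corners"
  have "tr y = 0" if y: "Alt (\<lambda>b. ctr (if b then corners else Q)) b c y" for b c y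
  proof -
    have yM: "y \<in> M" by (rule Alt_ctr_M[OF y]) (use corners_sub_M QM in auto)
    have "Alt (\<lambda>b. if b then ctr X else ctr Q0) b c (W * y * star W)"
      using y
    proof (induction rule: Alt.induct)
      case (single x b)
      then show ?case
        using trW[of x] corners_sub_M QM by (intro Alt.single) (auto simp: ctr_def X_def Q_def split: if_splits)
    next
      case (cons x i j k y)
      have "W * x * star W \<in> (if i then ctr X else ctr Q0)"
        using cons(1) trW[of x] corners_sub_M QM by (auto simp: ctr_def X_def Q_def split: if_splits)
      then have "Alt (\<lambda>b. if b then ctr X else ctr Q0) i k (W * x * star W * (W * y * star W))"
        by (rule Alt.cons[OF _ cons(4) cons(3)])
      then show ?case by (simp add: mult.assoc W1)
    qed
    then have "tr (W * y * star W) = 0"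
    proof (rule free_pair[rotated])
      fix x assume x: "x \<in> X" "tr x = 0"
      then obtain z where z: "z \<in> corners" "x = W * z * star W" by (auto simp: X_def)
      show "x \<in> cl (op.span (L' 1))"
      proof (rule standard_corner_cl[OF _ x(2)])
        show "x \<in> M" using z corners_sub_M W by (auto intro!: M_closed)
        fix i assume i: "i \<in> I"
        have zq: "z * q i = q i * z" using z i by (simp add: corners_def)
        have xe: "x * e i = W * (z * q i) * star W"
          unfolding z(2) using qW[OF i] by (simp add: mult.assoc)
        have ex: "e i * x = W * (q i * z) * star W"
        proof -
          have "e i * x = (e i * W) * z * star W" by (simp add: z(2) mult.assoc)
          also have "e i * W = W * q i" using eW[OF i] Wq[OF i] by simp
          finally show ?thesis by (simp add: mult.assoc)
        qed
        show "x * e i = e i * x" unfolding xe ex zq ..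
        obtain a where a: "a \<in> A i" "z * q i = u i * a * p i * star (u i)" using z i by (auto simp: corners_def)
        show "\<exists>a\<in>A i. x * e i = w i * a * p i * w i"
          unfolding xe a(2) using move[OF i a(1)] a(1) by blast
      qed
    qed
    then show ?thesis using trW[OF yM] by simp
  qed
  then have fr: "free (\<lambda>b. if b then corners else Q)" by (simp add: free_def)
  have "M = vhull (corners \<union> Q)"
  proof
    show "vhull (corners \<union> Q) \<subseteq> M" using corners_sub_M QM by (intro vhull_min[OF M]) simp
    show "M \<subseteq> vhull (corners \<union> Q)"
    proof
      fix x assume x: "x \<in> M"
      let ?V = "vhull (corners \<union> Q)"
      have sup: "corners \<union> Q \<subseteq> ?V" by (rule vhull_sub)
      have "vna {x. star W * x * star (star W) \<in> ?V}"
        by (rule vna_conjugate) (simp_all add: W vhull_vna)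
      then have L: "vna {x. star W * x * W \<in> ?V}" by simp
      have "M \<subseteq> {x. star W * x * W \<in> ?V}"
      proof (rule generate[OF L])
        show "Q0 \<subseteq> {x. star W * x * W \<in> ?V}"
        proof
          fix y assume "y \<in> Q0"
          then have "star W * y * W \<in> Q" by (simp add: Q_def mult.assoc W1 W)
          then show "y \<in> {x. star W * x * W \<in> ?V}" using sup by blast
        qed
        fix i a assume i: "i \<in> I" and a: "a \<in> A i"
        have "star W * (w i * a * p i * w i) * W = u i * a * p i * star (u i)"
          unfolding move[OF i a, symmetric] by (simp add: mult.assoc W1 W)
        then show "w i * a * p i * w i \<in> {x. star W * x * W \<in> ?V}"
          using corner_in_corners[OF i a] sup by auto
      qed
      moreover have "W * x * star W \<in> M" by (intro M_closed(5)[OF M_closed(5)[OF W(1) x] M_closed(8)[OF W(1)]])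
      ultimately have "star W * (W * x * star W) * W \<in> ?V" by blast
      then show "x \<in> ?V" by (simp add: mult.assoc W1 W)
    qed
  qed
  then show ?thesis using vQ QM nontriv fr by blast
qed

lemma Ab_mult: assumes "x \<in> Ab i" "y \<in> Ab i" shows "x * y \<in> Ab i"
proof (cases "i \<in> I")
  case True
  then show ?thesis using assms A_closed(5) by (simp add: Ab_def)
next
  case False
  obtain c where "x = sc c 1" using assms(1) False scalar_span[of x] by (auto simp: Ab_def)
  moreover obtain d where "y = sc d 1" using assms(2) False scalar_span[of y] by (auto simp: Ab_def)
  ultimately show ?thesis using False by (simp add: Ab_def op.span_scale op.span_base)
qed

lemma Ab_star: assumes "x \<in> Ab i" shows "star x \<in> Ab i"
proof (cases "i \<in> I")
  case True
  then show ?thesis using assms A_closed(8) by (simp add: Ab_def)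
next
  case False
  have "star x \<in> op.span {1}" by (rule span_star) (use assms False in \<open>auto simp: Ab_def\<close>)
  then show ?thesis using False by (simp add: Ab_def)
qed

lemma M_cl_wspan: "M \<subseteq> cl (wspan Ab)"
proof -
  have "vhull (\<Union>i. Ab i) \<subseteq> cl (wspan Ab)"
    by (rule vhull_cl_wspan[of Ab, OF Ab_subspace Ab_one Ab_M Ab_mult Ab_star])
  moreover have "M \<subseteq> vhull (\<Union>i. Ab i)"
  proof -
    have "(\<Union>i\<in>I. A i) \<subseteq> (\<Union>i. Ab i)" by (auto simp: Ab_def)
    then show ?thesis using vhull_min[OF vhull_vna, of "\<Union>i\<in>I. A i" "\<Union>i. Ab i"] vhull_sub[of "\<Union>i. Ab i"] gen_A by blast
  qed
  ultimately show ?thesis by blast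
qed

text \<open>Projections \<open>f\<close> of trace 1/2 yield the centred symmetries
  \<open>2 f - 1\<close> for \<open>center_trivial\<close>. In \<open>A 2\<close> the projections
  \<open>g\<close> and \<open>g1 + g2\<close> overlap in trace 1/4, so that
  \<open>tr (b * c) = 4/4 - 1 - 1 + 1 = 0\<close> for their symmetries \<open>b\<close> and
  \<open>c\<close>.\<close>

theorem center: assumes z: "z \<in> M" "z \<in> comm M" shows "z = sc (tr z) 1"
proof -
  have refl: "f + f - 1 \<in> A i \<and> star (f + f - 1) = f + f - 1 \<and> (f + f - 1) * (f + f - 1) = 1
      \<and> tr (f + f - 1) = tr f + tr f - 1" if "i \<in> I" "f \<in> A i" "proj f" for i f
    using that A_closed(1,3,4)[of i] A_in_M[of i f]
    by (auto simp: proj_def tr_add tr_diff tr_one M_closed algebra_simps)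
  have half: "\<exists>f\<in>A i. proj f \<and> r * f = f \<and> tr f = complex_of_real s"
    if i: "i \<in> I" and r: "r \<in> A i" "proj r" "0 \<le> s" "s \<le> Re (tr r)" for i r s
  proof -
    obtain f where f: "f \<in> A i" "proj f" "r * f = f" "Re (tr f) = s"
      using projection_of_trace[OF vna_A[OF i] A_M[OF i] diffuse_A[OF i] r] by blast
    then have "tr f = complex_of_real s" using tr_sa[OF A_in_M[OF i f(1)]] by (simp add: proj_def)
    then show ?thesis using f by blast
  qed
  have p1: "proj (1 :: 'h operator)" by (simp add: proj_def)
  obtain f where f: "f \<in> A 1" "proj f" "tr f = complex_of_real (1/2)"
    using half[OF I(2) A_closed(1)[OF I(2)] p1, of "1/2"] by (auto simp: tr_one)
  obtain g where g: "g \<in> A 2" "proj g" "tr g = complex_of_real (1/2)"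
    using half[OF I(3) A_closed(1)[OF I(3)] p1, of "1/2"] by (auto simp: tr_one)
  have gM: "g \<in> M" using A_in_M I(3) g by blast
  have g': "1 - g \<in> A 2" "proj (1 - g)" "tr (1 - g) = complex_of_real (1/2)"
    using g gM A_closed(1,4)[OF I(3)] proj_compl by (auto simp: tr_diff tr_one M_closed)
  obtain g1 where g1: "g1 \<in> A 2" "proj g1" "g * g1 = g1" "tr g1 = complex_of_real (1/4)"
    using half[OF I(3) g(1,2), of "1/4"] g(3) by auto
  obtain g2 where g2: "g2 \<in> A 2" "proj g2" "(1 - g) * g2 = g2" "tr g2 = complex_of_real (1/4)"
    using half[OF I(3) g'(1,2), of "1/4"] g'(3) by auto
  have gM': "g1 \<in> M" "g2 \<in> M" using A_in_M I(3) g1 g2 by blast+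
  have gg2: "g * g2 = 0" using g2(3) by (simp add: left_diff_distrib)
  have "g1 * g = g1" by (rule proj_sub(1)[OF g(2) g1(2,3)])
  then have "g1 * g2 = 0" using gg2 by (metis mult.assoc mult_zero_right)
  then have ph: "proj (g1 + g2)" by (intro proj_add g1 g2)
  have hA: "g1 + g2 \<in> A 2" using A_closed(3)[OF I(3)] g1 g2 by blast
  let ?a = "f + f - 1" and ?b = "g + g - 1" and ?c = "(g1 + g2) + (g1 + g2) - 1"
  note ra = refl[OF I(2) f(1,2)] and rb = refl[OF I(3) g(1,2)] and rc = refl[OF I(3) hA ph]
  have "?b * ?c = g1 + g1 + (g1 + g1) - (g + g) - (g1 + g2) - (g1 + g2) + 1"
    by (simp add: algebra_simps g1(3) gg2)
  then have "tr (?b * ?c) = tr g1 + tr g1 + (tr g1 + tr g1) - (tr g + tr g) - (tr g1 + tr g2) - (tr g1 + tr g2) + 1"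
    using gM gM' by (simp only: tr_add tr_diff tr_one M_closed(1,3,4))
  then have "tr (?b * ?c) = 0" unfolding g(3) g1(4) g2(4) by simp
  moreover have "?a \<in> ctr (Ab 1)" using ra f(3) I by (simp add: ctr_def Ab_def)
  moreover have "?b \<in> ctr (Ab 2)" using rb g(3) I by (simp add: ctr_def Ab_def)
  moreover have "?c \<in> ctr (Ab 2)"
    using rc g1(4) g2(4) gM' I by (simp add: ctr_def Ab_def tr_add)
  moreover have com: "z * x = x * z" if "x \<in> A i" "i \<in> I" for x i
    using z A_in_M that by (auto simp: comm_def)
  show ?thesis
  proof (rule center_trivial[of Ab 1 2 ?a ?b ?c, OF Ab_subspace Ab_one Ab_M Ab_mult Ab_star free_Ab M_cl_wspan])
    show "z * ?a = ?a * z" "z * ?b = ?b * z" "z * ?c = ?c * z"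
      using com ra rb rc I by blast+
  qed (use calculation ra rb rc z in auto)
qed

end

context corner_datum
begin

text \<open>For \<open>i \<noteq> 1\<close> the projections \<open>e i\<close> and
  \<open>p i\<close> come from the free algebras \<open>A 1\<close> and \<open>A i\<close> and have
  equal traces; for \<open>i = 1\<close> they coincide and the unitary is 1.\<close>

lemma exchange_exists: "\<exists>e w. exchange_datum M tr I A p u e w"
proof -
  obtain e where e: "\<And>i. i \<in> I \<Longrightarrow> e i \<in> A 1" "\<And>i. i \<in> I \<Longrightarrow> proj (e i)" "e 1 = p 1"
    "\<And>i j. i \<in> I \<Longrightarrow> j \<in> I \<Longrightarrow> i \<noteq> j \<Longrightarrow> e i * e j = 0"
    "\<And>i. i \<in> I \<Longrightarrow> tr (e i) = tr (p i)" "sot (\<lambda>n. \<Sum>i\<in>I \<inter> {..n}. e i) 1"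
    using exists_partition by metis
  have "\<exists>v. star v = v \<and> v * v = 1 \<and> v * e i * v = p i \<and> v * p i * v = e i \<and>
      (\<forall>L. vna L \<longrightarrow> e i \<in> L \<longrightarrow> p i \<in> L \<longrightarrow> v \<in> L) \<and> (i = 1 \<longrightarrow> v = 1)" if i: "i \<in> I" for i
  proof (cases "i = 1")
    case True
    then show ?thesis using e(3) vna_closed(1) by (intro exI[of _ 1]) auto
  next
    case False
    have eM: "e i \<in> M" using e(1)[OF i] A_in_M I(2) by blast
    obtain v where "star v = v" "v * v = 1" "v * e i * v = p i" "v * p i * v = e i"
      "\<And>L. vna L \<Longrightarrow> e i \<in> L \<Longrightarrow> p i \<in> L \<Longrightarrow> v \<in> L"
    proof (rule exchange_unitary[OF eM e(2)[OF i] pM[OF i] p(2)[OF i]])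
      show "tr (p i) = complex_of_real (tt i)" by (rule tr_p[OF i])
      then show "tr (e i) = complex_of_real (tt i)" using e(5)[OF i] by simp
      fix b c x
      assume x: "Alt (\<lambda>b. if b then {e i - sc (complex_of_real (tt i)) 1} else {p i - sc (complex_of_real (tt i)) 1}) b c x"
      have ce: "e i - sc (complex_of_real (tt i)) 1 \<in> ctr (A 1)"
        using e(1)[OF i] A_closed(1,4,6)[OF I(2)] eM e(5)[OF i] tr_p[OF i]
        by (simp add: ctr_def tr_diff tr_sc tr_one M_closed)
      have cp: "p i - sc (complex_of_real (tt i)) 1 \<in> ctr (A i)"
        using p(1)[OF i] A_closed(1,4,6)[OF i] pM[OF i] tr_p[OF i]
        by (simp add: ctr_def tr_diff tr_sc tr_one M_closed)
      let ?F = "\<lambda>i. if i \<in> I then ctr (A i) else {}"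
      let ?h = "\<lambda>b. if b then 1 else i"
      have "Alt ?F (?h b) (?h c) x"
        using x
      proof (induction rule: Alt.induct)
        case (single x b)
        then show ?case using ce cp i I by (intro Alt.single) (auto split: if_splits)
      next
        case (cons x b b' c y)
        have "x \<in> ?F (?h b)" using cons(1) ce cp i I by (auto split: if_splits)
        moreover have "?h b \<noteq> ?h b'" using cons(3) False by auto
        ultimately show ?case using cons(4) by (blast intro: Alt.cons)
      qed
      then show "tr x = 0" by (rule free_A)
    qed blast
    then show ?thesis using False by blast
  qed
  then obtain w where w: "\<And>i. i \<in> I \<Longrightarrow> star (w i) = w i \<and> w i * w i = 1 \<and> w i * e i * w i = p i \<and>
      w i * p i * w i = e i \<and> (\<forall>L. vna L \<longrightarrow> e i \<in> L \<longrightarrow> p i \<in> L \<longrightarrow> w i \<in> L) \<and> (i = 1 \<longrightarrow> w i = 1)" by metis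
  have "exchange_datum M tr I A p u e w"
    by unfold_locales (use e w I in auto)
  then show ?thesis by blast
qed

end

section \<open>Operators as functions\<close>

lemma self_adjoint_ap: "self_adjoint (ap x) \<longleftrightarrow> star x = x"
  by (simp add: self_adjoint_def ap_eq_iff flip: ap_star)

lemma projection_ap: "projection (ap x) \<longleftrightarrow> proj x"
  by (simp add: projection_def self_adjoint_ap proj_def ap_eq_iff flip: ap_mult)

lemma unitary_ap: "unitary (ap x) \<longleftrightarrow> star x * x = 1 \<and> x * star x = 1"
  by (simp add: unitary_def ap_eq_iff flip: ap_star ap_mult ap_one)

lemma op_le_ap: "star x = x \<Longrightarrow> star y = y \<Longrightarrow> op_le (ap x) (ap y) \<longleftrightarrow> x \<le> y"
  by (simp add: op_le_def operator_le)

lemma ap_zero: "ap 0 = (\<lambda>_. 0)"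
  by (rule ext) simp

lemma diffuse_ap: "diffuse (ap ` A) \<longleftrightarrow> diffuse_op A"
  by (simp add: diffuse_def diffuse_op_def projection_ap ap_eq_iff flip: ap_mult ap_zero)

lemma abelian_ap: "abelian (ap ` A) \<longleftrightarrow> (\<forall>x\<in>A. \<forall>y\<in>A. x * y = y * x)"
  by (simp add: abelian_def ap_eq_iff flip: ap_mult)

lemma scalars_ap: "(scalars :: ('h::complex_hilbert \<Rightarrow> 'h) set) = ap ` range (\<lambda>c. sc c 1)"
proof -
  have "((*\<^sub>C) :: complex \<Rightarrow> 'h \<Rightarrow> 'h) = (\<lambda>c. ap (sc c 1))" by (intro ext) simp
  then show ?thesis unfolding scalars_def image_image by (rule arg_cong[where f = range])
qed

lemma sot_ge:
  assumes inc: "\<And>n. a n \<le> a (Suc n)" and sa: "\<And>n. star (a n) = a n" and s: "sot a s"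
  shows "a n \<le> s"
proof -
  have "incseq (\<lambda>n. Re (cinner v (ap (a n) v)))" for v
    using inc by (intro incseq_SucI) (simp add: operator_le)
  then have "Re (cinner v (ap (a n) v)) \<le> Re (cinner v (ap s v))" for v
    using sot_quad[OF s, of v] by (intro incseq_le)
  then show ?thesis using sa sot_sa[OF s sa] by (simp add: operator_le)
qed

text \<open>An increasing sequence is a directed family whose strong limit is its least upper bound,
  so normality in the sense of the order yields the sequential form.\<close>

lemma tracial_ap:
  assumes "tracial_vn_algebra (ap ` M) \<tau>"
  shows "tracial M (\<lambda>x. \<tau> (ap x))"
proof -
  have f: "faithful_normal_tracial_state (ap ` M) \<tau>" and v: "vna M"
    using assms by (simp_all add: tracial_vn_algebra_def von_neumann_algebra_ap)
  note f = f[unfolded faithful_normal_tracial_state_def]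
  have a: "(\<lambda>v. ap x v + ap y v) = ap (x + y)" "(\<lambda>v. c *\<^sub>C ap x v) = ap (sc c x)" for x y c
    by (rule ext, simp)+
  show ?thesis
  proof
    show "vna M" by (rule v)
    show "\<tau> (ap (x + y)) = \<tau> (ap x) + \<tau> (ap y)" if "x \<in> M" "y \<in> M" for x y
      using f that by (simp flip: a)
    show "\<tau> (ap (sc c x)) = c * \<tau> (ap x)" if "x \<in> M" for x c
      using f that by (simp flip: a)
    show "Im (\<tau> (ap (star x * x))) = 0 \<and> 0 \<le> Re (\<tau> (ap (star x * x)))" if "x \<in> M" for x
      using f that by (simp add: ap_star ap_mult complex_nonneg_Reals_iff)
    show "\<tau> (ap 1) = 1" using f by (simp add: ap_one)
    show "\<tau> (ap (x * y)) = \<tau> (ap (y * x))" if "x \<in> M" "y \<in> M" for x y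
      using f that by (simp add: ap_mult)
    show "x = 0" if "x \<in> M" "\<tau> (ap (star x * x)) = 0" for x
      using f that by (simp add: ap_star ap_mult ap_eq_iff flip: ap_zero)
    fix a :: "nat \<Rightarrow> 'a operator" and s
    assume aM: "\<And>n. a n \<in> M" and sa: "\<And>n. star (a n) = a n" and inc: "\<And>n. a n \<le> a (Suc n)" and s: "sot a s"
    note ss = sot_sa[OF s sa] and ub = sot_ge[OF inc sa s]
    have mono: "a m \<le> a n" if "m \<le> n" for m n
      by (rule lift_Suc_mono_le[of a, OF inc that])
    let ?D = "range (\<lambda>n. ap (a n))"
    have nor: "normal_on (ap ` M) \<tau>" using f by blast
    have "Re (\<tau> (ap s)) = (SUP S\<in>?D. Re (\<tau> S))"
    proof (rule nor[unfolded normal_on_def, rule_format], intro conjI ballI allI impI)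
      show "?D \<subseteq> ap ` M" using aM by blast
      show "?D \<noteq> {}" by blast
      show "self_adjoint S" if "S \<in> ?D" for S using that sa by (auto simp: self_adjoint_ap)
      show "ap s \<in> ap ` M" using vna_sot[OF v s aM] by blast
      show "self_adjoint (ap s)" using ss by (simp add: self_adjoint_ap)
      show "op_le S (ap s)" if "S \<in> ?D" for S using that ub by (auto simp: op_le_ap sa ss)
      show "op_le (ap s) y" if y: "y \<in> ap ` M" "self_adjoint y \<and> (\<forall>S\<in>?D. op_le S y)" for y
      proof -
        obtain z where z: "y = ap z" using y(1) by blast
        then have "star z = z" using y(2) by (simp add: self_adjoint_ap)
        then show ?thesis using y(2) sot_le[OF s sa, of z] by (simp add: z op_le_ap sa ss)
      qed
      fix S T assume "S \<in> ?D" "T \<in> ?D"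
      then obtain m n where "S = ap (a m)" "T = ap (a n)" by blast
      then have "op_le S (ap (a (max m n)))" "op_le T (ap (a (max m n)))"
        using mono by (simp_all add: op_le_ap sa)
      then show "\<exists>R\<in>?D. op_le S R \<and> op_le T R" by blast
    qed
    then show "Re (\<tau> (ap s)) = (SUP n. Re (\<tau> (ap (a n))))" by (simp add: image_image)
  qed
qed

lemma Alt_list:
  "Alt F i k x \<Longrightarrow> \<exists>js xs. js \<noteq> [] \<and> hd js = i \<and> distinct_adj js \<and> list_all2 (\<lambda>j x. x \<in> F j) js xs \<and> x = foldr (*) xs 1"
  for x :: "'a::monoid_mult"
proof (induction rule: Alt.induct)
  case (single x i)
  then show ?case by (intro exI[of _ "[i]"] exI[of _ "[x]"]) simp
next
  case (cons x i j k y)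
  then obtain js xs where "js \<noteq> []" "hd js = j" "distinct_adj js" "list_all2 (\<lambda>j x. x \<in> F j) js xs"
    "y = foldr (*) xs 1" by blast
  then show ?case using cons by (intro exI[of _ "i # js"] exI[of _ "x # xs"]) (simp add: distinct_adj_Cons)
qed

lemma list_Alt:
  "list_all2 (\<lambda>j x. x \<in> F j) js xs \<Longrightarrow> distinct_adj js \<Longrightarrow> js \<noteq> [] \<Longrightarrow> \<exists>k. Alt F (hd js) k (foldr (*) xs 1)"
  for xs :: "'a::monoid_mult list"
proof (induction rule: list_all2_induct)
  case (Cons j js x xs)
  show ?case
  proof (cases "js = []")
    case True
    then show ?thesis using Cons by (auto intro: Alt.single)
  next
    case False
    then obtain k where "Alt F (hd js) k (foldr (*) xs 1)" "j \<noteq> hd js"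
      using Cons by (auto simp: distinct_adj_Cons)
    then show ?thesis using Cons(1) by (auto intro: Alt.cons)
  qed
qed simp

text \<open>The bridge from words as lists to \<open>Alt\<close>, which records the first and last
  index and so supports concatenation.\<close>

lemma freely_independent_ap:
  assumes N: "\<And>i. i \<in> J \<Longrightarrow> N i = ap ` F i"
  shows "freely_independent J N \<tau> \<longleftrightarrow>
    (\<forall>i k x. Alt (\<lambda>i. if i \<in> J then {x \<in> F i. \<tau> (ap x) = 0} else {}) i k x \<longrightarrow> \<tau> (ap x) = 0)"
proof -
  let ?F = "\<lambda>i. if i \<in> J then {x \<in> F i. \<tau> (ap x) = 0} else {}"
  have fold: "foldr (\<circ>) (map ap xs) id = ap (foldr (*) xs 1)" for xs :: "'b operator list"
    by (induction xs) (simp_all add: ap_one ap_mult)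
  have word: "js \<noteq> [] \<and> list_all2 (\<lambda>j x. x \<in> ?F j) js ys \<longleftrightarrow> map ap ys \<noteq> [] \<and> length js = length (map ap ys) \<and> set js \<subseteq> J \<and>
      (\<forall>k<length (map ap ys). map ap ys ! k \<in> N (js ! k) \<and> \<tau> (map ap ys ! k) = 0)" for js ys
  proof -
    have "map ap ys ! k \<in> N (js ! k) \<longleftrightarrow> ys ! k \<in> F (js ! k)" if "js ! k \<in> J" "k < length ys" for k
      using that N by (simp add: ap_mem_iff)
    then show ?thesis
      by (auto simp: list_all2_conv_all_nth set_conv_nth split: if_splits)
  qed
  show ?thesis
  proof
    assume fr: "freely_independent J N \<tau>"
    show "\<forall>i k x. Alt ?F i k x \<longrightarrow> \<tau> (ap x) = 0"
    proof (intro allI impI)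
      fix i k x assume "Alt ?F i k x"
      from Alt_list[OF this] obtain js xs where js: "js \<noteq> []" "distinct_adj js" "list_all2 (\<lambda>j x. x \<in> ?F j) js xs"
        "x = foldr (*) xs 1" by blast
      have "\<tau> (foldr (\<circ>) (map ap xs) id) = 0"
        using fr js(2) word[of js xs] js(1,3) unfolding freely_independent_def by blast
      then show "\<tau> (ap x) = 0" by (simp add: fold js(4))
    qed
  next
    assume fr: "\<forall>i k x. Alt ?F i k x \<longrightarrow> \<tau> (ap x) = 0"
    show "freely_independent J N \<tau>"
      unfolding freely_independent_def
    proof (intro allI impI)
      fix js xs
      assume a: "xs \<noteq> [] \<and> length js = length xs \<and> set js \<subseteq> J \<and> distinct_adj js \<and>
        (\<forall>k<length xs. xs ! k \<in> N (js ! k) \<and> \<tau> (xs ! k) = 0)"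
      have "\<exists>ys. xs = map ap ys"
      proof (rule ex_map_conv[THEN iffD2], rule ballI)
        fix x assume "x \<in> set xs"
        then obtain k where "k < length xs" "x = xs ! k" by (auto simp: in_set_conv_nth)
        then have "x \<in> N (js ! k)" "js ! k \<in> J" using a nth_mem[of k js] by auto
        then show "\<exists>y. x = ap y" using N by auto
      qed
      then obtain ys where ys: "xs = map ap ys" by blast
      have "js \<noteq> []" "list_all2 (\<lambda>j x. x \<in> ?F j) js ys" using word[of js ys] a unfolding ys by blast+
      then show "\<tau> (foldr (\<circ>) xs id) = 0" using list_Alt[of ?F js ys] fr a unfolding ys fold by blast
    qed
  qed
qed

lemma ap_sum: "ap (\<Sum>i\<in>F. f i) v = (\<Sum>i\<in>F. ap (f i) v)"
  by (induction F rule: infinite_finite_induct) auto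

text \<open>Every finite subset of \<open>I\<close> is eventually contained in
  \<open>I \<inter> {..n}\<close>.\<close>

lemma sot_of_has_sum:
  assumes "\<And>v. ((\<lambda>i. ap (x i) v) has_sum ap s v) I"
  shows "sot (\<lambda>n. \<Sum>i\<in>I \<inter> {..n::nat}. x i) s"
proof -
  have "\<forall>\<^sub>F n in sequentially. X \<subseteq> {..n}" if "finite X" for X :: "nat set"
    using that by (intro eventually_sequentiallyI[of "Max X"]) (auto intro: order_trans[OF Max_ge])
  then have f: "filterlim (\<lambda>n. I \<inter> {..n}) (finite_subsets_at_top I) sequentially"
    unfolding filterlim_finite_subsets_at_top by simp
  show ?thesis
    unfolding sot_def ap_sum
  proof
    show "(\<lambda>n. \<Sum>i\<in>I \<inter> {..n}. ap (x i) v) \<longlonglongrightarrow> ap s v" for v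
      using filterlim_compose[OF assms[of v, unfolded has_sum_def] f] .
  qed
qed

text \<open>Multiplication by \<open>q i\<close> recovers the \<open>i\<close>-th term of a summable
  family from its sum. Conversely \<open>y\<close> is the sum of the \<open>y * q i\<close>, since
  the \<open>q i\<close> sum to 1.\<close>

lemma (in corner_datum) direct_sum_corners:
  assumes h: "\<And>v. ((\<lambda>i. ap (q i) v) has_sum v) I"
    and C: "\<And>i. i \<in> I \<Longrightarrow> C i = ap ` (\<lambda>a. u i * a * p i * star (u i)) ` A i"
  shows "direct_sum I C = ap ` corners"
proof (rule set_eqI)
  fix X
  show "X \<in> direct_sum I C \<longleftrightarrow> X \<in> ap ` corners"
  proof
    assume "X \<in> direct_sum I C"
    then obtain c where c: "\<And>i. i \<in> I \<Longrightarrow> c i \<in> C i" and X: "bounded_op X" "\<And>v. ((\<lambda>i. c i v) has_sum X v) I"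
      by (auto simp: direct_sum_def sot_has_sum_def)
    obtain y where y: "X = ap y" using X(1) bounded_op_iff by blast
    have "\<exists>a. a \<in> A i \<and> c i = ap (u i * a * p i * star (u i))" if "i \<in> I" for i
      using c[OF that] C[OF that] by auto
    then obtain a where a: "\<And>i. i \<in> I \<Longrightarrow> a i \<in> A i" "\<And>i. i \<in> I \<Longrightarrow> c i = ap (u i * a i * p i * star (u i))"
      by metis
    define d where "d i = u i * a i * p i * star (u i)" for i
    have dq: "d i * q i = d i" if "i \<in> I" for i
      using that by (simp add: d_def mult.assoc uu ppz)
    have qd: "q i * d i = d i" if i: "i \<in> I" for i
    proof -
      have "q i * d i = u i * (p i * a i) * p i * star (u i)" using i by (simp add: d_def mult.assoc uu)
      also have "p i * a i = a i * p i" by (rule abelian_A[OF i p(1)[OF i] a(1)[OF i]])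
      finally show ?thesis using i by (simp add: d_def mult.assoc ppz)
    qed
    have sum: "((\<lambda>i. ap (d i) v) has_sum ap y v) I" for v
    proof -
      have "((\<lambda>i. ap (d i) v) has_sum ap y v) I \<longleftrightarrow> ((\<lambda>i. c i v) has_sum ap y v) I"
        using a(2) by (intro has_sum_cong) (simp add: d_def)
      then show ?thesis using X(2) y by simp
    qed
    have single: "g v = ap (f i) v" if "i \<in> I" "((\<lambda>j. ap (f j) v) has_sum g v) I" "\<And>j. j \<in> I \<Longrightarrow> j \<noteq> i \<Longrightarrow> f j = 0"
      for i f g v
    proof -
      have "((\<lambda>j. ap (f j) v) has_sum g v) I \<longleftrightarrow> ((\<lambda>j. ap (f j) v) has_sum g v) {i}"
        using that by (intro has_sum_cong_neutral) auto
      then show ?thesis using that(2) has_sum_finiteI[of "{i}" "ap (f i) v" "\<lambda>j. ap (f j) v"] has_sum_unique by fastforce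
    qed
    have yq: "y * q i = d i" if i: "i \<in> I" for i
    proof (rule operator_eqI)
      fix v
      have "ap (y * q i) v = ap (d i * q i) v"
      proof (rule single[OF i, of "\<lambda>j. d j * q i"])
        show "((\<lambda>j. ap (d j * q i) v) has_sum ap (y * q i) v) I" using sum[of "ap (q i) v"] by simp
        fix j assume j: "j \<in> I" "j \<noteq> i"
        have "d j * q i = d j * (q j * q i)" using dq[OF j(1)] by (simp only: flip: mult.assoc)
        then show "d j * q i = 0" by (simp only: q_orth[OF j(1) i j(2)] mult_zero_right)
      qed
      then show "ap (y * q i) v = ap (d i) v" by (simp only: dq[OF i])
    qed
    have qy: "q i * y = d i" if i: "i \<in> I" for i
    proof (rule operator_eqI)
      fix v
      have "ap (q i * y) v = ap (q i * d i) v"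
      proof (rule single[OF i, of "\<lambda>j. q i * d j"])
        show "((\<lambda>j. ap (q i * d j) v) has_sum ap (q i * y) v) I"
          using has_sum_bounded_linear[OF bounded_linear_ap sum[of v], of "q i"]
          by (simp only: ap_mult o_apply)
        fix j assume j: "j \<in> I" "j \<noteq> i"
        have "q i * d j = (q i * q j) * d j" using qd[OF j(1)] by (simp only: mult.assoc)
        then show "q i * d j = 0" by (simp only: q_orth[OF i j(1) j(2)[symmetric]] mult_zero_left)
      qed
      then show "ap (q i * y) v = ap (d i) v" by (simp only: qd[OF i])
    qed
    have "y \<in> corners" unfolding corners_def using yq qy a(1) by (auto simp: d_def)
    then show "X \<in> ap ` corners" using y by blast
  next
    assume "X \<in> ap ` corners"
    then obtain y where y: "X = ap y" "y \<in> corners" by blast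
    have "ap (y * q i) \<in> C i" if i: "i \<in> I" for i
    proof -
      obtain a where "a \<in> A i" "y * q i = u i * a * p i * star (u i)" using y(2) i by (auto simp: corners_def)
      then show ?thesis unfolding C[OF i] by (intro image_eqI[OF refl]) blast
    qed
    moreover have "((\<lambda>i. ap (y * q i) v) has_sum X v) I" for v
      using has_sum_bounded_linear[OF bounded_linear_ap h[of v], of y] unfolding y(1) by (simp only: ap_mult o_apply)
    ultimately show "X \<in> direct_sum I C"
      unfolding direct_sum_def sot_has_sum_def y(1) by (intro CollectI exI[of _ "\<lambda>i. ap (y * q i)"]) simp
  qed
qed

theorem theorem1p1:
  fixes n :: enat
    and I :: "nat set"
    and A :: "nat \<Rightarrow> ('h::complex_hilbert \<Rightarrow> 'h) set"
    and t :: "nat \<Rightarrow> ('h \<Rightarrow> 'h) \<Rightarrow> complex"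
    and M :: "('h \<Rightarrow> 'h) set"
    and \<tau> :: "('h \<Rightarrow> 'h) \<Rightarrow> complex"
    and p u :: "nat \<Rightarrow> 'h \<Rightarrow> 'h"
  assumes "2 \<le> n"
    and "I = {i. 1 \<le> i \<and> enat i \<le> n}"
    and "\<And>i. i \<in> I \<Longrightarrow> tracial_vn_algebra (A i) (t i)"
    and "\<And>i. i \<in> I \<Longrightarrow> abelian (A i)"
    and "\<And>i. i \<in> I \<Longrightarrow> diffuse (A i)"
    and "tracial_free_product I A t M \<tau>"
    and "\<And>i. i \<in> I \<Longrightarrow> p i \<in> A i \<and> projection (p i)"
    and "\<And>i. i \<in> I \<Longrightarrow> u i \<in> M \<and> unitary (u i)"
    and "sot_has_sum I (\<lambda>i. u i \<circ> p i \<circ> adj (u i)) id"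
  shows "freely_complemented (direct_sum I (\<lambda>i. conj_corner (u i) (A i) (p i))) M \<tau>"
proof -
  have tM: "tracial_vn_algebra M \<tau>" and sub: "\<And>i. i \<in> I \<Longrightarrow> vn_subalgebra (A i) M"
    and fr: "freely_independent I A \<tau>" and gen: "M = von_neumann_algebra hull (\<Union>i\<in>I. A i)"
    using assms(6) by (auto simp: tracial_free_product_def)
  obtain M' where M': "M = ap ` M'" "vna M'"
    using tM von_neumann_algebra_imp_ap by (auto simp: tracial_vn_algebra_def)
  define A' where "A' i = {x. ap x \<in> A i}" for i
  have A': "A i = ap ` A' i" if i: "i \<in> I" for i
  proof -
    obtain N where N: "A i = ap ` N"
      using von_neumann_algebra_imp_ap[of "A i"] sub[OF i] unfolding vn_subalgebra_def by metis
    then have "A' i = N" by (simp add: A'_def ap_mem_iff)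
    then show ?thesis using N by simp
  qed
  have pu: "\<exists>x y. p i = ap x \<and> u i = ap y" if "i \<in> I" for i
    using assms(7,8)[OF that] unfolding projection_def self_adjoint_def unitary_def bounded_op_iff by blast
  then obtain p' u' where p': "\<And>i. i \<in> I \<Longrightarrow> p i = ap (p' i)" and u': "\<And>i. i \<in> I \<Longrightarrow> u i = ap (u' i)" by metis
  let ?tr = "\<lambda>x. \<tau> (ap x)"
  interpret tracial M' ?tr using tracial_ap tM unfolding M' .
  have corner: "u i \<circ> ap a \<circ> p i \<circ> adj (u i) = ap (u' i * a * p' i * star (u' i))" if "i \<in> I" for i a
    using that by (simp add: p' u' ap_mult ap_star)
  have h: "((\<lambda>i. ap (u' i * p' i * star (u' i)) v) has_sum v) I" for v
  proof -
    have "((\<lambda>i. (u i \<circ> p i \<circ> adj (u i)) v) has_sum v) I" using assms(9) by (simp add: sot_has_sum_def)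
    moreover have "(u i \<circ> p i \<circ> adj (u i)) v = ap (u' i * p' i * star (u' i)) v" if "i \<in> I" for i
      using that by (simp add: p' u' ap_star)
    ultimately show ?thesis using has_sum_cong by (metis (no_types, lifting))
  qed
  interpret corner_datum M' ?tr I A' p' u'
  proof
    show "0 \<notin> I" "1 \<in> I" "2 \<in> I" using assms(1) unfolding assms(2)
      by (auto simp: numeral_eq_enat one_enat_def intro: order_trans[rotated])
    show "vna (A' i)" "A' i \<subseteq> M'" "diffuse_op (A' i)" "p' i \<in> A' i" "proj (p' i)"
      "u' i \<in> M'" "star (u' i) * u' i = 1" "u' i * star (u' i) = 1" if i: "i \<in> I" for i
      using sub[OF i] assms(5)[OF i] assms(7,8)[OF i] A'[OF i] M'(1) p'[OF i] u'[OF i]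
      by (simp_all add: vn_subalgebra_def von_neumann_algebra_ap ap_image_subset_iff diffuse_ap ap_mem_iff
          projection_ap unitary_ap)
    show "x * y = y * x" if "i \<in> I" "x \<in> A' i" "y \<in> A' i" for i x y
      using assms(4)[OF that(1)] A'[OF that(1)] that(2,3) by (simp add: abelian_ap)
    show "?tr x = 0" if "Alt (\<lambda>i. if i \<in> I then ctr (A' i) else {}) i k x" for i k x
      using fr that[unfolded ctr_def] freely_independent_ap[of I A A' \<tau>, OF A'] by blast
    have "(\<Union>i\<in>I. A i) = ap ` (\<Union>i\<in>I. A' i)" using A' by auto
    then have "ap ` M' = ap ` vhull (\<Union>i\<in>I. A' i)" using gen M'(1) hull_ap by metis
    then show "M' = vhull (\<Union>i\<in>I. A' i)" by (simp add: ap_image_eq_iff)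
    show "sot (\<lambda>n. \<Sum>i\<in>I \<inter> {..n}. u' i * p' i * star (u' i)) 1"
      using h by (intro sot_of_has_sum) simp
  qed
  obtain e w where "exchange_datum M' ?tr I A' p' u' e w" using exchange_exists by blast
  then interpret exchange_datum M' ?tr I A' p' u' e w .
  obtain Q where Q: "vna Q" "Q \<subseteq> M'" "\<exists>x\<in>Q. \<forall>c. x \<noteq> sc c 1"
    "free (\<lambda>b. if b then corners else Q)" "M' = vhull (corners \<union> Q)" using complement by blast
  have N: "direct_sum I (\<lambda>i. conj_corner (u i) (A i) (p i)) = ap ` corners"
    using h by (rule direct_sum_corners) (simp add: conj_corner_def A' image_image corner)
  have "M' \<inter> comm M' = range (\<lambda>c. sc c 1)"
    using center M_closed(1,6) by (auto simp: comm_def)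
  then have cen: "M \<inter> commutant M = scalars"
    unfolding M'(1) commutant_ap scalars_ap image_Int[OF inj_ap, symmetric] by simp
  have "diffuse M"
    using diffuse_M[OF vna_A[OF I(2)] A_M[OF I(2)] diffuse_A[OF I(2)]] unfolding M'(1) diffuse_ap .
  then have II1: "II1_factor M \<tau>" using tM cen by (simp add: II1_factor_def)
  have Qs: "ap ` Q \<noteq> scalars" using Q(3) unfolding scalars_ap ap_image_eq_iff by blast
  have "freely_independent UNIV (\<lambda>b. if b then ap ` corners else ap ` Q) \<tau>"
  proof (rule freely_independent_ap[THEN iffD2])
    show "(if b then ap ` corners else ap ` Q) = ap ` (if b then corners else Q)" for b by simp
  qed (use Q(4) in \<open>simp add: free_def ctr_def\<close>)
  moreover have "M = von_neumann_algebra hull (ap ` corners \<union> ap ` Q)"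
    using Q(5) M'(1) by (simp add: hull_ap flip: image_Un)
  moreover have "vn_subalgebra (ap ` corners) M" "vn_subalgebra (ap ` Q) M"
    using vna_corners corners_sub_M Q(1,2)
    by (simp_all add: vn_subalgebra_def von_neumann_algebra_ap M'(1) ap_image_subset_iff)
  ultimately show ?thesis using II1 Qs unfolding freely_complemented_def N by blast
qed

end
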